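(* Let $N$ and $k$ be positive integers and let $\mu\in\mathcal{O}(k-1,N)$. Let $z_k^{(i)}(\mu)$ be the eigenvalue of the central element $z_k^{(i)}\in B(k-1,N)$ in the irreducible representation $V(\mu,k-1)$, and put $Z(\mu,u)=\sum_{i\ge0}z_k^{(i)}(\mu)\,u^{-i}$. Then, as formal Laurent series in $u^{-1}$, $$Z(\mu,u)=\Bigl(u+\tfrac12\Bigr)\,Q(\mu,u)-u+\tfrac12 .$$
   Context: Brauer algebra. For $n\ge1$ let $\mathcal{G}(n)$ be the set of partitions of $\{1,\dots,n,\bar1,\dots,\bar n\}$ into pairs (graphs with $n$ edges). $B(n,N)$ is the complex associative algebra with basis $b(\gamma)$, $\gamma\in\mathcal{G}(n)$, and product $b(\gamma)b(\gamma')=N^{q}b(\gamma\circ\gamma')$: identify the vertices $\bar1,\dots,\bar n$ of $\gamma$ with $1,\dots,n$ of $\gamma'$, let $q$ be the number of loops, remove the loops and replace the other components by single edges joining their terminal vertices to get $\gamma\circ\gamma'$. A permutation $s\in S(n)$ is identified with $b(\gamma)$, $\gamma$ having edges $\{s(m),\bar m\}$. For $k\neq l$, $(k,l)$ is the transposition and $\overline{(k,l)}=b(\gamma)$ with $\gamma$ having edges $\{k,l\},\{\bar k,\bar l\}$ and $\{m,\bar m\}$, $m\ne k,l$. Put $\bar s_k=\overline{(k,k+1)}$. $B(n-1,N)\subset B(n,N)$ is spanned by the $b(\gamma)$ with $\{n,\bar n\}\in\gamma$, and $B(0,N)=\mathbb{C}$. For $k\ge1$, $x_k=\frac{N-1}{2}+\sum_{l=1}^{k-1}\bigl((k,l)-\overline{(k,l)}\bigr)\in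 B(k,N)$. For every $b\in B(k,N)$ there is a unique $b'\in B(k-1,N)$ with $\bar s_k b\bar s_k=b'\bar s_k$ in $B(k+1,N)$; the elements $z_k^{(i)}\in B(k-1,N)$, $i\ge0$, are defined by $\bar s_k x_k^i\bar s_k=z_k^{(i)}\bar s_k$; they are central in $B(k-1,N)$ and $z_k^{(0)}=N$. Representations. $N$ is a positive integer, $U=\mathbb{C}^N$ with standard orthonormal basis $u(1),\dots,u(N)$, $G=O(N,\mathbb{C})$, $C(n,N)=\operatorname{End}_G(U^{\otimes n})$. $B(n,N)$ maps onto $C(n,N)$: $(k,l)$ permutes the $k$-th and $l$-th tensor factors, and $\overline{(k,l)}$ sends $u(i_1)\otimes\cdots\otimes u(i_n)$ to $\delta_{i_k i_l}\sum_{i=1}^N$ of the same tensor with both the $k$-th and $l$-th factors replaced by $u(i)$. $\mathcal{O}(n,N)$ is the set of Young diagrams with at most $N$ boxes in the first two columns together and with $n-2r$ boxes in total, $r=0,1,\dots,[n/2]$ ($\mathcal{O}(0,N)$ consists of the empty diagram $\varnothing$, and $V(\varnothing,0)=\mathbb{C}$). For such a diagram $\lambda$ with $m$ boxes, $U(\lambda,N)$ is Weyl's irreducible representation of $G$: the space of traceless tensors in $U^{\otimes m}$ (those killed by all $\overline{(k,l)}$) decomposes under $G\times S(m)$ as $\bigoplus_\lambda U(\lambda,N)\otimes S^\lambda$, over diagrams $\lambda$ with $m$ boxes and at most $N$ boxes in the first two columns, $S^\lambda$ being the irreducible $S(m)$-module of $\lambda$ (trivial for a one-row diagram). One has $U^{\otimes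 n}=\bigoplus_{\lambda\in\mathcal{O}(n,N)}U(\lambda,N)\otimes V(\lambda,n)$ with $V(\lambda,n)$ the irreducible $C(n,N)$-modules, also regarded as $B(n,N)$-modules. The series $Q(\mu,u)$. The content of the box in row $i$ and column $j$ is $j-i$. Let $l$ be the number of pairwise distinct (nonzero) row lengths of $\mu$; then $l+1$ diagrams are obtained by adding a box to $\mu$ and $l$ diagrams by removing a box. Let $c_1,\dots,c_{l+1}$ and $d_1,\dots,d_l$ be the contents of these added, respectively removed, boxes. Let $b_1,\dots,b_{2l+1}$ be the numbers $\frac{N-1}{2}+c_1,\dots,\frac{N-1}{2}+c_{l+1},\,-\frac{N-1}{2}-d_1,\dots,-\frac{N-1}{2}-d_l$ in any order. Then $$Q(\mu,u)=\prod_{j=1}^{2l+1}\frac{u+b_j}{u-b_j},$$ expanded as a formal power series in $u^{-1}$. *)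

theory Defs
  imports
    "HOL-Algebra.Module"
    "HOL-Library.Disjoint_Sets"
    "HOL-Library.FuncSet"
    "HOL-Combinatorics.Permutations"
    "HOL-Computational_Algebra.Formal_Laurent_Series"
    "Jordan_Normal_Form.Matrix"
begin

section \<open>The Brauer algebra\<close>

datatype vertex = Vtx nat | Bar nat

type_synonym graph = "vertex set set"

definition vertices :: "nat \<Rightarrow> vertex set" where
  "vertices n = Vtx ` {1..n} \<union> Bar ` {1..n}"

definition brauer_graphs :: "nat \<Rightarrow> graph set" where
  "brauer_graphs n = {\<gamma>. partition_on (vertices n) \<gamma> \<and> (\<forall>e\<in>\<gamma>. card e = 2)}"

text \<open>To compose \<open>\<gamma>\<close> with \<open>\<gamma>'\<close>, both graphs are drawn on three rows of vertices; the middle row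
  carries the vertices \<open>Bar m\<close> of \<open>\<gamma>\<close>, identified with the vertices \<open>Vtx m\<close> of \<open>\<gamma>'\<close>.\<close>

datatype stacked_vertex = Upper nat | Middle nat | Lower nat

definition stacked_edges :: "graph \<Rightarrow> graph \<Rightarrow> stacked_vertex set set" where
  "stacked_edges \<gamma> \<gamma>' =
     (`) (case_vertex Upper Middle) ` \<gamma> \<union> (`) (case_vertex Middle Lower) ` \<gamma>'"

text \<open>The adjacency relation below is symmetric and reflexive on the set of all stacked vertices, so its
  transitive closure is the equivalence relation of lying in the same component.\<close>

definition stacked_components :: "graph \<Rightarrow> graph \<Rightarrow> stacked_vertex set set" where
  "stacked_components \<gamma> \<gamma>' =
     (let E = stacked_edges \<gamma> \<gamma>' in \<Union>E // {(x, y). \<exists>e\<in>E. x \<in> e \<and> y \<in> e}\<^sup>+)"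

text \<open>Middle vertices meet one edge from each graph and all other vertices meet one edge in total,
  so a component is a closed loop exactly if it stays within the middle row.\<close>

definition loops :: "graph \<Rightarrow> graph \<Rightarrow> stacked_vertex set set" where
  "loops \<gamma> \<gamma>' = {C \<in> stacked_components \<gamma> \<gamma>'. C \<subseteq> range Middle}"

definition terminals :: "stacked_vertex set \<Rightarrow> vertex set" where
  "terminals C = {Vtx m |m. Upper m \<in> C} \<union> {Bar m |m. Lower m \<in> C}"

definition graph_comp :: "graph \<Rightarrow> graph \<Rightarrow> graph" where
  "graph_comp \<gamma> \<gamma>' = terminals ` (stacked_components \<gamma> \<gamma>' - loops \<gamma> \<gamma>')"

text \<open>Elements of \<open>B(n,N)\<close> are given by their coefficients in the basis \<open>b(\<gamma>)\<close>.\<close>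

type_synonym bvec = "graph \<Rightarrow> complex"

definition bgen :: "graph \<Rightarrow> bvec" where
  "bgen \<gamma> = (\<lambda>\<delta>. if \<delta> = \<gamma> then 1 else 0)"

definition perm_graph :: "nat \<Rightarrow> (nat \<Rightarrow> nat) \<Rightarrow> graph" where
  "perm_graph n s = (\<lambda>m. {Vtx (s m), Bar m}) ` {1..n}"

definition bar_graph :: "nat \<Rightarrow> nat \<Rightarrow> nat \<Rightarrow> graph" where
  "bar_graph n k l =
     {{Vtx k, Vtx l}, {Bar k, Bar l}} \<union> (\<lambda>m. {Vtx m, Bar m}) ` ({1..n} - {k, l})"

definition brauer_mult :: "nat \<Rightarrow> nat \<Rightarrow> bvec \<Rightarrow> bvec \<Rightarrow> bvec" where
  "brauer_mult n N a b = (\<lambda>\<delta>. \<Sum>\<gamma>\<in>brauer_graphs n. \<Sum>\<gamma>'\<in>brauer_graphs n.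
     if graph_comp \<gamma> \<gamma>' = \<delta> then of_nat N ^ card (loops \<gamma> \<gamma>') * (a \<gamma> * b \<gamma>') else 0)"

definition brauer :: "nat \<Rightarrow> nat \<Rightarrow> (complex, bvec) module" where
  "brauer n N =
     \<lparr>carrier = {b. \<forall>\<gamma>. \<gamma> \<notin> brauer_graphs n \<longrightarrow> b \<gamma> = 0},
      mult = brauer_mult n N,
      one = bgen (perm_graph n id),
      zero = (\<lambda>_. 0),
      add = (\<lambda>a b \<gamma>. a \<gamma> + b \<gamma>),
      smult = (\<lambda>c b \<gamma>. c * b \<gamma>)\<rparr>"

text \<open>The inclusion of \<open>B(n,N)\<close> into \<open>B(n+1,N)\<close>, adding the edge from \<open>n+1\<close> to its barred copy.\<close>

definition brauer_incl :: "nat \<Rightarrow> bvec \<Rightarrow> bvec" where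
  "brauer_incl n b = (\<lambda>\<delta>. let e = {Vtx (n + 1), Bar (n + 1)} in
     if e \<in> \<delta> then b (\<delta> - {e}) else 0)"

definition transpos :: "nat \<Rightarrow> nat \<Rightarrow> nat \<Rightarrow> bvec" where
  "transpos n k l = bgen (perm_graph n (Transposition.transpose k l))"

definition bar_transpos :: "nat \<Rightarrow> nat \<Rightarrow> nat \<Rightarrow> bvec" where
  "bar_transpos n k l = bgen (bar_graph n k l)"

definition jucys_murphy :: "nat \<Rightarrow> nat \<Rightarrow> bvec" where
  "jucys_murphy N k = (\<lambda>\<gamma>. (of_nat N - 1) / 2 * bgen (perm_graph k id) \<gamma>
     + (\<Sum>l=1..<k. transpos k k l \<gamma> - bar_transpos k k l \<gamma>))"

definition z_elem :: "nat \<Rightarrow> nat \<Rightarrow> nat \<Rightarrow> bvec" where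
  "z_elem N k i =
     (let A = brauer (k + 1) N;
          s = bar_transpos (k + 1) k (k + 1);
          x = brauer_incl k (jucys_murphy N k)
      in THE b'. b' \<in> carrier (brauer (k - 1) N) \<and>
           s \<otimes>\<^bsub>A\<^esub> (x [^]\<^bsub>A\<^esub> i) \<otimes>\<^bsub>A\<^esub> s = brauer_incl k (brauer_incl (k - 1) b') \<otimes>\<^bsub>A\<^esub> s)"


section \<open>Tensors\<close>

text \<open>A tensor is given by its coordinates in the basis \<open>u(i\<^sub>1) \<otimes> \<dots> \<otimes> u(i\<^sub>n)\<close>. The basis of \<open>U\<close> is
  indexed by \<open>0, \<dots>, N - 1\<close>, as are the rows and columns of library matrices.\<close>

type_synonym tensor = "(nat \<Rightarrow> nat) \<Rightarrow> complex"

definition multi_indices :: "nat \<Rightarrow> nat \<Rightarrow> (nat \<Rightarrow> nat) set" where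
  "multi_indices n N = {1..n} \<rightarrow>\<^sub>E {..<N}"

definition tensors :: "nat \<Rightarrow> nat \<Rightarrow> tensor set" where
  "tensors n N = {t. \<forall>i. i \<notin> multi_indices n N \<longrightarrow> t i = 0}"

definition basis_tensor :: "(nat \<Rightarrow> nat) \<Rightarrow> tensor" where
  "basis_tensor i = (\<lambda>j. if j = i then 1 else 0)"

definition orthogonal_group :: "nat \<Rightarrow> complex mat set" where
  "orthogonal_group N = {g \<in> carrier_mat N N. g * transpose_mat g = 1\<^sub>m N}"

definition group_act :: "nat \<Rightarrow> nat \<Rightarrow> complex mat \<Rightarrow> tensor \<Rightarrow> tensor" where
  "group_act n N g t = (\<lambda>j. if j \<in> multi_indices n N
     then \<Sum>i\<in>multi_indices n N. (\<Prod>m=1..n. g $$ (j m, i m)) * t i else 0)"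

text \<open>The matrix entry of \<open>b(\<gamma>)\<close> at output index \<open>j\<close> and input index \<open>i\<close> is \<open>1\<close> if the labelling of
  \<open>Vtx m\<close> by \<open>j m\<close> and of \<open>Bar m\<close> by \<open>i m\<close> is constant on every edge, and \<open>0\<close> otherwise. The lemmas
  \<open>brauer_act_transpos\<close> and \<open>brauer_act_bar_transpos\<close> below give the action of the generators.\<close>

definition compatible :: "graph \<Rightarrow> (nat \<Rightarrow> nat) \<Rightarrow> (nat \<Rightarrow> nat) \<Rightarrow> bool" where
  "compatible \<gamma> j i \<longleftrightarrow> (\<forall>e\<in>\<gamma>. \<forall>x\<in>e. \<forall>y\<in>e. case_vertex j i x = case_vertex j i y)"

definition brauer_act :: "nat \<Rightarrow> nat \<Rightarrow> bvec \<Rightarrow> tensor \<Rightarrow> tensor" where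
  "brauer_act n N b t = (\<lambda>j. if j \<in> multi_indices n N
     then \<Sum>\<gamma>\<in>brauer_graphs n. b \<gamma> * (\<Sum>i | i \<in> multi_indices n N \<and> compatible \<gamma> j i. t i) else 0)"

lemma brauer_act_bgen:
  assumes "\<gamma> \<in> brauer_graphs n" and "i \<in> multi_indices n N"
  shows "brauer_act n N (bgen \<gamma>) (basis_tensor i) =
    (\<lambda>j. if j \<in> multi_indices n N \<and> compatible \<gamma> j i then 1 else 0)"
proof -
  have fin1: "finite (brauer_graphs n)"
    by (rule finite_subset[of _ "Pow (Pow (vertices n))"])
      (auto simp: brauer_graphs_def vertices_def partition_on_def)
  have fin2: "finite (multi_indices n N)"
    unfolding multi_indices_def by (intro finite_PiE) auto
  have *: "(\<Sum>i' | i' \<in> multi_indices n N \<and> compatible \<gamma> j i'. basis_tensor i i') =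
     (if compatible \<gamma> j i then 1 else 0)" for j
    unfolding basis_tensor_def using fin2 assms(2) by (subst sum.delta) auto
  show ?thesis
    unfolding brauer_act_def bgen_def
    by (rule ext) (simp add: if_distrib[of "\<lambda>x. x * _"] fin1 assms(1) sum.delta cong: if_cong, simp add: *)
qed

lemma perm_graph_mem:
  assumes "s permutes {1..n}"
  shows "perm_graph n s \<in> brauer_graphs n"
proof -
  have inj: "inj s" and im: "s ` {1..n} = {1..n}"
    using assms by (simp_all add: permutes_inj permutes_image)
  have "\<Union>(perm_graph n s) = Vtx ` (s ` {1..n}) \<union> Bar ` {1..n}"
    by (auto simp: perm_graph_def)
  then have "\<Union>(perm_graph n s) = vertices n"
    by (simp only: im vertices_def)
  then show ?thesis
    by (auto simp: brauer_graphs_def partition_on_def disjoint_def perm_graph_def inj_eq[OF inj])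
qed

lemma bar_graph_mem:
  assumes "k \<in> {1..n}" "l \<in> {1..n}" "k \<noteq> l"
  shows "bar_graph n k l \<in> brauer_graphs n"
proof -
  have "\<Union>(bar_graph n k l) = vertices n"
    using assms by (auto simp: bar_graph_def vertices_def)
  then show ?thesis
    using assms by (auto simp: brauer_graphs_def partition_on_def disjoint_def bar_graph_def)
qed

lemma brauer_act_transpos:
  assumes "k \<in> {1..n}" and "l \<in> {1..n}" and i: "i \<in> multi_indices n N"
  shows "brauer_act n N (transpos n k l) (basis_tensor i) =
    basis_tensor (i \<circ> Transposition.transpose k l)"
proof -
  let ?s = "Transposition.transpose k l"
  have s: "?s permutes {1..n}"
    using assms by (intro permutes_swap_id) auto
  have mem: "i \<circ> ?s \<in> multi_indices n N"
    using i assms(1,2) unfolding multi_indices_def PiE_def Pi_def extensional_def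
    by (auto simp: Transposition.transpose_def)
  have comp: "compatible (perm_graph n ?s) j i \<longleftrightarrow> (\<forall>m\<in>{1..n}. j (?s m) = i m)" for j
  proof -
    have "(\<forall>x\<in>{Vtx a, Bar b}. \<forall>y\<in>{Vtx a, Bar b}. case_vertex j i x = case_vertex j i y)
        \<longleftrightarrow> j a = i b" for a b
      by (simp add: eq_commute[of "i b"])
    then show ?thesis
      by (simp only: compatible_def perm_graph_def ball_simps)
  qed
  have "j \<in> multi_indices n N \<and> compatible (perm_graph n ?s) j i \<longleftrightarrow> j = i \<circ> ?s" for j
  proof
    assume j: "j \<in> multi_indices n N \<and> compatible (perm_graph n ?s) j i"
    show "j = i \<circ> ?s"
    proof (rule PiE_ext)
      show "j \<in> {1..n} \<rightarrow>\<^sub>E {..<N}" "i \<circ> ?s \<in> {1..n} \<rightarrow>\<^sub>E {..<N}"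
        using j mem by (simp_all only: multi_indices_def)
      fix x
      assume "x \<in> {1..n}"
      then have "?s x \<in> {1..n}"
        using permutes_in_image[OF s] by blast
      then have "j (?s (?s x)) = i (?s x)"
        using j comp by blast
      then show "j x = (i \<circ> ?s) x"
        by simp
    qed
  next
    assume j: "j = i \<circ> ?s"
    show "j \<in> multi_indices n N \<and> compatible (perm_graph n ?s) j i"
      unfolding comp using mem by (simp add: j)
  qed
  then show ?thesis
    unfolding transpos_def brauer_act_bgen[OF perm_graph_mem[OF s] i]
    by (simp add: basis_tensor_def)
qed

lemma brauer_act_bar_transpos:
  assumes kl: "k \<in> {1..n}" "l \<in> {1..n}" "k \<noteq> l" and i: "i \<in> multi_indices n N"
  shows "brauer_act n N (bar_transpos n k l) (basis_tensor i) =
    (\<lambda>j. if i k = i l then \<Sum>a<N. basis_tensor (i(k := a, l := a)) j else 0)"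
proof (rule ext)
  fix j
  let ?upd = "\<lambda>a. i(k := a, l := a)"
  have 1: "i k = i l \<and> j k < N \<and> j = ?upd (j k)"
    if j: "j \<in> multi_indices n N \<and> compatible (bar_graph n k l) j i"
  proof -
    have c: "case_vertex j i x = case_vertex j i y"
      if "e \<in> bar_graph n k l" "x \<in> e" "y \<in> e" for e x y
      using j that unfolding compatible_def by blast
    have *: "j k = j l" "i k = i l"
      using c[of "{Vtx k, Vtx l}" "Vtx k" "Vtx l"] c[of "{Bar k, Bar l}" "Bar k" "Bar l"]
      by (simp_all add: bar_graph_def)
    have "j m = ?upd (j k) m" for m
    proof -
      have "j m = i m" if "m \<in> {1..n} - {k, l}"
        using c[of "{Vtx m, Bar m}" "Vtx m" "Bar m"] that by (simp add: bar_graph_def)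
      moreover have "j m = i m" if "m \<notin> {1..n}"
        using i j that by (auto simp: multi_indices_def PiE_def extensional_def)
      ultimately show ?thesis
        using *(1) by auto
    qed
    moreover have "j k < N"
      using j kl(1) by (auto simp: multi_indices_def)
    ultimately show ?thesis
      using *(2) by blast
  qed
  have 2: "?upd a \<in> multi_indices n N \<and> compatible (bar_graph n k l) (?upd a) i"
    if "i k = i l" "a < N" for a
    using i that kl
    by (auto simp: multi_indices_def compatible_def bar_graph_def PiE_def Pi_def extensional_def)
  have "j \<in> multi_indices n N \<and> compatible (bar_graph n k l) j i \<longleftrightarrow>
      i k = i l \<and> j k < N \<and> j = ?upd (j k)"
    using 1 2[of "j k"] by metis
  moreover have "(\<Sum>a<N. basis_tensor (?upd a) j) =
    (if j k < N then if j = ?upd (j k) then 1 else 0 else 0)"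
  proof -
    have "basis_tensor (?upd a) j = (if a = j k then basis_tensor (?upd (j k)) j else 0)" for a
    proof (cases "a = j k")
      case False
      then have "j \<noteq> ?upd a"
        using kl(3) by (metis fun_upd_apply)
      then show ?thesis
        using False by (simp add: basis_tensor_def)
    qed simp
    then have "(\<Sum>a<N. basis_tensor (?upd a) j) =
        (\<Sum>a<N. if a = j k then basis_tensor (?upd (j k)) j else 0)"
      by (intro sum.cong refl)
    then show ?thesis
      by (simp only: sum.delta finite_lessThan lessThan_iff basis_tensor_def)
  qed
  ultimately show "brauer_act n N (bar_transpos n k l) (basis_tensor i) j =
      (if i k = i l then \<Sum>a<N. basis_tensor (?upd a) j else 0)"
    unfolding bar_transpos_def brauer_act_bgen[OF bar_graph_mem[OF kl] i]
    by (cases "i k = i l"; cases "j k < N"; cases "j = ?upd (j k)") (simp_all only: if_True if_False simp_thms)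
qed

definition traceless :: "nat \<Rightarrow> nat \<Rightarrow> tensor set" where
  "traceless n N = {t \<in> tensors n N. \<forall>k\<in>{1..n}. \<forall>l\<in>{1..n}.
     k \<noteq> l \<longrightarrow> brauer_act n N (bar_transpos n k l) t = (\<lambda>_. 0)}"


section \<open>Young diagrams and Specht modules\<close>

text \<open>A diagram is the set of its boxes (row, column), rows and columns being counted from 1.\<close>

type_synonym diagram = "(nat \<times> nat) set"

definition young_diagram :: "diagram \<Rightarrow> bool" where
  "young_diagram \<mu> \<longleftrightarrow> finite \<mu> \<and>
     (\<forall>(i, j)\<in>\<mu>. 1 \<le> i \<and> 1 \<le> j \<and> {1..i} \<times> {1..j} \<subseteq> \<mu>)"

definition box_content :: "nat \<times> nat \<Rightarrow> complex" where
  "box_content = (\<lambda>(i, j). of_nat j - of_nat i)"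

definition added_boxes :: "diagram \<Rightarrow> (nat \<times> nat) set" where
  "added_boxes \<mu> = {x. x \<notin> \<mu> \<and> young_diagram (insert x \<mu>)}"

definition removed_boxes :: "diagram \<Rightarrow> (nat \<times> nat) set" where
  "removed_boxes \<mu> = {x \<in> \<mu>. young_diagram (\<mu> - {x})}"

definition orth_diagrams :: "nat \<Rightarrow> nat \<Rightarrow> diagram set" where
  "orth_diagrams n N = {\<mu>. young_diagram \<mu> \<and> card {x \<in> \<mu>. snd x \<le> 2} \<le> N \<and>
     (\<exists>r\<le>n div 2. card \<mu> = n - 2 * r)}"

text \<open>The row-reading tableau: \<open>box_number \<mu>\<close> numbers the boxes by \<open>1, \<dots>, card \<mu>\<close>, row by row.\<close>

definition box_number :: "diagram \<Rightarrow> nat \<times> nat \<Rightarrow> nat" where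
  "box_number \<mu> = (\<lambda>(i, j). card {(i', j') \<in> \<mu>. i' < i \<or> i' = i \<and> j' \<le> j})"

definition box_at :: "diagram \<Rightarrow> nat \<Rightarrow> nat \<times> nat" where
  "box_at \<mu> = the_inv_into \<mu> (box_number \<mu>)"

definition row_group :: "diagram \<Rightarrow> (nat \<Rightarrow> nat) set" where
  "row_group \<mu> = {p. p permutes {1..card \<mu>} \<and>
     (\<forall>a\<in>{1..card \<mu>}. fst (box_at \<mu> (p a)) = fst (box_at \<mu> a))}"

definition col_group :: "diagram \<Rightarrow> (nat \<Rightarrow> nat) set" where
  "col_group \<mu> = {q. q permutes {1..card \<mu>} \<and>
     (\<forall>a\<in>{1..card \<mu>}. snd (box_at \<mu> (q a)) = snd (box_at \<mu> a))}"

text \<open>The group algebra of \<open>S(m)\<close> consists of functions on permutations, and \<open>S\<^sup>\<mu>\<close> is realised in it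
  as the left ideal generated by the Young symmetrizer.\<close>

type_synonym gvec = "(nat \<Rightarrow> nat) \<Rightarrow> complex"

definition young_symmetrizer :: "diagram \<Rightarrow> gvec" where
  "young_symmetrizer \<mu> = (\<lambda>s. \<Sum>p\<in>row_group \<mu>. \<Sum>q\<in>col_group \<mu>.
     if p \<circ> q = s then of_int (sign q) else 0)"

definition left_transl :: "(nat \<Rightarrow> nat) \<Rightarrow> gvec \<Rightarrow> gvec" where
  "left_transl p v = (\<lambda>s. v (Hilbert_Choice.inv p \<circ> s))"

definition specht :: "diagram \<Rightarrow> gvec set" where
  "specht \<mu> = {v. \<exists>a. v = (\<lambda>s. \<Sum>p | p permutes {1..card \<mu>}.
     a p * left_transl p (young_symmetrizer \<mu>) s)}"


section \<open>The modules \<open>U(\<mu>,N)\<close> and \<open>V(\<mu>,n)\<close>\<close>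

text \<open>The multiplicity space \<open>U(\<mu>,N)\<close> of \<open>S\<^sup>\<mu>\<close> in the traceless tensors is \<open>Hom\<close> over \<open>S(m)\<close> from \<open>S\<^sup>\<mu>\<close>
  to the traceless tensors, with \<open>m\<close> the number of boxes; the multiplicity space \<open>V(\<mu>,n)\<close> of
  \<open>U(\<mu>,N)\<close> in the \<open>n\<close>-th tensor power of \<open>U\<close> is \<open>Hom\<close> over \<open>G\<close> from \<open>U(\<mu>,N)\<close> to that power.
  Homomorphisms are extended by zero outside their domain, so that they are determined by their
  restriction to it. The groups and \<open>B(n,N)\<close> act on the values.\<close>

definition weyl_module :: "diagram \<Rightarrow> nat \<Rightarrow> (gvec \<Rightarrow> tensor) set" where
  "weyl_module \<mu> N = {\<phi>.
     (\<forall>v\<in>specht \<mu>. \<phi> v \<in> traceless (card \<mu>) N) \<and>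
     (\<forall>v. v \<notin> specht \<mu> \<longrightarrow> \<phi> v = (\<lambda>_. 0)) \<and>
     (\<forall>v\<in>specht \<mu>. \<forall>w\<in>specht \<mu>. \<forall>a b.
        \<phi> (\<lambda>s. a * v s + b * w s) = (\<lambda>i. a * \<phi> v i + b * \<phi> w i)) \<and>
     (\<forall>v\<in>specht \<mu>. \<forall>p. p permutes {1..card \<mu>} \<longrightarrow>
        \<phi> (left_transl p v) = brauer_act (card \<mu>) N (bgen (perm_graph (card \<mu>) p)) (\<phi> v))}"

definition brauer_module :: "diagram \<Rightarrow> nat \<Rightarrow> nat \<Rightarrow> ((gvec \<Rightarrow> tensor) \<Rightarrow> tensor) set" where
  "brauer_module \<mu> n N = {f.
     (\<forall>\<phi>\<in>weyl_module \<mu> N. f \<phi> \<in> tensors n N) \<and>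
     (\<forall>\<phi>. \<phi> \<notin> weyl_module \<mu> N \<longrightarrow> f \<phi> = (\<lambda>_. 0)) \<and>
     (\<forall>\<phi>\<in>weyl_module \<mu> N. \<forall>\<psi>\<in>weyl_module \<mu> N. \<forall>a b.
        f (\<lambda>v i. a * \<phi> v i + b * \<psi> v i) = (\<lambda>i. a * f \<phi> i + b * f \<psi> i)) \<and>
     (\<forall>\<phi>\<in>weyl_module \<mu> N. \<forall>g\<in>orthogonal_group N.
        f (\<lambda>v. group_act (card \<mu>) N g (\<phi> v)) = group_act n N g (f \<phi>))}"

text \<open>The scalar by which \<open>b\<close> acts on \<open>V(\<mu>,n)\<close>.\<close>

definition eigenvalue_on :: "diagram \<Rightarrow> nat \<Rightarrow> nat \<Rightarrow> bvec \<Rightarrow> complex" where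
  "eigenvalue_on \<mu> n N b = (THE c. \<forall>f\<in>brauer_module \<mu> n N.
     (\<lambda>\<phi>. brauer_act n N b (f \<phi>)) = (\<lambda>\<phi> i. c * f \<phi> i))"


section \<open>The generating series\<close>

text \<open>Formal Laurent series in \<open>u\<^sup>-\<^sup>1\<close>: the library variable \<open>fls_X\<close> is \<open>u\<^sup>-\<^sup>1\<close>. They form a field, in which
  the quotients below are the expansions in \<open>u\<^sup>-\<^sup>1\<close>. Distinct added (or removed) boxes have distinct
  contents, so the products run over boxes.\<close>

abbreviation var_u :: "complex fls" where
  "var_u \<equiv> fls_X_inv"

definition Z_series :: "nat \<Rightarrow> nat \<Rightarrow> diagram \<Rightarrow> complex fls" where
  "Z_series N k \<mu> = fps_to_fls (Abs_fps (\<lambda>i. eigenvalue_on \<mu> (k - 1) N (z_elem N k i)))"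

definition Q_factor :: "complex \<Rightarrow> complex fls" where
  "Q_factor b = (var_u + fls_const b) / (var_u - fls_const b)"

definition Q_series :: "nat \<Rightarrow> diagram \<Rightarrow> complex fls" where
  "Q_series N \<mu> =
     (\<Prod>x\<in>added_boxes \<mu>. Q_factor ((of_nat N - 1) / 2 + box_content x)) *
     (\<Prod>x\<in>removed_boxes \<mu>. Q_factor (- (of_nat N - 1) / 2 - box_content x))"

end

theory Submission
  imports Defs "HOL-Computational_Algebra.Polynomial" "Jordan_Normal_Form.Determinant"
begin

text \<open>The operator of \<open>z\<^sub>k\<^sup>(\<^sup>i\<^sup>)\<close> is the partial trace of the \<open>i\<close>-th power of \<open>x\<^sub>k\<close> over the \<open>k\<close>-th tensor
  factor. The relation of \<open>x\<^sub>k\<^sub>+\<^sub>1\<close> to \<open>x\<^sub>k\<close> gives a recursion in \<open>k\<close> for the partial trace of the resolvent of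
  \<open>x\<^sub>k\<close>, so the generating function of these operators is rational and symmetric in the Jucys--Murphy
  elements \<open>x\<^sub>1, \<dots>, x\<^sub>k\<^sub>-\<^sub>1\<close>. On the other hand, the operator is a polynomial in the generators of the Lie
  algebra of \<open>O(N)\<close> which does not depend on \<open>k\<close>, so its eigenvalue on \<open>V(\<mu>, k - 1)\<close> can be computed on
  the traceless tensors of degree \<open>m\<close>, the number of boxes of \<open>\<mu>\<close>. There \<open>B(m, N)\<close> acts through \<open>S(m)\<close>, and
  symmetric functions of the Jucys--Murphy elements act on \<open>S\<^sup>\<mu>\<close> by the values at the contents of the
  boxes. The resulting product over all boxes telescopes to \<open>Q(\<mu>, u)\<close>, box by box. It remains to see that
  \<open>V(\<mu>, k - 1)\<close> is not zero, for which isotropic vectors of \<open>U\<close> provide a traceless tensor.\<close>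

section \<open>Resolvents and contractions\<close>

text \<open>With T = u^-1 and W = T Z, the claim says that Y = 2 W + 2 - T acts by (2 + T) Q(\<mu>,
  u). Y is the combination for which the recursion becomes homogeneous: Y at k + 1 times 1 - (u -
  x)^-2 equals Y at k times 1 - (u + x)^-2, where x = x_k. With q(b) = (u + b) / (u - b), each step
  thus multiplies by q(x + 1) q(x - 1) / q(x)^2, which is how Q changes when a box of content x - (N
  - 1) / 2 is added. Two obstacles shape the proof. On the modules only symmetric polynomials in the
  x_k are known to act by scalars, so the solution of the recursion is kept as a polynomial identity
  Y D = P and divided only after evaluation on an eigenvector. For m < k - 1 the x_j on V(\<mu>, k -
  1) are not described by the contents of \<mu> alone; this is avoided by passing to degree m
  through G-homomorphisms. These commute with group elements only, and the Lie algebra generators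
  are recovered from them without limits, as finite combinations of rational rotations.\<close>

locale matrix_units =
  fixes N :: nat and E :: "nat \<Rightarrow> nat \<Rightarrow> nat \<Rightarrow> 'r::ring_1" and c0 :: 'r
  assumes E_mult: "\<lbrakk>a < N; b < N; c < N; d < N\<rbrakk> \<Longrightarrow> E l a b * E l c d = (if b = c then E l a d else 0)"
    and E_comm: "l \<noteq> l' \<Longrightarrow> E l a b * E l' c d = E l' c d * E l a b"
    and E_sum: "(\<Sum>a<N. E l a a) = 1"
    and c0_comm: "c0 * x = x * c0"
    and two_c0: "2 * c0 = of_nat N - 1"
begin

text \<open>\<open>E l a b\<close> stands for the matrix unit e_ab in the \<open>l\<close>-th tensor
  factor, so \<open>sw\<close> and \<open>ct\<close> are the images of (k,l) and of its barred
  version. Only the relations of the locale are used, because the results are needed both for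
  operators and for power series of operators.\<close>

definition sw :: "nat \<Rightarrow> nat \<Rightarrow> 'r" where
  "sw k l = (\<Sum>a<N. \<Sum>b<N. E k a b * E l b a)"

definition ct :: "nat \<Rightarrow> nat \<Rightarrow> 'r" where
  "ct k l = (\<Sum>a<N. \<Sum>b<N. E k a b * E l a b)"

definition X :: "nat \<Rightarrow> 'r" where
  "X k = c0 + (\<Sum>l=1..<k. sw k l - ct k l)"

text \<open>The partial trace over factor \<open>l\<close>, tensored again with the identity of that
  factor: the sum over \<open>a\<close> collects the diagonal entries of A, and the sum over
  \<open>c\<close> restores the identity.\<close>

definition tr :: "nat \<Rightarrow> 'r \<Rightarrow> 'r" where
  "tr l A = (\<Sum>a<N. \<Sum>c<N. E l c a * A * E l a c)"

text \<open>The action of e_ba - e_ab, an element of the Lie algebra of O(N), on the first k - 1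
  factors.\<close>

definition G :: "nat \<Rightarrow> nat \<Rightarrow> nat \<Rightarrow> 'r" where
  "G k a b = (\<Sum>l=1..<k. E l b a - E l a b)"

text \<open>Entry (a, b) of the i-th power of the N by N matrix \<open>c0 + G k\<close>, whose
  entries lie in the ring. By \<open>X_power\<close> these entries are the coefficients of
  \<open>X k ^ i\<close> in the matrix units of factor \<open>k\<close>.\<close>

primrec P :: "nat \<Rightarrow> nat \<Rightarrow> nat \<Rightarrow> nat \<Rightarrow> 'r" where
  "P k 0 = (\<lambda>a b. if a = b then 1 else 0)"
| "P k (Suc i) = (\<lambda>a b. c0 * P k i a b + (\<Sum>c<N. P k i a c * G k c b))"

section \<open>Relations between swaps, contractions and matrix units\<close>

lemma sw_sym: "k \<noteq> l \<Longrightarrow> sw k l = sw l k"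
  unfolding sw_def by (subst sum.swap) (simp add: E_comm)

lemma ct_sym: "k \<noteq> l \<Longrightarrow> ct k l = ct l k"
  unfolding ct_def by (simp add: E_comm)

lemma E_sw1:
  assumes "a < N" "b < N" "k \<noteq> l"
  shows "E k a b * sw k l = (\<Sum>d<N. E k a d * E l d b)"
proof -
  have "E k a b * sw k l = (\<Sum>c<N. \<Sum>d<N. (E k a b * E k c d) * E l d c)"
    unfolding sw_def by (simp add: sum_distrib_left mult.assoc)
  also have "\<dots> = (\<Sum>c<N. if c = b then (\<Sum>d<N. E k a d * E l d c) else 0)"
    using assms by (intro sum.cong) (auto simp: E_mult)
  finally show ?thesis using assms by simp
qed

lemma sw_E2:
  assumes "a < N" "b < N" "k \<noteq> l"
  shows "sw k l * E l a b = (\<Sum>d<N. E k a d * E l d b)"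
proof -
  have "sw k l * E l a b = (\<Sum>c<N. \<Sum>d<N. E k c d * (E l d c * E l a b))"
    unfolding sw_def by (simp add: sum_distrib_right mult.assoc)
  also have "\<dots> = (\<Sum>c<N. if c = a then (\<Sum>d<N. E k c d * E l d b) else 0)"
    using assms by (intro sum.cong) (auto simp: E_mult)
  finally show ?thesis using assms by simp
qed

lemma sw_E:
  assumes "a < N" "b < N" "k \<noteq> l"
  shows "sw k l * E l a b = E k a b * sw k l" "sw k l * E k a b = E l a b * sw k l"
proof -
  show 1: "sw k l * E l a b = E k a b * sw k l"
    using E_sw1[OF assms] sw_E2[OF assms] by simp
  show "sw k l * E k a b = E l a b * sw k l"
    using E_sw1[of a b l k] sw_E2[of a b l k] assms sw_sym[of k l] by simp
qed

text \<open>The contraction has rank one in factors \<open>k\<close> and \<open>l\<close>: it pairs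
  with the invariant vector. Pairing with that vector moves a matrix from one factor to the other as
  its transpose.\<close>

lemma ct_E:
  assumes "a < N" "b < N" "k \<noteq> l"
  shows "ct k l * E k a b = ct k l * E l b a"
proof -
  have 1: "ct k l * E k a b = (\<Sum>c<N. E k c b * E l c a)"
  proof -
    have "ct k l * E k a b = (\<Sum>c<N. \<Sum>d<N. E k c d * E k a b * E l c d)"
      unfolding ct_def using assms(3)
      by (auto simp: sum_distrib_right mult.assoc E_comm[of l k] intro!: sum.cong)
    also have "\<dots> = (\<Sum>c<N. \<Sum>d<N. if d = a then E k c b * E l c d else 0)"
      using assms by (intro sum.cong refl) (auto simp: E_mult)
    finally show ?thesis using assms by simp
  qed
  have 2: "ct k l * E l b a = (\<Sum>c<N. E k c b * E l c a)"
  proof -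
    have "ct k l * E l b a = (\<Sum>c<N. \<Sum>d<N. E k c d * (E l c d * E l b a))"
      unfolding ct_def by (simp add: sum_distrib_right mult.assoc)
    also have "\<dots> = (\<Sum>c<N. \<Sum>d<N. if d = b then E k c d * E l c a else 0)"
      using assms by (intro sum.cong refl) (auto simp: E_mult)
    finally show ?thesis using assms by simp
  qed
  show ?thesis using 1 2 by simp
qed

lemma E_ct:
  assumes "a < N" "b < N" "k \<noteq> l"
  shows "E k a b * ct k l = E l b a * ct k l"
proof -
  have 1: "E k a b * ct k l = (\<Sum>d<N. E k a d * E l b d)"
  proof -
    have "E k a b * ct k l = (\<Sum>c<N. \<Sum>d<N. (E k a b * E k c d) * E l c d)"
      unfolding ct_def by (simp add: sum_distrib_left mult.assoc)
    also have "\<dots> = (\<Sum>c<N. if c = b then \<Sum>d<N. E k a d * E l c d else 0)"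
      using assms by (intro sum.cong refl) (auto simp: E_mult)
    finally show ?thesis using assms by simp
  qed
  have 2: "E l b a * ct k l = (\<Sum>d<N. E k a d * E l b d)"
  proof -
    have "E l b a * ct k l = (\<Sum>c<N. \<Sum>d<N. E k c d * (E l b a * E l c d))"
      unfolding ct_def using assms(3)
      by (simp add: sum_distrib_left mult.assoc[symmetric] E_comm[of l k])
    also have "\<dots> = (\<Sum>c<N. if c = a then \<Sum>d<N. E k c d * E l b d else 0)"
      using assms by (intro sum.cong refl) (auto simp: E_mult)
    finally show ?thesis using assms by simp
  qed
  show ?thesis using 1 2 by simp
qed

lemma E_comm2:
  assumes "p \<noteq> k" "p \<noteq> l"
  shows "E k a b * E l c d * E p x y = E p x y * (E k a b * E l c d)"
proof -
  have "E k a b * E l c d * E p x y = E k a b * (E p x y * E l c d)"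
    using E_comm[of l p c d x y] assms by (simp add: mult.assoc)
  also have "\<dots> = E p x y * E k a b * E l c d"
    using E_comm[of k p a b x y] assms by (simp add: mult.assoc[symmetric])
  finally show ?thesis by (simp add: mult.assoc)
qed

lemma sw_comm_E: "p \<noteq> k \<Longrightarrow> p \<noteq> l \<Longrightarrow> sw k l * E p a b = E p a b * sw k l"
  unfolding sw_def by (simp add: sum_distrib_left sum_distrib_right E_comm2)

lemma ct_comm_E: "p \<noteq> k \<Longrightarrow> p \<noteq> l \<Longrightarrow> ct k l * E p a b = E p a b * ct k l"
  unfolding ct_def by (simp add: sum_distrib_left sum_distrib_right E_comm2)

lemma ct_sw: assumes "k \<noteq> l" shows "ct k l * sw k l = ct k l"
proof -
  have "ct k l * sw k l = (\<Sum>a<N. \<Sum>b<N. ct k l * E k a b * E l b a)"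
    unfolding sw_def[of k l] by (simp add: sum_distrib_left mult.assoc)
  also have "\<dots> = (\<Sum>a<N. \<Sum>b<N. ct k l * (E l b a * E l b a))"
    using assms by (intro sum.cong refl) (subst ct_E[OF _ _ assms], auto simp: mult.assoc)
  also have "\<dots> = (\<Sum>a<N. \<Sum>b<N. if b = a then ct k l * E l a a else 0)"
    by (intro sum.cong refl) (auto simp: E_mult)
  also have "\<dots> = ct k l * (\<Sum>a<N. E l a a)"
    by (simp add: sum_distrib_left)
  finally show ?thesis by (simp add: E_sum)
qed

lemma sw_ct: assumes "k \<noteq> l" shows "sw k l * ct k l = ct k l"
proof -
  have "sw k l * ct k l = (\<Sum>a<N. \<Sum>b<N. E k a b * (E l b a * ct k l))"
    unfolding sw_def[of k l] by (simp add: sum_distrib_right mult.assoc)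
  also have "\<dots> = (\<Sum>a<N. \<Sum>b<N. (E k a b * E k a b) * ct k l)"
    using assms by (intro sum.cong refl) (simp add: E_ct[of _ _ k l, symmetric] mult.assoc)
  also have "\<dots> = (\<Sum>a<N. \<Sum>b<N. if b = a then E k a a * ct k l else 0)"
    by (intro sum.cong refl) (auto simp: E_mult)
  also have "\<dots> = (\<Sum>a<N. E k a a) * ct k l"
    by (simp add: sum_distrib_right)
  finally show ?thesis by (simp add: E_sum)
qed

lemma ct_ct: assumes "k \<noteq> l" shows "ct k l * ct k l = of_nat N * ct k l"
proof -
  have "ct k l * ct k l = (\<Sum>a<N. \<Sum>b<N. ct k l * E k a b * E l a b)"
    unfolding ct_def[of k l] by (simp add: sum_distrib_left mult.assoc)
  also have "\<dots> = (\<Sum>a<N. \<Sum>b<N. ct k l * (E l b a * E l a b))"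
    using assms by (intro sum.cong refl) (subst ct_E[OF _ _ assms], auto simp: mult.assoc)
  also have "\<dots> = (\<Sum>a<N. \<Sum>b<N. ct k l * E l b b)"
    by (intro sum.cong refl) (auto simp: E_mult)
  also have "\<dots> = (\<Sum>a<N. ct k l * (\<Sum>b<N. E l b b))"
    by (simp add: sum_distrib_left)
  finally show ?thesis by (simp add: E_sum)
qed

lemma sw_sw: assumes "k \<noteq> l" shows "sw k l * sw k l = 1"
proof -
  have "sw k l * sw k l = (\<Sum>a<N. \<Sum>b<N. E k a b * (E l b a * sw k l))"
    by (subst sw_def) (simp add: sum_distrib_right mult.assoc)
  also have "\<dots> = (\<Sum>a<N. \<Sum>b<N. E k a b * sw k l * E k b a)"
    using assms by (intro sum.cong refl) (simp add: sw_E(2)[of _ _ k l, symmetric] mult.assoc)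
  also have "\<dots> = (\<Sum>a<N. \<Sum>b<N. \<Sum>d<N. E k a d * E l d b * E k b a)"
    using assms by (simp add: E_sw1 sum_distrib_right)
  also have "\<dots> = (\<Sum>a<N. \<Sum>b<N. \<Sum>d<N. if d = b then E k a a * E l d b else 0)"
    using assms by (intro sum.cong refl) (simp add: mult.assoc E_comm[of l k], simp add: mult.assoc[symmetric] E_mult)
  also have "\<dots> = (\<Sum>a<N. E k a a * (\<Sum>b<N. E l b b))"
    by (simp add: sum_distrib_left)
  finally show ?thesis by (simp add: E_sum)
qed

section \<open>Jucys-Murphy elements and the Lie algebra of O(N)\<close>

lemma G_antisym: "G k a b = - G k b a"
  unfolding G_def by (simp add: sum_negf[symmetric])

lemma G_comm_E: "k \<le> p \<Longrightarrow> G k a b * E p c d = E p c d * G k a b"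
  unfolding G_def by (simp add: sum_distrib_left sum_distrib_right algebra_simps E_comm)

lemma X_eq_G: "X k = c0 + (\<Sum>a<N. \<Sum>b<N. G k a b * E k a b)"
proof -
  have "sw k l - ct k l = (\<Sum>a<N. \<Sum>b<N. (E l b a - E l a b) * E k a b)" if "l < k" for l
    unfolding sw_def ct_def using that by (simp add: sum_subtractf algebra_simps E_comm)
  then have "(\<Sum>l=1..<k. sw k l - ct k l) = (\<Sum>l=1..<k. \<Sum>a<N. \<Sum>b<N. (E l b a - E l a b) * E k a b)"
    by simp
  also have "\<dots> = (\<Sum>a<N. \<Sum>l=1..<k. \<Sum>b<N. (E l b a - E l a b) * E k a b)"
    by (rule sum.swap)
  also have "\<dots> = (\<Sum>a<N. \<Sum>b<N. \<Sum>l=1..<k. (E l b a - E l a b) * E k a b)"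
    by (intro sum.cong refl sum.swap)
  finally show ?thesis
    unfolding X_def G_def by (simp add: sum_distrib_right)
qed

lemma X_comm_E: "k < p \<Longrightarrow> X k * E p a b = E p a b * X k"
  unfolding X_def
  by (simp add: algebra_simps sum_distrib_left sum_distrib_right c0_comm sw_comm_E ct_comm_E)

lemma sw_comm_G:
  assumes "1 \<le> i" "i < k" "1 \<le> j" "j < k" "i \<noteq> j" "a < N" "b < N"
  shows "sw i j * G k a b = G k a b * sw i j"
proof -
  let ?\<tau> = "id(i := j, j := i)"
  have *: "sw i j * (E l b a - E l a b) = (E (?\<tau> l) b a - E (?\<tau> l) a b) * sw i j" for l
    using assms by (auto simp: algebra_simps sw_E sw_comm_E)
  have "sw i j * G k a b = (\<Sum>l=1..<k. E (?\<tau> l) b a - E (?\<tau> l) a b) * sw i j"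
    unfolding G_def sum_distrib_left sum_distrib_right using * by (intro sum.cong) auto
  also have "(\<Sum>l=1..<k. E (?\<tau> l) b a - E (?\<tau> l) a b) = G k a b"
    unfolding G_def
    by (rule sum.reindex_bij_witness[of _ ?\<tau> ?\<tau>]) (use assms in auto)
  finally show ?thesis .
qed

text \<open>The invariant vector in factors \<open>i\<close> and \<open>j\<close> is killed by the
  Lie algebra: transposition turns the contribution of one factor into the negative of the other.
  The remaining factors do not meet the contraction.\<close>

lemma ct_comm_G:
  assumes "1 \<le> i" "i < k" "1 \<le> j" "j < k" "i \<noteq> j" "a < N" "b < N"
  shows "ct i j * G k a b = G k a b * ct i j"
proof -
  have split: "G k a b = (E i b a - E i a b) + (E j b a - E j a b) + (\<Sum>l\<in>{1..<k} - {i, j}. E l b a - E l a b)"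
  proof -
    have "{1..<k} = insert i (insert j ({1..<k} - {i, j}))" using assms by auto
    then show ?thesis unfolding G_def using assms
      by (metis (no_types, lifting) Diff_iff add.assoc finite_Diff finite_atLeastLessThan finite_insert insert_iff sum.insert)
  qed
  have "ct i j * (\<Sum>l\<in>{1..<k} - {i, j}. E l b a - E l a b) = (\<Sum>l\<in>{1..<k} - {i, j}. E l b a - E l a b) * ct i j"
    unfolding sum_distrib_left sum_distrib_right
    by (intro sum.cong refl) (auto simp: algebra_simps ct_comm_E)
  moreover have "ct i j * (E i b a - E i a b + (E j b a - E j a b)) = 0"
    using ct_E[of a b i j] ct_E[of b a i j] assms by (simp add: algebra_simps)
  moreover have "(E i b a - E i a b + (E j b a - E j a b)) * ct i j = 0"
    using E_ct[of a b i j] E_ct[of b a i j] assms by (simp add: algebra_simps)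
  ultimately show ?thesis
    unfolding split by (simp add: distrib_left distrib_right)
qed

lemma sw_comm_X:
  assumes "1 \<le> i" "i < k" "1 \<le> j" "j < k" "i \<noteq> j"
  shows "sw i j * X k = X k * sw i j"
proof -
  have "sw i j * (G k a b * E k a b) = G k a b * E k a b * sw i j" if "a < N" "b < N" for a b
    using sw_comm_G[OF assms that] sw_comm_E[of k i j a b] assms by (metis mult.assoc nat_less_le)
  then show ?thesis
    unfolding X_eq_G by (simp add: distrib_left distrib_right sum_distrib_left sum_distrib_right c0_comm)
qed

lemma ct_comm_X:
  assumes "1 \<le> i" "i < k" "1 \<le> j" "j < k" "i \<noteq> j"
  shows "ct i j * X k = X k * ct i j"
proof -
  have "ct i j * (G k a b * E k a b) = G k a b * E k a b * ct i j" if "a < N" "b < N" for a b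
    using ct_comm_G[OF assms that] ct_comm_E[of k i j a b] assms by (metis mult.assoc nat_less_le)
  then show ?thesis
    unfolding X_eq_G by (simp add: distrib_left distrib_right sum_distrib_left sum_distrib_right c0_comm)
qed

lemma X_comm_less: "1 \<le> j \<Longrightarrow> j < k \<Longrightarrow> X j * X k = X k * X j"
  unfolding X_def[of j]
  by (simp add: algebra_simps sum_distrib_left sum_distrib_right c0_comm sw_comm_X ct_comm_X)

lemma X_comm: "1 \<le> j \<Longrightarrow> 1 \<le> k \<Longrightarrow> X j * X k = X k * X j"
  using X_comm_less[of j k] X_comm_less[of k j] by (cases j k rule: linorder_cases) auto

text \<open>Conjugation by the swap moves factor \<open>k\<close> to \<open>k + 1\<close> and fixes
  the factors below, so it turns the terms of \<open>X k\<close> into those of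
  \<open>X (Suc k)\<close> with l < k. The term with l = k has to be added.\<close>

lemma X_Suc:
  assumes "1 \<le> k"
  shows "X (Suc k) = sw k (Suc k) * X k * sw k (Suc k) + sw k (Suc k) - ct k (Suc k)"
proof -
  let ?s = "sw k (Suc k)"
  have conj: "?s * E k a b * ?s = E (Suc k) a b" if "a < N" "b < N" for a b
    using sw_E(2)[of a b k "Suc k"] sw_sw[of k "Suc k"] that by (simp add: mult.assoc)
  have conj2: "?s * (E l a b * E k c d) * ?s = E l a b * E (Suc k) c d"
    if "l < k" "c < N" "d < N" for l a b c d
  proof -
    have "?s * (E l a b * E k c d) * ?s = E l a b * (?s * E k c d * ?s)"
      using sw_comm_E[of l k "Suc k" a b] that(1) by (simp add: mult.assoc[symmetric])
    then show ?thesis using conj that by simp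
  qed
  have c1: "?s * sw k l * ?s = sw (Suc k) l" if "l < k" for l
  proof -
    have "?s * sw k l * ?s = (\<Sum>a<N. \<Sum>b<N. ?s * (E l b a * E k a b) * ?s)"
      unfolding sw_def[of k l] using that E_comm[of k l]
      by (simp add: sum_distrib_left sum_distrib_right)
    then show ?thesis
      unfolding sw_def[of "Suc k" l] using that E_comm[of "Suc k" l] by (simp add: conj2)
  qed
  have c2: "?s * ct k l * ?s = ct (Suc k) l" if "l < k" for l
  proof -
    have "?s * ct k l * ?s = (\<Sum>a<N. \<Sum>b<N. ?s * (E l a b * E k a b) * ?s)"
      unfolding ct_def[of k l] using that E_comm[of k l]
      by (simp add: sum_distrib_left sum_distrib_right)
    then show ?thesis
      unfolding ct_def[of "Suc k" l] using that E_comm[of "Suc k" l] by (simp add: conj2)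
  qed
  have "?s * X k * ?s = c0 * (?s * ?s) + (\<Sum>l=1..<k. ?s * sw k l * ?s - ?s * ct k l * ?s)"
    unfolding X_def
    by (simp add: distrib_left distrib_right sum_distrib_left sum_distrib_right algebra_simps c0_comm)
  also have "\<dots> = c0 + (\<Sum>l=1..<k. sw (Suc k) l - ct (Suc k) l)"
    by (simp add: sw_sw c1 c2)
  finally show ?thesis
    unfolding X_def[of "Suc k"] using assms
    by (simp add: sw_sym[of "Suc k" k] ct_sym[of "Suc k" k])
qed

lemma X_Suc_eq: "1 \<le> k \<Longrightarrow> X (Suc k) = X k + sw k (Suc k) - ct k (Suc k)
    + (\<Sum>a<N. \<Sum>b<N. G k a b * (E (Suc k) a b - E k a b))"
proof -
  assume k: "1 \<le> k"
  have "(\<Sum>a<N. \<Sum>b<N. G (Suc k) a b * E (Suc k) a b) =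
    (\<Sum>a<N. \<Sum>b<N. G k a b * E (Suc k) a b) + (\<Sum>a<N. \<Sum>b<N. (E k b a - E k a b) * E (Suc k) a b)"
    using k by (simp add: G_def sum.distrib distrib_right)
  also have "(\<Sum>a<N. \<Sum>b<N. (E k b a - E k a b) * E (Suc k) a b) = sw k (Suc k) - ct k (Suc k)"
    by (simp add: sw_sym[of k "Suc k"] sum_subtractf left_diff_distrib ct_def, simp add: sw_def E_comm)
  finally show ?thesis
    unfolding X_eq_G by (simp add: sum_subtractf right_diff_distrib algebra_simps)
qed

text \<open>Here the constant (N - 1) / 2 in the Jucys-Murphy elements is forced. Next to the
  contraction the \<open>G\<close> terms of factors \<open>k\<close> and \<open>k + 1\<close>
  cancel, since transposition turns \<open>G\<close> into its negative. What is left is 2 c0 + 1 - N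
  = 0, because the swap acts as 1 and the contraction as N.\<close>

lemma ct_X_cancel:
  assumes "1 \<le> k"
  shows "ct k (Suc k) * (X k + X (Suc k)) = 0"
proof -
  let ?e = "ct k (Suc k)"
  have eG: "?e * G k a b = G k a b * ?e" for a b
    unfolding G_def by (simp add: sum_distrib_left sum_distrib_right algebra_simps ct_comm_E)
  have "?e * (\<Sum>a<N. \<Sum>b<N. G k a b * E k a b) = (\<Sum>a<N. \<Sum>b<N. G k a b * (?e * E k a b))"
    by (simp add: sum_distrib_left mult.assoc[symmetric] eG)
  also have "\<dots> = (\<Sum>a<N. \<Sum>b<N. G k a b * (?e * E (Suc k) b a))"
    by (intro sum.cong refl arg_cong[where f = "(*) _"] ct_E) auto
  also have "\<dots> = (\<Sum>b<N. \<Sum>a<N. G k a b * (?e * E (Suc k) b a))"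
    by (rule sum.swap)
  also have "\<dots> = - (\<Sum>b<N. \<Sum>a<N. G k b a * (?e * E (Suc k) b a))"
    by (subst G_antisym) (simp add: sum_negf)
  also have "(\<Sum>b<N. \<Sum>a<N. G k b a * (?e * E (Suc k) b a)) = ?e * (\<Sum>a<N. \<Sum>b<N. G k a b * E (Suc k) a b)"
    by (simp add: sum_distrib_left mult.assoc[symmetric] eG)
  finally have 1: "?e * (\<Sum>a<N. \<Sum>b<N. G k a b * E k a b) = - (?e * (\<Sum>a<N. \<Sum>b<N. G k a b * E (Suc k) a b))" .
  have "X k + X (Suc k) = 2 * c0 + (\<Sum>a<N. \<Sum>b<N. G k a b * E k a b)
     + (\<Sum>a<N. \<Sum>b<N. G k a b * E (Suc k) a b) + sw k (Suc k) - ct k (Suc k)"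
    using X_Suc_eq[OF assms] X_eq_G[of k] by (simp add: algebra_simps sum_subtractf mult_2)
  then have "?e * (X k + X (Suc k)) = ?e * (2 * c0) + ?e * sw k (Suc k) - ?e * ?e"
    using 1 by (simp add: distrib_left right_diff_distrib)
  then show ?thesis
    unfolding two_c0 by (simp add: ct_sw ct_ct right_diff_distrib mult_of_nat_commute)
qed

lemma X_ct_cancel:
  assumes "1 \<le> k"
  shows "(X k + X (Suc k)) * ct k (Suc k) = 0"
proof -
  let ?e = "ct k (Suc k)"
  have "(\<Sum>a<N. \<Sum>b<N. G k a b * E k a b) * ?e = (\<Sum>a<N. \<Sum>b<N. G k a b * (E k a b * ?e))"
    by (simp add: sum_distrib_right mult.assoc)
  also have "\<dots> = (\<Sum>a<N. \<Sum>b<N. G k a b * (E (Suc k) b a * ?e))"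
    by (intro sum.cong refl arg_cong[where f = "(*) _"] E_ct) auto
  also have "\<dots> = (\<Sum>b<N. \<Sum>a<N. G k a b * (E (Suc k) b a * ?e))"
    by (rule sum.swap)
  also have "\<dots> = - (\<Sum>b<N. \<Sum>a<N. G k b a * (E (Suc k) b a * ?e))"
    by (subst G_antisym) (simp add: sum_negf)
  also have "(\<Sum>b<N. \<Sum>a<N. G k b a * (E (Suc k) b a * ?e)) = (\<Sum>a<N. \<Sum>b<N. G k a b * E (Suc k) a b) * ?e"
    by (simp add: sum_distrib_right mult.assoc)
  finally have 1: "(\<Sum>a<N. \<Sum>b<N. G k a b * E k a b) * ?e = - ((\<Sum>a<N. \<Sum>b<N. G k a b * E (Suc k) a b) * ?e)" .
  have "X k + X (Suc k) = 2 * c0 + (\<Sum>a<N. \<Sum>b<N. G k a b * E k a b)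
     + (\<Sum>a<N. \<Sum>b<N. G k a b * E (Suc k) a b) + sw k (Suc k) - ct k (Suc k)"
    using X_Suc_eq[OF assms] X_eq_G[of k] by (simp add: algebra_simps sum_subtractf mult_2)
  then have "(X k + X (Suc k)) * ?e = (2 * c0) * ?e + sw k (Suc k) * ?e - ?e * ?e"
    using 1 by (simp add: distrib_right left_diff_distrib)
  then show ?thesis
    unfolding two_c0 by (simp add: sw_ct ct_ct left_diff_distrib)
qed

section \<open>The partial trace over one factor\<close>

lemma tr_add: "tr l (A + B) = tr l A + tr l B"
  unfolding tr_def by (simp add: algebra_simps sum.distrib)

lemma tr_diff: "tr l (A - B) = tr l A - tr l B"
  unfolding tr_def by (simp add: algebra_simps sum_subtractf)

lemma tr_mult_left:
  assumes "\<And>a b. B * E l a b = E l a b * B"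
  shows "tr l (B * A) = B * tr l A"
proof -
  have "E l c a * (B * A) * E l a c = B * (E l c a * A * E l a c)" for a c
    using assms by (metis mult.assoc)
  then show ?thesis unfolding tr_def by (simp add: sum_distrib_left)
qed

lemma tr_mult_right:
  assumes "\<And>a b. B * E l a b = E l a b * B"
  shows "tr l (A * B) = tr l A * B"
proof -
  have "E l c a * (A * B) * E l a c = E l c a * A * E l a c * B" for a c
    using assms by (metis mult.assoc)
  then show ?thesis unfolding tr_def by (simp add: sum_distrib_right)
qed

lemma tr_1: "tr l 1 = of_nat N"
proof -
  have "tr l 1 = (\<Sum>a<N. \<Sum>c<N. E l c c)"
    unfolding tr_def by (intro sum.cong refl) (simp add: E_mult)
  then show ?thesis by (simp add: E_sum)
qed

lemma tr_const:
  assumes "\<And>a b. B * E l a b = E l a b * B"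
  shows "tr l B = B * of_nat N"
  using tr_mult_left[OF assms, of 1] by (simp add: tr_1)

lemma tr_E:
  assumes "a < N" "b < N"
  shows "tr l (E l a b) = (if a = b then 1 else 0)"
proof -
  have "tr l (E l a b) = (\<Sum>p<N. \<Sum>c<N. if p = a then (if a = b then E l c c else 0) else 0)"
    unfolding tr_def using assms by (intro sum.cong refl) (auto simp: E_mult)
  also have "\<dots> = (\<Sum>p<N. if p = a then (if a = b then 1 else 0) else 0)"
    by (intro sum.cong refl) (auto simp: E_sum)
  also have "\<dots> = (if a = b then 1 else 0)"
    using assms by simp
  finally show ?thesis .
qed

lemma tr_sum: "tr l (\<Sum>x\<in>S. f x) = (\<Sum>x\<in>S. tr l (f x))"
proof (cases "finite S")
  case True
  then show ?thesis by (induction S) (auto simp: tr_add, simp_all add: tr_def)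
qed (simp add: tr_def)

lemma tr_sw: assumes "k \<noteq> l" shows "tr l (sw k l) = 1"
proof -
  have "tr l (sw k l) = (\<Sum>a<N. \<Sum>b<N. E k a b * tr l (E l b a))"
    unfolding sw_def tr_sum using assms by (simp add: tr_mult_left E_comm)
  also have "\<dots> = (\<Sum>a<N. \<Sum>b<N. if b = a then E k a b else 0)"
    by (intro sum.cong refl) (auto simp: tr_E)
  finally show ?thesis by (simp add: E_sum)
qed

lemma tr_ct: assumes "k \<noteq> l" shows "tr l (ct k l) = 1"
proof -
  have "tr l (ct k l) = (\<Sum>a<N. \<Sum>b<N. E k a b * tr l (E l a b))"
    unfolding ct_def tr_sum using assms by (simp add: tr_mult_left E_comm)
  also have "\<dots> = (\<Sum>a<N. \<Sum>b<N. if b = a then E k a b else 0)"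
    by (intro sum.cong refl) (auto simp: tr_E)
  finally show ?thesis by (simp add: E_sum)
qed

text \<open>The partial trace is scalar in factor \<open>l\<close>, whatever A does there.\<close>

lemma tr_comm_E:
  assumes "a < N" "b < N"
  shows "tr l A * E l a b = E l a b * tr l A"
proof -
  have "tr l A * E l a b = (\<Sum>p<N. \<Sum>c<N. E l c p * A * (E l p c * E l a b))"
    unfolding tr_def by (simp add: sum_distrib_right mult.assoc)
  also have "\<dots> = (\<Sum>p<N. \<Sum>c<N. if c = a then E l a p * A * E l p b else 0)"
    using assms by (intro sum.cong refl) (auto simp: E_mult)
  also have "\<dots> = (\<Sum>p<N. E l a p * A * E l p b)"
    using assms by simp
  also have "\<dots> = (\<Sum>p<N. \<Sum>c<N. if c = b then E l a p * A * E l p b else 0)"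
    using assms by simp
  also have "\<dots> = (\<Sum>p<N. \<Sum>c<N. (E l a b * E l c p) * A * E l p c)"
    using assms by (intro sum.cong refl) (auto simp: E_mult)
  also have "\<dots> = E l a b * tr l A"
    unfolding tr_def by (simp add: sum_distrib_left mult.assoc)
  finally show ?thesis .
qed

lemma tr_comm:
  assumes "\<And>a b. B * E l a b = E l a b * B" "B * A = A * B"
  shows "B * tr l A = tr l A * B"
  using tr_mult_left[OF assms(1), of A] tr_mult_right[OF assms(1), of A] assms(2) by simp

text \<open>This brings in the partial trace: for l = k + 1 and A = x_k^i the left side is the
  sandwich that defines z_k^(i). Each matrix unit of factor \<open>l\<close> is carried over to
  factor \<open>k\<close> by the contraction on its right.\<close>

lemma ct_sandwich:
  assumes "k \<noteq> l" and A: "\<And>a b. A * E l a b = E l a b * A"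
  shows "ct k l * A * ct k l = tr k A * ct k l"
proof -
  have "ct k l * A * ct k l = (\<Sum>a<N. \<Sum>b<N. E k a b * E l a b * A * ct k l)"
    unfolding ct_def[of k l] by (simp add: sum_distrib_right)
  also have "\<dots> = (\<Sum>a<N. \<Sum>b<N. E k a b * A * (E l a b * ct k l))"
    by (simp add: mult.assoc A[symmetric])
  also have "\<dots> = (\<Sum>a<N. \<Sum>b<N. E k a b * A * E k b a * ct k l)"
    using E_ct[of _ _ k l, OF _ _ assms(1)] by (intro sum.cong refl) (simp add: mult.assoc)
  also have "\<dots> = (\<Sum>b<N. \<Sum>a<N. E k a b * A * E k b a) * ct k l"
    by (subst sum.swap) (simp add: sum_distrib_right)
  finally show ?thesis unfolding tr_def .
qed

text \<open>Tracing out \<open>l\<close> after exchanging the factors is tracing out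
  \<open>k\<close> before. The two swaps that remain outside cancel, because \<open>tr k A\<close>
  is scalar in both factors and so commutes with the swap.\<close>

lemma tr_sw_conj:
  assumes "k \<noteq> l" and A: "\<And>a b. A * E l a b = E l a b * A"
  shows "tr l (sw k l * A * sw k l) = tr k A"
proof -
  let ?s = "sw k l"
  have "E l c a * (?s * A * ?s) * E l a c = ?s * (E k c a * A * E k a c) * ?s"
    if "a < N" "c < N" for a c
  proof -
    have "E l c a * (?s * A * ?s) * E l a c = (E l c a * ?s) * A * (?s * E l a c)"
      by (simp add: mult.assoc)
    also have "\<dots> = (?s * E k c a) * A * (E k a c * ?s)"
      using sw_E[of c a k l] sw_E[of a c k l] that assms(1) by simp
    finally show ?thesis by (simp add: mult.assoc)
  qed
  then have "tr l (?s * A * ?s) = (\<Sum>a<N. \<Sum>c<N. ?s * (E k c a * A * E k a c) * ?s)"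
    unfolding tr_def by (intro sum.cong refl) auto
  also have "\<dots> = ?s * tr k A * ?s"
    unfolding tr_def by (simp add: sum_distrib_left sum_distrib_right)
  also have "\<dots> = tr k A * ?s * ?s"
  proof -
    have E: "tr k A * E l a b = E l a b * tr k A" for a b
      by (rule tr_comm[symmetric]) (use assms E_comm A in auto)
    have "E k a b * E l b a * tr k A = tr k A * (E k a b * E l b a)" if "a < N" "b < N" for a b
    proof -
      have "E k a b * E l b a * tr k A = E k a b * tr k A * E l b a"
        by (simp add: mult.assoc E)
      then show ?thesis using tr_comm_E[OF that, of k A] by (simp add: mult.assoc[symmetric])
    qed
    then have "?s * tr k A = tr k A * ?s"
      unfolding sw_def by (simp add: sum_distrib_left sum_distrib_right)
    then show ?thesis by simp
  qed
  finally show ?thesis using assms by (simp add: mult.assoc sw_sw)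
qed

lemma P_comm_E: "k \<le> p \<Longrightarrow> P k i a b * E p c d = E p c d * P k i a b"
proof (induction i arbitrary: a b)
  case (Suc i)
  have "P k i a x * G k x b * E p c d = E p c d * (P k i a x * G k x b)" for x
  proof -
    have "P k i a x * G k x b * E p c d = P k i a x * (E p c d * G k x b)"
      using G_comm_E[of k p] Suc.prems by (simp add: mult.assoc)
    then show ?thesis using Suc by (simp add: mult.assoc[symmetric])
  qed
  moreover have "c0 * P k i a b * E p c d = E p c d * (c0 * P k i a b)"
  proof -
    have "c0 * P k i a b * E p c d = c0 * E p c d * P k i a b"
      using Suc by (simp add: mult.assoc)
    then show ?thesis using c0_comm[of "E p c d"] by (simp add: mult.assoc)
  qed
  ultimately show ?case
    by (simp add: distrib_left distrib_right sum_distrib_left sum_distrib_right)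
qed auto

lemma X_power: "X k ^ i = (\<Sum>a<N. \<Sum>b<N. P k i a b * E k a b)"
proof (induction i)
  case 0
  have "(\<Sum>a<N. \<Sum>b<N. P k 0 a b * E k a b) = (\<Sum>a<N. \<Sum>b<N. if b = a then E k a a else 0)"
    by (intro sum.cong refl) auto
  then show ?case by (simp add: E_sum)
next
  case (Suc i)
  let ?G = "\<Sum>a<N. \<Sum>b<N. G k a b * E k a b"
  have "P k i a b * E k a b * ?G = (\<Sum>d<N. P k i a b * G k b d * E k a d)" if "a < N" "b < N" for a b
  proof -
    have "P k i a b * E k a b * ?G = (\<Sum>c<N. \<Sum>d<N. P k i a b * (E k a b * (G k c d * E k c d)))"
      by (simp add: sum_distrib_left mult.assoc)
    also have "\<dots> = (\<Sum>c<N. \<Sum>d<N. P k i a b * (G k c d * (E k a b * E k c d)))"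
    proof -
      have "E k a b * (G k c d * y) = G k c d * (E k a b * y)" for c d y
        using G_comm_E[of k k c d a b] by (simp add: mult.assoc[symmetric])
      then show ?thesis by simp
    qed
    also have "\<dots> = (\<Sum>c<N. if c = b then \<Sum>d<N. P k i a b * (G k b d * E k a d) else 0)"
      using that by (intro sum.cong refl) (auto simp: E_mult)
    finally show ?thesis using that by (simp add: mult.assoc)
  qed
  then have "X k ^ i * ?G = (\<Sum>a<N. \<Sum>b<N. \<Sum>d<N. P k i a b * G k b d * E k a d)"
    unfolding Suc by (simp add: sum_distrib_right)
  also have "\<dots> = (\<Sum>a<N. \<Sum>d<N. \<Sum>b<N. P k i a b * G k b d * E k a d)"
    by (intro sum.cong refl sum.swap)
  finally have "X k ^ i * ?G = (\<Sum>a<N. \<Sum>d<N. (\<Sum>b<N. P k i a b * G k b d) * E k a d)"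
    by (simp add: sum_distrib_right)
  moreover have "X k ^ i * c0 = (\<Sum>a<N. \<Sum>d<N. c0 * P k i a d * E k a d)"
    unfolding Suc by (simp add: c0_comm[symmetric] sum_distrib_left mult.assoc)
  ultimately show ?case
    unfolding power_Suc2 X_eq_G by (simp add: distrib_left distrib_right sum.distrib)
qed

text \<open>The traced power is a polynomial in the \<open>G k a b\<close> of the same shape for
  every \<open>k\<close>. This is what later permits a change of the tensor degree.\<close>

lemma tr_X_power: "tr k (X k ^ i) = (\<Sum>a<N. P k i a a)"
proof -
  have "tr k (X k ^ i) = (\<Sum>a<N. \<Sum>b<N. P k i a b * tr k (E k a b))"
    unfolding X_power tr_sum by (intro sum.cong refl tr_mult_left P_comm_E) simp
  also have "\<dots> = (\<Sum>a<N. \<Sum>b<N. if b = a then P k i a a else 0)"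
    by (intro sum.cong refl) (auto simp: tr_E)
  finally show ?thesis by simp
qed

end

section \<open>The recursion for the traced resolvent\<close>

locale matrix_units_resolvent = matrix_units N E c0
  for N and E :: "nat \<Rightarrow> nat \<Rightarrow> nat \<Rightarrow> 'r::ring_1" and c0 +
  fixes T :: 'r and g h :: "nat \<Rightarrow> 'r"
  assumes T_comm: "T * x = x * T"
    and g1: "1 \<le> k \<Longrightarrow> g k * (1 - T * X k) = 1" and g2: "1 \<le> k \<Longrightarrow> (1 - T * X k) * g k = 1"
    and h1: "1 \<le> k \<Longrightarrow> h k * (1 + T * X k) = 1" and h2: "1 \<le> k \<Longrightarrow> (1 + T * X k) * h k = 1"
begin


lemma TX_comm: "x * X k = X k * x \<Longrightarrow> T * X k * x = x * (T * X k)"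
proof -
  assume "x * X k = X k * x"
  then have "T * X k * x = T * x * X k" by (simp add: mult.assoc)
  then show ?thesis using T_comm[of x] by (simp add: mult.assoc)
qed

lemma g_comm:
  assumes "1 \<le> k" "x * X k = X k * x"
  shows "x * g k = g k * x"
proof -
  have *: "(1 - T * X k) * x = x * (1 - T * X k)"
    using TX_comm[OF assms(2)] by (simp add: algebra_simps)
  have "g k * x = g k * (x * (1 - T * X k)) * g k"
    using g2[OF assms(1)] by (simp add: mult.assoc)
  also have "\<dots> = g k * (1 - T * X k) * x * g k"
    unfolding *[symmetric] by (simp add: mult.assoc)
  finally show ?thesis using g1[OF assms(1)] by simp
qed

lemma h_comm:
  assumes "1 \<le> k" "x * X k = X k * x"
  shows "x * h k = h k * x"
proof -
  have *: "(1 + T * X k) * x = x * (1 + T * X k)"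
    using TX_comm[OF assms(2)] by (simp add: algebra_simps)
  have "h k * x = h k * (x * (1 + T * X k)) * h k"
    using h2[OF assms(1)] by (simp add: mult.assoc)
  also have "\<dots> = h k * (1 + T * X k) * x * h k"
    unfolding *[symmetric] by (simp add: mult.assoc)
  finally show ?thesis using h1[OF assms(1)] by simp
qed

text \<open>For T = u^-1 these are R = (u - x_k)^-1, S = (u + x_k)^-1 and the partial trace W of R.
  Y is 2 T times the generating series plus u - 1/2, the combination that the theorem equates with
  (u + 1/2) Q.\<close>

definition R :: "nat \<Rightarrow> 'r" where "R k = T * g k"
definition S :: "nat \<Rightarrow> 'r" where "S k = T * h k"
definition W :: "nat \<Rightarrow> 'r" where "W k = tr k (R k)"
definition Y :: "nat \<Rightarrow> 'r" where "Y k = 2 * W k + 2 - T"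

lemma R_comm: "1 \<le> k \<Longrightarrow> x * X k = X k * x \<Longrightarrow> x * R k = R k * x"
  unfolding R_def using g_comm[of k x] T_comm by (metis mult.assoc)

lemma S_comm: "1 \<le> k \<Longrightarrow> x * X k = X k * x \<Longrightarrow> x * S k = S k * x"
  unfolding S_def using h_comm[of k x] T_comm by (metis mult.assoc)

text \<open>The partial fraction identity 2 u / ((u - x) (u + x)) = 1 / (u - x) + 1 / (u + x),
  multiplied by T.\<close>

lemma R_S_rel:
  assumes "1 \<le> k"
  shows "T * (R k + S k) = 2 * (R k * S k)"
proof -
  have gh: "g k * h k = h k * g k"
    by (rule h_comm) (use assms g_comm[of k "X k"] in auto)
  have "g k + h k = g k * ((1 + T * X k) + (1 - T * X k)) * h k"
  proof -
    have "g k * (1 + T * X k) * h k = g k" using h2[OF assms] by (simp add: mult.assoc)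
    moreover have "g k * (1 - T * X k) * h k = h k" using g1[OF assms] by simp
    ultimately show ?thesis by (simp only: distrib_left distrib_right)
  qed
  then have "g k + h k = 2 * (g k * h k)" by (simp add: mult_2 mult_2_right distrib_right distrib_left)
  then have "T * T * (g k + h k) = 2 * (T * g k * (T * h k))"
    using T_comm[of "g k"] by (simp add: mult.assoc mult_2 distrib_left) (metis mult.assoc)
  then show ?thesis unfolding R_def S_def by (simp add: distrib_left mult.assoc)
qed

text \<open>The relations x_(k+1) s = s x_k + 1 - e and s x_(k+1) = x_k s + 1 - e, multiplied by
  resolvents from both sides.\<close>

lemma R_Suc_sw:
  assumes "1 \<le> k"
  defines "s \<equiv> sw k (Suc k)" and "e \<equiv> ct k (Suc k)"
  shows "s * R k = R (Suc k) * s - R (Suc k) * R k + R (Suc k) * e * R k"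
    and "R k * s = s * R (Suc k) - R k * R (Suc k) + R k * e * R (Suc k)"
proof -
  let ?x = "X k" and ?x' = "X (Suc k)"
  have ss: "s * s = 1" unfolding s_def by (rule sw_sw) simp
  have es: "e * s = e" "s * e = e" unfolding s_def e_def by (simp_all add: ct_sw sw_ct)
  have x': "?x' = s * ?x * s + s - e" unfolding s_def e_def by (rule X_Suc[OF assms(1)])
  have 1: "?x' * s = s * ?x + 1 - e" unfolding x' using ss es by (simp add: left_diff_distrib right_diff_distrib distrib_left distrib_right mult.assoc)
  have 2: "s * ?x' = ?x * s + 1 - e" unfolding x' using ss es by (simp add: left_diff_distrib right_diff_distrib distrib_left distrib_right mult.assoc[symmetric])
  have T: "s * T = T * s" using T_comm[of s] by simp
  have a: "s * (1 - T * ?x) = (1 - T * ?x') * s + T * (1 - e)"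
  proof -
    have "T * (?x' * s) = T * (s * ?x) + T * (1 - e)" unfolding 1 by (simp add: algebra_simps)
    moreover have "s * (T * ?x) = T * (s * ?x)" using T by (simp add: mult.assoc[symmetric])
    ultimately show ?thesis by (simp add: algebra_simps)
  qed
  have b: "(1 - T * ?x) * s = s * (1 - T * ?x') + T * (1 - e)"
  proof -
    have "T * (s * ?x') = T * (?x * s) + T * (1 - e)" unfolding 2 by (simp add: algebra_simps)
    moreover have "s * (T * ?x') = T * (s * ?x')" using T by (simp add: mult.assoc[symmetric])
    ultimately show ?thesis by (simp add: algebra_simps)
  qed
  let ?g = "g k" and ?g' = "g (Suc k)"
  have k': "1 \<le> Suc k" by simp
  have "?g' * s = ?g' * (s * (1 - T * ?x)) * ?g"
    using g2[OF assms(1)] by (simp add: mult.assoc)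
  also have "\<dots> = (?g' * (1 - T * ?x')) * s * ?g + ?g' * T * (1 - e) * ?g"
    unfolding a by (simp only: distrib_left distrib_right mult.assoc)
  finally have A: "s * ?g = ?g' * s - ?g' * T * (1 - e) * ?g"
    using g1[OF k'] by simp
  have "s * ?g' = ?g * ((1 - T * ?x) * s) * ?g'"
    using g1[OF assms(1)] by (simp add: mult.assoc[symmetric])
  also have "\<dots> = ?g * s * ((1 - T * ?x') * ?g') + ?g * T * (1 - e) * ?g'"
    unfolding b by (simp only: distrib_left distrib_right mult.assoc)
  finally have B: "?g * s = s * ?g' - ?g * T * (1 - e) * ?g'"
    using g2[OF k'] by simp
  have "s * R k = T * (s * ?g)" unfolding R_def using T by (simp add: mult.assoc[symmetric])
  also have "\<dots> = R (Suc k) * s - R (Suc k) * (1 - e) * R k"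
  proof -
    have "T * (?g' * T * (1 - e) * ?g) = (T * ?g') * (1 - e) * (T * ?g)"
      using T_comm[of "1 - e"] by (simp add: mult.assoc)
    then show ?thesis unfolding A R_def by (simp add: right_diff_distrib mult.assoc)
  qed
  finally show "s * R k = R (Suc k) * s - R (Suc k) * R k + R (Suc k) * e * R k"
    by (simp add: algebra_simps)
  have "R k * s = T * (?g * s)" unfolding R_def by (simp add: mult.assoc)
  also have "\<dots> = s * R (Suc k) - R k * (1 - e) * R (Suc k)"
  proof -
    have "T * (?g * T * (1 - e) * ?g') = (T * ?g) * (1 - e) * (T * ?g')"
      using T_comm[of "1 - e"] by (simp add: mult.assoc)
    moreover have "T * (s * ?g') = s * (T * ?g')" using T by (simp add: mult.assoc[symmetric])
    ultimately show ?thesis unfolding B R_def by (simp add: right_diff_distrib)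
  qed
  finally show "R k * s = s * R (Suc k) - R k * R (Suc k) + R k * e * R (Suc k)"
    by (simp add: algebra_simps)
qed

text \<open>By \<open>ct_X_cancel\<close> and \<open>X_ct_cancel\<close>, x_(k+1) may be replaced by
  - x_k next to the contraction, so (u - x_(k+1))^-1 becomes (u + x_k)^-1.\<close>

lemma ct_R_Suc:
  assumes "1 \<le> k"
  defines "e \<equiv> ct k (Suc k)"
  shows "e * R (Suc k) = e * S k" and "R (Suc k) * e = S k * e"
proof -
  have k': "1 \<le> Suc k" by simp
  have "X k * X (Suc k) = X (Suc k) * X k" using X_comm[OF assms(1) k'] .
  then have xg: "X k * g (Suc k) = g (Suc k) * X k" by (rule g_comm[OF k'])
  have eT: "e * T = T * e" using T_comm[of e] by simp
  have e1: "e * (1 - T * X (Suc k)) = e * (1 + T * X k)"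
    using ct_X_cancel[OF assms(1)] eT unfolding e_def
    by (simp add: algebra_simps) (metis add_eq_0_iff2 minus_mult_right mult.assoc)
  have e2: "(1 - T * X (Suc k)) * e = (1 + T * X k) * e"
    using X_ct_cancel[OF assms(1)] unfolding e_def
    by (simp add: algebra_simps) (metis add_eq_0_iff2 minus_mult_right)
  have c: "g (Suc k) * (1 + T * X k) = (1 + T * X k) * g (Suc k)"
    using xg T_comm[of "g (Suc k)"] by (simp add: algebra_simps) (metis mult.assoc)
  have "e * h k = e * (1 - T * X (Suc k)) * g (Suc k) * h k"
    using g2[OF k'] by (simp add: mult.assoc)
  also have "\<dots> = e * (g (Suc k) * (1 + T * X k)) * h k"
    unfolding e1 c by (simp add: mult.assoc)
  finally have A: "e * h k = e * g (Suc k)" using h2[OF assms(1)] by (simp add: mult.assoc)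
  have "h k * e = h k * (g (Suc k) * ((1 - T * X (Suc k)) * e))"
    using g1[OF k'] by (simp add: mult.assoc[symmetric])
  also have "\<dots> = h k * ((1 + T * X k) * g (Suc k)) * e"
    unfolding e2 c[symmetric] by (simp add: mult.assoc)
  also have "\<dots> = g (Suc k) * e" using h1[OF assms(1)] by (simp add: mult.assoc[symmetric])
  finally have B: "h k * e = g (Suc k) * e" .
  show "e * R (Suc k) = e * S k" unfolding R_def S_def
    using A eT by (simp add: mult.assoc[symmetric]) (simp add: mult.assoc)
  show "R (Suc k) * e = S k * e" unfolding R_def S_def
    using B by (simp add: mult.assoc)
qed

lemma RR_comm: "1 \<le> j \<Longrightarrow> 1 \<le> k \<Longrightarrow> R j * R k = R k * R j"
  by (metis R_comm X_comm)

lemma RS_comm: "1 \<le> k \<Longrightarrow> R k * S k = S k * R k"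
  by (metis R_comm S_comm)

lemma R_comm_E: "1 \<le> k \<Longrightarrow> k < p \<Longrightarrow> R k * E p a b = E p a b * R k"
  by (rule R_comm[symmetric]) (simp_all add: X_comm_E)

lemma S_comm_E: "1 \<le> k \<Longrightarrow> k < p \<Longrightarrow> S k * E p a b = E p a b * S k"
  by (rule S_comm[symmetric]) (simp_all add: X_comm_E)

lemma W_comm: "1 \<le> k \<Longrightarrow> (\<And>a b. x * E k a b = E k a b * x) \<Longrightarrow> x * X k = X k * x \<Longrightarrow> x * W k = W k * x"
  unfolding W_def by (rule tr_comm) (auto intro: R_comm)

lemma W_comm_E: "1 \<le> k \<Longrightarrow> k < p \<Longrightarrow> W k * E p a b = E p a b * W k"
  by (rule W_comm[symmetric]) (auto simp: E_comm X_comm_E)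

text \<open>Cyclicity for a constant matrix in the traced factor. For two general elements it fails,
  since their entries in that factor need not commute.\<close>

lemma tr_cyclic:
  assumes "a < N" "b < N"
  shows "tr l (E l a b * A) = tr l (A * E l a b)"
proof -
  have "tr l (E l a b * A) = (\<Sum>p<N. \<Sum>c<N. if p = a then E l c b * A * E l a c else 0)"
    unfolding tr_def using assms by (intro sum.cong refl) (auto simp: mult.assoc[symmetric] E_mult)
  also have "\<dots> = (\<Sum>c<N. E l c b * A * E l a c)"
    by (subst sum.swap) (use assms in simp)
  also have "\<dots> = (\<Sum>p<N. \<Sum>c<N. if p = b then E l c b * A * E l a c else 0)"
    by (subst sum.swap) (use assms in simp)
  also have "\<dots> = tr l (A * E l a b)"
    unfolding tr_def using assms by (intro sum.cong refl) (auto simp: mult.assoc E_mult)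
  finally show ?thesis .
qed

lemma G_Suc_comm_X:
  assumes "1 \<le> k" "a < N" "b < N"
  shows "G (Suc k) a b * X k = X k * G (Suc k) a b"
proof -
  have "G (Suc k) a b * sw k l = sw k l * G (Suc k) a b" "G (Suc k) a b * ct k l = ct k l * G (Suc k) a b"
    if "l \<in> {1..<k}" for l
    using sw_comm_G[of k "Suc k" l a b] ct_comm_G[of k "Suc k" l a b] assms that by auto
  then show ?thesis
    unfolding X_def by (simp add: distrib_left distrib_right sum_distrib_left sum_distrib_right
      right_diff_distrib left_diff_distrib c0_comm)
qed

text \<open>\<open>R k\<close> commutes with the Lie algebra acting on the factors 1, ..., k. The
  generator is split into its part on the first k - 1 factors, which passes through the trace, and
  its part on factor \<open>k\<close>, whose commutator has trace zero by
  \<open>tr_cyclic\<close>.\<close>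

lemma G_comm_W:
  assumes k: "1 \<le> k" and ab: "a < N" "b < N"
  shows "G k a b * W k = W k * G k a b"
proof -
  let ?F = "E k b a - E k a b"
  have "G (Suc k) a b * R k = R k * G (Suc k) a b"
    by (rule R_comm[OF k G_Suc_comm_X[OF assms]])
  moreover have "G (Suc k) a b = G k a b + ?F"
    using k by (simp add: G_def)
  ultimately have "tr k (G k a b * R k) + tr k (?F * R k) = tr k (R k * G k a b) + tr k (R k * ?F)"
    by (simp add: tr_add[symmetric] distrib_left distrib_right)
  moreover have "tr k (?F * R k) = tr k (R k * ?F)"
    using ab by (simp add: tr_diff tr_cyclic left_diff_distrib right_diff_distrib)
  moreover have "tr k (G k a b * R k) = G k a b * W k" "tr k (R k * G k a b) = W k * G k a b"
    unfolding W_def by (simp_all add: tr_mult_left tr_mult_right G_comm_E)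
  ultimately show ?thesis by simp
qed

lemma W_comm_X: 
  assumes "1 \<le> k"
  shows "W k * X k = X k * W k"
proof -
  have "W k * (G k a b * E k a b) = G k a b * E k a b * W k" if "a < N" "b < N" for a b
  proof -
    have "W k * (G k a b * E k a b) = G k a b * (W k * E k a b)"
      using G_comm_W[OF assms that] by (simp add: mult.assoc[symmetric])
    then show ?thesis using tr_comm_E[OF that, of k "R k"] by (simp add: W_def mult.assoc)
  qed
  then show ?thesis
    unfolding X_eq_G by (simp add: distrib_left distrib_right sum_distrib_left sum_distrib_right c0_comm)
qed

lemma W_comm_X_le:
  assumes "1 \<le> j" "j \<le> k"
  shows "X j * W k = W k * X j"
proof (cases "j = k")
  case False
  then show ?thesis using assms by (intro W_comm) (auto simp: X_comm X_comm_E)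
qed (use assms W_comm_X in simp)

text \<open>Solves for the resolvent of x_(k+1). On the right, factor k + 1 occurs only in s and e,
  so that the partial trace over it can be evaluated.\<close>

lemma R_Suc_expand:
  assumes k: "1 \<le> k"
  defines "s \<equiv> sw k (Suc k)" and "e \<equiv> ct k (Suc k)"
  shows "R (Suc k) - R k * R k * R (Suc k) = s * R k * s + R k * s * R k - R k * S k * e * R k
     - S k * e * S k + S k * e * S k * R k - S k * W k * e * S k"
proof -
  let ?R = "R k" and ?R' = "R (Suc k)" and ?S = "S k"
  have ss: "s * s = 1" unfolding s_def by (rule sw_sw) simp
  have es: "e * s = e" unfolding s_def e_def by (simp add: ct_sw)
  have eR': "e * ?R' = e * ?S" "?R' * e = ?S * e"
    unfolding e_def using ct_R_Suc[OF k] by auto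
  have RR: "?R' * ?R = ?R * ?R'" using RR_comm[of "Suc k" k] k by simp
  \<comment> \<open>Two contractions around \<open>R k\<close> produce its partial trace; this makes
    the recursion close in W.\<close>
  have eRe: "e * ?R * e = W k * e"
    unfolding e_def W_def by (rule ct_sandwich) (use k in \<open>auto intro: R_comm_E\<close>)
  have 1: "s * ?R = ?R' * s - ?R * ?R' + ?S * e * ?R"
    using R_Suc_sw(1)[OF k] eR' RR unfolding s_def e_def by simp
  have 2: "?R * s = s * ?R' - ?R * ?R' + ?R * e * ?R'"
    using R_Suc_sw(2)[OF k] unfolding s_def e_def by simp
  have "e * ?R * s = e * (s * ?R' - ?R * ?R' + ?R * e * ?R')"
    using 2 by (simp add: mult.assoc)
  also have "\<dots> = e * s * ?R' - e * (?R' * ?R) + (e * ?R * e) * ?R'"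
    unfolding RR by (simp add: algebra_simps)
  also have "\<dots> = e * ?S - e * ?S * ?R + W k * e * ?S"
    unfolding es eRe using eR' by (simp add: mult.assoc[symmetric]) (simp add: mult.assoc eR')
  finally have eRs: "e * ?R * s = e * ?S - e * ?S * ?R + W k * e * ?S" .
  have "s * ?R * s = ?R' * (s * s) - ?R * ?R' * s + ?S * (e * ?R * s)"
    unfolding 1 by (simp add: left_diff_distrib distrib_right mult.assoc)
  then have A: "?R' = s * ?R * s + ?R * ?R' * s - ?S * (e * ?R * s)"
    unfolding ss by simp
  have "?R * s * ?R = ?R * ?R' * s - ?R * ?R * ?R' + ?R * ?S * e * ?R"
    unfolding mult.assoc[of ?R s ?R] 1 by (simp add: right_diff_distrib distrib_left mult.assoc)
  then have B: "?R * ?R' * s - ?R * ?R * ?R' = ?R * s * ?R - ?R * ?S * e * ?R"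
    by (simp add: eq_diff_eq)
  have "?R' - ?R * ?R * ?R' = s * ?R * s + (?R * ?R' * s - ?R * ?R * ?R') - ?S * (e * ?R * s)"
    by (subst A) simp
  also have "\<dots> = s * ?R * s + (?R * s * ?R - ?R * ?S * e * ?R) - (?S * e * ?S - ?S * e * ?S * ?R + ?S * W k * e * ?S)"
    unfolding B eRs by (simp add: right_diff_distrib distrib_left mult.assoc)
  finally show ?thesis
    by simp
qed

text \<open>The partial trace over factor k + 1 of \<open>R_Suc_expand\<close>: s and e have trace
  1, and s R s has trace W by \<open>tr_sw_conj\<close>.\<close>

lemma W_Suc:
  assumes k: "1 \<le> k"
  shows "W (Suc k) - R k * R k * W (Suc k) = W k + R k * R k - R k * S k * R k
     - S k * S k + S k * S k * R k - S k * W k * S k"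
proof -
  let ?s = "sw k (Suc k)" and ?e = "ct k (Suc k)"
  let ?t = "tr (Suc k)"
  define C where "C x \<longleftrightarrow> (\<forall>a b. x * E (Suc k) a b = E (Suc k) a b * x)" for x
  have C: "C (R k)" "C (S k)" "C (W k)"
    unfolding C_def using k by (simp_all add: R_comm_E S_comm_E W_comm_E)
  have Cm: "C (x * y)" if "C x" "C y" for x y
    using that unfolding C_def by (metis mult.assoc)
  have l: "?t (x * y) = x * ?t y" if "C x" for x y
    by (rule tr_mult_left) (use that C_def in auto)
  have r: "?t (y * x) = ?t y * x" if "C x" for x y
    by (rule tr_mult_right) (use that C_def in auto)
  have t: "?t ?s = 1" "?t ?e = 1" by (simp_all add: tr_sw tr_ct)
  have c: "?t (?s * R k * ?s) = W k"
    unfolding W_def by (rule tr_sw_conj) (use C(1) C_def in auto)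
  have "?t (R (Suc k) - R k * R k * R (Suc k)) = W (Suc k) - R k * R k * W (Suc k)"
    by (simp add: tr_diff l Cm C W_def)
  moreover have "?t (?s * R k * ?s + R k * ?s * R k - R k * S k * ?e * R k
     - S k * ?e * S k + S k * ?e * S k * R k - S k * W k * ?e * S k) =
     W k + R k * R k - R k * S k * R k - S k * S k + S k * S k * R k - S k * W k * S k"
    by (simp add: tr_diff tr_add r l Cm C c t)
  ultimately show ?thesis
    unfolding R_Suc_expand[OF k] by simp
qed

text \<open>The inhomogeneous terms of \<open>W_Suc\<close> are absorbed by 2 - T. What is left over
  is T R^2 - T S^2 = 2 R S (R - S), the partial fraction identity times R - S.\<close>

lemma Y_Suc:
  assumes k: "1 \<le> k"
  shows "Y (Suc k) * (1 - R k * R k) = Y k * (1 - S k * S k)"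
proof -
  let ?a = "R k" and ?b = "S k" and ?W = "W k" and ?V = "W (Suc k)"
  have ab: "?b * ?a = ?a * ?b" using RS_comm[OF k] by simp
  have Wb: "?b * ?W = ?W * ?b" using S_comm[OF k W_comm_X[OF k]] by simp
  have Va: "?V * ?a = ?a * ?V"
    by (rule R_comm[OF k]) (use W_comm_X_le[of k "Suc k"] k in simp)
  have 1: "?V - ?V * ?a * ?a = ?W + ?a * ?a - ?a * ?a * ?b - ?b * ?b + ?a * ?b * ?b - ?W * ?b * ?b"
  proof -
    have "?a * ?a * ?V = ?V * ?a * ?a" using Va by (metis mult.assoc)
    moreover have "?a * ?b * ?a = ?a * ?a * ?b" "?b * ?b * ?a = ?a * ?b * ?b"
      using ab by (metis mult.assoc)+
    moreover have "?b * ?W * ?b = ?W * ?b * ?b" using Wb by simp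
    ultimately show ?thesis using W_Suc[OF k] by simp
  qed
  have rel: "T * ?a + T * ?b = 2 * (?a * ?b)"
    using R_S_rel[OF k] by (simp add: distrib_left)
  have "(T * ?a + T * ?b) * (?a - ?b) = T * ?a * ?a - T * ?b * ?b"
    using ab by (simp add: algebra_simps)
  then have 2: "T * ?a * ?a - T * ?b * ?b = 2 * (?a * ?a * ?b) - 2 * (?a * ?b * ?b)"
    unfolding rel using ab by (simp add: right_diff_distrib mult.assoc)
  have "Y (Suc k) * (1 - ?a * ?a) - Y k * (1 - ?b * ?b) =
     2 * (?V - ?V * ?a * ?a) - 2 * (?W - ?W * ?b * ?b) + 2 * (?b * ?b) - 2 * (?a * ?a)
     + (T * ?a * ?a - T * ?b * ?b)"
    unfolding Y_def by (simp add: algebra_simps)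
  also have "\<dots> = 0"
    unfolding 1 2 by (simp add: algebra_simps)
  finally show ?thesis by simp
qed

text \<open>Denominators are cleared: R (1 - T x) = T, hence (1 - R^2) (1 - T x)^2 = (1 - T - T x)
  (1 + T - T x), and likewise for S with - x. Polynomials in the x_k are wanted because their
  symmetric functions have known eigenvalues.\<close>

lemma Y_Suc_poly:
  assumes k: "1 \<le> k"
  shows "Y (Suc k) * (((1 - T) - T * X k) * ((1 + T) - T * X k) * ((1 + T * X k) * (1 + T * X k)))
    = Y k * (((1 - T) + T * X k) * ((1 + T) + T * X k) * ((1 - T * X k) * (1 - T * X k)))"
proof -
  let ?x = "T * X k"
  have Tx: "T * ?x = ?x * T" using T_comm[of ?x] .
  have mp: "(1 - ?x) * (1 + ?x) = (1 + ?x) * (1 - ?x)" by (simp add: algebra_simps)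
  have Tm: "T * (1 - ?x) = (1 - ?x) * T" "T * (1 + ?x) = (1 + ?x) * T"
    using T_comm by blast+
  have 1: "((1 - T) - ?x) * ((1 + T) - ?x) = (1 - R k * R k) * ((1 - ?x) * (1 - ?x))"
  proof -
    have "R k * (1 - ?x) = T" unfolding R_def using g1[OF k] by (simp add: mult.assoc)
    moreover have "R k * R k * ((1 - ?x) * (1 - ?x)) = R k * (R k * (1 - ?x)) * (1 - ?x)"
      by (simp add: mult.assoc)
    ultimately have "R k * R k * ((1 - ?x) * (1 - ?x)) = T * T"
      using T_comm[of "R k"] by (metis mult.assoc)
    then show ?thesis using Tx by (simp add: algebra_simps)
  qed
  have 2: "((1 - T) + ?x) * ((1 + T) + ?x) = (1 - S k * S k) * ((1 + ?x) * (1 + ?x))"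
  proof -
    have "S k * (1 + ?x) = T" unfolding S_def using h1[OF k] by (simp add: mult.assoc)
    moreover have "S k * S k * ((1 + ?x) * (1 + ?x)) = S k * (S k * (1 + ?x)) * (1 + ?x)"
      by (simp add: mult.assoc)
    ultimately have "S k * S k * ((1 + ?x) * (1 + ?x)) = T * T"
      using T_comm[of "S k"] by (metis mult.assoc)
    then show ?thesis using Tx by (simp add: algebra_simps)
  qed
  have 3: "((1 - ?x) * (1 - ?x)) * ((1 + ?x) * (1 + ?x)) = ((1 + ?x) * (1 + ?x)) * ((1 - ?x) * (1 - ?x))"
    using mp by (metis mult.assoc)
  have "Y (Suc k) * ((1 - R k * R k) * ((1 - ?x) * (1 - ?x)) * ((1 + ?x) * (1 + ?x)))
     = (Y (Suc k) * (1 - R k * R k)) * (((1 - ?x) * (1 - ?x)) * ((1 + ?x) * (1 + ?x)))"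
    by (simp only: mult.assoc)
  also have "\<dots> = Y k * ((1 - S k * S k) * ((1 + ?x) * (1 + ?x)) * ((1 - ?x) * (1 - ?x)))"
    unfolding Y_Suc[OF k] 3 by (simp only: mult.assoc)
  finally show ?thesis
    unfolding 1[symmetric] 2[symmetric] by simp
qed

end

text \<open>Linear maps on all functions, without bounds on the degree or on N, so that they form a
  single type of class \<open>ring_1\<close>. As \<open>tensor\<close> and \<open>gvec\<close> are
  the same type, the ring also contains the left translations of the group algebra.\<close>

typedef tensor_op = "{A :: tensor \<Rightarrow> tensor. \<forall>c t s. A (\<lambda>j. c * t j + s j) = (\<lambda>j. c * A t j + A s j)}"
  morphisms app Tensor_Op
  by (rule exI[of _ id]) simp

setup_lifting type_definition_tensor_op

lemma app_linear: "app A (\<lambda>j. c * t j + s j) = (\<lambda>j. c * app A t j + app A s j)"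
  using app[of A] by simp

lemma app_add_arg: "app A (\<lambda>j. t j + s j) = (\<lambda>j. app A t j + app A s j)"
  using app_linear[of A 1 t s] by simp

lemma app_zero_arg [simp]: "app A (\<lambda>_. 0) = (\<lambda>_. 0)"
  using app_linear[of A "-1" t t] by (simp add: fun_eq_iff)

lemma app_scale_arg: "app A (\<lambda>j. c * t j) = (\<lambda>j. c * app A t j)"
  using app_linear[of A c t "\<lambda>_. 0"] by simp

lemma app_sum_arg: "app A (\<lambda>j. \<Sum>x\<in>S. f x j) = (\<lambda>j. \<Sum>x\<in>S. app A (f x) j)"
  by (induction S rule: infinite_finite_induct) (auto simp: app_add_arg)

lemma op_eqI: "(\<And>t j. app A t j = app B t j) \<Longrightarrow> A = B"
  by (simp add: app_inject[symmetric] fun_eq_iff)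

instantiation tensor_op :: ring_1
begin

lift_definition zero_tensor_op :: tensor_op is "\<lambda>t j. 0" by simp
lift_definition one_tensor_op :: tensor_op is "\<lambda>t. t" by simp
lift_definition plus_tensor_op :: "tensor_op \<Rightarrow> tensor_op \<Rightarrow> tensor_op" is "\<lambda>A B t j. A t j + B t j"
  by (simp add: fun_eq_iff algebra_simps)
lift_definition uminus_tensor_op :: "tensor_op \<Rightarrow> tensor_op" is "\<lambda>A t j. - A t j"
  by (simp add: fun_eq_iff algebra_simps)
lift_definition minus_tensor_op :: "tensor_op \<Rightarrow> tensor_op \<Rightarrow> tensor_op" is "\<lambda>A B t j. A t j - B t j"
  by (simp add: fun_eq_iff algebra_simps)
lift_definition times_tensor_op :: "tensor_op \<Rightarrow> tensor_op \<Rightarrow> tensor_op" is "\<lambda>A B t. A (B t)"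
  by simp

instance
proof
  fix a b c :: tensor_op
  show "a + b + c = a + (b + c)" by transfer (simp add: fun_eq_iff)
  show "a + b = b + a" by transfer (simp add: fun_eq_iff)
  show "0 + a = a" by transfer simp
  show "- a + a = 0" by transfer simp
  show "a - b = a + - b" by transfer simp
  show "a * b * c = a * (b * c)" by transfer simp
  show "1 * a = a" by transfer simp
  show "a * 1 = a" by transfer simp
  show "(a + b) * c = a * c + b * c" by transfer simp
  show "a * (b + c) = a * b + a * c"
    by (rule op_eqI) (simp add: times_tensor_op.rep_eq plus_tensor_op.rep_eq app_add_arg)
  show "(0::tensor_op) \<noteq> 1"
  proof
    assume "(0::tensor_op) = 1"
    then have "app 0 (\<lambda>_. 1) = app 1 (\<lambda>_. 1)" by simp
    then show False by (simp add: zero_tensor_op.rep_eq one_tensor_op.rep_eq fun_eq_iff)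
  qed
qed

end

lift_definition scalar_op :: "complex \<Rightarrow> tensor_op" is "\<lambda>c t j. c * t j"
  by (simp add: fun_eq_iff algebra_simps)

lemmas app_simps = zero_tensor_op.rep_eq one_tensor_op.rep_eq plus_tensor_op.rep_eq
  uminus_tensor_op.rep_eq minus_tensor_op.rep_eq times_tensor_op.rep_eq scalar_op.rep_eq

lemma app_sum: "app (\<Sum>x\<in>S. f x) t j = (\<Sum>x\<in>S. app (f x) t j)"
  by (induction S rule: infinite_finite_induct) (auto simp: app_simps)

lemma scalar_op_comm: "scalar_op c * A = A * scalar_op c"
  by (rule op_eqI) (simp add: app_simps app_scale_arg)

lemma scalar_op_hom:
  "scalar_op 0 = 0" "scalar_op 1 = 1" "scalar_op (a + b) = scalar_op a + scalar_op b"
  "scalar_op (a * b) = scalar_op a * scalar_op b" "scalar_op (- a) = - scalar_op a"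
  "scalar_op (a - b) = scalar_op a - scalar_op b"
  by (rule op_eqI, simp add: app_simps algebra_simps)+

lemma scalar_op_of_nat: "scalar_op (of_nat n) = of_nat n"
  by (induction n) (simp_all add: scalar_op_hom)

lemma scalar_op_sum: "scalar_op (\<Sum>x\<in>S. f x) = (\<Sum>x\<in>S. scalar_op (f x))"
  by (induction S rule: infinite_finite_induct) (auto simp: scalar_op_hom)

text \<open>An index \<open>j\<close> is read as the pair \<open>(j mod N, j div N)\<close>, and the matrix units act on the first
  component. So the diagonal units sum to the identity on all functions, not only on tensors.\<close>

lift_definition unit_op :: "nat \<Rightarrow> nat \<Rightarrow> nat \<Rightarrow> nat \<Rightarrow> tensor_op" is
  "\<lambda>N l a b t j. if j l mod N = a then t (j(l := b + N * (j l div N))) else 0"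
  by (simp add: fun_eq_iff)

definition c0_op :: "nat \<Rightarrow> tensor_op" where "c0_op N = scalar_op ((of_nat N - 1) / 2)"

lemma matrix_units_op:
  assumes "N \<ge> 1"
  shows "matrix_units N (unit_op N) (c0_op N)"
proof
  fix a b c d l
  assume "a < N" "b < N" "c < N" "d < N"
  then show "unit_op N l a b * unit_op N l c d = (if b = c then unit_op N l a d else 0)"
    by (intro op_eqI) (auto simp: app_simps unit_op.rep_eq)
next
  fix l l' a b c d :: nat
  assume "l \<noteq> l'"
  then show "unit_op N l a b * unit_op N l' c d = unit_op N l' c d * unit_op N l a b"
    by (intro op_eqI) (auto simp: app_simps unit_op.rep_eq fun_upd_twist)
next
  fix l
  show "(\<Sum>a<N. unit_op N l a a) = 1"
  proof (rule op_eqI)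
    fix t j
    have "app (\<Sum>a<N. unit_op N l a a) t j = (\<Sum>a<N. if a = j l mod N then t (j(l := a + N * (j l div N))) else 0)"
      unfolding app_sum by (intro sum.cong refl) (auto simp: unit_op.rep_eq)
    also have "\<dots> = t (j(l := j l mod N + N * (j l div N)))"
      using assms by simp
    finally show "app (\<Sum>a<N. unit_op N l a a) t j = app 1 t j"
      by (simp add: app_simps)
  qed
next
  show "c0_op N * x = x * c0_op N" for x
    unfolding c0_op_def by (rule scalar_op_comm)
  show "2 * c0_op N = of_nat N - 1"
  proof -
    have "c0_op N + c0_op N = scalar_op (of_nat N - 1)"
      unfolding c0_op_def scalar_op_hom(3)[symmetric] by simp
    then show ?thesis by (simp add: mult_2 scalar_op_hom scalar_op_of_nat)
  qed
qed

section \<open>Power series of operators\<close>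

lemma fps_const_sum_ring: "fps_const (\<Sum>x\<in>S. f x) = (\<Sum>x\<in>S. fps_const (f x :: 'a::ring_1))"
  by (induction S rule: infinite_finite_induct) (auto simp flip: fps_const_add)

lemma fps_const_central:
  fixes c :: "'a::ring_1"
  assumes "\<And>x. c * x = x * c"
  shows "fps_const c * A = A * fps_const c"
  by (rule fps_ext) (simp add: assms)

lemma matrix_units_fps:
  assumes "matrix_units N E c0"
  shows "matrix_units N (\<lambda>l a b. fps_const (E l a b)) (fps_const c0)"
proof -
  interpret matrix_units N E c0 by fact
  show ?thesis
  proof
    show "(2::'a fps) * fps_const c0 = of_nat N - 1"
      using two_c0 by (simp add: mult_2 flip: fps_of_nat fps_const_1_eq_1)
  qed (auto simp: E_mult fps_const_sum_ring[symmetric] E_sum E_comm intro!: fps_const_central c0_comm)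
qed

text \<open>\<open>resolvent A\<close> is \<open>(1 - A T)\<^sup>-\<^sup>1\<close>, with \<open>T = u\<^sup>-\<^sup>1\<close>.\<close>

definition resolvent :: "'a::ring_1 \<Rightarrow> 'a fps" where
  "resolvent A = Abs_fps (\<lambda>n. A ^ n)"

lemma resolvent:
  "resolvent A * (1 - fps_X * fps_const A) = 1" "(1 - fps_X * fps_const A) * resolvent A = 1"
proof -
  have "resolvent A = 1 + resolvent A * (fps_X * fps_const A)"
  proof (rule fps_ext)
    fix n
    have "resolvent A * (fps_X * fps_const A) = fps_X * (resolvent A * fps_const A)"
      by (metis fps_mult_fps_X_commute mult.assoc)
    then show "fps_nth (resolvent A) n = fps_nth (1 + resolvent A * (fps_X * fps_const A)) n"
      by (cases n) (simp_all add: resolvent_def power_commutes)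
  qed
  then show "resolvent A * (1 - fps_X * fps_const A) = 1" by (simp add: algebra_simps)
  have "resolvent A = 1 + fps_X * (fps_const A * resolvent A)"
  proof (rule fps_ext)
    show "fps_nth (resolvent A) n = fps_nth (1 + fps_X * (fps_const A * resolvent A)) n" for n
      by (cases n) (simp_all add: resolvent_def)
  qed
  then show "(1 - fps_X * fps_const A) * resolvent A = 1" by (simp add: algebra_simps)
qed

locale orth_ops =
  fixes N :: nat
  assumes N: "N \<ge> 1"
begin

sublocale op: matrix_units N "unit_op N" "c0_op N"
  by (rule matrix_units_op[OF N])

sublocale fp: matrix_units N "\<lambda>l a b. fps_const (unit_op N l a b)" "fps_const (c0_op N)"
  by (rule matrix_units_fps[OF op.matrix_units_axioms])

lemma fp_sw: "fp.sw k l = fps_const (op.sw k l)"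
  unfolding fp.sw_def op.sw_def by (simp add: fps_const_sum_ring)

lemma fp_ct: "fp.ct k l = fps_const (op.ct k l)"
  unfolding fp.ct_def op.ct_def by (simp add: fps_const_sum_ring)

lemma fp_X: "fp.X k = fps_const (op.X k)"
  unfolding fp.X_def op.X_def by (simp add: fps_const_sum_ring fp_sw fp_ct flip: fps_const_add)

lemma fp_tr: "fps_nth (fp.tr k A) n = op.tr k (fps_nth A n)"
  unfolding fp.tr_def op.tr_def by (simp add: fps_sum_nth)

sublocale fr: matrix_units_resolvent N "\<lambda>l a b. fps_const (unit_op N l a b)" "fps_const (c0_op N)"
  fps_X "\<lambda>k. resolvent (op.X k)" "\<lambda>k. resolvent (- op.X k)"
proof
  show "fps_X * x = x * fps_X" for x :: "tensor_op fps"
    by (simp add: fps_mult_fps_X_commute)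
  show "resolvent (op.X k) * (1 - fps_X * fp.X k) = 1" "(1 - fps_X * fp.X k) * resolvent (op.X k) = 1" for k
    unfolding fp_X by (rule resolvent)+
  show "resolvent (- op.X k) * (1 + fps_X * fp.X k) = 1" "(1 + fps_X * fp.X k) * resolvent (- op.X k) = 1" for k
    using resolvent[of "- op.X k"] unfolding fp_X by (simp_all flip: fps_const_neg)
qed

definition Z_op :: "nat \<Rightarrow> nat \<Rightarrow> tensor_op" where
  "Z_op k i = (\<Sum>a<N. op.P k i a a)"

text \<open>The factor T in R shifts the index, so coefficient i + 1 of W belongs to the i-th power
  of x_k.\<close>

lemma W_nth: "fps_nth (fr.W k) n = (case n of 0 \<Rightarrow> 0 | Suc i \<Rightarrow> Z_op k i)"
proof -
  have "fps_nth (fr.W k) n = op.tr k (fps_nth (fps_X * resolvent (op.X k)) n)"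
    by (simp add: fr.W_def fr.R_def fp_tr)
  then show ?thesis
    by (cases n) (simp_all add: resolvent_def op.tr_X_power Z_op_def, simp add: op.tr_def)
qed

end

text \<open>Elementary symmetric polynomials of x_1, ..., x_m. The factors stand in increasing order
  of their indices, as the ring need not be commutative.\<close>

fun esym :: "(nat \<Rightarrow> 'a::ring_1) \<Rightarrow> nat \<Rightarrow> nat \<Rightarrow> 'a" where
  "esym x 0 m = 1"
| "esym x (Suc r) 0 = 0"
| "esym x (Suc r) (Suc m) = esym x (Suc r) m + esym x r m * x (Suc m)"

primrec oprod :: "(nat \<Rightarrow> 'a::ring_1) \<Rightarrow> nat \<Rightarrow> 'a" where
  "oprod f 0 = 1"
| "oprod f (Suc m) = oprod f m * f (Suc m)"

lemma esym_eq_0: "m < r \<Longrightarrow> esym x r m = 0"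
  by (induction x r m rule: esym.induct) auto

lemma esym_fps_const: "esym (\<lambda>k. fps_const (x k)) r m = fps_const (esym x r m)"
  by (induction x r m rule: esym.induct) (auto simp flip: fps_const_add)

text \<open>The generating function of the elementary symmetric polynomials. It reduces an ordered
  product of linear factors to the \<open>esym\<close>, whose action is what will be known.\<close>

lemma oprod_linear:
  fixes x :: "nat \<Rightarrow> 'a::ring_1"
  assumes \<alpha>: "\<And>y. \<alpha> * y = y * \<alpha>" and \<beta>: "\<And>y. \<beta> * y = y * \<beta>"
  shows "oprod (\<lambda>k. \<alpha> + \<beta> * x k) m = (\<Sum>r\<le>m. \<alpha> ^ (m - r) * \<beta> ^ r * esym x r m)"
proof (induction m)
  case (Suc m)
  have \<alpha>': "\<alpha> ^ p * y = y * \<alpha> ^ p" and \<beta>': "\<beta> ^ p * y = y * \<beta> ^ p" for p y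
    by (simp_all add: power_commuting_commutes \<alpha> \<beta>)
  let ?t = "\<lambda>r. \<alpha> ^ (m - r) * \<beta> ^ r * esym x r m"
  have "oprod (\<lambda>k. \<alpha> + \<beta> * x k) (Suc m) = (\<Sum>r\<le>m. ?t r * \<alpha>) + (\<Sum>r\<le>m. ?t r * (\<beta> * x (Suc m)))"
    by (simp add: Suc sum_distrib_right distrib_left)
  also have "(\<Sum>r\<le>m. ?t r * \<alpha>) = (\<Sum>r\<le>m. \<alpha> ^ (Suc m - r) * \<beta> ^ r * esym x r m)"
  proof (intro sum.cong refl)
    fix r assume "r \<in> {..m}"
    then show "?t r * \<alpha> = \<alpha> ^ (Suc m - r) * \<beta> ^ r * esym x r m"
      using \<alpha>[of "?t r"] by (simp add: Suc_diff_le mult.assoc)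
  qed
  also have "\<dots> = (\<Sum>r\<le>Suc m. \<alpha> ^ (Suc m - r) * \<beta> ^ r * esym x r m)"
    by (simp add: esym_eq_0)
  also have "\<dots> = \<alpha> ^ Suc m + (\<Sum>r\<le>m. \<alpha> ^ (m - r) * \<beta> ^ Suc r * esym x (Suc r) m)"
    by (subst sum.atMost_Suc_shift) simp
  also have "(\<Sum>r\<le>m. ?t r * (\<beta> * x (Suc m))) = (\<Sum>r\<le>m. \<alpha> ^ (m - r) * \<beta> ^ Suc r * (esym x r m * x (Suc m)))"
  proof (intro sum.cong refl)
    fix r
    have "?t r * (\<beta> * x (Suc m)) = \<alpha> ^ (m - r) * \<beta> ^ r * (esym x r m * \<beta>) * x (Suc m)"
      by (simp add: mult.assoc)
    also have "\<dots> = \<alpha> ^ (m - r) * (\<beta> ^ r * \<beta>) * (esym x r m * x (Suc m))"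
      unfolding \<beta>[of "esym x r m", symmetric] by (simp only: mult.assoc)
    finally show "?t r * (\<beta> * x (Suc m)) = \<alpha> ^ (m - r) * \<beta> ^ Suc r * (esym x r m * x (Suc m))"
      by (simp only: power_Suc power_commutes)
  qed
  finally have "oprod (\<lambda>k. \<alpha> + \<beta> * x k) (Suc m) = \<alpha> ^ Suc m +
      (\<Sum>r\<le>m. \<alpha> ^ (m - r) * \<beta> ^ Suc r * esym x (Suc r) (Suc m))"
    by (simp add: distrib_left sum.distrib del: power_Suc)
  then show ?case
    by (subst sum.atMost_Suc_shift) simp
qed simp

lemma oprod_mult:
  assumes "\<And>j k. 1 \<le> j \<Longrightarrow> j \<le> m \<Longrightarrow> 1 \<le> k \<Longrightarrow> k \<le> m \<Longrightarrow> f j * g k = g k * f j"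
  shows "oprod (\<lambda>k. f k * g k) m = oprod f m * oprod g m"
  using assms
proof (induction m)
  case (Suc m)
  note comm = Suc.prems
  have c: "oprod g i * f (Suc m) = f (Suc m) * oprod g i" if "i \<le> m" for i
    using that
  proof (induction i)
    case (Suc i)
    have "oprod g (Suc i) * f (Suc m) = oprod g i * (f (Suc m) * g (Suc i))"
      using comm[of "Suc m" "Suc i"] Suc.prems by (simp add: mult.assoc)
    then show ?case using Suc by (simp add: mult.assoc[symmetric])
  qed simp
  have "oprod (\<lambda>k. f k * g k) (Suc m) = oprod f m * (oprod g m * f (Suc m)) * g (Suc m)"
    using Suc by (simp add: mult.assoc)
  then show ?case by (simp add: c mult.assoc)
qed simp

lemma oprod_comm:
  assumes "\<And>j. 1 \<le> j \<Longrightarrow> j \<le> m \<Longrightarrow> y * f j = f j * y"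
  shows "y * oprod f m = oprod f m * y"
  using assms
proof (induction m)
  case (Suc m)
  have "y * oprod f (Suc m) = (y * oprod f m) * f (Suc m)" by (simp add: mult.assoc)
  also have "\<dots> = oprod f m * (y * f (Suc m))" using Suc by (simp add: mult.assoc)
  finally show ?case using Suc.prems by (simp add: mult.assoc)
qed simp

text \<open>Solving a recursion \<open>y (k + 1) d k = y k n k\<close> of commuting elements.\<close>

lemma oprod_recursion:
  assumes rec: "\<And>k. 1 \<le> k \<Longrightarrow> k \<le> m \<Longrightarrow> y (Suc k) * d k = y k * n k"
    and dd: "\<And>j k. 1 \<le> j \<Longrightarrow> j \<le> m \<Longrightarrow> 1 \<le> k \<Longrightarrow> k \<le> m \<Longrightarrow> d j * d k = d k * d j"
    and dn: "\<And>j k. 1 \<le> j \<Longrightarrow> j \<le> m \<Longrightarrow> 1 \<le> k \<Longrightarrow> k \<le> m \<Longrightarrow> d j * n k = n k * d j"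
  shows "y (Suc m) * oprod d m = y 1 * oprod n m"
  using assms
proof (induction m)
  case (Suc m)
  have "y (Suc (Suc m)) * oprod d (Suc m) = y (Suc (Suc m)) * d (Suc m) * oprod d m"
    using oprod_comm[of m "d (Suc m)" d] Suc.prems(2) by (simp add: mult.assoc)
  also have "\<dots> = y (Suc m) * (n (Suc m) * oprod d m)"
    using Suc.prems(1)[of "Suc m"] by (simp add: mult.assoc)
  also have "\<dots> = y (Suc m) * oprod d m * n (Suc m)"
    using oprod_comm[of m "n (Suc m)" d] Suc.prems(3) by (simp add: mult.assoc)
  also have "\<dots> = y 1 * oprod n m * n (Suc m)"
    using Suc by simp
  finally show ?case by (simp add: mult.assoc)
qed simp

lemma commute_mult_right: "x * y = y * x \<Longrightarrow> x * z = z * x \<Longrightarrow> x * (y * z) = y * z * x"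
  for x :: "'a::ring_1"
  using mult.assoc[of x y z] mult.assoc[of y x z] mult.assoc[of y z x] by simp

lemma commute_mult_left: "x * z = z * x \<Longrightarrow> y * z = z * y \<Longrightarrow> x * y * z = z * (x * y)"
  for x :: "'a::ring_1"
  using mult.assoc[of x y z] mult.assoc[of x z y] mult.assoc[of z x y] by simp

lemma commute_linear:
  fixes x y :: "'a::ring_1"
  assumes "x * y = y * x" and a: "\<And>z. a * z = z * a" and b: "\<And>z. b * z = z * b"
    and a': "\<And>z. a' * z = z * a'" and b': "\<And>z. b' * z = z * b'"
  shows "(a + b * x) * (a' + b' * y) = (a' + b' * y) * (a + b * x)"
proof -
  have "b * x * (b' * y) = b * b' * (x * y)"
    using b'[of x] by (simp add: mult.assoc) (simp add: mult.assoc[symmetric])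
  also have "\<dots> = b' * y * (b * x)"
    using assms(1) b[of y] b[of b'] by (simp add: mult.assoc) (simp add: mult.assoc[symmetric])
  finally have "b * x * (b' * y) = b' * y * (b * x)" .
  moreover have "a * a' = a' * a" "a * (b' * y) = b' * y * a" "a' * (b * x) = b * x * a'"
    by (rule a a')+
  ultimately show ?thesis
    by (simp add: distrib_left distrib_right add_ac)
qed

section \<open>Eigenvectors of operator series\<close>

definition fps_scalar :: "complex fps \<Rightarrow> tensor_op fps" where
  "fps_scalar a = Abs_fps (\<lambda>n. scalar_op (fps_nth a n))"

lemma fps_scalar_central: "fps_scalar a * A = A * fps_scalar a"
proof (rule fps_ext)
  fix n
  have "fps_nth (fps_scalar a * A) n = (\<Sum>i=0..n. fps_nth A (n - i) * scalar_op (fps_nth a i))"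
    unfolding fps_mult_nth fps_scalar_def by (simp add: scalar_op_comm)
  also have "\<dots> = (\<Sum>i=0..n. fps_nth A i * scalar_op (fps_nth a (n - i)))"
    by (rule sum.reindex_bij_witness[of _ "\<lambda>i. n - i" "\<lambda>i. n - i"]) auto
  finally show "fps_nth (fps_scalar a * A) n = fps_nth (A * fps_scalar a) n"
    unfolding fps_mult_nth fps_scalar_def by simp
qed

lemma fps_scalar_hom:
  "fps_scalar 1 = 1" "fps_scalar (a + b) = fps_scalar a + fps_scalar b"
  "fps_scalar (a - b) = fps_scalar a - fps_scalar b" "fps_scalar (- a) = - fps_scalar a"
  "fps_scalar (a * b) = fps_scalar a * fps_scalar b" "fps_scalar fps_X = fps_X"
  "fps_scalar (fps_const c) = fps_const (scalar_op c)"
  by (rule fps_ext; simp add: fps_scalar_def scalar_op_hom fps_mult_nth scalar_op_sum fps_X_def)+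

lemma fps_scalar_0: "fps_scalar 0 = 0"
  by (rule fps_ext) (simp add: fps_scalar_def scalar_op_hom)

definition acts :: "tensor_op fps \<Rightarrow> complex fps \<Rightarrow> tensor \<Rightarrow> bool" where
  "acts A a w \<longleftrightarrow> (\<forall>n. app (fps_nth A n) w = (\<lambda>j. fps_nth a n * w j))"

lemma acts_scalar: "acts (fps_scalar a) a w"
  by (simp add: acts_def fps_scalar_def app_simps)

lemma acts_add: "acts A a w \<Longrightarrow> acts B b w \<Longrightarrow> acts (A + B) (a + b) w"
  by (simp add: acts_def app_simps fun_eq_iff algebra_simps)

lemma acts_sum: "(\<And>x. x \<in> S \<Longrightarrow> acts (f x) (g x) w) \<Longrightarrow> acts (\<Sum>x\<in>S. f x) (\<Sum>x\<in>S. g x) w"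
  by (induction S rule: infinite_finite_induct) (auto simp: acts_add, auto simp: acts_def app_simps)

lemma acts_mult: "acts A a w \<Longrightarrow> acts B b w \<Longrightarrow> acts (A * B) (a * b) w"
  unfolding acts_def
proof (intro allI ext)
  fix n j
  assume A: "\<forall>n. app (fps_nth A n) w = (\<lambda>j. fps_nth a n * w j)"
    and B: "\<forall>n. app (fps_nth B n) w = (\<lambda>j. fps_nth b n * w j)"
  have "app (fps_nth A i) (app (fps_nth B k) w) j = fps_nth a i * fps_nth b k * w j" for i k
    using A B by (simp add: app_scale_arg)
  then show "app (fps_nth (A * B) n) w j = fps_nth (a * b) n * w j"
    by (simp add: fps_mult_nth app_sum app_simps sum_distrib_right)
qed

lemma acts_power: "acts A a w \<Longrightarrow> acts (A ^ n) (a ^ n) w"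
  by (induction n) (auto intro: acts_mult simp: acts_scalar[of 1, unfolded fps_scalar_hom])

lemma acts_const: "app A w = (\<lambda>j. c * w j) \<Longrightarrow> acts (fps_const A) (fps_const c) w"
  by (simp add: acts_def app_simps)

text \<open>Division by D. Since d has constant term 1, the values of the coefficients of Y on w are
  determined one after another; it is not presupposed that w is an eigenvector of Y.\<close>

lemma acts_cancel:
  assumes "acts (Y * D) (y * d) w" "acts D d w" "fps_nth d 0 = 1"
  shows "acts Y y w"
proof -
  have "app (fps_nth Y n) w = (\<lambda>j. fps_nth y n * w j)" for n
  proof (induction n rule: less_induct)
    case (less n)
    have "app (fps_nth (Y * D) n) w = (\<lambda>j. fps_nth (y * d) n * w j)"
      using assms(1) by (simp add: acts_def)
    moreover have "app (fps_nth (Y * D) n) w j = (\<Sum>i=0..n. fps_nth d (n - i) * app (fps_nth Y i) w j)" for j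
      using assms(2) unfolding fps_mult_nth acts_def by (simp add: app_sum app_simps app_scale_arg)
    moreover have "fps_nth (y * d) n * w j = (\<Sum>i=0..n. fps_nth d (n - i) * (fps_nth y i * w j))" for j
      unfolding fps_mult_nth sum_distrib_right by (intro sum.cong refl) simp
    ultimately have "(\<Sum>i=0..n. fps_nth d (n - i) * app (fps_nth Y i) w j) = (\<Sum>i=0..n. fps_nth d (n - i) * (fps_nth y i * w j))" for j
      by (metis (no_types, lifting))
    moreover have "(\<Sum>i=0..n. fps_nth d (n - i) * app (fps_nth Y i) w j)
        = (\<Sum>i=0..<n. fps_nth d (n - i) * (fps_nth y i * w j)) + app (fps_nth Y n) w j" for j
      using less assms(3) by (simp add: atLeast0LessThan[symmetric] sum.atLeastLessThan_Suc flip: atLeastLessThanSuc_atLeastAtMost)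
    moreover have "(\<Sum>i=0..n. fps_nth d (n - i) * (fps_nth y i * w j))
        = (\<Sum>i=0..<n. fps_nth d (n - i) * (fps_nth y i * w j)) + fps_nth y n * w j" for j
      using assms(3) by (simp add: sum.atLeastLessThan_Suc flip: atLeastLessThanSuc_atLeastAtMost)
    ultimately show ?case by (simp add: fun_eq_iff)
  qed
  then show ?thesis by (simp add: acts_def)
qed

context orth_ops
begin

abbreviation "c0 \<equiv> (of_nat N - 1) / (2 :: complex)"

definition jm_op :: "nat \<Rightarrow> tensor_op" where
  "jm_op k = op.X k - c0_op N"

text \<open>A single Jucys-Murphy element need not act on w by a scalar, only the
  \<open>esym\<close> do. The central constant c0 is therefore split off first and the product
  expanded in the \<open>esym\<close> of \<open>jm_op\<close>.\<close>

lemma acts_oprod: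
  assumes w: "\<And>r. r \<le> m \<Longrightarrow> app (esym jm_op r m) w = (\<lambda>j. esym c r m * w j)"
  shows "acts (oprod (\<lambda>k. fps_scalar a + fps_scalar b * fps_const (op.X k)) m)
    (oprod (\<lambda>k. a + b * fps_const (c0 + c k)) m) w"
proof -
  let ?\<alpha> = "a + b * fps_const c0"
  have 1: "fps_scalar a + fps_scalar b * fps_const (op.X k) = fps_scalar ?\<alpha> + fps_scalar b * fps_const (jm_op k)" for k
    unfolding jm_op_def
    by (simp add: fps_scalar_hom c0_op_def distrib_left add.assoc right_diff_distrib del: fps_const_sub flip: fps_const_sub)
  have 2: "a + b * fps_const (c0 + c k) = ?\<alpha> + b * fps_const (c k)" for k
    by (simp add: algebra_simps flip: fps_const_add)
  have "acts (\<Sum>r\<le>m. fps_scalar ?\<alpha> ^ (m - r) * fps_scalar b ^ r * esym (\<lambda>k. fps_const (jm_op k)) r m)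
     (\<Sum>r\<le>m. ?\<alpha> ^ (m - r) * b ^ r * esym (\<lambda>k. fps_const (c k)) r m) w"
    unfolding esym_fps_const
    by (intro acts_sum acts_mult acts_power acts_scalar acts_const w) auto
  moreover have "oprod (\<lambda>k. fps_scalar ?\<alpha> + fps_scalar b * fps_const (jm_op k)) m =
      (\<Sum>r\<le>m. fps_scalar ?\<alpha> ^ (m - r) * fps_scalar b ^ r * esym (\<lambda>k. fps_const (jm_op k)) r m)"
    by (rule oprod_linear) (rule fps_scalar_central)+
  moreover have "oprod (\<lambda>k. ?\<alpha> + b * fps_const (c k)) m =
      (\<Sum>r\<le>m. ?\<alpha> ^ (m - r) * b ^ r * esym (\<lambda>k. fps_const (c k)) r m)"
    by (rule oprod_linear) (rule mult.commute)+
  ultimately show ?thesis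
    unfolding 1 2 by (simp only:)
qed

end

context orth_ops
begin

text \<open>\<open>y\<close> is the series by which Y of index m + 1 acts on w: the recursion solved
  with x_k replaced by c0 + c k. The second conclusion undoes Y = 2 W + 2 - T, whose coefficient i +
  1 is twice \<open>Z_op\<close>, minus 1 for i = 0.\<close>

lemma Z_op_eigen:
  assumes w: "\<And>r. r \<le> m \<Longrightarrow> app (esym jm_op r m) w = (\<lambda>j. esym c r m * w j)"
  defines "x \<equiv> \<lambda>k. fps_X * fps_const (c0 + c k)"
  obtains y where
    "y * ((1 - fps_X * fps_const c0) * (\<Prod>k=1..m. (1 - fps_X - x k) * (1 + fps_X - x k) * (1 + x k) ^ 2))
     = (2 * of_nat N * fps_X + (2 - fps_X) * (1 - fps_X * fps_const c0)) *
       (\<Prod>k=1..m. (1 - fps_X + x k) * (1 + fps_X + x k) * (1 - x k) ^ 2)"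
    "\<And>i. app (Z_op (Suc m) i) w = (\<lambda>j. (fps_nth y (Suc i) + (if i = 0 then 1 else 0)) / 2 * w j)"
proof -
  let ?X = "\<lambda>k. fps_const (op.X k)"
  define f where "f a b k = fps_scalar a + fps_scalar b * ?X k" for a b k
  define f' where "f' a b k = a + b * fps_const (c0 + c k)" for a b k
  have XX: "?X j * ?X k = ?X k * ?X j" if "1 \<le> j" "1 \<le> k" for j k
    using op.X_comm[OF that] by simp
  have ff: "f a b j * f a' b' k = f a' b' k * f a b j" if "1 \<le> j" "1 \<le> k" for a b a' b' j k
    unfolding f_def using XX[OF that] by (intro commute_linear fps_scalar_central)
  let ?T = "fps_X :: complex fps"
  define d where "d k = f (1 - ?T) (- ?T) k * f (1 + ?T) (- ?T) k * (f 1 ?T k * f 1 ?T k)" for k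
  define n where "n k = f (1 - ?T) ?T k * f (1 + ?T) ?T k * (f 1 (- ?T) k * f 1 (- ?T) k)" for k
  define d' where "d' k = f' (1 - ?T) (- ?T) k * f' (1 + ?T) (- ?T) k * (f' 1 ?T k * f' 1 ?T k)" for k
  define n' where "n' k = f' (1 - ?T) ?T k * f' (1 + ?T) ?T k * (f' 1 (- ?T) k * f' 1 (- ?T) k)" for k
  have dd: "d j * d k = d k * d j" and dn: "d j * n k = n k * d j" if "1 \<le> j" "1 \<le> k" for j k
    unfolding d_def n_def by (intro commute_mult_left commute_mult_right ff that)+
  have rec: "fr.Y (Suc k) * d k = fr.Y k * n k" if "1 \<le> k" for k
    using fr.Y_Suc_poly[OF that] unfolding d_def n_def f_def fp_X
    by (simp add: fps_scalar_hom)
  have main: "fr.Y (Suc m) * oprod d m = fr.Y 1 * oprod n m"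
    by (rule oprod_recursion) (auto simp: rec dd dn)
  have od: "oprod d m = oprod (f (1 - ?T) (- ?T)) m * oprod (f (1 + ?T) (- ?T)) m * (oprod (f 1 ?T) m * oprod (f 1 ?T) m)"
    unfolding d_def by (simp only: oprod_mult[OF ff] oprod_mult[OF commute_mult_left[OF commute_mult_right[OF ff ff] commute_mult_right[OF ff ff]]])
  have on: "oprod n m = oprod (f (1 - ?T) ?T) m * oprod (f (1 + ?T) ?T) m * (oprod (f 1 (- ?T)) m * oprod (f 1 (- ?T)) m)"
    unfolding n_def by (simp only: oprod_mult[OF ff] oprod_mult[OF commute_mult_left[OF commute_mult_right[OF ff ff] commute_mult_right[OF ff ff]]])
  have od': "oprod d' m = oprod (f' (1 - ?T) (- ?T)) m * oprod (f' (1 + ?T) (- ?T)) m * (oprod (f' 1 ?T) m * oprod (f' 1 ?T) m)"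
    unfolding d'_def by (simp add: oprod_mult mult_ac)
  have on': "oprod n' m = oprod (f' (1 - ?T) ?T) m * oprod (f' (1 + ?T) ?T) m * (oprod (f' 1 (- ?T)) m * oprod (f' 1 (- ?T)) m)"
    unfolding n'_def by (simp add: oprod_mult mult_ac)
  have af: "acts (oprod (f a b) m) (oprod (f' a b) m) w" for a b
    using acts_oprod[OF w, where a = a and b = b] by (simp add: f_def[abs_def] f'_def[abs_def])
  have aD: "acts (oprod d m) (oprod d' m) w" and aN: "acts (oprod n m) (oprod n' m) w"
    unfolding od od' on on' by (intro acts_mult af)+
  let ?v = "1 - ?T * fps_const c0"
  have "op.X 1 = c0_op N" unfolding op.X_def by simp
  then have X1: "op.X 1 = scalar_op c0" unfolding c0_op_def .
  \<comment> \<open>The initial value: x_1 is the scalar c0, so W_1 is N T / (1 - T c0).\<close>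
  have Y1: "fps_scalar ?v * fr.Y 1 = fps_scalar (2 * of_nat N * ?T + (2 - ?T) * ?v)"
  proof -
    have v: "fps_scalar ?v = 1 - fps_X * fps_const (op.X 1)"
      unfolding X1 by (simp add: fps_scalar_hom)
    have W1: "fr.W 1 = fr.R 1 * of_nat N"
      unfolding fr.W_def
    proof (rule fp.tr_const)
      fix a b
      have "op.X 1 * unit_op N 1 a b = unit_op N 1 a b * op.X 1" unfolding X1 by (rule scalar_op_comm)
      then have "fps_const (unit_op N 1 a b) * fr.R 1 = fr.R 1 * fps_const (unit_op N 1 a b)"
        by (intro fr.R_comm) (simp_all add: fp_X)
      then show "fr.R 1 * fps_const (unit_op N 1 a b) = fps_const (unit_op N 1 a b) * fr.R 1" by simp
    qed
    have "fps_scalar ?v * fr.W 1 = fps_X * (fps_scalar ?v * resolvent (op.X 1)) * of_nat N"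
      unfolding W1 fr.R_def using fps_scalar_central[of ?v fps_X] by (simp only: mult.assoc[symmetric])
    then have vW: "fps_scalar ?v * fr.W 1 = fps_X * of_nat N"
      unfolding v by (simp add: resolvent)
    have two: "fps_scalar 2 = 2" using fps_scalar_hom(2)[of 1 1] by (simp add: fps_scalar_hom)
    have nat: "fps_scalar (of_nat p) = of_nat p" for p
      by (induction p) (simp_all add: fps_scalar_hom fps_scalar_0)
    have gen: "p * (2 * V + 2 - fps_X) = 2 * (p * V) + (2 - fps_X) * p" for p V :: "tensor_op fps"
      by (simp only: distrib_left right_diff_distrib left_diff_distrib mult_2 mult_2_right
          fps_mult_fps_X_commute[of p] add_diff_eq)
    have "fps_scalar ?v * fr.Y 1 = 2 * (fps_scalar ?v * fr.W 1) + (2 - fps_X) * fps_scalar ?v"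
      unfolding fr.Y_def by (rule gen)
    also have "\<dots> = fps_scalar (2 * of_nat N * ?T + (2 - ?T) * ?v)"
      unfolding vW fps_scalar_hom(2,5) fps_scalar_hom(3)[of 2] two nat fps_scalar_hom(6)
        fps_mult_fps_X_commute[of "of_nat N"] mult.assoc ..
    finally show ?thesis .
  qed
  define dd where "dd = ?v * oprod d' m"
  define nn where "nn = (2 * of_nat N * ?T + (2 - ?T) * ?v) * oprod n' m"
  have dd0: "fps_nth dd 0 = 1"
  proof -
    have "fps_nth (oprod d' i) 0 = 1" for i
      by (induction i) (simp_all add: d'_def f'_def)
    then show ?thesis by (simp add: dd_def)
  qed
  define y where "y = nn * inverse dd"
  have y: "y * dd = nn" unfolding y_def using dd0 by (simp add: mult.assoc inverse_mult_eq_1)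
  have aD2: "acts (fps_scalar ?v * oprod d m) dd w"
    unfolding dd_def by (intro acts_mult acts_scalar aD)
  have "fr.Y (Suc m) * (fps_scalar ?v * oprod d m) = fps_scalar ?v * (fr.Y (Suc m) * oprod d m)"
    unfolding mult.assoc[symmetric] fps_scalar_central[of ?v "fr.Y (Suc m)"] ..
  also have "\<dots> = fps_scalar (2 * of_nat N * ?T + (2 - ?T) * ?v) * oprod n m"
    unfolding main by (simp only: mult.assoc[symmetric] Y1)
  finally have "acts (fr.Y (Suc m) * (fps_scalar ?v * oprod d m)) (y * dd) w"
    unfolding y nn_def by (simp only:) (intro acts_mult acts_scalar aN)
  then have aY: "acts (fr.Y (Suc m)) y w"
    using aD2 dd0 by (rule acts_cancel)
  have oprod_prod: "oprod F i = (\<Prod>k=1..i. F k)" for F :: "nat \<Rightarrow> complex fps" and i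
    by (induction i) (simp_all add: mult.commute)
  show ?thesis
  proof (rule that)
    show "y * ((1 - fps_X * fps_const c0) * (\<Prod>k=1..m. (1 - fps_X - x k) * (1 + fps_X - x k) * (1 + x k) ^ 2))
     = (2 * of_nat N * fps_X + (2 - fps_X) * (1 - fps_X * fps_const c0)) *
       (\<Prod>k=1..m. (1 - fps_X + x k) * (1 + fps_X + x k) * (1 - x k) ^ 2)"
      using y unfolding dd_def nn_def oprod_prod d'_def n'_def f'_def x_def
      by (simp add: power2_eq_square del: fps_const_add)
    fix i
    have "app (fps_nth (fr.Y (Suc m)) (Suc i)) w = (\<lambda>j. fps_nth y (Suc i) * w j)"
      using aY by (simp add: acts_def)
    moreover have "fps_nth (fr.Y (Suc m)) (Suc i) = Z_op (Suc m) i + Z_op (Suc m) i - (if i = 0 then 1 else 0)"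
      unfolding fr.Y_def by (simp add: W_nth mult_2 fps_numeral_nth)
    ultimately show "app (Z_op (Suc m) i) w = (\<lambda>j. (fps_nth y (Suc i) + (if i = 0 then 1 else 0)) / 2 * w j)"
      by (auto simp: app_simps fun_eq_iff field_simps split: if_splits)
  qed
qed

end

section \<open>Composition of Brauer graphs\<close>

lemma finite_vertices [simp]: "finite (vertices n)"
  by (simp add: vertices_def)

lemma finite_brauer_graphs [simp]: "finite (brauer_graphs n)"
  by (rule finite_subset[of _ "Pow (Pow (vertices n))"])
    (auto simp: brauer_graphs_def partition_on_def)

lemma finite_multi_indices [simp]: "finite (multi_indices n N)"
  unfolding multi_indices_def by (intro finite_PiE) auto

text \<open>A finite connected graph has at least one edge less than vertices. A largest set that
  contains x0 and satisfies the bound is all of C, since an edge leaving it would add one vertex and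
  at least one edge.\<close>

lemma card_connected_le:
  fixes E :: "'v set set"
  defines "r \<equiv> {(x, y). \<exists>e\<in>E. x \<in> e \<and> y \<in> e}"
  assumes fin: "finite E" and card: "\<And>e. e \<in> E \<Longrightarrow> card e = 2"
    and x0: "x0 \<in> C" and C: "finite C" "C = r\<^sup>+ `` {x0}"
  shows "card C \<le> Suc (card {e \<in> E. e \<subseteq> C})"
proof -
  define good where "good A \<longleftrightarrow> x0 \<in> A \<and> A \<subseteq> C \<and> card A \<le> Suc (card {e \<in> E. e \<subseteq> A})" for A
  have "good {x0}" using x0 by (simp add: good_def)
  moreover have "\<forall>A. good A \<longrightarrow> card A < Suc (card C)"
    using C by (auto simp: good_def less_Suc_eq_le intro: card_mono)
  ultimately have "\<exists>A. good A \<and> (\<forall>B. good B \<longrightarrow> card B \<le> card A)"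
    by (rule Lattices_Big.ex_has_greatest_nat)
  then obtain A where A: "good A" and max: "\<And>B. good B \<Longrightarrow> card B \<le> card A"
    by metis
  have "A = C"
  proof (rule ccontr)
    assume "A \<noteq> C"
    have "\<exists>a b. a \<in> A \<and> b \<notin> A \<and> (a, b) \<in> r"
    proof (rule ccontr)
      assume no: "\<not> ?thesis"
      have "y \<in> A" if "(x0, y) \<in> r\<^sup>+" for y
        using that by (induction rule: trancl_induct) (use no A in \<open>auto simp: good_def\<close>)
      then have "C \<subseteq> A" using C by auto
      then show False using \<open>A \<noteq> C\<close> A by (auto simp: good_def)
    qed
    then obtain a b where ab: "a \<in> A" "b \<notin> A" "(a, b) \<in> r" by blast
    then obtain e where e: "e \<in> E" "a \<in> e" "b \<in> e" by (auto simp: r_def)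
    have e_eq: "e = {a, b}"
    proof -
      have "finite e" using card[OF e(1)] by (metis card.infinite zero_neq_numeral)
      moreover have "a \<noteq> b" using ab by blast
      then have "card {a, b} = 2" by simp
      ultimately show ?thesis using card_subset_eq[of e "{a, b}"] e card[OF e(1)] by auto
    qed
    have "b \<in> C"
      using A ab C by (auto simp: good_def intro: trancl_into_trancl)
    have finA: "finite A" using A C by (auto simp: good_def intro: finite_subset)
    have "insert e {e \<in> E. e \<subseteq> A} \<subseteq> {e \<in> E. e \<subseteq> insert b A}"
      using e e_eq ab by auto
    then have "card (insert e {e \<in> E. e \<subseteq> A}) \<le> card {e \<in> E. e \<subseteq> insert b A}"
      by (rule card_mono[rotated]) (use fin in auto)
    moreover have "e \<notin> {e \<in> E. e \<subseteq> A}" using ab e by auto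
    ultimately have "good (insert b A)"
      using A \<open>b \<in> C\<close> fin finA ab by (auto simp: good_def)
    from max[OF this] show False using finA ab by simp
  qed
  then show ?thesis using A by (auto simp: good_def)
qed

abbreviation upper_half :: "vertex \<Rightarrow> stacked_vertex" where "upper_half \<equiv> case_vertex Upper Middle"
abbreviation lower_half :: "vertex \<Rightarrow> stacked_vertex" where "lower_half \<equiv> case_vertex Middle Lower"

lemma inj_halves: "inj upper_half" "inj lower_half"
  by (auto simp: inj_def split: vertex.splits)

lemma brauer_graphs_edge:
  assumes "\<gamma> \<in> brauer_graphs n" "e \<in> \<gamma>"
  shows "card e = 2" "e \<subseteq> vertices n"
  using assms by (auto simp: brauer_graphs_def partition_on_def)

lemma brauer_graphs_disjoint:
  "\<gamma> \<in> brauer_graphs n \<Longrightarrow> e \<in> \<gamma> \<Longrightarrow> f \<in> \<gamma> \<Longrightarrow> x \<in> e \<Longrightarrow> x \<in> f \<Longrightarrow> e = f"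
  by (auto simp: brauer_graphs_def partition_on_def disjoint_def)

lemma brauer_graphs_cover:
  "\<gamma> \<in> brauer_graphs n \<Longrightarrow> x \<in> vertices n \<Longrightarrow> \<exists>e\<in>\<gamma>. x \<in> e"
  by (auto simp: brauer_graphs_def partition_on_def)

lemma finite_brauer_graph: "\<gamma> \<in> brauer_graphs n \<Longrightarrow> finite \<gamma>"
  by (auto simp: brauer_graphs_def intro: finite_elements[OF finite_vertices])

section \<open>Components of two stacked graphs\<close>

locale stacked =
  fixes n :: nat and \<gamma> \<gamma>' :: graph
  assumes g: "\<gamma> \<in> brauer_graphs n" and g': "\<gamma>' \<in> brauer_graphs n"
begin

abbreviation "E \<equiv> stacked_edges \<gamma> \<gamma>'"
abbreviation "E1 \<equiv> (`) upper_half ` \<gamma>"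
abbreviation "E2 \<equiv> (`) lower_half ` \<gamma>'"
definition adj :: "(stacked_vertex \<times> stacked_vertex) set" where
  "adj = {(x, y). \<exists>e\<in>E. x \<in> e \<and> y \<in> e}"
definition S :: "stacked_vertex set" where
  "S = Upper ` {1..n} \<union> Middle ` {1..n} \<union> Lower ` {1..n}"

lemma E_eq: "E = E1 \<union> E2" by (simp add: stacked_edges_def)

lemma Union_E1: "\<Union>E1 = Upper ` {1..n} \<union> Middle ` {1..n}"
proof -
  have "\<Union>E1 = upper_half ` vertices n"
    using g by (simp add: brauer_graphs_def partition_on_def flip: image_Union)
  then show ?thesis by (auto simp: vertices_def image_Un image_image)
qed

lemma Union_E2: "\<Union>E2 = Middle ` {1..n} \<union> Lower ` {1..n}"
proof -
  have "\<Union>E2 = lower_half ` vertices n"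
    using g' by (simp add: brauer_graphs_def partition_on_def flip: image_Union)
  then show ?thesis by (auto simp: vertices_def image_Un image_image)
qed

lemma E1_disj: "e \<in> E1 \<Longrightarrow> f \<in> E1 \<Longrightarrow> x \<in> e \<Longrightarrow> x \<in> f \<Longrightarrow> e = f"
proof -
  assume "e \<in> E1" "f \<in> E1" "x \<in> e" "x \<in> f"
  then obtain e' f' v w where "e' \<in> \<gamma>" "e = upper_half ` e'" "f' \<in> \<gamma>" "f = upper_half ` f'"
    "v \<in> e'" "w \<in> f'" "upper_half v = upper_half w" by auto
  then show "e = f" using brauer_graphs_disjoint[OF g, of e' f' v] injD[OF inj_halves(1)] by metis
qed

lemma E2_disj: "e \<in> E2 \<Longrightarrow> f \<in> E2 \<Longrightarrow> x \<in> e \<Longrightarrow> x \<in> f \<Longrightarrow> e = f"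
proof -
  assume "e \<in> E2" "f \<in> E2" "x \<in> e" "x \<in> f"
  then obtain e' f' v w where "e' \<in> \<gamma>'" "e = lower_half ` e'" "f' \<in> \<gamma>'" "f = lower_half ` f'"
    "v \<in> e'" "w \<in> f'" "lower_half v = lower_half w" by auto
  then show "e = f" using brauer_graphs_disjoint[OF g', of e' f' v] injD[OF inj_halves(2)] by metis
qed

lemma Union_E: "\<Union>E = S"
  unfolding E_eq Union_Un_distrib Union_E1 Union_E2 S_def by auto

lemma finite_S [simp]: "finite S" by (simp add: S_def)

lemma finite_E: "finite E"
  using g g' finite_brauer_graph by (simp add: E_eq)

lemma card_E: "e \<in> E \<Longrightarrow> card e = 2"
  using brauer_graphs_edge(1)[OF g] brauer_graphs_edge(1)[OF g']
  by (auto simp: E_eq card_image inj_on_subset[OF inj_halves(1)] inj_on_subset[OF inj_halves(2)])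

lemma comps_eq: "stacked_components \<gamma> \<gamma>' = S // adj\<^sup>+"
  unfolding stacked_components_def Let_def Union_E adj_def ..

lemma adj_sym: "sym adj" by (auto simp: adj_def sym_def)

lemma equiv_adj: "equiv S (adj\<^sup>+)"
proof (rule equivI)
  show "refl_on S (adj\<^sup>+)"
  proof (rule refl_onI)
    fix x assume "x \<in> S"
    then have "(x, x) \<in> adj" unfolding Union_E[symmetric] by (auto simp: adj_def)
    then show "(x, x) \<in> adj\<^sup>+" ..
  qed
  have "adj \<subseteq> S \<times> S" unfolding Union_E[symmetric] by (auto simp: adj_def)
  then show "adj\<^sup>+ \<subseteq> S \<times> S" by (rule trancl_subset_Sigma)
qed (simp_all add: sym_trancl adj_sym trans_trancl)

lemma comps_Union: "\<Union>(stacked_components \<gamma> \<gamma>') = S"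
  unfolding comps_eq by (rule Union_quotient[OF equiv_adj])

lemma comps_disj:
  "C \<in> stacked_components \<gamma> \<gamma>' \<Longrightarrow> D \<in> stacked_components \<gamma> \<gamma>' \<Longrightarrow> x \<in> C \<Longrightarrow> x \<in> D \<Longrightarrow> C = D"
  unfolding comps_eq using quotient_disj[OF equiv_adj] by blast

lemma comps_nonempty: "C \<in> stacked_components \<gamma> \<gamma>' \<Longrightarrow> C \<noteq> {}"
  unfolding comps_eq using in_quotient_imp_non_empty[OF equiv_adj] by blast

lemma comps_subset: "C \<in> stacked_components \<gamma> \<gamma>' \<Longrightarrow> C \<subseteq> S"
  using comps_Union by blast

lemma comps_edge:
  assumes "C \<in> stacked_components \<gamma> \<gamma>'" "e \<in> E" "x \<in> e" "x \<in> C"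
  shows "e \<subseteq> C"
proof
  fix y assume "y \<in> e"
  then have "(x, y) \<in> adj" using assms by (auto simp: adj_def)
  then have "(x, y) \<in> adj\<^sup>+" ..
  then show "y \<in> C"
    using assms in_quotient_imp_closed[OF equiv_adj] unfolding comps_eq by blast
qed

lemma comps_ex: "x \<in> S \<Longrightarrow> \<exists>C\<in>stacked_components \<gamma> \<gamma>'. x \<in> C"
  using comps_Union by blast

lemma finite_comps [simp]: "finite (stacked_components \<gamma> \<gamma>')"
  by (rule finite_subset[of _ "Pow S"]) (use comps_subset in auto)

lemma comps_root: "C \<in> stacked_components \<gamma> \<gamma>' \<Longrightarrow> x \<in> C \<Longrightarrow> C = adj\<^sup>+ `` {x}"
  unfolding comps_eq by (metis Image_singleton_iff equiv_adj quotientE equiv_class_eq)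

lemma compsI:
  assumes "x0 \<in> C" "C \<subseteq> S" "\<And>x. x \<in> C \<Longrightarrow> (x0, x) \<in> adj\<^sup>+"
    and closed: "\<And>e x. e \<in> E \<Longrightarrow> x \<in> e \<Longrightarrow> x \<in> C \<Longrightarrow> e \<subseteq> C"
  shows "C \<in> stacked_components \<gamma> \<gamma>'"
proof -
  have "y \<in> C" if "(x0, y) \<in> adj\<^sup>+" for y
    using that by (induction rule: trancl_induct) (use assms(1) closed in \<open>auto simp: adj_def\<close>)
  then have "C = adj\<^sup>+ `` {x0}" using assms(3) by auto
  then show ?thesis unfolding comps_eq using assms(1,2) by (auto intro: quotientI)
qed

lemma card_half_edges:
  assumes C: "C \<in> stacked_components \<gamma> \<gamma>'" and F: "F \<subseteq> E"
    and disj: "\<And>e f x. e \<in> F \<Longrightarrow> f \<in> F \<Longrightarrow> x \<in> e \<Longrightarrow> x \<in> f \<Longrightarrow> e = f"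
  shows "2 * card {e \<in> F. e \<subseteq> C} = card (C \<inter> \<Union>F)"
proof -
  have eq: "\<Union>{e \<in> F. e \<subseteq> C} = C \<inter> \<Union>F"
    using comps_edge[OF C] F by fast
  have "finite F" using F finite_E by (rule finite_subset)
  moreover have "finite C" using comps_subset[OF C] by (rule finite_subset) simp
  ultimately have "2 * card {e \<in> F. e \<subseteq> C} = card (\<Union>{e \<in> F. e \<subseteq> C})"
  proof (intro card_partition)
    show "c1 \<inter> c2 = {}" if "c1 \<in> {e \<in> F. e \<subseteq> C}" "c2 \<in> {e \<in> F. e \<subseteq> C}" "c1 \<noteq> c2" for c1 c2
      using disj[of c1 c2] that by blast
  qed (use eq card_E F in auto)
  then show ?thesis unfolding eq .
qed

text \<open>Here u, m, l count the upper, middle and lower vertices of a component, a and b its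
  edges from the two graphs, and c all its edges. Middle vertices lie on two edges and the others on
  one, so u + l is even; connectedness bounds it by 2. A component that is not a loop is thus a path
  with two ends.\<close>

lemma degree_count:
  fixes a b c u m l :: nat
  assumes "2 * a = u + m" "2 * b = m + l" "u + m + l \<le> Suc c" "c \<le> a + b" "u + l \<noteq> 0"
  shows "u + l = 2"
proof -
  have "u + l + 2 * m = 2 * (a + b)" using assms(1,2) by simp
  then have "even (u + l)" by (metis dvd_triv_left even_add)
  moreover have "u + l \<noteq> 1" using calculation by fastforce
  moreover have "u + l \<le> 2" using assms(1-4) by linarith
  ultimately show ?thesis using assms(5) by (metis One_nat_def le_neq_implies_less less_2_cases)
qed

lemma card_terminals:
  assumes C: "C \<in> stacked_components \<gamma> \<gamma>'" and nl: "C \<notin> loops \<gamma> \<gamma>'"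
  shows "card (terminals C) = 2"
proof -
  let ?U = "C \<inter> range Upper" and ?M = "C \<inter> range Middle" and ?L = "C \<inter> range Lower"
  have CS: "C \<subseteq> S" by (rule comps_subset[OF C])
  have fin: "finite C" using CS by (rule finite_subset) simp
  obtain x0 where x0: "x0 \<in> C" using comps_nonempty[OF C] by blast
  have C3: "C = (?U \<union> ?M) \<union> ?L" using CS by (auto simp: S_def)
  have "card C = card (?U \<union> ?M) + card ?L"
    by (subst C3, rule card_Un_disjoint) (use fin in auto)
  also have "card (?U \<union> ?M) = card ?U + card ?M"
    by (rule card_Un_disjoint) (use fin in auto)
  finally have cC: "card C = card ?U + card ?M + card ?L" .
  have i1: "C \<inter> \<Union>E1 = ?U \<union> ?M" and i2: "C \<inter> \<Union>E2 = ?M \<union> ?L"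
    unfolding Union_E1 Union_E2 using CS by (auto simp: S_def)
  have "2 * card {e \<in> E1. e \<subseteq> C} = card ?U + card ?M"
  proof -
    have "2 * card {e \<in> E1. e \<subseteq> C} = card (C \<inter> \<Union>E1)"
      by (rule card_half_edges[OF C _ E1_disj]) (auto simp: E_eq)
    also have "\<dots> = card ?U + card ?M"
      unfolding i1 by (rule card_Un_disjoint) (use fin in auto)
    finally show ?thesis .
  qed
  moreover have "2 * card {e \<in> E2. e \<subseteq> C} = card ?M + card ?L"
  proof -
    have "2 * card {e \<in> E2. e \<subseteq> C} = card (C \<inter> \<Union>E2)"
      by (rule card_half_edges[OF C _ E2_disj]) (auto simp: E_eq)
    also have "\<dots> = card ?M + card ?L"
      unfolding i2 by (rule card_Un_disjoint) (use fin in auto)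
    finally show ?thesis .
  qed
  moreover have "card C \<le> Suc (card {e \<in> E. e \<subseteq> C})"
    by (rule card_connected_le[OF finite_E card_E x0 fin])
      (use comps_root[OF C x0] in \<open>auto simp: adj_def\<close>)
  moreover have "card {e \<in> E. e \<subseteq> C} \<le> card {e \<in> E1. e \<subseteq> C} + card {e \<in> E2. e \<subseteq> C}"
  proof -
    have *: "{e \<in> E. e \<subseteq> C} = {e \<in> E1. e \<subseteq> C} \<union> {e \<in> E2. e \<subseteq> C}"
      unfolding E_eq by blast
    show ?thesis unfolding * by (rule card_Un_le)
  qed
  moreover have "card ?U + card ?L \<noteq> 0"
  proof -
    obtain x where x: "x \<in> C" "x \<notin> range Middle" using nl C by (auto simp: loops_def)
    then have "x \<in> ?U \<union> ?L" by (cases x) auto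
    moreover have "finite ?U" "finite ?L" using fin by auto
    ultimately show ?thesis unfolding add_is_0 by (metis card_eq_0_iff empty_iff Un_iff)
  qed
  ultimately have "card ?U + card ?L = 2"
    unfolding cC by (rule degree_count)
  moreover have "card (terminals C) = card ?U + card ?L"
  proof -
    have U: "?U = Upper ` {m. Upper m \<in> C}" and L: "?L = Lower ` {m. Lower m \<in> C}" by auto
    have fU: "finite {m. Upper m \<in> C}" and fL: "finite {m. Lower m \<in> C}"
      using finite_vimageI[OF fin, of Upper] finite_vimageI[OF fin, of Lower]
      by (simp_all add: vimage_def inj_def)
    have "terminals C = Vtx ` {m. Upper m \<in> C} \<union> Bar ` {m. Lower m \<in> C}"
      by (auto simp: terminals_def)
    moreover have "card (Vtx ` {m. Upper m \<in> C} \<union> Bar ` {m. Lower m \<in> C}) = card (Vtx ` {m. Upper m \<in> C}) + card (Bar ` {m. Lower m \<in> C})"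
      using fU fL by (intro card_Un_disjoint) auto
    ultimately show ?thesis
      unfolding U L by (simp add: card_image inj_on_def)
  qed
  ultimately show ?thesis by linarith
qed

lemma graph_comp_mem: "graph_comp \<gamma> \<gamma>' \<in> brauer_graphs n"
proof -
  have c2: "card e = 2" if "e \<in> graph_comp \<gamma> \<gamma>'" for e
    using that card_terminals by (auto simp: graph_comp_def)
  have "partition_on (vertices n) (graph_comp \<gamma> \<gamma>')"
  proof (rule partition_onI)
    show "\<Union>(graph_comp \<gamma> \<gamma>') = vertices n"
    proof
      show "\<Union>(graph_comp \<gamma> \<gamma>') \<subseteq> vertices n"
        using comps_subset by (fastforce simp: graph_comp_def terminals_def vertices_def S_def)
      show "vertices n \<subseteq> \<Union>(graph_comp \<gamma> \<gamma>')"
      proof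
        fix v assume v: "v \<in> vertices n"
        define x where "x = case_vertex Upper Lower v"
        have "x \<in> S" using v by (auto simp: x_def vertices_def S_def)
        then obtain C where C: "C \<in> stacked_components \<gamma> \<gamma>'" "x \<in> C" using comps_ex by blast
        then have "C \<notin> loops \<gamma> \<gamma>'" by (auto simp: loops_def x_def split: vertex.splits)
        moreover have "v \<in> terminals C" using C by (auto simp: terminals_def x_def split: vertex.splits)
        ultimately show "v \<in> \<Union>(graph_comp \<gamma> \<gamma>')" using C by (auto simp: graph_comp_def)
      qed
    qed
    show "{} \<notin> graph_comp \<gamma> \<gamma>'" using c2 by fastforce
    show "disjnt e f" if ef: "e \<in> graph_comp \<gamma> \<gamma>'" "f \<in> graph_comp \<gamma> \<gamma>'" "e \<noteq> f" for e f
    proof -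
      obtain C D where "C \<in> stacked_components \<gamma> \<gamma>'" "e = terminals C"
        "D \<in> stacked_components \<gamma> \<gamma>'" "f = terminals D"
        using ef(1,2) unfolding graph_comp_def by blast
      then have "C \<inter> D = {}" "e = terminals C" "f = terminals D" using ef(3) comps_disj[of C D] by auto
      then show ?thesis by (auto simp: disjnt_def terminals_def)
    qed
  qed
  then show ?thesis using c2 by (auto simp: brauer_graphs_def)
qed

section \<open>Labellings of stacked graphs and multiplicativity of the action\<close>

abbreviation lab :: "(nat \<Rightarrow> nat) \<Rightarrow> (nat \<Rightarrow> nat) \<Rightarrow> (nat \<Rightarrow> nat) \<Rightarrow> stacked_vertex \<Rightarrow> nat" where
  "lab j i l \<equiv> case_stacked_vertex j i l"

text \<open>For the product of two matrices: the output index labels the upper row, the summation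
  index the middle row and the input index the lower row.\<close>

lemma compatible_iff:
  "compatible \<gamma> j i \<and> compatible \<gamma>' i l \<longleftrightarrow>
    (\<forall>C\<in>stacked_components \<gamma> \<gamma>'. \<forall>x\<in>C. \<forall>y\<in>C. lab j i l x = lab j i l y)"
proof -
  have 1: "lab j i l (upper_half v) = case_vertex j i v" "lab j i l (lower_half v) = case_vertex i l v" for v
    by (simp_all split: vertex.splits)
  have "compatible \<gamma> j i \<and> compatible \<gamma>' i l \<longleftrightarrow> (\<forall>e\<in>E. \<forall>x\<in>e. \<forall>y\<in>e. lab j i l x = lab j i l y)"
    unfolding compatible_def E_eq ball_Un by (simp add: 1 del: stacked_vertex.case)
  also have "\<dots> \<longleftrightarrow> (\<forall>C\<in>stacked_components \<gamma> \<gamma>'. \<forall>x\<in>C. \<forall>y\<in>C. lab j i l x = lab j i l y)"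
  proof (intro iffI ballI)
    fix C x y assume *: "\<forall>e\<in>E. \<forall>x\<in>e. \<forall>y\<in>e. lab j i l x = lab j i l y"
      and C: "C \<in> stacked_components \<gamma> \<gamma>'" "x \<in> C" "y \<in> C"
    have "lab j i l x = lab j i l z" if "(x, z) \<in> adj\<^sup>+" for z
      using that by (induction rule: trancl_induct) (use * in \<open>auto simp: adj_def\<close>)
    then show "lab j i l x = lab j i l y" using comps_root[OF C(1,2)] C(3) by auto
  next
    fix e x y assume *: "\<forall>C\<in>stacked_components \<gamma> \<gamma>'. \<forall>x\<in>C. \<forall>y\<in>C. lab j i l x = lab j i l y"
      and e: "e \<in> E" "x \<in> e" "y \<in> e"
    then have "x \<in> S" using Union_E by blast
    then obtain C where "C \<in> stacked_components \<gamma> \<gamma>'" "x \<in> C" using comps_ex by blast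
    then show "lab j i l x = lab j i l y" using * comps_edge[of C e x] e by blast
  qed
  finally show ?thesis .
qed

text \<open>The ends of a path are never middle vertices, so the middle labels \<open>i\<close> may
  be arbitrary.\<close>

lemma compatible_comp_iff:
  "compatible (graph_comp \<gamma> \<gamma>') j l \<longleftrightarrow> (\<forall>C\<in>stacked_components \<gamma> \<gamma>' - loops \<gamma> \<gamma>'.
    \<forall>x\<in>C - range Middle. \<forall>y\<in>C - range Middle. lab j i l x = lab j i l y)"
proof -
  have "C - range Middle = case_vertex Upper Lower ` terminals C" for C
  proof
    show "C - range Middle \<subseteq> case_vertex Upper Lower ` terminals C"
    proof
      fix x assume "x \<in> C - range Middle"
      then show "x \<in> case_vertex Upper Lower ` terminals C"
        by (cases x) (force simp: terminals_def)+
    qed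
  qed (auto simp: terminals_def)
  moreover have "case_vertex j l v = lab j i l (case_vertex Upper Lower v)" for v
    by (simp split: vertex.splits)
  ultimately show ?thesis
    unfolding compatible_def graph_comp_def by simp
qed

text \<open>The middle labels are forced on a path by the labels of its ends, while each loop may
  carry any of N labels. This is the origin of the factor N^q in the product of the Brauer
  algebra.\<close>

lemma card_middle_labels:
  assumes j: "j \<in> multi_indices n N" and l: "l \<in> multi_indices n N"
  shows "card {i \<in> multi_indices n N. compatible \<gamma> j i \<and> compatible \<gamma>' i l} =
    (if compatible (graph_comp \<gamma> \<gamma>') j l then N ^ card (loops \<gamma> \<gamma>') else 0)"
proof (cases "compatible (graph_comp \<gamma> \<gamma>') j l")
  case False
  have "compatible (graph_comp \<gamma> \<gamma>') j l" if "compatible \<gamma> j i \<and> compatible \<gamma>' i l" for i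
    using that unfolding compatible_iff compatible_comp_iff[of j l i] by blast
  then have "{i \<in> multi_indices n N. compatible \<gamma> j i \<and> compatible \<gamma>' i l} = {}"
    using False by blast
  then show ?thesis using False by simp
next
  case True
  let ?K = "stacked_components \<gamma> \<gamma>'" and ?O = "loops \<gamma> \<gamma>'"
  let ?I = "{i \<in> multi_indices n N. compatible \<gamma> j i \<and> compatible \<gamma>' i l}"
  define comp where "comp m = adj\<^sup>+ `` {Middle m}" for m
  have comp: "comp m \<in> ?K" "Middle m \<in> comp m" if "m \<in> {1..n}" for m
  proof -
    have "Middle m \<in> S" using that by (auto simp: S_def)
    then obtain C where "C \<in> ?K" "Middle m \<in> C" using comps_ex by blast
    then show "comp m \<in> ?K" "Middle m \<in> comp m" unfolding comp_def using comps_root by auto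
  qed
  have compD: "comp m = C" if "C \<in> ?K" "Middle m \<in> C" for m C
    unfolding comp_def using comps_root[OF that] by simp
  have term_ex: "\<exists>x. x \<in> C \<and> x \<notin> range Middle" if "C \<in> ?K" "C \<notin> ?O" for C
    using that by (auto simp: loops_def)
  define val where "val C = lab j l l (SOME x. x \<in> C \<and> x \<notin> range Middle)" for C
  have lab2: "lab j i l x = lab j l l x" if "x \<notin> range Middle" for i x
    using that by (cases x) auto
  have val: "lab j i l x = val C" if "C \<in> ?K" "C \<notin> ?O" "x \<in> C" "x \<notin> range Middle" for C x i
  proof -
    let ?y = "SOME x. x \<in> C \<and> x \<notin> range Middle"
    have "?y \<in> C \<and> ?y \<notin> range Middle" using term_ex[OF that(1,2)] by (rule someI_ex)
    then have "lab j l l x = lab j l l ?y"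
      using True[unfolded compatible_comp_iff[of j l l]] that by blast
    then show ?thesis using lab2[OF that(4), of i] unfolding val_def by (simp only:)
  qed
  have valN: "val C < N" if CC: "C \<in> ?K" "C \<notin> ?O" for C
  proof -
    obtain x where x: "x \<in> C" "x \<notin> range Middle" using term_ex[OF CC] by blast
    have "x \<in> S" using x CC comps_subset by blast
    then have "lab j l l x < N" using j l x by (auto simp: S_def multi_indices_def)
    then show ?thesis using val[OF CC x] by simp
  qed
  \<comment> \<open>\<open>mk\<close> fills the middle row from a choice of one label per loop, and
    \<open>rd\<close> recovers the choice at some vertex of each loop.\<close>
  define mk where "mk \<phi> = (\<lambda>m. if m \<in> {1..n} then if comp m \<in> ?O then \<phi> (comp m) else val (comp m) else undefined)" for \<phi>
  define rd where "rd i = (\<lambda>C. if C \<in> ?O then i (SOME m. Middle m \<in> C) else undefined)" for i :: "nat \<Rightarrow> nat"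
  have loop_mid: "\<exists>m. Middle m \<in> C" if "C \<in> ?O" for C
    using that comps_nonempty[of C] by (auto simp: loops_def)
  have loop_some: "Middle (SOME m. Middle m \<in> C) \<in> C" if "C \<in> ?O" for C
    using loop_mid[OF that] by (rule someI_ex)
  have OK: "?O \<subseteq> ?K" by (auto simp: loops_def)
  have midS: "m \<in> {1..n}" if "C \<in> ?K" "Middle m \<in> C" for C m
    using comps_subset[OF that(1)] that(2) by (auto simp: S_def)
  have mkI: "mk \<phi> \<in> ?I" if \<phi>: "\<phi> \<in> ?O \<rightarrow>\<^sub>E {..<N}" for \<phi>
  proof -
    have "mk \<phi> \<in> multi_indices n N"
      using \<phi> comp valN by (auto simp: multi_indices_def mk_def PiE_def Pi_def extensional_def)
    moreover have "lab j (mk \<phi>) l x = (if C \<in> ?O then \<phi> C else val C)" if C: "C \<in> ?K" "x \<in> C" for C x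
    proof (cases x)
      case (Middle m)
      then have "m \<in> {1..n}" "comp m = C" using C midS compD by auto
      then show ?thesis using Middle by (simp add: mk_def)
    next
      case (Upper m)
      then have "C \<notin> ?O" "x \<notin> range Middle" using C by (auto simp: loops_def)
      then show ?thesis using val[OF C(1) _ C(2)] by simp
    next
      case (Lower m)
      then have "C \<notin> ?O" "x \<notin> range Middle" using C by (auto simp: loops_def)
      then show ?thesis using val[OF C(1) _ C(2)] by simp
    qed
    ultimately show ?thesis unfolding mem_Collect_eq compatible_iff by simp
  qed
  have "bij_betw mk (?O \<rightarrow>\<^sub>E {..<N}) ?I"
  proof (rule bij_betwI)
    show "mk \<in> (?O \<rightarrow>\<^sub>E {..<N}) \<rightarrow> ?I" using mkI by blast
    show "rd \<in> ?I \<rightarrow> (?O \<rightarrow>\<^sub>E {..<N})"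
    proof
      fix i assume "i \<in> ?I"
      then show "rd i \<in> ?O \<rightarrow>\<^sub>E {..<N}"
        using loop_some OK midS by (auto simp: rd_def multi_indices_def PiE_def Pi_def extensional_def)
    qed
    show "rd (mk \<phi>) = \<phi>" if "\<phi> \<in> ?O \<rightarrow>\<^sub>E {..<N}" for \<phi>
    proof
      fix C
      show "rd (mk \<phi>) C = \<phi> C"
      proof (cases "C \<in> ?O")
        case True
        then have "comp (SOME m. Middle m \<in> C) = C" "(SOME m. Middle m \<in> C) \<in> {1..n}"
          using loop_some compD OK midS by blast+
        then show ?thesis using True by (simp add: rd_def mk_def)
      qed (use that in \<open>auto simp: rd_def\<close>)
    qed
    show "mk (rd i) = i" if i: "i \<in> ?I" for i
    proof
      fix m
      have cst: "\<forall>C\<in>?K. \<forall>x\<in>C. \<forall>y\<in>C. lab j i l x = lab j i l y"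
        using i unfolding mem_Collect_eq compatible_iff by blast
      show "mk (rd i) m = i m"
      proof (cases "m \<in> {1..n}")
        case m: True
        show ?thesis
        proof (cases "comp m \<in> ?O")
          case True
          have "lab j i l (Middle (SOME m'. Middle m' \<in> comp m)) = lab j i l (Middle m)"
            using cst comp[OF m] loop_some[OF True] by blast
          then show ?thesis using True m by (simp add: mk_def rd_def)
        next
          case False
          obtain x where x: "x \<in> comp m" "x \<notin> range Middle" using term_ex[OF comp(1)[OF m] False] by blast
          have "lab j i l (Middle m) = lab j i l x"
            using cst comp[OF m] x by blast
          then show ?thesis using val[OF comp(1)[OF m] False x] m False by (simp add: mk_def)
        qed
      qed (use i in \<open>auto simp: mk_def multi_indices_def PiE_def extensional_def\<close>)
    qed
  qed
  then have "card ?I = card (?O \<rightarrow>\<^sub>E {..<N})" by (simp add: bij_betw_same_card)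
  also have "\<dots> = N ^ card ?O"
    using OK by (subst card_PiE) (auto intro: finite_subset)
  finally show ?thesis using True by simp
qed

end

lemma brauer_act_mult:
  "brauer_act n N (brauer_mult n N a b) t = brauer_act n N a (brauer_act n N b t)"
proof
  fix j
  let ?G = "brauer_graphs n" and ?M = "multi_indices n N"
  show "brauer_act n N (brauer_mult n N a b) t j = brauer_act n N a (brauer_act n N b t) j"
  proof (cases "j \<in> ?M")
    case j: True
    have filter: "(\<Sum>x | x \<in> ?M \<and> P x. F x) = (\<Sum>x\<in>?M. if P x then F x else 0)"
      for F :: "(nat \<Rightarrow> nat) \<Rightarrow> complex" and P
      by (rule sum.inter_filter) simp
    let ?s = "\<lambda>\<delta> j. \<Sum>l | l \<in> ?M \<and> compatible \<delta> j l. t l"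
    let ?w = "\<lambda>\<gamma> \<gamma>'. of_nat N ^ card (loops \<gamma> \<gamma>') * (a \<gamma> * b \<gamma>') :: complex"
    have "brauer_act n N (brauer_mult n N a b) t j =
      (\<Sum>\<delta>\<in>?G. \<Sum>\<gamma>\<in>?G. \<Sum>\<gamma>'\<in>?G. if graph_comp \<gamma> \<gamma>' = \<delta> then ?w \<gamma> \<gamma>' * ?s \<delta> j else 0)"
      using j unfolding brauer_act_def brauer_mult_def
      by (simp add: sum_distrib_right if_distrib[of "\<lambda>x. x * _"] cong: if_cong)
    also have "\<dots> = (\<Sum>\<gamma>\<in>?G. \<Sum>\<gamma>'\<in>?G. \<Sum>\<delta>\<in>?G. if graph_comp \<gamma> \<gamma>' = \<delta> then ?w \<gamma> \<gamma>' * ?s \<delta> j else 0)"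
      by (rule trans[OF sum.swap]) (intro sum.cong refl sum.swap)
    also have "\<dots> = (\<Sum>\<gamma>\<in>?G. \<Sum>\<gamma>'\<in>?G. ?w \<gamma> \<gamma>' * ?s (graph_comp \<gamma> \<gamma>') j)"
      by (intro sum.cong refl) (simp add: stacked.graph_comp_mem[OF stacked.intro])
    also have "\<dots> = (\<Sum>\<gamma>\<in>?G. \<Sum>\<gamma>'\<in>?G. a \<gamma> * b \<gamma>' * (\<Sum>i | i \<in> ?M \<and> compatible \<gamma> j i. ?s \<gamma>' i))"
    proof (intro sum.cong refl)
      fix \<gamma> \<gamma>' assume g: "\<gamma> \<in> ?G" "\<gamma>' \<in> ?G"
      have "(\<Sum>i | i \<in> ?M \<and> compatible \<gamma> j i. ?s \<gamma>' i)
        = (\<Sum>i\<in>?M. \<Sum>l\<in>?M. if compatible \<gamma> j i \<and> compatible \<gamma>' i l then t l else 0)"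
        by (simp only: filter[of _ "\<lambda>i. compatible \<gamma> j i"] filter[of t]) (intro sum.cong refl, auto)
      also have "\<dots> = (\<Sum>l\<in>?M. \<Sum>i\<in>?M. if compatible \<gamma> j i \<and> compatible \<gamma>' i l then t l else 0)"
        by (rule sum.swap)
      also have "\<dots> = (\<Sum>l\<in>?M. of_nat (card {i \<in> ?M. compatible \<gamma> j i \<and> compatible \<gamma>' i l}) * t l)"
        by (intro sum.cong refl, subst filter[symmetric]) simp
      also have "\<dots> = (\<Sum>l\<in>?M. if compatible (graph_comp \<gamma> \<gamma>') j l then of_nat N ^ card (loops \<gamma> \<gamma>') * t l else 0)"
        using stacked.card_middle_labels[OF stacked.intro[OF g] j] by (intro sum.cong refl) simp
      also have "\<dots> = of_nat N ^ card (loops \<gamma> \<gamma>') * ?s (graph_comp \<gamma> \<gamma>') j"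
        by (simp only: filter[of t] sum_distrib_left) (intro sum.cong refl, auto)
      finally show "?w \<gamma> \<gamma>' * ?s (graph_comp \<gamma> \<gamma>') j = a \<gamma> * b \<gamma>' * (\<Sum>i | i \<in> ?M \<and> compatible \<gamma> j i. ?s \<gamma>' i)"
        by simp
    qed
    also have "\<dots> = (\<Sum>\<gamma>\<in>?G. a \<gamma> * (\<Sum>i | i \<in> ?M \<and> compatible \<gamma> j i. \<Sum>\<gamma>'\<in>?G. b \<gamma>' * ?s \<gamma>' i))"
    proof (intro sum.cong refl)
      fix \<gamma>
      define I where "I = {i. i \<in> ?M \<and> compatible \<gamma> j i}"
      have "(\<Sum>i\<in>I. \<Sum>\<gamma>'\<in>?G. b \<gamma>' * ?s \<gamma>' i) = (\<Sum>\<gamma>'\<in>?G. b \<gamma>' * (\<Sum>i\<in>I. ?s \<gamma>' i))"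
        by (subst sum.swap) (simp only: sum_distrib_left)
      then show "(\<Sum>\<gamma>'\<in>?G. a \<gamma> * b \<gamma>' * (\<Sum>i | i \<in> ?M \<and> compatible \<gamma> j i. ?s \<gamma>' i))
        = a \<gamma> * (\<Sum>i | i \<in> ?M \<and> compatible \<gamma> j i. \<Sum>\<gamma>'\<in>?G. b \<gamma>' * ?s \<gamma>' i)"
        unfolding I_def by (simp only: sum_distrib_left mult.assoc)
    qed
    also have "\<dots> = brauer_act n N a (brauer_act n N b t) j"
      using j unfolding brauer_act_def by simp
    finally show ?thesis .
  qed (simp add: brauer_act_def)
qed

section \<open>Products with the contraction of k and k + 1, and the elements z_k\<close>

context stacked
begin

lemma graph_compI:
  "C \<in> stacked_components \<gamma> \<gamma>' \<Longrightarrow> C \<notin> loops \<gamma> \<gamma>' \<Longrightarrow> terminals C = e \<Longrightarrow> e \<in> graph_comp \<gamma> \<gamma>'"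
  unfolding graph_comp_def by blast

lemma graph_comp_upper_edge:
  assumes "{Vtx a, Vtx b} \<in> \<gamma>"
  shows "{Vtx a, Vtx b} \<in> graph_comp \<gamma> \<gamma>'"
proof -
  let ?C = "{Upper a, Upper b}"
  have e: "?C \<in> E1" using imageI[OF assms, of "(`) upper_half"] by simp
  have eE: "?C \<in> E" unfolding E_eq using e by blast
  have C: "?C \<in> stacked_components \<gamma> \<gamma>'"
  proof (rule compsI[of "Upper a"])
    show "?C \<subseteq> S" using Union_E eE by blast
    show "(Upper a, x) \<in> adj\<^sup>+" if "x \<in> ?C" for x
      using eE that unfolding adj_def by (intro r_into_trancl) blast
    show "f \<subseteq> ?C" if "f \<in> E" "x \<in> f" "x \<in> ?C" for f x
    proof (cases "f \<in> E1")
      case True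
      then show ?thesis using E1_disj[OF e True that(3,2)] by blast
    next
      case False
      then have "f \<in> E2" using that(1) E_eq by simp
      then have "x \<in> \<Union>E2" using that(2) by (rule UnionI)
      then show ?thesis unfolding Union_E2 using that(3) by auto
    qed
  qed simp
  have "terminals ?C = {Vtx a, Vtx b}" by (auto simp: terminals_def)
  moreover have "?C \<notin> loops \<gamma> \<gamma>'" by (auto simp: loops_def)
  ultimately show ?thesis by (intro graph_compI[OF C])
qed

lemma graph_comp_lower_edge:
  assumes "{Bar a, Bar b} \<in> \<gamma>'"
  shows "{Bar a, Bar b} \<in> graph_comp \<gamma> \<gamma>'"
proof -
  let ?C = "{Lower a, Lower b}"
  have e: "?C \<in> E2" using imageI[OF assms, of "(`) lower_half"] by simp
  have eE: "?C \<in> E" unfolding E_eq using e by blast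
  have C: "?C \<in> stacked_components \<gamma> \<gamma>'"
  proof (rule compsI[of "Lower a"])
    show "?C \<subseteq> S" using Union_E eE by blast
    show "(Lower a, x) \<in> adj\<^sup>+" if "x \<in> ?C" for x
      using eE that unfolding adj_def by (intro r_into_trancl) blast
    show "f \<subseteq> ?C" if "f \<in> E" "x \<in> f" "x \<in> ?C" for f x
    proof (cases "f \<in> E2")
      case True
      then show ?thesis using E2_disj[OF e True that(3,2)] by blast
    next
      case False
      then have "f \<in> E1" using that(1) E_eq by simp
      then have "x \<in> \<Union>E1" using that(2) by (rule UnionI)
      then show ?thesis unfolding Union_E1 using that(3) by auto
    qed
  qed simp
  have "terminals ?C = {Bar a, Bar b}" by (auto simp: terminals_def)
  moreover have "?C \<notin> loops \<gamma> \<gamma>'" by (auto simp: loops_def)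
  ultimately show ?thesis by (intro graph_compI[OF C])
qed

end

text \<open>Both are perfect matchings of the same vertices. A composition can therefore be computed
  by exhibiting enough of its edges, without classifying all components.\<close>

lemma brauer_graphs_subset_eq:
  assumes "\<gamma> \<in> brauer_graphs n" "\<delta> \<in> brauer_graphs n" "\<gamma> \<subseteq> \<delta>"
  shows "\<gamma> = \<delta>"
proof
  show "\<delta> \<subseteq> \<gamma>"
  proof
    fix e assume e: "e \<in> \<delta>"
    then obtain x where x: "x \<in> e" using brauer_graphs_edge[OF assms(2) e] by fastforce
    then have "x \<in> vertices n" using brauer_graphs_edge[OF assms(2) e] by blast
    then obtain f where "f \<in> \<gamma>" "x \<in> f" using brauer_graphs_cover[OF assms(1)] by blast
    then show "e \<in> \<gamma>" using brauer_graphs_disjoint[OF assms(2) e _ x] assms(3) by blast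
  qed
qed fact

text \<open>The vertices \<open>k, k+1\<close> and their barred copies, added to a graph on \<open>k-1\<close> points.\<close>

abbreviation new_vertices :: "nat \<Rightarrow> vertex set" where
  "new_vertices k \<equiv> {Vtx k, Vtx (k + 1), Bar k, Bar (k + 1)}"

lemma vertices_add2: "1 \<le> k \<Longrightarrow> vertices (k + 1) = vertices (k - 1) \<union> new_vertices k"
proof -
  assume "1 \<le> k"
  then have "{1..k + 1} = {1..k - 1} \<union> {k, k + 1}" by auto
  then show ?thesis unfolding vertices_def by auto
qed

lemma new_vertices_disjoint: "vertices (k - 1) \<inter> new_vertices k = {}"
  by (auto simp: vertices_def)

lemma brauer_graphs_add2:
  assumes "1 \<le> k" "card e = 2" "card f = 2" "e \<inter> f = {}" "e \<union> f = new_vertices k"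
    and \<gamma>: "\<gamma> \<in> brauer_graphs (k - 1)"
  shows "\<gamma> \<union> {e, f} \<in> brauer_graphs (k + 1)" "\<gamma> \<inter> {e, f} = {}"
proof -
  have *: "g \<subseteq> vertices (k - 1)" "g \<noteq> {}" if "g \<in> \<gamma>" for g
    using brauer_graphs_edge[OF \<gamma> that] by auto
  have ef: "e \<inter> vertices (k - 1) = {}" "f \<inter> vertices (k - 1) = {}"
    using assms(5) new_vertices_disjoint by blast+
  have dis: "disjoint (\<gamma> \<union> {e, f})"
  proof (rule disjointI)
    fix a b assume ab: "a \<in> \<gamma> \<union> {e, f}" "b \<in> \<gamma> \<union> {e, f}" "a \<noteq> b"
    then show "a \<inter> b = {}"
      using brauer_graphs_disjoint[OF \<gamma>, of a b] * ef assms(4) by blast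
  qed
  have un: "\<Union>\<gamma> = vertices (k - 1)" and ne: "{} \<notin> \<gamma>" and c: "\<forall>e\<in>\<gamma>. card e = 2"
    using \<gamma> by (auto simp: brauer_graphs_def partition_on_def)
  have "\<Union>(\<gamma> \<union> {e, f}) = vertices (k + 1)"
    unfolding vertices_add2[OF assms(1)] using assms(5) un by auto
  moreover have "e \<noteq> {}" "f \<noteq> {}" using assms(2,3) by auto
  ultimately show "\<gamma> \<union> {e, f} \<in> brauer_graphs (k + 1)"
    using dis ne c assms(2,3) by (simp add: brauer_graphs_def partition_on_def)
  show "\<gamma> \<inter> {e, f} = {}" using * ef by blast
qed

lemma brauer_graphs_remove2:
  assumes "1 \<le> k" "e \<in> \<delta>" "f \<in> \<delta>" "e \<union> f = new_vertices k" and \<delta>: "\<delta> \<in> brauer_graphs (k + 1)"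
  shows "\<delta> - {e, f} \<in> brauer_graphs (k - 1)"
proof -
  have un: "\<Union>\<delta> = vertices (k + 1)" and ne: "{} \<notin> \<delta>" and c: "\<forall>e\<in>\<delta>. card e = 2" and d: "disjoint \<delta>"
    using \<delta> by (auto simp: brauer_graphs_def partition_on_def)
  have "\<Union>(\<delta> - {e, f}) = vertices (k - 1)"
  proof
    show "\<Union>(\<delta> - {e, f}) \<subseteq> vertices (k - 1)"
    proof
      fix x assume "x \<in> \<Union>(\<delta> - {e, f})"
      then obtain g where g: "g \<in> \<delta>" "g \<noteq> e" "g \<noteq> f" "x \<in> g" by blast
      then have "x \<notin> e \<union> f" using brauer_graphs_disjoint[OF \<delta>] assms(2,3) by blast
      moreover have "x \<in> vertices (k + 1)" using un g by blast
      ultimately show "x \<in> vertices (k - 1)"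
        unfolding vertices_add2[OF assms(1)] assms(4) by blast
    qed
    show "vertices (k - 1) \<subseteq> \<Union>(\<delta> - {e, f})"
    proof
      fix x assume x: "x \<in> vertices (k - 1)"
      then have "x \<in> \<Union>\<delta>" unfolding un vertices_add2[OF assms(1)] by blast
      moreover have "x \<notin> e \<union> f" unfolding assms(4) using x new_vertices_disjoint by blast
      ultimately show "x \<in> \<Union>(\<delta> - {e, f})" by blast
    qed
  qed
  moreover have "disjoint (\<delta> - {e, f})" using d by (auto simp: disjoint_def)
  ultimately show ?thesis using ne c by (simp add: brauer_graphs_def partition_on_def)
qed

text \<open>On basis elements this is the inclusion of B(k-1,N) into B(k+1,N). By
  \<open>comp_add_verticals\<close>, multiplication by the contraction of k and k + 1 on the right
  turns it into \<open>add_horizontals\<close>.\<close>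

definition add_verticals :: "nat \<Rightarrow> graph \<Rightarrow> graph" where
  "add_verticals k \<gamma> = \<gamma> \<union> {{Vtx k, Bar k}, {Vtx (k + 1), Bar (k + 1)}}"

definition add_horizontals :: "nat \<Rightarrow> graph \<Rightarrow> graph" where
  "add_horizontals k \<gamma> = \<gamma> \<union> {{Vtx k, Vtx (k + 1)}, {Bar k, Bar (k + 1)}}"

lemma add_verticals_mem:
  assumes "1 \<le> k" "\<gamma> \<in> brauer_graphs (k - 1)"
  shows "add_verticals k \<gamma> \<in> brauer_graphs (k + 1)"
    "\<gamma> \<inter> {{Vtx k, Bar k}, {Vtx (k + 1), Bar (k + 1)}} = {}"
  unfolding add_verticals_def by (rule brauer_graphs_add2[OF assms(1) _ _ _ _ assms(2)]; auto)+

lemma add_horizontals_mem: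
  assumes "1 \<le> k" "\<gamma> \<in> brauer_graphs (k - 1)"
  shows "add_horizontals k \<gamma> \<in> brauer_graphs (k + 1)"
    "\<gamma> \<inter> {{Vtx k, Vtx (k + 1)}, {Bar k, Bar (k + 1)}} = {}"
  unfolding add_horizontals_def by (rule brauer_graphs_add2[OF assms(1) _ _ _ _ assms(2)]; auto)+

lemma comp_add_verticals:
  assumes k: "1 \<le> k" and \<gamma>: "\<gamma> \<in> brauer_graphs (k - 1)"
  defines "g \<equiv> bar_graph (k + 1) k (k + 1)"
  shows "graph_comp (add_verticals k \<gamma>) g = add_horizontals k \<gamma>" "loops (add_verticals k \<gamma>) g = {}"
proof -
  have gm: "g \<in> brauer_graphs (k + 1)" unfolding g_def by (rule bar_graph_mem) (use k in auto)
  interpret stacked "k + 1" "add_verticals k \<gamma>" g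
    using add_verticals_mem(1)[OF k \<gamma>] gm by unfold_locales
  have vm: "Vtx m \<in> vertices (k - 1) \<longleftrightarrow> 1 \<le> m \<and> m < k" "Bar m \<in> vertices (k - 1) \<longleftrightarrow> 1 \<le> m \<and> m < k" for m
    using k by (auto simp: vertices_def)
  have E2: "E2 = {{Middle k, Middle (k + 1)}, {Lower k, Lower (k + 1)}} \<union> (\<lambda>m. {Middle m, Lower m}) ` {1..<k}"
  proof -
    have "{1..k + 1} - {k, k + 1} = {1..<k}" using k by auto
    then show ?thesis unfolding g_def bar_graph_def by (simp add: image_Un image_image)
  qed
  have E1: "E1 = (`) upper_half ` \<gamma> \<union> {{Upper k, Middle k}, {Upper (k + 1), Middle (k + 1)}}"
    unfolding add_verticals_def by (simp add: image_Un)
  let ?K = "stacked_components (add_verticals k \<gamma>) g"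
  \<comment> \<open>The component of an old edge e: the edge in the upper part, prolonged below each
    barred end by a vertical edge of the bar graph.\<close>
  define Ce where "Ce e = upper_half ` e \<union> {Lower b |b. Bar b \<in> e}" for e
  have Ce_mem: "Upper m \<in> Ce e \<longleftrightarrow> Vtx m \<in> e" "Middle m \<in> Ce e \<longleftrightarrow> Bar m \<in> e" "Lower m \<in> Ce e \<longleftrightarrow> Bar m \<in> e" for m e
  proof -
    have "Upper m = upper_half v \<longleftrightarrow> v = Vtx m" "Middle m = upper_half v \<longleftrightarrow> v = Bar m" "Lower m \<noteq> upper_half v" for v
      by (cases v; auto)+
    then show "Upper m \<in> Ce e \<longleftrightarrow> Vtx m \<in> e" "Middle m \<in> Ce e \<longleftrightarrow> Bar m \<in> e" "Lower m \<in> Ce e \<longleftrightarrow> Bar m \<in> e"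
      by (auto simp: Ce_def image_iff)
  qed
  have Ce: "Ce e \<in> ?K" if e: "e \<in> \<gamma>" for e
  proof -
    have ev: "e \<subseteq> vertices (k - 1)" "card e = 2" using brauer_graphs_edge[OF \<gamma> e] by auto
    then obtain v0 where v0: "v0 \<in> e" by fastforce
    have ue: "upper_half ` e \<in> E" unfolding E_eq E1 using e by blast
    have ml: "{Middle b, Lower b} \<in> E" if "Bar b \<in> e" for b
      unfolding E_eq E2 using ev that vm[of b] by auto
    show ?thesis
    proof (rule compsI[of "upper_half v0"])
      show "upper_half v0 \<in> Ce e" using v0 by (auto simp: Ce_def)
      show "Ce e \<subseteq> S"
        using ue ml Union_E unfolding Ce_def by blast
      show "(upper_half v0, x) \<in> adj\<^sup>+" if xC: "x \<in> Ce e" for x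
      proof -
        have 1: "(upper_half v0, upper_half v) \<in> adj" if "v \<in> e" for v
          unfolding adj_def using ue v0 that by blast
        show ?thesis
        proof (cases "x \<in> upper_half ` e")
          case True then show ?thesis using 1 by blast
        next
          case False
          then obtain b where b: "x = Lower b" "Bar b \<in> e" using xC by (auto simp: Ce_def)
          have "(upper_half v0, Middle b) \<in> adj" using 1[OF b(2)] by simp
          moreover have "(Middle b, x) \<in> adj" unfolding adj_def b(1) using ml[OF b(2)] by blast
          ultimately show ?thesis by (rule trancl_into_trancl[OF r_into_trancl])
        qed
      qed
      show "f \<subseteq> Ce e" if f: "f \<in> E" "x \<in> f" "x \<in> Ce e" for f x
      proof (cases "f \<in> E1")
        case True
        have "x \<in> \<Union>E1" using True f(2) by (rule UnionI)
        then have "x \<notin> range Lower" unfolding Union_E1 by auto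
        then have "x \<in> upper_half ` e" using f(3) by (auto simp: Ce_def)
        moreover have "upper_half ` e \<in> E1" unfolding E1 using e by blast
        ultimately have "f = upper_half ` e"
          using E1_disj[OF True _ f(2)] by blast
        then show ?thesis by (auto simp: Ce_def)
      next
        case False
        then have "f \<in> E2" using f(1) E_eq by simp
        show ?thesis
        proof -
          have "\<not> (Bar k \<in> e \<or> Bar (k + 1) \<in> e)" using ev(1) vm by fastforce
          then have "Middle k \<notin> Ce e" "Middle (k + 1) \<notin> Ce e" "Lower k \<notin> Ce e" "Lower (k + 1) \<notin> Ce e"
            unfolding Ce_mem by blast+
          then obtain m where m: "f = {Middle m, Lower m}"
            using \<open>f \<in> E2\<close> f(2,3) unfolding E2 by blast
          show ?thesis unfolding m using f(2,3) unfolding m by (auto simp: Ce_mem)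
        qed
      qed
    qed
  qed
  have tCe: "terminals (Ce e) = e" for e
  proof -
    have "terminals (Ce e) = {Vtx m |m. Vtx m \<in> e} \<union> {Bar m |m. Bar m \<in> e}"
      unfolding terminals_def Ce_mem ..
    also have "\<dots> = e"
    proof
      show "e \<subseteq> {Vtx m |m. Vtx m \<in> e} \<union> {Bar m |m. Bar m \<in> e}"
      proof
        fix v assume "v \<in> e"
        then show "v \<in> {Vtx m |m. Vtx m \<in> e} \<union> {Bar m |m. Bar m \<in> e}" by (cases v) auto
      qed
    qed auto
    finally show ?thesis .
  qed
  \<comment> \<open>The path that goes down at k, along the horizontal edge of the middle row, and
    up at k + 1; it becomes the new upper edge.\<close>
  let ?T = "{Upper k, Middle k, Middle (k + 1), Upper (k + 1)}"
  have T: "?T \<in> ?K"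
  proof (rule compsI[of "Upper k"])
    have e: "{Upper k, Middle k} \<in> E" "{Upper (k + 1), Middle (k + 1)} \<in> E" "{Middle k, Middle (k + 1)} \<in> E"
      unfolding E_eq E1 E2 by blast+
    show "?T \<subseteq> S" using e Union_E by blast
    have "(Upper k, Upper k) \<in> adj" "(Upper k, Middle k) \<in> adj" "(Middle k, Middle (k + 1)) \<in> adj"
        "(Middle (k + 1), Upper (k + 1)) \<in> adj"
      unfolding adj_def using e by blast+
    then have "(Upper k, Upper k) \<in> adj\<^sup>+" "(Upper k, Middle k) \<in> adj\<^sup>+" "(Upper k, Middle (k + 1)) \<in> adj\<^sup>+"
        "(Upper k, Upper (k + 1)) \<in> adj\<^sup>+"
      by (meson r_into_trancl trancl_into_trancl)+
    then show "(Upper k, x) \<in> adj\<^sup>+" if "x \<in> ?T" for x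
      using that by blast
    show "f \<subseteq> ?T" if f: "f \<in> E" "x \<in> f" "x \<in> ?T" for f x
    proof -
      have "f \<notin> (`) upper_half ` \<gamma>"
      proof
        assume "f \<in> (`) upper_half ` \<gamma>"
        then obtain v e where "e \<in> \<gamma>" "v \<in> e" "x = upper_half v" using f(2) by blast
        then show False using brauer_graphs_edge(2)[OF \<gamma>, of e] vm f(3) by (cases v) auto
      qed
      moreover have "f \<in> ((`) upper_half ` \<gamma> \<union> {{Upper k, Middle k}, {Upper (k + 1), Middle (k + 1)}}) \<union> E2"
        using f(1) unfolding E_eq E1 .
      ultimately have "f \<in> {{Upper k, Middle k}, {Upper (k + 1), Middle (k + 1)}} \<union> E2"
        by (simp only: Un_iff) simp
      then show ?thesis unfolding E2 using f(2,3) by auto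
    qed
  qed simp
  have "add_horizontals k \<gamma> = graph_comp (add_verticals k \<gamma>) g"
  proof (rule brauer_graphs_subset_eq[OF add_horizontals_mem(1)[OF k \<gamma>] graph_comp_mem])
    have "terminals ?T = {Vtx k, Vtx (k + 1)}" by (auto simp: terminals_def)
    moreover have "?T \<notin> loops (add_verticals k \<gamma>) g" by (auto simp: loops_def)
    ultimately have "{Vtx k, Vtx (k + 1)} \<in> graph_comp (add_verticals k \<gamma>) g"
      by (intro graph_compI[OF T])
    moreover have "{Bar k, Bar (k + 1)} \<in> graph_comp (add_verticals k \<gamma>) g"
      by (rule graph_comp_lower_edge) (simp add: g_def bar_graph_def)
    moreover have "e \<in> graph_comp (add_verticals k \<gamma>) g" if "e \<in> \<gamma>" for e
    proof -
      have "terminals (Ce e) \<noteq> {}" unfolding tCe using brauer_graphs_edge(1)[OF \<gamma> that] by auto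
      then have "Ce e \<notin> loops (add_verticals k \<gamma>) g" by (auto simp: loops_def terminals_def)
      then show ?thesis by (intro graph_compI[OF Ce[OF that]] tCe)
    qed
    ultimately show "add_horizontals k \<gamma> \<subseteq> graph_comp (add_verticals k \<gamma>) g"
      unfolding add_horizontals_def by blast
  qed
  then show "graph_comp (add_verticals k \<gamma>) g = add_horizontals k \<gamma>" ..
  \<comment> \<open>Every middle vertex lies on one of the paths found above, and these leave the
    middle row.\<close>
  show "loops (add_verticals k \<gamma>) g = {}"
  proof (rule ccontr)
    assume "loops (add_verticals k \<gamma>) g \<noteq> {}"
    then obtain C where C: "C \<in> ?K" "C \<subseteq> range Middle" by (auto simp: loops_def)
    then obtain m where m: "Middle m \<in> C" using comps_nonempty by blast
    then have "Middle m \<in> S" using comps_subset[OF C(1)] by blast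
    then have "m \<in> {1..k + 1}" unfolding S_def by blast
    then consider "m = k" | "m = k + 1" | "1 \<le> m" "m < k" by fastforce
    then show False
    proof cases
      case 1
      then have "C = ?T" using comps_disj[OF C(1) T m] by blast
      then show False using C(2) by blast
    next
      case 2
      then have "C = ?T" using comps_disj[OF C(1) T m] by blast
      then show False using C(2) by blast
    next
      case 3
      then obtain e where e: "e \<in> \<gamma>" "Bar m \<in> e"
        using brauer_graphs_cover[OF \<gamma>, of "Bar m"] vm by blast
      then have "Middle m \<in> Ce e" "Lower m \<in> Ce e" unfolding Ce_mem by blast+
      then have "Lower m \<in> C" using comps_disj[OF C(1) Ce[OF e(1)] m] by blast
      then show False using C(2) by blast
    qed
  qed
qed

lemma brauer_mult_bgen_right:
  assumes "g \<in> brauer_graphs n"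
  shows "brauer_mult n N b (bgen g) \<delta> = (\<Sum>\<gamma>\<in>brauer_graphs n.
    if graph_comp \<gamma> g = \<delta> then of_nat N ^ card (loops \<gamma> g) * b \<gamma> else 0)"
proof -
  have "(\<Sum>\<gamma>'\<in>brauer_graphs n. if graph_comp \<gamma> \<gamma>' = \<delta> then of_nat N ^ card (loops \<gamma> \<gamma>') * (b \<gamma> * bgen g \<gamma>') else 0)
    = (\<Sum>\<gamma>'\<in>brauer_graphs n. if \<gamma>' = g then if graph_comp \<gamma> g = \<delta> then of_nat N ^ card (loops \<gamma> g) * b \<gamma> else 0 else 0)" for \<gamma>
    by (intro sum.cong refl) (auto simp: bgen_def)
  then show ?thesis unfolding brauer_mult_def using assms by simp
qed

definition incl2 :: "nat \<Rightarrow> bvec \<Rightarrow> bvec" where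
  "incl2 k b = brauer_incl k (brauer_incl (k - 1) b)"

lemma incl2_add_verticals:
  assumes "1 \<le> k" "\<gamma> \<in> brauer_graphs (k - 1)"
  shows "incl2 k b (add_verticals k \<gamma>) = b \<gamma>"
proof -
  let ?e = "{Vtx (k + 1), Bar (k + 1)}" and ?f = "{Vtx k, Bar k}"
  have ne: "?e \<noteq> ?f" by (simp add: doubleton_eq_iff)
  have notin: "?e \<notin> \<gamma>" "?f \<notin> \<gamma>" using add_verticals_mem(2)[OF assms] by blast+
  have 1: "add_verticals k \<gamma> - {?e} = insert ?f \<gamma>"
    unfolding add_verticals_def using ne notin by blast
  have 2: "insert ?f \<gamma> - {?f} = \<gamma>" using notin by blast
  have 3: "?e \<in> add_verticals k \<gamma>" unfolding add_verticals_def by blast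
  have k1: "k - 1 + 1 = k" using assms(1) by simp
  show ?thesis
    unfolding incl2_def brauer_incl_def Let_def k1 using 1 2 3 by (simp only: if_True insertI1)
qed

lemma incl2_nonzero:
  assumes k: "1 \<le> k" and "\<delta> \<in> brauer_graphs (k + 1)" "incl2 k b \<delta> \<noteq> 0"
  shows "\<exists>\<gamma>\<in>brauer_graphs (k - 1). \<delta> = add_verticals k \<gamma>"
proof -
  let ?e = "{Vtx (k + 1), Bar (k + 1)}" and ?f = "{Vtx k, Bar k}"
  have k1: "k - 1 + 1 = k" using assms(1) by simp
  have "?e \<in> \<delta>" "?f \<in> \<delta>"
    using assms(3) unfolding incl2_def brauer_incl_def Let_def k1 by (metis DiffD1)+
  then have "\<delta> - {?f, ?e} \<in> brauer_graphs (k - 1)"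
    by (intro brauer_graphs_remove2[OF k _ _ _ assms(2)]) auto
  moreover have "\<delta> = add_verticals k (\<delta> - {?f, ?e})"
    using \<open>?e \<in> \<delta>\<close> \<open>?f \<in> \<delta>\<close> unfolding add_verticals_def by blast
  ultimately show ?thesis by blast
qed

lemma add_horizontals_inj:
  assumes "1 \<le> k" "\<gamma> \<in> brauer_graphs (k - 1)" "\<gamma>' \<in> brauer_graphs (k - 1)"
    "add_horizontals k \<gamma> = add_horizontals k \<gamma>'"
  shows "\<gamma> = \<gamma>'"
  using add_horizontals_mem(2)[OF assms(1,2)] add_horizontals_mem(2)[OF assms(1,3)] assms(4)
  unfolding add_horizontals_def by blast

lemma add_verticals_inj:
  assumes "1 \<le> k" "\<gamma> \<in> brauer_graphs (k - 1)" "\<gamma>' \<in> brauer_graphs (k - 1)"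
    "add_verticals k \<gamma> = add_verticals k \<gamma>'"
  shows "\<gamma> = \<gamma>'"
  using add_verticals_mem(2)[OF assms(1,2)] add_verticals_mem(2)[OF assms(1,3)] assms(4)
  unfolding add_verticals_def by blast

lemma incl2_mult_bar:
  assumes k: "1 \<le> k"
  shows "brauer_mult (k + 1) N (incl2 k b) (bar_transpos (k + 1) k (k + 1)) \<delta> =
    (\<Sum>\<gamma>\<in>brauer_graphs (k - 1). if add_horizontals k \<gamma> = \<delta> then b \<gamma> else 0)"
proof -
  let ?g = "bar_graph (k + 1) k (k + 1)"
  let ?F = "\<lambda>\<gamma>. if graph_comp \<gamma> ?g = \<delta> then of_nat N ^ card (loops \<gamma> ?g) * incl2 k b \<gamma> else 0"
  have gm: "?g \<in> brauer_graphs (k + 1)" by (rule bar_graph_mem) (use k in auto)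
  have "brauer_mult (k + 1) N (incl2 k b) (bar_transpos (k + 1) k (k + 1)) \<delta> = sum ?F (brauer_graphs (k + 1))"
    unfolding bar_transpos_def by (rule brauer_mult_bgen_right[OF gm])
  also have "\<dots> = sum ?F (add_verticals k ` brauer_graphs (k - 1))"
    by (rule sum.mono_neutral_right) (use add_verticals_mem(1)[OF k] incl2_nonzero[OF k] in fastforce)+
  also have "\<dots> = (\<Sum>\<gamma>\<in>brauer_graphs (k - 1). ?F (add_verticals k \<gamma>))"
  proof -
    have inj: "inj_on (add_verticals k) (brauer_graphs (k - 1))"
      by (rule inj_onI) (rule add_verticals_inj[OF k])
    show ?thesis unfolding sum.reindex[OF inj] by simp
  qed
  also have "\<dots> = (\<Sum>\<gamma>\<in>brauer_graphs (k - 1). if add_horizontals k \<gamma> = \<delta> then b \<gamma> else 0)"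
    by (intro sum.cong refl) (simp only: comp_add_verticals[OF k] incl2_add_verticals[OF k] card.empty power_0 mult_1)
  finally show ?thesis .
qed

text \<open>The coefficients of b' can be read off from the product, whence the uniqueness of
  z_k^(i).\<close>

lemma incl2_mult_bar_horizontals:
  assumes k: "1 \<le> k" and \<gamma>: "\<gamma> \<in> brauer_graphs (k - 1)"
  shows "brauer_mult (k + 1) N (incl2 k b) (bar_transpos (k + 1) k (k + 1)) (add_horizontals k \<gamma>) = b \<gamma>"
proof -
  have "(\<Sum>\<gamma>'\<in>brauer_graphs (k - 1). if add_horizontals k \<gamma>' = add_horizontals k \<gamma> then b \<gamma>' else 0)
     = (\<Sum>\<gamma>'\<in>brauer_graphs (k - 1). if \<gamma>' = \<gamma> then b \<gamma>' else 0)"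
    using add_horizontals_inj[OF k _ \<gamma>] by (intro sum.cong refl) auto
  then show ?thesis unfolding incl2_mult_bar[OF k] using \<gamma> by simp
qed

lemma brauer_mult_nonzero:
  assumes "brauer_mult n N a b \<delta> \<noteq> 0"
  shows "\<exists>\<gamma>\<in>brauer_graphs n. \<exists>\<gamma>'\<in>brauer_graphs n. \<delta> = graph_comp \<gamma> \<gamma>' \<and> a \<gamma> \<noteq> 0 \<and> b \<gamma>' \<noteq> 0"
proof (rule ccontr)
  assume "\<not> ?thesis"
  then have "brauer_mult n N a b \<delta> = 0"
    unfolding brauer_mult_def by (intro sum.neutral ballI) auto
  then show False using assms by simp
qed

text \<open>Horizontal edges of the outer factors survive composition, so every graph in s x s
  contains both of them and comes from a graph on k - 1 points. This gives the existence of
  z_k^(i).\<close>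

lemma bar_mult_bar_nonzero:
  assumes k: "1 \<le> k"
  defines "s \<equiv> bar_transpos (k + 1) k (k + 1)"
  assumes "brauer_mult (k + 1) N (brauer_mult (k + 1) N s x) s \<delta> \<noteq> 0"
  shows "\<exists>\<gamma>\<in>brauer_graphs (k - 1). \<delta> = add_horizontals k \<gamma>"
proof -
  let ?e = "{Vtx k, Vtx (k + 1)}" and ?f = "{Bar k, Bar (k + 1)}"
  let ?g = "bar_graph (k + 1) k (k + 1)"
  have s: "s \<gamma> \<noteq> 0 \<Longrightarrow> \<gamma> = ?g" for \<gamma> by (auto simp: s_def bar_transpos_def bgen_def split: if_splits)
  have ef: "?e \<in> ?g" "?f \<in> ?g" by (auto simp: bar_graph_def)
  obtain \<gamma> where 1: "\<gamma> \<in> brauer_graphs (k + 1)" "?g \<in> brauer_graphs (k + 1)" "\<delta> = graph_comp \<gamma> ?g"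
    "brauer_mult (k + 1) N s x \<gamma> \<noteq> 0"
    using brauer_mult_nonzero[OF assms(3)] s by blast
  obtain \<gamma>' where 2: "\<gamma>' \<in> brauer_graphs (k + 1)" "\<gamma> = graph_comp ?g \<gamma>'"
    using brauer_mult_nonzero[OF 1(4)] s by blast
  have "?e \<in> \<gamma>" unfolding 2(2)
    by (rule stacked.graph_comp_upper_edge[OF stacked.intro[OF 1(2) 2(1)] ef(1)])
  then have e: "?e \<in> \<delta>" unfolding 1(3)
    by (rule stacked.graph_comp_upper_edge[OF stacked.intro[OF 1(1,2)]])
  have f: "?f \<in> \<delta>" unfolding 1(3)
    by (rule stacked.graph_comp_lower_edge[OF stacked.intro[OF 1(1,2)] ef(2)])
  have \<delta>: "\<delta> \<in> brauer_graphs (k + 1)" unfolding 1(3)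
    by (rule stacked.graph_comp_mem[OF stacked.intro[OF 1(1,2)]])
  have "\<delta> - {?e, ?f} \<in> brauer_graphs (k - 1)"
    by (rule brauer_graphs_remove2[OF k e f _ \<delta>]) auto
  moreover have "\<delta> = add_horizontals k (\<delta> - {?e, ?f})"
    using e f unfolding add_horizontals_def by blast
  ultimately show ?thesis by blast
qed

text \<open>The definite description in \<open>z_elem_def\<close> is justified: existence comes from
  \<open>bar_mult_bar_nonzero\<close>, uniqueness from
  \<open>incl2_mult_bar_horizontals\<close>.\<close>

lemma z_elem:
  fixes N :: nat
  assumes k: "1 \<le> k"
  defines "A \<equiv> brauer (k + 1) N" and "s \<equiv> bar_transpos (k + 1) k (k + 1)"
    and "x \<equiv> brauer_incl k (jucys_murphy N k)"
  shows "s \<otimes>\<^bsub>A\<^esub> (x [^]\<^bsub>A\<^esub> i) \<otimes>\<^bsub>A\<^esub> s = incl2 k (z_elem N k i) \<otimes>\<^bsub>A\<^esub> s"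
proof -
  define y where "y = x [^]\<^bsub>A\<^esub> i"
  define v where "v = s \<otimes>\<^bsub>A\<^esub> y \<otimes>\<^bsub>A\<^esub> s"
  have mA: "a \<otimes>\<^bsub>A\<^esub> b = brauer_mult (k + 1) N a b" for a b by (simp add: A_def brauer_def)
  \<comment> \<open>The coefficients are those of s x^i s at the graphs with the two horizontal
    edges added.\<close>
  define b' where "b' \<gamma> = (if \<gamma> \<in> brauer_graphs (k - 1) then v (add_horizontals k \<gamma>) else 0)" for \<gamma>
  let ?P = "\<lambda>b'. b' \<in> carrier (brauer (k - 1) N) \<and> v = incl2 k b' \<otimes>\<^bsub>A\<^esub> s"
  have "?P b'"
  proof
    show "b' \<in> carrier (brauer (k - 1) N)" by (simp add: brauer_def b'_def)
    show "v = incl2 k b' \<otimes>\<^bsub>A\<^esub> s"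
    proof
      fix \<delta>
      show "v \<delta> = (incl2 k b' \<otimes>\<^bsub>A\<^esub> s) \<delta>"
      proof (cases "\<exists>\<gamma>\<in>brauer_graphs (k - 1). \<delta> = add_horizontals k \<gamma>")
        case True
        then show ?thesis
          unfolding mA s_def using incl2_mult_bar_horizontals[OF k] by (auto simp: b'_def)
      next
        case False
        then have "v \<delta> = 0"
          using bar_mult_bar_nonzero[OF k] unfolding v_def mA s_def by blast
        moreover have "(incl2 k b' \<otimes>\<^bsub>A\<^esub> s) \<delta> = 0"
          unfolding mA s_def incl2_mult_bar[OF k] using False by (intro sum.neutral) auto
        ultimately show ?thesis by simp
      qed
    qed
  qed
  moreover have "c = b'" if "?P c" for c
  proof
    fix \<gamma>
    show "c \<gamma> = b' \<gamma>"
    proof (cases "\<gamma> \<in> brauer_graphs (k - 1)")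
      case True
      have "c \<gamma> = v (add_horizontals k \<gamma>)"
        using that incl2_mult_bar_horizontals[OF k True] unfolding mA s_def by simp
      then show ?thesis using True by (simp add: b'_def)
    next
      case False
      then show ?thesis using that by (simp add: b'_def brauer_def)
    qed
  qed
  ultimately have "?P (THE b'. ?P b')" by (intro theI[of ?P b']) blast+
  moreover have "z_elem N k i = (THE b'. ?P b')"
    unfolding z_elem_def Let_def v_def y_def A_def s_def x_def incl2_def ..
  ultimately show ?thesis unfolding v_def y_def by simp
qed

section \<open>The action on tensors in coordinates\<close>

lemma multi_indices_iff:
  "j \<in> multi_indices n N \<longleftrightarrow> (\<forall>m. if m \<in> {1..n} then j m < N else j m = undefined)"
  by (auto simp: multi_indices_def PiE_def Pi_def extensional_def)

lemma multi_indices_less: "j \<in> multi_indices n N \<Longrightarrow> m \<in> {1..n} \<Longrightarrow> j m < N"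
  by (auto simp: multi_indices_def)

lemma tensors_outside: "t \<in> tensors n N \<Longrightarrow> j \<notin> multi_indices n N \<Longrightarrow> t j = 0"
  by (simp add: tensors_def)

lemma brauer_act_tensors: "brauer_act n N b t \<in> tensors n N"
  by (simp add: tensors_def brauer_act_def)

lemma brauer_act_linear:
  "brauer_act n N (\<lambda>\<gamma>. c * a \<gamma> + b \<gamma>) t = (\<lambda>j. c * brauer_act n N a t j + brauer_act n N b t j)"
  by (rule ext) (simp add: brauer_act_def sum_distrib_left sum.distrib algebra_simps)

lemma brauer_act_sum:
  "brauer_act n N (\<lambda>\<gamma>. \<Sum>x\<in>S. f x \<gamma>) t = (\<lambda>j. \<Sum>x\<in>S. brauer_act n N (f x) t j)"
proof (induction S rule: infinite_finite_induct)
  case (insert x S)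
  then show ?case
    using brauer_act_linear[of n N 1 "f x" "\<lambda>\<gamma>. \<Sum>x\<in>S. f x \<gamma>" t] by simp
qed (simp_all add: brauer_act_def fun_eq_iff)

lemma brauer_act_basis:
  assumes "t \<in> tensors n N"
  shows "brauer_act n N b t j = (\<Sum>i\<in>multi_indices n N. t i * brauer_act n N b (basis_tensor i) j)"
proof (cases "j \<in> multi_indices n N")
  case True
  let ?M = "multi_indices n N"
  have "(\<Sum>i\<in>?M. t i * brauer_act n N b (basis_tensor i) j)
    = (\<Sum>i\<in>?M. \<Sum>\<gamma>\<in>brauer_graphs n. b \<gamma> * (t i * (if compatible \<gamma> j i then 1 else 0)))"
  proof (intro sum.cong refl)
    fix i assume i: "i \<in> ?M"
    have "(\<Sum>i' | i' \<in> ?M \<and> compatible \<gamma> j i'. basis_tensor i i') = (if compatible \<gamma> j i then 1 else 0)" for \<gamma>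
      unfolding basis_tensor_def using i by (subst sum.delta) auto
    then show "t i * brauer_act n N b (basis_tensor i) j = (\<Sum>\<gamma>\<in>brauer_graphs n. b \<gamma> * (t i * (if compatible \<gamma> j i then 1 else 0)))"
      using True by (simp add: brauer_act_def sum_distrib_left mult_ac)
  qed
  also have "\<dots> = (\<Sum>\<gamma>\<in>brauer_graphs n. \<Sum>i\<in>?M. b \<gamma> * (t i * (if compatible \<gamma> j i then 1 else 0)))"
    by (rule sum.swap)
  also have "\<dots> = (\<Sum>\<gamma>\<in>brauer_graphs n. b \<gamma> * (\<Sum>i | i \<in> ?M \<and> compatible \<gamma> j i. t i))"
  proof (intro sum.cong refl)
    fix \<gamma>
    have "(\<Sum>i | i \<in> ?M \<and> compatible \<gamma> j i. t i) = (\<Sum>i\<in>?M. if compatible \<gamma> j i then t i else 0)"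
      by (rule sum.inter_filter) simp
    then show "(\<Sum>i\<in>?M. b \<gamma> * (t i * (if compatible \<gamma> j i then 1 else 0))) = b \<gamma> * (\<Sum>i | i \<in> ?M \<and> compatible \<gamma> j i. t i)"
      by (simp add: sum_distrib_left if_distrib cong: if_cong)
  qed
  finally show ?thesis using True by (simp add: brauer_act_def)
qed (simp add: brauer_act_def)

lemma perm_graph_act:
  assumes p: "p permutes {1..n}" and t: "t \<in> tensors n N"
  shows "brauer_act n N (bgen (perm_graph n p)) t = (\<lambda>j. t (j \<circ> p))"
proof
  fix j
  have mem: "j \<circ> p \<in> multi_indices n N \<longleftrightarrow> j \<in> multi_indices n N" for j
  proof -
    have A: "j \<circ> p \<in> multi_indices n N" if "j \<in> multi_indices n N" "p permutes {1..n}" for j p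
      using that permutes_in_image[of p "{1..n}"] unfolding multi_indices_iff by (metis comp_apply)
    have "j = (j \<circ> p) \<circ> Hilbert_Choice.inv p" using permutes_inv_o(1)[OF p] by (simp add: comp_assoc)
    then show ?thesis using A[OF _ p] A[OF _ permutes_inv[OF p], of "j \<circ> p"] by auto
  qed
  show "brauer_act n N (bgen (perm_graph n p)) t j = t (j \<circ> p)"
  proof (cases "j \<in> multi_indices n N")
    case True
    have c: "compatible (perm_graph n p) j i \<longleftrightarrow> i = j \<circ> p" if i: "i \<in> multi_indices n N" for i
    proof -
      have "(\<forall>x\<in>{Vtx a, Bar b}. \<forall>y\<in>{Vtx a, Bar b}. case_vertex j i x = case_vertex j i y)
          \<longleftrightarrow> j a = i b" for a b
        by (simp add: eq_commute[of "i b"])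
      then have "compatible (perm_graph n p) j i \<longleftrightarrow> (\<forall>m\<in>{1..n}. j (p m) = i m)"
        by (simp only: compatible_def perm_graph_def ball_simps)
      moreover have "i m = (j \<circ> p) m" if "m \<notin> {1..n}" for m
        using i mem[of j] True that unfolding multi_indices_iff by metis
      ultimately show ?thesis unfolding fun_eq_iff by (metis comp_apply)
    qed
    have "brauer_act n N (bgen (perm_graph n p)) t j = (\<Sum>i\<in>multi_indices n N. t i * (if i = j \<circ> p then 1 else 0))"
      unfolding brauer_act_basis[OF t]
      by (intro sum.cong refl) (simp add: brauer_act_bgen perm_graph_mem[OF p] True c)
    also have "\<dots> = t (j \<circ> p)"
      using mem[of j] True by (simp add: if_distrib cong: if_cong)
    finally show ?thesis .
  next
    case False
    then show ?thesis using tensors_outside[OF t] mem[of j] by (simp add: brauer_act_def)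
  qed
qed

lemma transpos_act:
  assumes "k \<in> {1..n}" "l \<in> {1..n}" "t \<in> tensors n N"
  shows "brauer_act n N (transpos n k l) t = (\<lambda>j. t (j \<circ> Transposition.transpose k l))"
  unfolding transpos_def by (rule perm_graph_act[OF permutes_swap_id[OF assms(1,2)] assms(3)])

lemma bar_transpos_act:
  assumes kl: "k \<in> {1..n}" "l \<in> {1..n}" "k \<noteq> l" and t: "t \<in> tensors n N" and j: "j \<in> multi_indices n N"
  shows "brauer_act n N (bar_transpos n k l) t j = (if j k = j l then \<Sum>a<N. t (j(k := a, l := a)) else 0)"
proof -
  let ?M = "multi_indices n N"
  have "brauer_act n N (bar_transpos n k l) t j =
    (\<Sum>i\<in>?M. t i * (if i k = i l \<and> j k = j l \<and> (\<forall>m. m \<noteq> k \<longrightarrow> m \<noteq> l \<longrightarrow> j m = i m) then 1 else 0))"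
    unfolding brauer_act_basis[OF t]
  proof (intro sum.cong refl)
    fix i assume i: "i \<in> ?M"
    have "compatible (bar_graph n k l) j i \<longleftrightarrow> i k = i l \<and> j k = j l \<and> (\<forall>m\<in>{1..n} - {k, l}. j m = i m)"
      unfolding compatible_def bar_graph_def by (auto simp: ball_Un)
    also have "\<dots> \<longleftrightarrow> i k = i l \<and> j k = j l \<and> (\<forall>m. m \<noteq> k \<longrightarrow> m \<noteq> l \<longrightarrow> j m = i m)"
      using i j unfolding multi_indices_iff by (metis DiffD1 DiffD2 DiffI insertCI empty_iff insertE)
    finally show "t i * brauer_act n N (bar_transpos n k l) (basis_tensor i) j =
      t i * (if i k = i l \<and> j k = j l \<and> (\<forall>m. m \<noteq> k \<longrightarrow> m \<noteq> l \<longrightarrow> j m = i m) then 1 else 0)"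
      unfolding bar_transpos_def using j i by (simp add: brauer_act_bgen bar_graph_mem[OF kl])
  qed
  also have "\<dots> = (if j k = j l then \<Sum>a<N. t (j(k := a, l := a)) else 0)"
  proof (cases "j k = j l")
    case True
    let ?A = "(\<lambda>a. j(k := a, l := a)) ` {..<N}"
    have sub: "?A \<subseteq> ?M"
      using j kl unfolding image_subset_iff multi_indices_iff by (simp del: atLeastAtMost_iff)
    have inj: "inj_on (\<lambda>a. j(k := a, l := a)) {..<N}"
      by (rule inj_onI) (metis fun_upd_same)
    have "(\<Sum>i\<in>?M. t i * (if i k = i l \<and> j k = j l \<and> (\<forall>m. m \<noteq> k \<longrightarrow> m \<noteq> l \<longrightarrow> j m = i m) then 1 else 0)) = (\<Sum>i\<in>?A. t i)"
    proof (rule sum.mono_neutral_cong_right)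
      show "\<forall>i\<in>?M - ?A. t i * (if i k = i l \<and> j k = j l \<and> (\<forall>m. m \<noteq> k \<longrightarrow> m \<noteq> l \<longrightarrow> j m = i m) then 1 else 0) = 0"
      proof
        fix i assume i: "i \<in> ?M - ?A"
        have "\<not> (i k = i l \<and> (\<forall>m. m \<noteq> k \<longrightarrow> m \<noteq> l \<longrightarrow> j m = i m))"
        proof
          assume "i k = i l \<and> (\<forall>m. m \<noteq> k \<longrightarrow> m \<noteq> l \<longrightarrow> j m = i m)"
          then have "i = j(k := i k, l := i k)" by (auto simp: fun_eq_iff)
          moreover have "i k < N" using multi_indices_less[of i n N k] i kl by blast
          ultimately show False using i by blast
        qed
        then show "t i * (if i k = i l \<and> j k = j l \<and> (\<forall>m. m \<noteq> k \<longrightarrow> m \<noteq> l \<longrightarrow> j m = i m) then 1 else 0) = 0"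
          by auto
      qed
    qed (use sub True kl(3) in auto)
    also have "\<dots> = (\<Sum>a<N. t (j(k := a, l := a)))"
      unfolding sum.reindex[OF inj] by simp
    finally show ?thesis using True by simp
  qed simp
  finally show ?thesis .
qed

lemma brauer_incl_bgen:
  assumes "\<gamma> \<in> brauer_graphs n"
  shows "brauer_incl n (bgen \<gamma>) = bgen (insert {Vtx (n + 1), Bar (n + 1)} \<gamma>)"
proof
  fix \<delta>
  let ?e = "{Vtx (n + 1), Bar (n + 1)}"
  have "?e \<notin> \<gamma>" using brauer_graphs_edge(2)[OF assms, of ?e] by (auto simp: vertices_def)
  then have eq: "?e \<in> \<delta> \<and> \<delta> - {?e} = \<gamma> \<longleftrightarrow> \<delta> = insert ?e \<gamma>" by blast
  have gen: "(P \<and> Q \<longleftrightarrow> R) \<Longrightarrow> (if P then if Q then 1 else 0 else 0) = (if R then 1 else (0::complex))" for P Q R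
    by auto
  show "brauer_incl n (bgen \<gamma>) \<delta> = bgen (insert ?e \<gamma>) \<delta>"
    unfolding brauer_incl_def bgen_def Let_def by (rule gen[OF eq])
qed

lemma jucys_murphy_incl:
  assumes k: "1 \<le> k"
  shows "brauer_incl k (jucys_murphy N k) = (\<lambda>\<gamma>. (of_nat N - 1) / 2 * bgen (perm_graph (k + 1) id) \<gamma>
     + (\<Sum>l=1..<k. transpos (k + 1) k l \<gamma> - bar_transpos (k + 1) k l \<gamma>))"
proof -
  let ?e = "{Vtx (k + 1), Bar (k + 1)}"
  have perm: "brauer_incl k (bgen (perm_graph k s)) = bgen (perm_graph (k + 1) s)" if "s permutes {1..k}" for s
  proof -
    have "s (k + 1) = k + 1" using permutes_not_in[OF that] by simp
    moreover have "{1..k + 1} = insert (k + 1) {1..k}" using k by auto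
    ultimately have "insert ?e (perm_graph k s) = perm_graph (k + 1) s"
      unfolding perm_graph_def by simp
    then show ?thesis using brauer_incl_bgen[OF perm_graph_mem[OF that]] by simp
  qed
  have bar: "brauer_incl k (bgen (bar_graph k k l)) = bgen (bar_graph (k + 1) k l)" if "l \<in> {1..<k}" for l
  proof -
    have "{1..k + 1} - {k, l} = insert (k + 1) ({1..k} - {k, l})" using k that by auto
    then have "insert ?e (bar_graph k k l) = bar_graph (k + 1) k l"
      unfolding bar_graph_def by auto
    moreover have "bar_graph k k l \<in> brauer_graphs k" by (rule bar_graph_mem) (use k that in auto)
    ultimately show ?thesis using brauer_incl_bgen by metis
  qed
  have tr: "brauer_incl k (transpos k k l) = transpos (k + 1) k l"
    "brauer_incl k (bar_transpos k k l) = bar_transpos (k + 1) k l" if "l \<in> {1..<k}" for l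
    unfolding transpos_def bar_transpos_def
    by (rule perm, rule permutes_swap_id, use that k in simp, use that in simp, rule bar[OF that])
  have id: "brauer_incl k (bgen (perm_graph k id)) = bgen (perm_graph (k + 1) id)"
    by (rule perm) (rule permutes_id)
  show ?thesis
  proof
    fix \<gamma>
    have "brauer_incl k (jucys_murphy N k) \<gamma> = (of_nat N - 1) / 2 * brauer_incl k (bgen (perm_graph k id)) \<gamma>
      + (\<Sum>l=1..<k. brauer_incl k (transpos k k l) \<gamma> - brauer_incl k (bar_transpos k k l) \<gamma>)"
      unfolding brauer_incl_def jucys_murphy_def Let_def
      by (cases "{Vtx (k + 1), Bar (k + 1)} \<in> \<gamma>") (simp_all only: if_True if_False mult_zero_right diff_self sum.neutral_const add_0)
    also have "\<dots> = (of_nat N - 1) / 2 * bgen (perm_graph (k + 1) id) \<gamma>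
      + (\<Sum>l=1..<k. transpos (k + 1) k l \<gamma> - bar_transpos (k + 1) k l \<gamma>)"
      unfolding id by (intro arg_cong2[where f = "(+)"] refl sum.cong) (simp only: tr)
    finally show "brauer_incl k (jucys_murphy N k) \<gamma> = (of_nat N - 1) / 2 * bgen (perm_graph (k + 1) id) \<gamma>
      + (\<Sum>l=1..<k. transpos (k + 1) k l \<gamma> - bar_transpos (k + 1) k l \<gamma>)" .
  qed
qed

section \<open>Brauer elements as operators built from matrix units\<close>

context orth_ops
begin

lemma sum_mod_delta: "(\<Sum>a<N. if x mod N = a then (f a :: complex) else 0) = f (x mod N)"
  using N by simp

lemma sw_app:
  assumes "k \<noteq> l"
  shows "app (op.sw k l) t j = t (j(k := j l mod N + N * (j k div N), l := j k mod N + N * (j l div N)))"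
proof -
  have "app (op.sw k l) t j = (\<Sum>a<N. \<Sum>b<N. if j k mod N = a then if j l mod N = b then
     t (j(k := b + N * (j k div N), l := a + N * (j l div N))) else 0 else 0)"
    unfolding op.sw_def app_sum using assms
    by (intro sum.cong refl) (auto simp: app_simps unit_op.rep_eq)
  also have "\<dots> = (\<Sum>a<N. if j k mod N = a then \<Sum>b<N. if j l mod N = b then
     t (j(k := b + N * (j k div N), l := a + N * (j l div N))) else 0 else 0)"
    by (intro sum.cong refl) auto
  finally show ?thesis unfolding sum_mod_delta .
qed

lemma ct_app:
  assumes "k \<noteq> l"
  shows "app (op.ct k l) t j = (if j k mod N = j l mod N then
    \<Sum>b<N. t (j(k := b + N * (j k div N), l := b + N * (j l div N))) else 0)"
proof -
  have "app (op.ct k l) t j = (\<Sum>a<N. \<Sum>b<N. if j k mod N = a then if j l mod N = a then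
     t (j(k := b + N * (j k div N), l := b + N * (j l div N))) else 0 else 0)"
    unfolding op.ct_def app_sum using assms
    by (intro sum.cong refl) (auto simp: app_simps unit_op.rep_eq)
  also have "\<dots> = (\<Sum>a<N. if j k mod N = a then if j l mod N = a then
     \<Sum>b<N. t (j(k := b + N * (j k div N), l := b + N * (j l div N))) else 0 else 0)"
    by (intro sum.cong refl) auto
  finally show ?thesis unfolding sum_mod_delta by simp
qed

text \<open>The quotient \<open>j l div N\<close> is kept when the entry is changed, so an index out
  of range stays out of range.\<close>

lemma unit_op_tensors:
  assumes "t \<in> tensors n N" "l \<in> {1..n}" "b < N"
  shows "app (unit_op N l a b) t \<in> tensors n N"
  unfolding tensors_def
proof (intro CollectI allI impI)
  fix j assume j: "j \<notin> multi_indices n N"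
  have "j(l := b + N * (j l div N)) \<notin> multi_indices n N"
  proof
    assume A: "j(l := b + N * (j l div N)) \<in> multi_indices n N"
    then have "b + N * (j l div N) < N" using assms(2) unfolding multi_indices_iff by (metis fun_upd_same)
    then have "j l div N = 0" by (metis add_lessD1 add.commute mult_is_0 nat_mult_less_cancel_disj less_one mult.right_neutral neq0_conv)
    then have "j l < N" using N by (simp add: div_eq_0_iff)
    then have "j \<in> multi_indices n N"
      using A assms(2) unfolding multi_indices_iff by (metis fun_upd_other)
    then show False using j by simp
  qed
  then show "app (unit_op N l a b) t j = 0"
    using tensors_outside[OF assms(1)] by (simp add: unit_op.rep_eq)
qed

lemma tensors_add: "s \<in> tensors n N \<Longrightarrow> t \<in> tensors n N \<Longrightarrow> (\<lambda>j. s j + t j) \<in> tensors n N"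
  and tensors_diff: "s \<in> tensors n N \<Longrightarrow> t \<in> tensors n N \<Longrightarrow> (\<lambda>j. s j - t j) \<in> tensors n N"
  and tensors_scale: "t \<in> tensors n N \<Longrightarrow> (\<lambda>j. c * t j) \<in> tensors n N"
  by (auto simp: tensors_def)

lemma tensors_sum: "(\<And>x. x \<in> S \<Longrightarrow> f x \<in> tensors n N) \<Longrightarrow> (\<lambda>j. \<Sum>x\<in>S. f x j) \<in> tensors n N"
  by (auto simp: tensors_def)

lemma app_sum_fun: "app (\<Sum>x\<in>S. f x) t = (\<lambda>j. \<Sum>x\<in>S. app (f x) t j)"
  by (rule ext) (rule app_sum)

lemma app_mult: "app (A * B) t = app A (app B t)"
  by (simp add: app_simps)

lemma G_tensors:
  assumes "t \<in> tensors n N" "a < N" "b < N"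
  shows "app (op.G (Suc n) a b) t \<in> tensors n N"
proof -
  have "(\<lambda>j. \<Sum>l=1..<Suc n. app (unit_op N l b a) t j - app (unit_op N l a b) t j) \<in> tensors n N"
    by (intro tensors_sum tensors_diff unit_op_tensors) (use assms in auto)
  then show ?thesis unfolding op.G_def app_sum_fun by (simp add: app_simps)
qed

lemma sw_tensors:
  assumes "t \<in> tensors n N" "k \<in> {1..n}" "l \<in> {1..n}"
  shows "app (op.sw k l) t \<in> tensors n N"
  unfolding op.sw_def app_sum_fun app_mult using assms
  by (intro tensors_sum unit_op_tensors) auto

lemma ct_tensors:
  assumes "t \<in> tensors n N" "k \<in> {1..n}" "l \<in> {1..n}"
  shows "app (op.ct k l) t \<in> tensors n N"
  unfolding op.ct_def app_sum_fun app_mult using assms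
  by (intro tensors_sum unit_op_tensors) auto

lemma sw_act:
  assumes "k \<in> {1..n}" "l \<in> {1..n}" "k \<noteq> l" "t \<in> tensors n N"
  shows "app (op.sw k l) t = (\<lambda>j. t (j \<circ> Transposition.transpose k l))"
proof
  fix j
  let ?s = "brauer_act n N (transpos n k l) t"
  show "app (op.sw k l) t j = t (j \<circ> Transposition.transpose k l)"
  proof (cases "j \<in> multi_indices n N")
    case True
    then have "j k < N" "j l < N" using assms by (auto intro: multi_indices_less)
    then have "j(k := j l mod N + N * (j k div N), l := j k mod N + N * (j l div N)) = j \<circ> Transposition.transpose k l"
      by (auto simp: Transposition.transpose_def fun_eq_iff)
    then show ?thesis unfolding sw_app[OF assms(3)] by simp
  next
    case False
    then show ?thesis
      using tensors_outside[OF sw_tensors[OF assms(4,1,2)] False]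
        tensors_outside[OF brauer_act_tensors False, of "transpos n k l" t] transpos_act[OF assms(1,2,4)] by simp
  qed
qed

lemma transpos_act_op:
  assumes "k \<in> {1..n}" "l \<in> {1..n}" "k \<noteq> l" "t \<in> tensors n N"
  shows "brauer_act n N (transpos n k l) t = app (op.sw k l) t"
  using sw_act[OF assms] transpos_act[OF assms(1,2,4)] by simp

lemma bar_transpos_act_op:
  assumes "k \<in> {1..n}" "l \<in> {1..n}" "k \<noteq> l" "t \<in> tensors n N"
  shows "brauer_act n N (bar_transpos n k l) t = app (op.ct k l) t"
proof
  fix j
  show "brauer_act n N (bar_transpos n k l) t j = app (op.ct k l) t j"
  proof (cases "j \<in> multi_indices n N")
    case True
    then have "j k < N" "j l < N" using assms by (auto intro: multi_indices_less)
    then show ?thesis unfolding bar_transpos_act[OF assms True] ct_app[OF assms(3)] by simp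
  next
    case False
    then show ?thesis
      using tensors_outside[OF ct_tensors[OF assms(4,1,2)] False]
        tensors_outside[OF brauer_act_tensors False] by simp
  qed
qed

lemma id_act: "t \<in> tensors n N \<Longrightarrow> brauer_act n N (bgen (perm_graph n id)) t = t"
  using perm_graph_act[OF permutes_id, of t n N] by simp

lemma jucys_murphy_act:
  assumes k: "1 \<le> k" and t: "t \<in> tensors (k + 1) N"
  shows "brauer_act (k + 1) N (brauer_incl k (jucys_murphy N k)) t = app (op.X k) t"
proof -
  have "brauer_act (k + 1) N (brauer_incl k (jucys_murphy N k)) t =
    (\<lambda>j. (of_nat N - 1) / 2 * t j + (\<Sum>l=1..<k. app (op.sw k l) t j - app (op.ct k l) t j))"
  proof -
    have d: "brauer_act (k + 1) N (\<lambda>\<gamma>. transpos (k + 1) k l \<gamma> - bar_transpos (k + 1) k l \<gamma>) t j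
      = app (op.sw k l) t j - app (op.ct k l) t j" if "l \<in> {1..<k}" for l j
      using brauer_act_linear[of "k + 1" N "-1" "bar_transpos (k + 1) k l" "transpos (k + 1) k l" t]
        transpos_act_op[of k "k + 1" l t] bar_transpos_act_op[of k "k + 1" l t] that k t by simp
    show ?thesis
      unfolding jucys_murphy_incl[OF k] brauer_act_linear brauer_act_sum id_act[OF t]
      by (intro ext arg_cong2[where f = "(+)"] refl sum.cong d)
  qed
  moreover have "app (op.X k) t j = app (c0_op N) t j + (\<Sum>l=1..<k. app (op.sw k l) t j - app (op.ct k l) t j)" for j
    unfolding op.X_def by (simp add: app_simps app_sum)
  moreover have "app (c0_op N) t j = (of_nat N - 1) / 2 * t j" for j
    by (simp add: c0_op_def app_simps)
  ultimately show ?thesis by (simp only: fun_eq_iff) simp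
qed

lemma X_tensors:
  assumes "1 \<le> k" "t \<in> tensors (k + 1) N"
  shows "app (op.X k) t \<in> tensors (k + 1) N"
  using brauer_act_tensors jucys_murphy_act[OF assms] by metis

lemma X_power_act:
  assumes k: "1 \<le> k" and t: "t \<in> tensors (k + 1) N"
  shows "brauer_act (k + 1) N (brauer_incl k (jucys_murphy N k) [^]\<^bsub>brauer (k + 1) N\<^esub> i) t = app (op.X k ^ i) t"
  using t
proof (induction i arbitrary: t)
  case 0
  then show ?case by (simp add: nat_pow_def brauer_def id_act app_simps)
next
  case (Suc i)
  let ?x = "brauer_incl k (jucys_murphy N k)" and ?A = "brauer (k + 1) N"
  have "?x [^]\<^bsub>?A\<^esub> Suc i = brauer_mult (k + 1) N (?x [^]\<^bsub>?A\<^esub> i) ?x"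
    by (simp add: nat_pow_def) (simp add: brauer_def)
  then show ?case
    using Suc.IH[OF X_tensors[OF k Suc.prems]] jucys_murphy_act[OF k Suc.prems]
    by (simp add: brauer_act_mult power_Suc2 app_mult del: power_Suc)
qed

text \<open>An induction principle: a relation between operators that contains the constants,
  respects sums and products and relates the generators also relates the polynomials. It serves,
  through \<open>Z_op_rel\<close>, for stability of tensors, for locality and for
  intertwiners.\<close>

lemma P_rel:
  assumes 0: "Q 0 0" and 1: "Q 1 1" and c0: "Q (c0_op N) (c0_op N)"
    and add: "\<And>A A' B B'. Q A A' \<Longrightarrow> Q B B' \<Longrightarrow> Q (A + B) (A' + B')"
    and mult: "\<And>A A' B B'. Q A A' \<Longrightarrow> Q B B' \<Longrightarrow> Q (A * B) (A' * B')"
    and G: "\<And>a b. a < N \<Longrightarrow> b < N \<Longrightarrow> Q (op.G k a b) (op.G k' a b)"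
    and ab: "a < N" "b < N"
  shows "Q (op.P k i a b) (op.P k' i a b)"
proof -
  have sum: "Q (\<Sum>x\<in>S. f x) (\<Sum>x\<in>S. g x)" if "\<And>x. x \<in> S \<Longrightarrow> Q (f x) (g x)" for S :: "nat set" and f g
    using that by (induction S rule: infinite_finite_induct) (auto intro: 0 add)
  show ?thesis using ab(2)
  proof (induction i arbitrary: b)
    case 0
    then show ?case by (auto intro: assms)
  next
    case (Suc i)
    then show ?case by (auto intro!: add mult c0 sum G ab)
  qed
qed

text \<open>\<open>Z_op k i\<close> is a polynomial in the \<open>op.G k a b\<close> which does not depend on \<open>k\<close>.\<close>

lemma Z_op_rel:
  assumes 0: "Q 0 0" and 1: "Q 1 1" and c0: "Q (c0_op N) (c0_op N)"
    and add: "\<And>A A' B B'. Q A A' \<Longrightarrow> Q B B' \<Longrightarrow> Q (A + B) (A' + B')"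
    and mult: "\<And>A A' B B'. Q A A' \<Longrightarrow> Q B B' \<Longrightarrow> Q (A * B) (A' * B')"
    and G: "\<And>a b. a < N \<Longrightarrow> b < N \<Longrightarrow> Q (op.G k a b) (op.G k' a b)"
  shows "Q (Z_op k i) (Z_op k' i)"
proof -
  have sum: "Q (\<Sum>x\<in>S. f x) (\<Sum>x\<in>S. g x)" if "\<And>x. x \<in> S \<Longrightarrow> Q (f x) (g x)" for S :: "nat set" and f g
    using that by (induction S rule: infinite_finite_induct) (auto intro: 0 add)
  show ?thesis unfolding Z_op_def
    by (rule sum) (use P_rel[of Q, OF assms] in auto)
qed

lemma c0_op_tensors: "t \<in> tensors n N \<Longrightarrow> app (c0_op N) t \<in> tensors n N"
  by (simp add: c0_op_def app_simps tensors_def)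

lemma Z_op_tensors:
  assumes "t \<in> tensors n N"
  shows "app (Z_op (Suc n) i) t \<in> tensors n N"
proof -
  let ?Q = "\<lambda>A B. \<forall>t\<in>tensors n N. app A t \<in> tensors n N"
  have "?Q (Z_op (Suc n) i) (Z_op (Suc n) i)"
    by (rule Z_op_rel[of ?Q]) (auto simp: c0_op_tensors G_tensors app_mult, auto simp: app_simps tensors_add tensors_def)
  then show ?thesis using assms by blast
qed

text \<open>The relation s x^i s = z s holds in B(k+1,N), so it is applied to t tensored with two
  basis vectors. The contraction replaces these by the invariant vector, and the coordinates whose
  entries at k and k + 1 are 0 give back t and the action of z on it.\<close>

lemma z_elem_act:
  assumes k: "1 \<le> k" and t: "t \<in> tensors (k - 1) N"
  shows "brauer_act (k - 1) N (z_elem N k i) t = app (Z_op k i) t"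
proof
  fix j
  let ?u = "undefined :: nat" and ?M = "\<lambda>n. multi_indices n N"
  let ?e = "op.ct k (k + 1)" and ?s = "bar_transpos (k + 1) k (k + 1)"
  \<comment> \<open>\<open>up\<close> puts the entries 0, 0 at positions k and k + 1;
    \<open>dn\<close> takes them away, restoring \<open>undefined\<close> as required of an index of
    length k - 1.\<close>
  define up where "up j = j(k := 0, k + 1 := 0 :: nat)" for j :: "nat \<Rightarrow> nat"
  define dn where "dn j = j(k := ?u, k + 1 := ?u)" for j :: "nat \<Rightarrow> nat"
  define t' where "t' j = (if j k = 0 \<and> j (k + 1) = 0 then t (dn j) else 0)" for j
  have updn: "up (dn j) = up j" "dn (up j) = dn j" for j by (auto simp: up_def dn_def fun_eq_iff)
  define I where "I = {1..k - 1}"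
  have kI: "k \<notin> I" "k + 1 \<notin> I" unfolding I_def by auto
  have I2: "{1..k + 1} = insert k (insert (k + 1) I)" unfolding I_def using k by auto
  define ok where "ok j \<longleftrightarrow> (\<forall>m\<in>I. j m < N) \<and> (\<forall>m. m \<notin> I \<longrightarrow> m \<noteq> k \<longrightarrow> m \<noteq> k + 1 \<longrightarrow> j m = ?u)" for j
  have mem_dn: "dn j \<in> ?M (k - 1) \<longleftrightarrow> ok j" for j
    unfolding multi_indices_iff dn_def I_def[symmetric] ok_def using kI by auto
  have mem_up: "up j \<in> ?M (k + 1) \<longleftrightarrow> ok j" for j
    unfolding multi_indices_iff up_def I2 ok_def using kI N by auto
  have t': "t' \<in> tensors (k + 1) N"
    unfolding tensors_def
  proof (intro CollectI allI impI)
    fix j assume j: "j \<notin> ?M (k + 1)"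
    show "t' j = 0"
    proof (cases "j k = 0 \<and> j (k + 1) = 0")
      case True
      then have "up j = j" by (auto simp: up_def fun_eq_iff)
      then have "dn j \<notin> ?M (k - 1)" using j mem_up[of j] mem_dn[of j] by simp
      then show ?thesis using tensors_outside[OF t] by (simp add: t'_def)
    qed (auto simp: t'_def)
  qed
  have kk: "k \<in> {1..k + 1}" "k + 1 \<in> {1..k + 1}" "k \<noteq> k + 1" using k by auto
  define w where "w = app ?e t'"
  have wT: "w \<in> tensors (k + 1) N" unfolding w_def by (rule ct_tensors[OF t' kk(1,2)])
  have w_up: "w (up j) = t (dn j)" for j
  proof -
    have "w (up j) = (\<Sum>b<N. t' ((up j)(k := b, k + 1 := b)))"
      unfolding w_def ct_app[OF kk(3)] by (simp add: up_def)
    also have "\<dots> = (\<Sum>b<N. if b = 0 then t (dn j) else 0)"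
      by (intro sum.cong refl) (auto simp: t'_def dn_def up_def fun_upd_twist)
    finally show ?thesis using N by simp
  qed
  have "brauer_act (k + 1) N (brauer_mult (k + 1) N (brauer_mult (k + 1) N ?s
      (brauer_incl k (jucys_murphy N k) [^]\<^bsub>brauer (k + 1) N\<^esub> i)) ?s) t'
    = brauer_act (k + 1) N (brauer_mult (k + 1) N (incl2 k (z_elem N k i)) ?s) t'"
    using z_elem[OF k, of N i] by (simp add: brauer_def)
  then have "app ?e (app (op.X k ^ i) w) = brauer_act (k + 1) N (incl2 k (z_elem N k i)) w"
    unfolding brauer_act_mult bar_transpos_act_op[OF kk t'] w_def[symmetric] X_power_act[OF k wT]
    using bar_transpos_act_op[OF kk] brauer_act_tensors X_power_act[OF k wT] by metis
  moreover have "app ?e (app (op.X k ^ i) w) = app (Z_op k i) w"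
  proof -
    have "op.X k * unit_op N (k + 1) a b = unit_op N (k + 1) a b * op.X k" for a b
      by (rule op.X_comm_E) simp
    then have "op.X k ^ i * unit_op N (k + 1) a b = unit_op N (k + 1) a b * op.X k ^ i" for a b
      by (rule power_commuting_commutes)
    then have "?e * op.X k ^ i * ?e = op.tr k (op.X k ^ i) * ?e"
      by (rule op.ct_sandwich[OF kk(3)])
    then show ?thesis unfolding w_def app_mult[symmetric] Z_op_def op.tr_X_power by (simp add: mult.assoc)
  qed
  ultimately have main: "brauer_act (k + 1) N (incl2 k (z_elem N k i)) w = app (Z_op k i) w" by simp
  \<comment> \<open>\<open>Z_op k i\<close> touches only the first k - 1 factors, so it is
    compatible with fixing the entries at k and k + 1.\<close>
  have loc: "app (Z_op k i) w (up j) = app (Z_op k i) t (dn j)" for j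
  proof -
    let ?Q = "\<lambda>A B. \<forall>(w :: tensor) (t :: tensor). (\<forall>j. w (up j) = t (dn j)) \<longrightarrow> (\<forall>j. app A w (up j) = app A t (dn j))"
    have G: "?Q (op.G k a b) (op.G k a b)" for a b
    proof (intro allI impI)
      fix w t :: tensor and j assume *: "\<forall>j. w (up j) = t (dn j)"
      have E: "app (unit_op N l a b) w (up j) = app (unit_op N l a b) t (dn j)" if "l \<in> {1..<k}" for l a b
      proof -
        have "up j l = j l" "dn j l = j l" "(up j)(l := x) = up (j(l := x))" "(dn j)(l := x) = dn (j(l := x))" for x
          using that by (auto simp: up_def dn_def fun_eq_iff)
        then show ?thesis using * by (simp add: unit_op.rep_eq)
      qed
      show "app (op.G k a b) w (up j) = app (op.G k a b) t (dn j)"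
        unfolding op.G_def app_sum by (intro sum.cong refl) (simp add: app_simps E)
    qed
    have "?Q (Z_op k i) (Z_op k i)"
    proof (rule Z_op_rel[of ?Q])
      fix A B A' B' assume A: "?Q A A'" and B: "?Q B B'"
      show "?Q (A + B) (A' + B')"
      proof (intro allI impI)
        fix w t :: tensor and j assume "\<forall>j. w (up j) = t (dn j)"
        then have "app A w (up j) = app A t (dn j)" "app B w (up j) = app B t (dn j)" using A B by blast+
        then show "app (A + B) w (up j) = app (A + B) t (dn j)" by (simp add: app_simps)
      qed
      show "?Q (A * B) (A' * B')" unfolding app_mult using A B by blast
    qed (use G in \<open>auto simp: app_simps c0_op_def\<close>)
    then show ?thesis using w_up by blast
  qed
  show "brauer_act (k - 1) N (z_elem N k i) t j = app (Z_op k i) t j"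
  proof (cases "j \<in> ?M (k - 1)")
    case True
    have dj: "dn j = j" using True kI unfolding multi_indices_iff dn_def I_def[symmetric] fun_eq_iff by simp
    have uj: "up j \<in> ?M (k + 1)" using mem_up[of j] mem_dn[of j] True dj by simp
    \<comment> \<open>The vertical edges force the entries of i at k and k + 1 to be those of
      \<open>up j\<close>, that is 0.\<close>
    have comp: "compatible (add_verticals k \<gamma>) (up j) i \<longleftrightarrow> compatible \<gamma> j (dn i) \<and> up i = i"
      if \<gamma>: "\<gamma> \<in> brauer_graphs (k - 1)" for \<gamma> i
    proof -
      have "case_vertex (up j) i v = case_vertex j (dn i) v" if "e \<in> \<gamma>" "v \<in> e" for e v
      proof -
        have "v \<in> vertices (k - 1)" using brauer_graphs_edge(2)[OF \<gamma> that(1)] that(2) by blast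
        then show ?thesis using k by (auto simp: vertices_def up_def dn_def)
      qed
      then have "compatible \<gamma> (up j) i \<longleftrightarrow> compatible \<gamma> j (dn i)"
        unfolding compatible_def by simp
      moreover have "compatible (add_verticals k \<gamma>) (up j) i \<longleftrightarrow> compatible \<gamma> (up j) i \<and> i k = 0 \<and> i (k + 1) = 0"
        unfolding compatible_def add_verticals_def by (auto simp: up_def ball_Un)
      moreover have "up i = i \<longleftrightarrow> i k = 0 \<and> i (k + 1) = 0"
      proof
        assume "up i = i"
        moreover have "up i k = 0" "up i (k + 1) = 0" by (simp_all add: up_def)
        ultimately show "i k = 0 \<and> i (k + 1) = 0" by (simp only:)
      next
        assume *: "i k = 0 \<and> i (k + 1) = 0"
        have "i(k := i k, k + 1 := i (k + 1)) = i" by (simp only: fun_upd_triv)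
        then show "up i = i" unfolding up_def using * by (simp only:)
      qed
      ultimately show ?thesis by simp
    qed
    let ?F = "\<lambda>\<gamma>. incl2 k (z_elem N k i) \<gamma> * (\<Sum>i | i \<in> ?M (k + 1) \<and> compatible \<gamma> (up j) i. w i)"
    have "app (Z_op k i) t j = brauer_act (k + 1) N (incl2 k (z_elem N k i)) w (up j)"
      using loc[of j] main dj by simp
    also have "\<dots> = sum ?F (brauer_graphs (k + 1))"
      using uj by (simp add: brauer_act_def)
    also have "\<dots> = sum ?F (add_verticals k ` brauer_graphs (k - 1))"
      by (rule sum.mono_neutral_right) (use add_verticals_mem(1)[OF k] incl2_nonzero[OF k] in fastforce)+
    also have "\<dots> = (\<Sum>\<gamma>\<in>brauer_graphs (k - 1). ?F (add_verticals k \<gamma>))"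
    proof -
      have inj: "inj_on (add_verticals k) (brauer_graphs (k - 1))"
        by (rule inj_onI) (rule add_verticals_inj[OF k])
      show ?thesis unfolding sum.reindex[OF inj] by simp
    qed
    also have "\<dots> = (\<Sum>\<gamma>\<in>brauer_graphs (k - 1). z_elem N k i \<gamma> * (\<Sum>i | i \<in> ?M (k - 1) \<and> compatible \<gamma> j i. t i))"
    proof (intro sum.cong refl)
      fix \<gamma> assume \<gamma>: "\<gamma> \<in> brauer_graphs (k - 1)"
      have "(\<Sum>i | i \<in> ?M (k + 1) \<and> compatible (add_verticals k \<gamma>) (up j) i. w i)
        = (\<Sum>i | i \<in> ?M (k - 1) \<and> compatible \<gamma> j i. t i)"
      proof (rule sum.reindex_bij_witness[of _ up dn])
        fix i assume i: "i \<in> {i. i \<in> ?M (k + 1) \<and> compatible (add_verticals k \<gamma>) (up j) i}"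
        then have ui: "up i = i" "compatible \<gamma> j (dn i)" using comp[OF \<gamma>] by auto
        then show "up (dn i) = i" "t (dn i) = w i" using updn w_up[of i] by auto
        show "dn i \<in> {i. i \<in> ?M (k - 1) \<and> compatible \<gamma> j i}"
          using i ui mem_up[of i] mem_dn[of i] by simp
      next
        fix i assume i: "i \<in> {i. i \<in> ?M (k - 1) \<and> compatible \<gamma> j i}"
        then have di: "dn i = i" using kI unfolding mem_Collect_eq multi_indices_iff dn_def I_def[symmetric] fun_eq_iff by simp
        then show "dn (up i) = i" using updn by simp
        have "up (up i) = up i" using updn by metis
        then show "up i \<in> {i. i \<in> ?M (k + 1) \<and> compatible (add_verticals k \<gamma>) (up j) i}"
          using i di updn(2)[of i] mem_up[of i] mem_dn[of i] comp[OF \<gamma>] by simp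
      qed
      then show "?F (add_verticals k \<gamma>) = z_elem N k i \<gamma> * (\<Sum>i | i \<in> ?M (k - 1) \<and> compatible \<gamma> j i. t i)"
        unfolding incl2_add_verticals[OF k \<gamma>] by (simp only:)
    qed
    also have "\<dots> = brauer_act (k - 1) N (z_elem N k i) t j"
      using True by (simp add: brauer_act_def)
    finally show ?thesis by simp
  next
    case False
    then show ?thesis
      using tensors_outside[OF Z_op_tensors[OF t] False] tensors_outside[OF brauer_act_tensors False] k by simp
  qed
qed

end

section \<open>Intertwiners of the orthogonal group\<close>

lemma multi_indices_permute:
  assumes p: "p permutes {1..n}"
  shows "j \<circ> p \<in> multi_indices n N \<longleftrightarrow> j \<in> multi_indices n N"
proof -
  have A: "j \<circ> p \<in> multi_indices n N" if "j \<in> multi_indices n N" "p permutes {1..n}" for j p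
    using that permutes_in_image[of p "{1..n}"] unfolding multi_indices_iff by (metis comp_apply)
  have "j = (j \<circ> p) \<circ> Hilbert_Choice.inv p" using permutes_inv_o(1)[OF p] by (simp add: comp_assoc)
  then show ?thesis using A[OF _ p] A[OF _ permutes_inv[OF p], of "j \<circ> p"] by auto
qed

lemma multi_indices_upd:
  "j \<in> multi_indices n N \<Longrightarrow> m \<in> {1..n} \<Longrightarrow> c < N \<Longrightarrow> j(m := c) \<in> multi_indices n N"
  unfolding multi_indices_iff by (metis fun_upd_apply)

lemma tensors_comp:
  assumes "p permutes {1..n}" "t \<in> tensors n N"
  shows "(\<lambda>j. t (j \<circ> p)) \<in> tensors n N"
  using assms multi_indices_permute[OF assms(1)] by (simp add: tensors_def)

lemma group_act_tensors: "group_act n N g t \<in> tensors n N"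
  by (simp add: group_act_def tensors_def)

lemma group_act_linear:
  "group_act n N g (\<lambda>i. a * t i + b * s i) = (\<lambda>j. a * group_act n N g t j + b * group_act n N g s j)"
  by (rule ext) (simp add: group_act_def sum_distrib_left sum.distrib algebra_simps)

lemma group_act_perm:
  assumes p: "p permutes {1..n}"
  shows "group_act n N g (\<lambda>j. t (j \<circ> p)) = (\<lambda>j. group_act n N g t (j \<circ> p))"
proof
  fix j
  let ?M = "multi_indices n N"
  show "group_act n N g (\<lambda>j. t (j \<circ> p)) j = group_act n N g t (j \<circ> p)"
  proof (cases "j \<in> ?M")
    case True
    have "(\<Sum>i\<in>?M. (\<Prod>m=1..n. g $$ (j m, i m)) * t (i \<circ> p)) = (\<Sum>i\<in>?M. (\<Prod>m=1..n. g $$ (j (p m), i m)) * t i)"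
    proof (rule sum.reindex_bij_witness[of _ "\<lambda>i. i \<circ> Hilbert_Choice.inv p" "\<lambda>i. i \<circ> p"])
      fix i assume i: "i \<in> ?M"
      show "i \<circ> p \<circ> Hilbert_Choice.inv p = i" "i \<circ> Hilbert_Choice.inv p \<circ> p = i"
        using permutes_inv_o[OF p] by (simp_all add: comp_assoc)
      show "i \<circ> p \<in> ?M" "i \<circ> Hilbert_Choice.inv p \<in> ?M"
        using i multi_indices_permute[OF p] multi_indices_permute[OF permutes_inv[OF p]] by auto
      have "(\<Prod>m=1..n. g $$ (j m, i m)) = (\<Prod>m=1..n. g $$ (j (p m), i (p m)))"
        using prod.permute[OF p, of "\<lambda>m. g $$ (j m, i m)"] by (simp add: comp_def)
      then show "(\<Prod>m=1..n. g $$ (j (p m), (i \<circ> p) m)) * t (i \<circ> p) = (\<Prod>m=1..n. g $$ (j m, i m)) * t (i \<circ> p)"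
        by simp
    qed
    then show ?thesis using True multi_indices_permute[OF p, of j N] by (simp add: group_act_def)
  next
    case False
    then show ?thesis using multi_indices_permute[OF p, of j N] by (simp add: group_act_def)
  qed
qed

lemma orthogonal_group_cols:
  assumes g: "g \<in> orthogonal_group N" and "x < N" "y < N"
  shows "(\<Sum>c<N. g $$ (c, x) * g $$ (c, y)) = (if x = y then 1 else 0)"
proof -
  have gc: "g \<in> carrier_mat N N" and 1: "g * transpose_mat g = 1\<^sub>m N"
    using g by (auto simp: orthogonal_group_def)
  have "transpose_mat g * g = 1\<^sub>m N"
    by (rule mat_mult_left_right_inverse[OF gc _ 1]) (use gc in simp)
  then have "(transpose_mat g * g) $$ (x, y) = (if x = y then 1 else 0)"
    using assms by simp
  moreover have "(transpose_mat g * g) $$ (x, y) = (\<Sum>c<N. g $$ (c, x) * g $$ (c, y))"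
    using gc assms(2,3) by (simp add: scalar_prod_def atLeast0LessThan)
  ultimately show ?thesis by simp
qed

text \<open>Contraction commutes with orthogonal matrices: the sum over c of two entries of column i
  k and column i l of g is 1 or 0, and what is left contains contractions of t as inner
  sums.\<close>

lemma contraction_group_act:
  assumes g: "g \<in> orthogonal_group N" and kl: "k \<in> {1..n}" "l \<in> {1..n}" "k \<noteq> l"
    and zero: "\<And>j. j \<in> multi_indices n N \<Longrightarrow> j k = j l \<Longrightarrow> (\<Sum>a<N. t (j(k := a, l := a))) = 0"
    and j: "j \<in> multi_indices n N"
  shows "(\<Sum>c<N. group_act n N g t (j(k := c, l := c))) = 0"
proof -
  let ?M = "multi_indices n N"
  have split: "(\<Prod>m=1..n. F m) = F k * F l * (\<Prod>m\<in>{1..n} - {k, l}. F m)" for F :: "nat \<Rightarrow> complex"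
  proof -
    have "{1..n} = insert k (insert l ({1..n} - {k, l}))" using kl by auto
    then have "(\<Prod>m=1..n. F m) = (\<Prod>m\<in>insert k (insert l ({1..n} - {k, l})). F m)" by simp
    also have "\<dots> = F k * (F l * (\<Prod>m\<in>{1..n} - {k, l}. F m))"
      using kl(3) by (subst prod.insert) auto
    finally show ?thesis by (simp add: mult.assoc)
  qed
  define F where "F i = (\<Prod>m\<in>{1..n} - {k, l}. g $$ (j m, i m))" for i
  have "(\<Sum>c<N. group_act n N g t (j(k := c, l := c)))
    = (\<Sum>c<N. \<Sum>i\<in>?M. g $$ (c, i k) * g $$ (c, i l) * (F i * t i))"
  proof (intro sum.cong refl)
    fix c assume c: "c \<in> {..<N}"
    have "j(k := c, l := c) \<in> ?M" using j kl c by (intro multi_indices_upd) auto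
    moreover have "(\<Prod>m\<in>{1..n} - {k, l}. g $$ ((j(k := c, l := c)) m, i m)) = F i" for i
      unfolding F_def by (intro prod.cong) auto
    ultimately show "group_act n N g t (j(k := c, l := c)) = (\<Sum>i\<in>?M. g $$ (c, i k) * g $$ (c, i l) * (F i * t i))"
      unfolding group_act_def split using kl(3) by (simp add: mult.assoc)
  qed
  also have "\<dots> = (\<Sum>i\<in>?M. (\<Sum>c<N. g $$ (c, i k) * g $$ (c, i l)) * (F i * t i))"
    by (subst sum.swap) (simp add: sum_distrib_right)
  also have "\<dots> = (\<Sum>i\<in>?M. if i k = i l then F i * t i else 0)"
    by (intro sum.cong refl) (use kl multi_indices_less[of _ n N] in \<open>simp add: orthogonal_group_cols[OF g]\<close>)
  also have "\<dots> = (\<Sum>i\<in>{i \<in> ?M. i k = i l}. F i * t i)"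
    by (simp add: sum.inter_filter)
  \<comment> \<open>An index with i k = i l is encoded by the index with both entries reset to 0,
    together with their common value a.\<close>
  also have "\<dots> = (\<Sum>(i, a)\<in>{i \<in> ?M. i k = 0 \<and> i l = 0} \<times> {..<N}. F i * t (i(k := a, l := a)))"
  proof (rule sum.reindex_bij_witness[of _ "\<lambda>(i, a). i(k := a, l := a)" "\<lambda>i. (i(k := 0, l := 0), i k)"])
    fix i assume i: "i \<in> {i \<in> ?M. i k = i l}"
    then have N: "i k < N" using kl multi_indices_less by blast
    show "(case (i(k := 0, l := 0), i k) of (i, a) \<Rightarrow> i(k := a, l := a)) = i"
      using i kl(3) by (auto simp: fun_eq_iff)
    show "(i(k := 0, l := 0), i k) \<in> {i \<in> ?M. i k = 0 \<and> i l = 0} \<times> {..<N}"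
      using i N kl by (auto intro!: multi_indices_upd)
    have "F (i(k := 0, l := 0)) = F i" unfolding F_def by (intro prod.cong) auto
    moreover have "i(k := i k, l := i k) = i" using i by (auto simp: fun_eq_iff)
    ultimately show "(case (i(k := 0, l := 0), i k) of (i, a) \<Rightarrow> F i * t (i(k := a, l := a))) = F i * t i"
      by simp
  next
    fix ia assume ia: "ia \<in> {i \<in> ?M. i k = 0 \<and> i l = 0} \<times> {..<N}"
    obtain i a where [simp]: "ia = (i, a)" by (cases ia)
    have i: "i \<in> ?M" "i k = 0" "i l = 0" "a < N" using ia by auto
    show "((case ia of (i, a) \<Rightarrow> i(k := a, l := a))(k := 0, l := 0), (case ia of (i, a) \<Rightarrow> i(k := a, l := a)) k) = ia"
      using i kl(3) by (auto simp: fun_eq_iff)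
    show "(case ia of (i, a) \<Rightarrow> i(k := a, l := a)) \<in> {i \<in> ?M. i k = i l}"
      using i kl by (auto intro!: multi_indices_upd)
  qed
  also have "\<dots> = (\<Sum>i\<in>{i \<in> ?M. i k = 0 \<and> i l = 0}. F i * (\<Sum>a<N. t (i(k := a, l := a))))"
    by (subst sum.cartesian_product[symmetric]) (simp add: sum_distrib_left)
  also have "\<dots> = 0"
    by (intro sum.neutral) (use zero in auto)
  finally show ?thesis .
qed

section \<open>Traceless tensors and the module U\<close>

lemma traceless_iff:
  "t \<in> traceless n N \<longleftrightarrow> t \<in> tensors n N \<and> (\<forall>k\<in>{1..n}. \<forall>l\<in>{1..n}. k \<noteq> l \<longrightarrow>
    (\<forall>j\<in>multi_indices n N. j k = j l \<longrightarrow> (\<Sum>a<N. t (j(k := a, l := a))) = 0))"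
proof -
  have "brauer_act n N (bar_transpos n k l) t = (\<lambda>_. 0) \<longleftrightarrow>
    (\<forall>j\<in>multi_indices n N. j k = j l \<longrightarrow> (\<Sum>a<N. t (j(k := a, l := a))) = 0)"
    if "k \<in> {1..n}" "l \<in> {1..n}" "k \<noteq> l" "t \<in> tensors n N" for k l
  proof -
    have "brauer_act n N (bar_transpos n k l) t = (\<lambda>_. 0) \<longleftrightarrow>
      (\<forall>j\<in>multi_indices n N. brauer_act n N (bar_transpos n k l) t j = 0)"
      unfolding fun_eq_iff using tensors_outside[OF brauer_act_tensors] by metis
    then show ?thesis using bar_transpos_act[OF that] by auto
  qed
  then show ?thesis unfolding traceless_def by blast
qed

lemma traceless_tensors: "t \<in> traceless n N \<Longrightarrow> t \<in> tensors n N"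
  by (simp add: traceless_def)

lemma traceless_group_act:
  assumes "g \<in> orthogonal_group N" "t \<in> traceless n N"
  shows "group_act n N g t \<in> traceless n N"
  using assms contraction_group_act[OF assms(1)] unfolding traceless_iff
  by (auto simp: group_act_tensors simp del: fun_upd_apply)

lemma traceless_linear:
  assumes "s \<in> traceless n N" "t \<in> traceless n N"
  shows "(\<lambda>i. a * s i + b * t i) \<in> traceless n N"
  using assms unfolding traceless_iff
  by (auto simp: tensors_def sum.distrib sum_distrib_left[symmetric])

lemma specht_transl:
  assumes "v \<in> specht \<mu>" "p permutes {1..card \<mu>}"
  shows "left_transl p v \<in> specht \<mu>"
proof -
  let ?n = "card \<mu>"
  obtain a where v: "v = (\<lambda>s. \<Sum>q | q permutes {1..?n}. a q * left_transl q (young_symmetrizer \<mu>) s)"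
    using assms(1) by (auto simp: specht_def)
  have p: "bij p" using assms(2) by (rule permutes_bij)
  have "left_transl p v s = (\<Sum>q | q permutes {1..?n}. a (Hilbert_Choice.inv p \<circ> q) * left_transl q (young_symmetrizer \<mu>) s)" for s
    unfolding left_transl_def[of p] v
  proof (rule sum.reindex_bij_witness[of _ "\<lambda>q. Hilbert_Choice.inv p \<circ> q" "\<lambda>q. p \<circ> q"])
    fix q assume q: "q \<in> {q. q permutes {1..?n}}"
    show "Hilbert_Choice.inv p \<circ> (p \<circ> q) = q" "p \<circ> (Hilbert_Choice.inv p \<circ> q) = q"
      using permutes_inv_o[OF assms(2)] by (simp_all add: comp_assoc[symmetric])
    show "p \<circ> q \<in> {q. q permutes {1..?n}}" "Hilbert_Choice.inv p \<circ> q \<in> {q. q permutes {1..?n}}"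
      using q assms(2) by (auto intro: permutes_compose permutes_inv)
    have "Hilbert_Choice.inv (p \<circ> q) = Hilbert_Choice.inv q \<circ> Hilbert_Choice.inv p"
      using q p by (intro o_inv_distrib) (auto simp: permutes_bij)
    then show "a (Hilbert_Choice.inv p \<circ> (p \<circ> q)) * left_transl (p \<circ> q) (young_symmetrizer \<mu>) s
      = a q * left_transl q (young_symmetrizer \<mu>) (Hilbert_Choice.inv p \<circ> s)"
      using permutes_inv_o[OF assms(2)] by (simp add: left_transl_def comp_assoc[symmetric])
  qed
  then show ?thesis unfolding specht_def mem_Collect_eq by (intro exI ext)
qed

lemma weyl_moduleD:
  assumes "\<phi> \<in> weyl_module \<mu> N"
  shows "v \<in> specht \<mu> \<Longrightarrow> \<phi> v \<in> traceless (card \<mu>) N"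
    and "v \<notin> specht \<mu> \<Longrightarrow> \<phi> v = (\<lambda>_. 0)"
    and "v \<in> specht \<mu> \<Longrightarrow> w \<in> specht \<mu> \<Longrightarrow> \<phi> (\<lambda>s. a * v s + b * w s) = (\<lambda>i. a * \<phi> v i + b * \<phi> w i)"
    and "v \<in> specht \<mu> \<Longrightarrow> p permutes {1..card \<mu>} \<Longrightarrow> \<phi> (left_transl p v) = (\<lambda>j. \<phi> v (j \<circ> p))"
proof -
  note d = assms[unfolded weyl_module_def mem_Collect_eq]
  show t: "v \<in> specht \<mu> \<Longrightarrow> \<phi> v \<in> traceless (card \<mu>) N" for v using d by blast
  show "v \<notin> specht \<mu> \<Longrightarrow> \<phi> v = (\<lambda>_. 0)" using d by blast
  show "v \<in> specht \<mu> \<Longrightarrow> w \<in> specht \<mu> \<Longrightarrow> \<phi> (\<lambda>s. a * v s + b * w s) = (\<lambda>i. a * \<phi> v i + b * \<phi> w i)" using d by blast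
  assume v: "v \<in> specht \<mu>" and p: "p permutes {1..card \<mu>}"
  show "\<phi> (left_transl p v) = (\<lambda>j. \<phi> v (j \<circ> p))"
    using d v p perm_graph_act[OF p traceless_tensors[OF t[OF v]]] by simp
qed

lemma weyl_moduleI:
  assumes "\<And>v. v \<in> specht \<mu> \<Longrightarrow> \<phi> v \<in> traceless (card \<mu>) N"
    "\<And>v. v \<notin> specht \<mu> \<Longrightarrow> \<phi> v = (\<lambda>_. 0)"
    "\<And>v w a b. v \<in> specht \<mu> \<Longrightarrow> w \<in> specht \<mu> \<Longrightarrow> \<phi> (\<lambda>s. a * v s + b * w s) = (\<lambda>i. a * \<phi> v i + b * \<phi> w i)"
    "\<And>v p. v \<in> specht \<mu> \<Longrightarrow> p permutes {1..card \<mu>} \<Longrightarrow> \<phi> (left_transl p v) = (\<lambda>j. \<phi> v (j \<circ> p))"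
  shows "\<phi> \<in> weyl_module \<mu> N"
  unfolding weyl_module_def mem_Collect_eq
proof (intro conjI ballI allI impI)
  fix v p assume "v \<in> specht \<mu>" "p permutes {1..card \<mu>}"
  then show "\<phi> (left_transl p v) = brauer_act (card \<mu>) N (bgen (perm_graph (card \<mu>) p)) (\<phi> v)"
    using assms(4) perm_graph_act[OF _ traceless_tensors[OF assms(1)]] by simp
qed (rule assms; assumption)+

lemma weyl_module_linear:
  assumes "\<phi> \<in> weyl_module \<mu> N" "\<psi> \<in> weyl_module \<mu> N"
  shows "(\<lambda>v i. a * \<phi> v i + b * \<psi> v i) \<in> weyl_module \<mu> N"
proof (rule weyl_moduleI)
  show "(\<lambda>i. a * \<phi> v i + b * \<psi> v i) \<in> traceless (card \<mu>) N" if "v \<in> specht \<mu>" for v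
    using that assms weyl_moduleD(1) by (intro traceless_linear) blast+
  show "(\<lambda>i. a * \<phi> v i + b * \<psi> v i) = (\<lambda>_. 0)" if "v \<notin> specht \<mu>" for v
    using weyl_moduleD(2)[OF assms(1) that] weyl_moduleD(2)[OF assms(2) that] by simp
  show "(\<lambda>i. a * \<phi> (\<lambda>s. c * v s + d * w s) i + b * \<psi> (\<lambda>s. c * v s + d * w s) i)
    = (\<lambda>i. c * (a * \<phi> v i + b * \<psi> v i) + d * (a * \<phi> w i + b * \<psi> w i))"
    if "v \<in> specht \<mu>" "w \<in> specht \<mu>" for v w c d
    using weyl_moduleD(3)[OF assms(1) that] weyl_moduleD(3)[OF assms(2) that] by (simp add: algebra_simps)
  show "(\<lambda>i. a * \<phi> (left_transl p v) i + b * \<psi> (left_transl p v) i) = (\<lambda>j. a * \<phi> v (j \<circ> p) + b * \<psi> v (j \<circ> p))"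
    if "v \<in> specht \<mu>" "p permutes {1..card \<mu>}" for v p
    using weyl_moduleD(4)[OF assms(1) that] weyl_moduleD(4)[OF assms(2) that] by simp
qed

lemma weyl_module_group:
  assumes \<phi>: "\<phi> \<in> weyl_module \<mu> N" and g: "g \<in> orthogonal_group N"
  shows "(\<lambda>v. group_act (card \<mu>) N g (\<phi> v)) \<in> weyl_module \<mu> N"
proof (rule weyl_moduleI)
  show "group_act (card \<mu>) N g (\<phi> v) \<in> traceless (card \<mu>) N" if "v \<in> specht \<mu>" for v
    by (rule traceless_group_act[OF g weyl_moduleD(1)[OF \<phi> that]])
  show "group_act (card \<mu>) N g (\<phi> v) = (\<lambda>_. 0)" if "v \<notin> specht \<mu>" for v
    using weyl_moduleD(2)[OF \<phi> that] by (simp add: group_act_def fun_eq_iff)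
  show "group_act (card \<mu>) N g (\<phi> (\<lambda>s. a * v s + b * w s))
    = (\<lambda>i. a * group_act (card \<mu>) N g (\<phi> v) i + b * group_act (card \<mu>) N g (\<phi> w) i)"
    if "v \<in> specht \<mu>" "w \<in> specht \<mu>" for v w a b
    unfolding weyl_moduleD(3)[OF \<phi> that] by (rule group_act_linear)
  show "group_act (card \<mu>) N g (\<phi> (left_transl p v)) = (\<lambda>j. group_act (card \<mu>) N g (\<phi> v) (j \<circ> p))"
    if "v \<in> specht \<mu>" "p permutes {1..card \<mu>}" for v p
    unfolding weyl_moduleD(4)[OF \<phi> that] by (rule group_act_perm[OF that(2)])
qed

section \<open>Lie algebra generators as finite combinations of rotations\<close>

lemma pderiv_sum_poly: "pderiv (\<Sum>x\<in>S. f x) = (\<Sum>x\<in>S. pderiv (f x :: complex poly))"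
  by (induction S rule: infinite_finite_induct) (simp_all add: pderiv_add)

text \<open>Evaluations at sufficiently many points determine the derivative at 0 of a polynomial of bounded degree.\<close>

lemma derivative_functional:
  obtains c :: "nat \<Rightarrow> complex" where
    "\<And>p. degree p \<le> D \<Longrightarrow> (\<Sum>s\<le>D. c s * poly p (of_nat s)) = poly (pderiv p) 0"
proof -
  let ?x = "\<lambda>s. of_nat s :: complex"
  \<comment> \<open>The Lagrange basis for the nodes 0, ..., D. The weights of the functional are
    the derivatives of these polynomials at 0.\<close>
  define L where "L s = (\<Prod>r\<in>{..D} - {s}. Polynomial.smult (1 / (?x s - ?x r)) [:- ?x r, 1:])" for s
  have L: "poly (L s) (?x r) = (if r = s then 1 else 0)" if "r \<le> D" "s \<le> D" for r s
  proof (cases "r = s")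
    case True
    have "poly (Polynomial.smult (1 / (?x s - ?x r)) [:- ?x r, 1:]) (?x s) = 1" if "r \<in> {..D} - {s}" for r
      using that by (simp add: diff_divide_distrib[symmetric])
    then show ?thesis unfolding L_def poly_prod using True by (auto intro: prod.neutral)
  next
    case False
    then have "poly (Polynomial.smult (1 / (?x s - ?x r)) [:- ?x r, 1:]) (?x r) = 0" "r \<in> {..D} - {s}"
      using that by auto
    then show ?thesis unfolding L_def poly_prod using False by (simp add: prod_zero_iff)
  qed
  have deg: "degree (L s) \<le> D" if "s \<le> D" for s
  proof -
    have "degree (L s) \<le> (\<Sum>r\<in>{..D} - {s}. 1)"
      unfolding L_def by (rule order_trans[OF degree_prod_sum_le]) (auto intro!: sum_mono)
    also have "\<dots> = D" using that by simp
    finally show ?thesis .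
  qed
  have interp: "p = (\<Sum>s\<le>D. Polynomial.smult (poly p (?x s)) (L s))" if "degree p \<le> D" for p
  proof (rule poly_eqI_degree[of "?x ` {..D}"])
    fix x assume "x \<in> ?x ` {..D}"
    then obtain r where r: "x = ?x r" "r \<le> D" by auto
    have "poly (\<Sum>s\<le>D. Polynomial.smult (poly p (?x s)) (L s)) x = (\<Sum>s\<le>D. if s = r then poly p (?x s) else 0)"
      unfolding poly_sum by (intro sum.cong refl) (auto simp: r L)
    then show "poly p x = poly (\<Sum>s\<le>D. Polynomial.smult (poly p (?x s)) (L s)) x" using r by simp
  next
    have c: "card (?x ` {..D}) = Suc D" by (subst card_image) (auto simp: inj_on_def)
    show "degree p < card (?x ` {..D})" using that c by simp
    have "degree (\<Sum>s\<le>D. Polynomial.smult (poly p (?x s)) (L s)) \<le> D"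
      by (intro degree_sum_le) (auto intro: order_trans[OF degree_smult_le] deg)
    then show "degree (\<Sum>s\<le>D. Polynomial.smult (poly p (?x s)) (L s)) < card (?x ` {..D})" using c by simp
  qed
  show ?thesis
  proof (rule that)
    fix p :: "complex poly" assume p: "degree p \<le> D"
    have "poly (pderiv p) 0 = poly (pderiv (\<Sum>s\<le>D. Polynomial.smult (poly p (?x s)) (L s))) 0"
      using interp[OF p] by simp
    also have "\<dots> = (\<Sum>s\<le>D. poly p (?x s) * poly (pderiv (L s)) 0)"
      by (simp add: pderiv_sum_poly pderiv_smult poly_sum)
    finally show "(\<Sum>s\<le>D. poly (pderiv (L s)) 0 * poly p (?x s)) = poly (pderiv p) 0"
      by (simp add: mult.commute)
  qed
qed

text \<open>The rotation with cosine \<open>(1 - s\<^sup>2) / (1 + s\<^sup>2)\<close> and sine \<open>2 s / (1 + s\<^sup>2)\<close>.\<close>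

definition rot_poly :: "nat \<Rightarrow> nat \<Rightarrow> nat \<Rightarrow> nat \<Rightarrow> complex poly" where
  "rot_poly a b x y = (if x = y then if x = a \<or> x = b then [:1, 0, -1:] else [:1, 0, 1:]
     else if x = b \<and> y = a then [:0, 2:] else if x = a \<and> y = b then [:0, -2:] else 0)"

definition rotation :: "nat \<Rightarrow> nat \<Rightarrow> nat \<Rightarrow> complex \<Rightarrow> complex mat" where
  "rotation N a b s = mat N N (\<lambda>(x, y). poly (rot_poly a b x y) s / (1 + s ^ 2))"

lemma rotation_orthogonal:
  assumes ab: "a < N" "b < N" "a \<noteq> b" and s: "1 + s ^ 2 \<noteq> 0"
  shows "rotation N a b s \<in> orthogonal_group N"
proof -
  let ?g = "rotation N a b s"
  define e where "e x y = poly (rot_poly a b x y) s" for x y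
  have gc: "?g \<in> carrier_mat N N" by (simp add: rotation_def)
  have "(\<Sum>y<N. e x y * e z y) = (if x = z then (1 + s ^ 2) ^ 2 else 0)" if xz: "x < N" "z < N" for x z
  proof (cases "x = a \<or> x = b")
    case True
    have "(\<Sum>y<N. e x y * e z y) = (\<Sum>y\<in>{a, b}. e x y * e z y)"
      by (rule sum.mono_neutral_right) (use ab True in \<open>auto simp: e_def rot_poly_def\<close>)
    also have "\<dots> = e x a * e z a + e x b * e z b" using ab(3) by simp
    also have "\<dots> = (if x = z then (1 + s ^ 2) ^ 2 else 0)"
      using True ab(3) by (auto simp: e_def rot_poly_def power2_eq_square algebra_simps)
    finally show ?thesis .
  next
    case False
    have "(\<Sum>y<N. e x y * e z y) = (\<Sum>y\<in>{x}. e x y * e z y)"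
      by (rule sum.mono_neutral_right) (use xz False in \<open>auto simp: e_def rot_poly_def\<close>)
    also have "\<dots> = (if x = z then (1 + s ^ 2) ^ 2 else 0)"
      using False by (auto simp: e_def rot_poly_def power2_eq_square algebra_simps)
    finally show ?thesis .
  qed
  then have "(\<Sum>y<N. e x y / (1 + s ^ 2) * (e z y / (1 + s ^ 2))) = (if x = z then 1 else 0)"
    if "x < N" "z < N" for x z
    using that s by (simp add: power2_eq_square flip: sum_divide_distrib)
  then have "?g * transpose_mat ?g = 1\<^sub>m N"
    by (intro eq_matI) (simp_all add: rotation_def scalar_prod_def e_def atLeast0LessThan)
  then show ?thesis using gc by (simp add: orthogonal_group_def)
qed

lemma degree_rot_poly: "degree (rot_poly a b x y) \<le> 2"
  by (simp add: rot_poly_def)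

text \<open>The nodes are natural numbers and so avoid the two poles of the rational
  rotation.\<close>

lemma one_plus_square_neq_0: "1 + (of_nat s :: complex) ^ 2 \<noteq> 0"
proof -
  have "1 + (of_nat s :: complex) ^ 2 = of_nat (1 + s ^ 2)" by simp
  then show ?thesis by (metis of_nat_eq_0_iff add_is_0 one_neq_zero)
qed

context orth_ops
begin

lemma G_app:
  assumes j: "j \<in> multi_indices n N" and ab: "a < N" "b < N"
  shows "app (op.G (Suc n) a b) t j =
    (\<Sum>m=1..n. (if j m = b then t (j(m := a)) else 0) - (if j m = a then t (j(m := b)) else 0))"
proof -
  have "{1..<Suc n} = {1..n}" by auto
  then have "app (op.G (Suc n) a b) t j = (\<Sum>m=1..n. app (unit_op N m b a - unit_op N m a b) t j)"
    unfolding op.G_def app_sum by simp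
  also have "\<dots> = (\<Sum>m=1..n. (if j m = b then t (j(m := a)) else 0) - (if j m = a then t (j(m := b)) else 0))"
    by (intro sum.cong refl) (use multi_indices_less[OF j] ab in \<open>simp add: app_simps unit_op.rep_eq\<close>)
  finally show ?thesis .
qed

text \<open>The factor (1 + s^2)^M clears the denominators of all n matrix entries and, with
  derivative 0 and value 1 at s = 0, does not affect the derivative there. The sine has derivative
  2, hence the factor 2. M is independent of n so that the same weights serve for two tensor
  degrees.\<close>

lemma rotation_derivative:
  assumes ab: "a < N" "b < N" "a \<noteq> b" and n: "n \<le> M"
    and c: "\<And>p. degree p \<le> 2 * M \<Longrightarrow> (\<Sum>s\<le>2 * M. c s * poly p (of_nat s)) = poly (pderiv p) (0 :: complex)"
    and t: "t \<in> tensors n N"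
  shows "(\<lambda>j. \<Sum>s\<le>2 * M. c s * (1 + of_nat s ^ 2) ^ M * group_act n N (rotation N a b (of_nat s)) t j)
    = (\<lambda>j. 2 * app (op.G (Suc n) a b) t j)"
proof
  fix j
  let ?I = "multi_indices n N" and ?D = "2 * M"
  show "(\<Sum>s\<le>?D. c s * (1 + of_nat s ^ 2) ^ M * group_act n N (rotation N a b (of_nat s)) t j) = 2 * app (op.G (Suc n) a b) t j"
  proof (cases "j \<in> ?I")
    case j: True
    define q where "q i = (\<Prod>m=1..n. rot_poly a b (j m) (i m))" for i
    define Q where "Q i = [:1, 0, 1:] ^ (M - n) * q i" for i
    have poly_Q: "poly (Q i) s = (1 + s ^ 2) ^ M * (\<Prod>m=1..n. rotation N a b s $$ (j m, i m))"
      if i: "i \<in> ?I" and s: "1 + s ^ 2 \<noteq> 0" for i s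
    proof -
      have "(\<Prod>m=1..n. rotation N a b s $$ (j m, i m)) = (\<Prod>m=1..n. poly (rot_poly a b (j m) (i m)) s / (1 + s ^ 2))"
        by (intro prod.cong refl) (use multi_indices_less[OF i] multi_indices_less[OF j] in \<open>simp add: rotation_def\<close>)
      also have "\<dots> = poly (q i) s / (1 + s ^ 2) ^ n"
        by (simp add: q_def poly_prod prod_dividef)
      finally have "(1 + s ^ 2) ^ M * (\<Prod>m=1..n. rotation N a b s $$ (j m, i m)) = (1 + s ^ 2) ^ (M - n) * poly (q i) s"
        using s n by (simp add: power_diff)
      then show ?thesis by (simp add: Q_def poly_power power2_eq_square)
    qed
    have deg: "degree (Q i) \<le> ?D" for i
    proof -
      have "degree (q i) \<le> sum (degree \<circ> (\<lambda>m. rot_poly a b (j m) (i m))) {1..n}"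
        unfolding q_def by (rule degree_prod_sum_le) simp
      also have "\<dots> \<le> (\<Sum>m=1..n. 2)"
        by (rule sum_mono) (simp add: degree_rot_poly)
      finally have "degree (q i) \<le> (\<Sum>m=1..n. 2)" .
      moreover have "degree ([:1, 0, 1 :: complex:] ^ (M - n)) \<le> 2 * (M - n)"
        by (rule order_trans[OF degree_power_le]) simp
      ultimately show ?thesis unfolding Q_def using n degree_mult_le[of "[:1, 0, 1:] ^ (M - n)" "q i"] by simp
    qed
    define d :: "nat \<Rightarrow> nat \<Rightarrow> complex" where
      "d x y = (if x = b \<and> y = a then 2 else if x = a \<and> y = b then -2 else 0)" for x y
    have r0: "poly (rot_poly a b x y) 0 = (if x = y then 1 else 0)" for x y
      by (simp add: rot_poly_def)
    have r1: "poly (pderiv (rot_poly a b x y)) 0 = d x y" for x y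
      using ab(3) by (auto simp: rot_poly_def d_def pderiv_pCons)
    have dQ: "poly (pderiv (Q i)) 0 = (\<Sum>m=1..n. (\<Prod>m'\<in>{1..n} - {m}. if j m' = i m' then 1 else 0) * d (j m) (i m))" for i
    proof -
      have "poly (pderiv ([:1, 0, 1 :: complex:] ^ (M - n))) 0 = 0"
        by (cases "M - n") (simp_all add: pderiv_power_Suc pderiv_pCons del: power_Suc)
      then have "poly (pderiv (Q i)) 0 = poly (pderiv (q i)) 0"
        by (simp add: Q_def pderiv_mult poly_power)
      also have "\<dots> = (\<Sum>m=1..n. (\<Prod>m'\<in>{1..n} - {m}. if j m' = i m' then 1 else 0) * d (j m) (i m))"
        unfolding q_def by (simp add: pderiv_prod poly_sum poly_prod r0 r1)
      finally show ?thesis .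
    qed
    have "(\<Sum>s\<le>?D. c s * (1 + of_nat s ^ 2) ^ M * group_act n N (rotation N a b (of_nat s)) t j)
      = (\<Sum>s\<le>?D. \<Sum>i\<in>?I. t i * (c s * poly (Q i) (of_nat s)))"
      using j by (intro sum.cong refl)
        (simp add: group_act_def sum_distrib_left poly_Q[OF _ one_plus_square_neq_0] mult_ac)
    also have "\<dots> = (\<Sum>i\<in>?I. t i * (\<Sum>s\<le>?D. c s * poly (Q i) (of_nat s)))"
      by (subst sum.swap) (simp add: sum_distrib_left)
    also have "\<dots> = (\<Sum>i\<in>?I. \<Sum>m=1..n. t i * ((\<Prod>m'\<in>{1..n} - {m}. if j m' = i m' then 1 else 0) * d (j m) (i m)))"
      by (simp add: c deg dQ sum_distrib_left)
    also have "\<dots> = (\<Sum>m=1..n. \<Sum>i\<in>?I. t i * ((\<Prod>m'\<in>{1..n} - {m}. if j m' = i m' then 1 else 0) * d (j m) (i m)))"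
      by (rule sum.swap)
    also have "\<dots> = (\<Sum>m=1..n. 2 * ((if j m = b then t (j(m := a)) else 0) - (if j m = a then t (j(m := b)) else 0)))"
    proof (intro sum.cong refl)
      fix m assume m: "m \<in> {1..n}"
      \<comment> \<open>In the term where factor m is differentiated, the other factors are
        evaluated at s = 0, where the rotation is the identity; so i can differ from j only at
        m.\<close>
      let ?A = "(\<lambda>x. j(m := x)) ` {..<N}"
      have inj: "inj_on (\<lambda>x. j(m := x)) {..<N}" by (rule inj_onI) (metis fun_upd_same)
      have sub: "?A \<subseteq> ?I" using j m by (auto intro: multi_indices_upd)
      have prod: "(\<Prod>m'\<in>{1..n} - {m}. if j m' = i m' then 1 else 0) = (if i \<in> ?A then 1 else 0 :: complex)" if i: "i \<in> ?I" for i
      proof (cases "i \<in> ?A")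
        case True
        then show ?thesis by auto
      next
        case False
        have "\<exists>m'\<in>{1..n} - {m}. j m' \<noteq> i m'"
        proof (rule ccontr)
          assume no: "\<not> ?thesis"
          have "i = j(m := i m)"
          proof
            fix m' show "i m' = (j(m := i m)) m'"
            proof (cases "m' \<in> {1..n}")
              case True then show ?thesis using no by auto
            next
              case False then show ?thesis using i j m unfolding multi_indices_iff by (metis fun_upd_other)
            qed
          qed
          then show False using False multi_indices_less[OF i m] by blast
        qed
        then have "(\<Prod>m'\<in>{1..n} - {m}. if j m' = i m' then 1 else (0 :: complex)) = 0"
          by (auto simp: prod_zero_iff)
        then show ?thesis using False by simp
      qed
      have "(\<Sum>i\<in>?I. t i * ((\<Prod>m'\<in>{1..n} - {m}. if j m' = i m' then 1 else 0) * d (j m) (i m)))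
        = (\<Sum>i\<in>?A. t i * d (j m) (i m))"
        by (rule sum.mono_neutral_cong_right) (use sub prod in auto)
      also have "\<dots> = (\<Sum>x<N. t (j(m := x)) * d (j m) x)"
        unfolding sum.reindex[OF inj] by simp
      also have "\<dots> = (\<Sum>x<N. (if x = a then if j m = b then 2 * t (j(m := x)) else 0 else 0)
         - (if x = b then if j m = a then 2 * t (j(m := x)) else 0 else 0))"
        using ab(3) by (intro sum.cong refl) (auto simp: d_def)
      also have "\<dots> = 2 * ((if j m = b then t (j(m := a)) else 0) - (if j m = a then t (j(m := b)) else 0))"
        using ab by (simp add: sum_subtractf)
      finally show "(\<Sum>i\<in>?I. t i * ((\<Prod>m'\<in>{1..n} - {m}. if j m' = i m' then 1 else 0) * d (j m) (i m)))
        = 2 * ((if j m = b then t (j(m := a)) else 0) - (if j m = a then t (j(m := b)) else 0))" .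
    qed
    also have "\<dots> = 2 * app (op.G (Suc n) a b) t j"
      unfolding G_app[OF j ab(1,2)] by (simp add: sum_distrib_left)
    finally show ?thesis .
  next
    case False
    then show ?thesis
      using tensors_outside[OF G_tensors[OF t ab(1,2)] False] by (simp add: group_act_def)
  qed
qed

section \<open>Intertwiners and the Lie algebra\<close>

lemma weyl_module_zero: "(\<lambda>v i. 0) \<in> weyl_module \<mu> N"
proof (rule weyl_moduleI)
  show "(\<lambda>i. 0) \<in> traceless (card \<mu>) N"
    by (simp add: traceless_iff tensors_def)
qed simp_all

lemma weyl_module_sum:
  "(\<And>s. s \<in> S \<Longrightarrow> \<phi> s \<in> weyl_module \<mu> N) \<Longrightarrow> (\<lambda>v i. \<Sum>s\<in>S. c s * \<phi> s v i) \<in> weyl_module \<mu> N"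
proof (induction S rule: infinite_finite_induct)
  case (insert x S)
  then show ?case using weyl_module_linear[of "\<phi> x" \<mu> N "\<lambda>v i. \<Sum>s\<in>S. c s * \<phi> s v i" "c x" 1] by simp
qed (simp_all add: weyl_module_zero)

lemma brauer_moduleD:
  assumes "f \<in> brauer_module \<mu> n N"
  shows "\<phi> \<in> weyl_module \<mu> N \<Longrightarrow> f \<phi> \<in> tensors n N"
    and "\<phi> \<notin> weyl_module \<mu> N \<Longrightarrow> f \<phi> = (\<lambda>_. 0)"
    and "\<phi> \<in> weyl_module \<mu> N \<Longrightarrow> \<psi> \<in> weyl_module \<mu> N \<Longrightarrow>
      f (\<lambda>v i. a * \<phi> v i + b * \<psi> v i) = (\<lambda>i. a * f \<phi> i + b * f \<psi> i)"
    and "\<phi> \<in> weyl_module \<mu> N \<Longrightarrow> g \<in> orthogonal_group N \<Longrightarrow>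
      f (\<lambda>v. group_act (card \<mu>) N g (\<phi> v)) = group_act n N g (f \<phi>)"
  using assms unfolding brauer_module_def mem_Collect_eq by blast+

lemma brauer_module_sum:
  assumes f: "f \<in> brauer_module \<mu> n N"
  shows "(\<And>s. s \<in> S \<Longrightarrow> \<phi> s \<in> weyl_module \<mu> N) \<Longrightarrow>
    f (\<lambda>v i. \<Sum>s\<in>S. c s * \<phi> s v i) = (\<lambda>i. \<Sum>s\<in>S. c s * f (\<phi> s) i)"
proof (induction S rule: infinite_finite_induct)
  case (insert x S)
  then show ?case
    using brauer_moduleD(3)[OF f, of "\<phi> x" "\<lambda>v i. \<Sum>s\<in>S. c s * \<phi> s v i" "c x" 1] weyl_module_sum[of S \<phi> \<mu> c]
    by simp
qed (use brauer_moduleD(3)[OF f weyl_module_zero weyl_module_zero, of 0 0] in simp_all)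

text \<open>f is only known to commute with the group. The generator is one and the same linear
  combination of rotations in degree \<open>card \<mu>\<close> and in degree n, so linearity of f
  carries it over.\<close>

lemma G_intertwine:
  assumes f: "f \<in> brauer_module \<mu> n N" and \<phi>: "\<phi> \<in> weyl_module \<mu> N" and mn: "card \<mu> \<le> n"
    and ab: "a < N" "b < N"
  shows "(\<lambda>v. app (op.G (Suc (card \<mu>)) a b) (\<phi> v)) \<in> weyl_module \<mu> N"
    and "f (\<lambda>v. app (op.G (Suc (card \<mu>)) a b) (\<phi> v)) = app (op.G (Suc n) a b) (f \<phi>)"
proof -
  let ?m = "card \<mu>"
  have "(\<lambda>v. app (op.G (Suc ?m) a b) (\<phi> v)) \<in> weyl_module \<mu> N \<and>
    f (\<lambda>v. app (op.G (Suc ?m) a b) (\<phi> v)) = app (op.G (Suc n) a b) (f \<phi>)"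
  proof (cases "a = b")
    case True
    then have "op.G k a b = 0" for k by (simp add: op.G_def)
    then show ?thesis
      using brauer_module_sum[OF f, of "{}" "\<lambda>_. \<phi>"] by (simp add: app_simps weyl_module_zero)
  next
    case ne: False
    obtain c where c: "\<And>p. degree p \<le> 2 * n \<Longrightarrow> (\<Sum>s\<le>2 * n. c s * poly p (of_nat s)) = poly (pderiv p) (0 :: complex)"
      using derivative_functional[of "2 * n"] by blast
    \<comment> \<open>Weights taken for the larger degree n, which are valid in degree
      \<open>card \<mu>\<close> as well.\<close>
    define C where "C s = c s * (1 + of_nat s ^ 2) ^ n / 2" for s
    let ?g = "\<lambda>s. rotation N a b (of_nat s)"
    have g: "?g s \<in> orthogonal_group N" for s
      by (rule rotation_orthogonal[OF ab ne one_plus_square_neq_0])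
    have \<phi>T: "\<phi> v \<in> tensors ?m N" for v
    proof (cases "v \<in> specht \<mu>")
      case True
      then show ?thesis by (rule traceless_tensors[OF weyl_moduleD(1)[OF \<phi>]])
    next
      case False
      then show ?thesis using weyl_moduleD(2)[OF \<phi>] by (simp add: tensors_def)
    qed
    have comb: "app (op.G (Suc p) a b) t = (\<lambda>j. \<Sum>s\<le>2 * n. C s * group_act p N (?g s) t j)"
      if "t \<in> tensors p N" "p \<le> n" for p t
    proof
      fix j
      have "2 * app (op.G (Suc p) a b) t j = (\<Sum>s\<le>2 * n. c s * (1 + of_nat s ^ 2) ^ n * group_act p N (?g s) t j)"
        using rotation_derivative[OF ab ne that(2) c that(1)] by metis
      also have "\<dots> = 2 * (\<Sum>s\<le>2 * n. C s * group_act p N (?g s) t j)"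
        unfolding C_def sum_distrib_left by (intro sum.cong refl) simp
      finally show "app (op.G (Suc p) a b) t j = (\<Sum>s\<le>2 * n. C s * group_act p N (?g s) t j)" by simp
    qed
    have eq: "(\<lambda>v. app (op.G (Suc ?m) a b) (\<phi> v)) = (\<lambda>v i. \<Sum>s\<le>2 * n. C s * group_act ?m N (?g s) (\<phi> v) i)"
      by (rule ext) (rule comb[OF \<phi>T mn])
    have "f (\<lambda>v. app (op.G (Suc ?m) a b) (\<phi> v)) = (\<lambda>i. \<Sum>s\<le>2 * n. C s * group_act n N (?g s) (f \<phi>) i)"
      unfolding eq using brauer_module_sum[OF f, of "{..2 * n}" "\<lambda>s v. group_act ?m N (?g s) (\<phi> v)" C]
        weyl_module_group[OF \<phi> g] brauer_moduleD(4)[OF f \<phi> g] by simp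
    moreover have "\<dots> = app (op.G (Suc n) a b) (f \<phi>)"
      using comb[OF brauer_moduleD(1)[OF f \<phi>] order_refl] by simp
    moreover have "(\<lambda>v. app (op.G (Suc ?m) a b) (\<phi> v)) \<in> weyl_module \<mu> N"
      unfolding eq by (rule weyl_module_sum) (rule weyl_module_group[OF \<phi> g])
    ultimately show ?thesis by simp
  qed
  then show "(\<lambda>v. app (op.G (Suc ?m) a b) (\<phi> v)) \<in> weyl_module \<mu> N"
    "f (\<lambda>v. app (op.G (Suc ?m) a b) (\<phi> v)) = app (op.G (Suc n) a b) (f \<phi>)" by auto
qed

lemma Z_op_intertwine:
  assumes f: "f \<in> brauer_module \<mu> n N" and \<phi>: "\<phi> \<in> weyl_module \<mu> N" and mn: "card \<mu> \<le> n"
  shows "f (\<lambda>v. app (Z_op (Suc (card \<mu>)) i) (\<phi> v)) = app (Z_op (Suc n) i) (f \<phi>)"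
proof -
  define Q where "Q A B \<longleftrightarrow> (\<forall>\<phi>\<in>weyl_module \<mu> N. (\<lambda>v. app A (\<phi> v)) \<in> weyl_module \<mu> N \<and>
    f (\<lambda>v. app A (\<phi> v)) = app B (f \<phi>))" for A B
  have "Q (Z_op (Suc (card \<mu>)) i) (Z_op (Suc n) i)"
  proof (rule Z_op_rel)
    show "Q 0 0"
      using brauer_module_sum[OF f, of "{}"] by (simp add: Q_def app_simps weyl_module_zero)
    show "Q 1 1" by (simp add: Q_def app_simps)
    show "Q (c0_op N) (c0_op N)"
      unfolding Q_def
    proof (intro ballI conjI)
      fix \<phi> assume \<phi>: "\<phi> \<in> weyl_module \<mu> N"
      show "(\<lambda>v. app (c0_op N) (\<phi> v)) \<in> weyl_module \<mu> N"
        using weyl_module_linear[OF \<phi> \<phi>, of c0 0] by (simp add: c0_op_def app_simps)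
      show "f (\<lambda>v. app (c0_op N) (\<phi> v)) = app (c0_op N) (f \<phi>)"
        using brauer_moduleD(3)[OF f \<phi> \<phi>, of c0 0] by (simp add: c0_op_def app_simps)
    qed
    show "Q (A + B) (A' + B')" if "Q A A'" "Q B B'" for A A' B B'
      unfolding Q_def
    proof (intro ballI conjI)
      fix \<phi> assume \<phi>: "\<phi> \<in> weyl_module \<mu> N"
      have A: "(\<lambda>v. app A (\<phi> v)) \<in> weyl_module \<mu> N" "f (\<lambda>v. app A (\<phi> v)) = app A' (f \<phi>)"
        and B: "(\<lambda>v. app B (\<phi> v)) \<in> weyl_module \<mu> N" "f (\<lambda>v. app B (\<phi> v)) = app B' (f \<phi>)"
        using that \<phi> by (auto simp: Q_def)
      show "(\<lambda>v. app (A + B) (\<phi> v)) \<in> weyl_module \<mu> N"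
        using weyl_module_linear[OF A(1) B(1), of 1 1] by (simp add: app_simps)
      show "f (\<lambda>v. app (A + B) (\<phi> v)) = app (A' + B') (f \<phi>)"
        using brauer_moduleD(3)[OF f A(1) B(1), of 1 1] A(2) B(2) by (simp add: app_simps)
    qed
    show "Q (A * B) (A' * B')" if "Q A A'" "Q B B'" for A A' B B'
      using that by (auto simp: Q_def app_mult)
    show "Q (op.G (Suc (card \<mu>)) a b) (op.G (Suc n) a b)" if "a < N" "b < N" for a b
      using G_intertwine[OF f _ mn that] by (auto simp: Q_def)
  qed
  then show ?thesis using \<phi> by (auto simp: Q_def)
qed

end

section \<open>Jucys--Murphy elements and Specht modules\<close>

lift_definition perm_op :: "(nat \<Rightarrow> nat) \<Rightarrow> tensor_op" is "\<lambda>p t j. t (j \<circ> p)" by simp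

lift_definition lt_op :: "(nat \<Rightarrow> nat) \<Rightarrow> tensor_op" is "\<lambda>p v s. v (Hilbert_Choice.inv p \<circ> s)" by simp

lemma app_lt_op: "app (lt_op p) v = left_transl p v"
  by (simp add: lt_op.rep_eq left_transl_def fun_eq_iff)

section \<open>Symmetric functions of Jucys-Murphy elements are central\<close>

locale perm_rep =
  fixes \<pi> :: "(nat \<Rightarrow> nat) \<Rightarrow> 'a::ring_1"
  assumes hom: "bij p \<Longrightarrow> bij q \<Longrightarrow> \<pi> (p \<circ> q) = \<pi> p * \<pi> q" and hom_id: "\<pi> id = 1"
begin

definition jm :: "nat \<Rightarrow> 'a" where
  "jm k = (\<Sum>l=1..<k. \<pi> (Transposition.transpose l k))"

abbreviation "tp a b \<equiv> \<pi> (Transposition.transpose a b)"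

lemma tp_tp: "tp a b * tp a b = 1"
  by (simp add: hom[symmetric] hom_id)

lemma tp_conj:
  assumes "a \<noteq> b"
  shows "tp a b * tp c d = tp (Transposition.transpose a b c) (Transposition.transpose a b d) * tp a b"
proof -
  have "Transposition.transpose a b \<circ> Transposition.transpose c d =
    Transposition.transpose (Transposition.transpose a b c) (Transposition.transpose a b d) \<circ> Transposition.transpose a b"
    by (rule ext) (auto simp: Transposition.transpose_def)
  then show ?thesis by (simp add: hom[symmetric])
qed

lemma tp_jm_far:
  assumes "1 \<le> i" "k < i \<or> Suc i < k"
  shows "tp i (Suc i) * jm k = jm k * tp i (Suc i)"
proof -
  let ?\<tau> = "Transposition.transpose i (Suc i)"
  have k: "?\<tau> k = k" using assms by (auto simp: Transposition.transpose_def)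
  have "tp i (Suc i) * jm k = (\<Sum>l=1..<k. tp (?\<tau> l) k) * tp i (Suc i)"
    unfolding jm_def sum_distrib_left sum_distrib_right by (intro sum.cong refl) (simp add: tp_conj k)
  also have "(\<Sum>l=1..<k. tp (?\<tau> l) k) = jm k"
    unfolding jm_def
    by (rule sum.reindex_bij_witness[of _ ?\<tau> ?\<tau>]) (use assms in \<open>auto simp: Transposition.transpose_def\<close>)
  finally show ?thesis .
qed

lemma tp_jm:
  assumes "1 \<le> i"
  shows "tp i (Suc i) * jm i = jm (Suc i) * tp i (Suc i) - 1"
proof -
  let ?\<tau> = "Transposition.transpose i (Suc i)"
  have "tp i (Suc i) * jm i = (\<Sum>l=1..<i. tp l (Suc i)) * tp i (Suc i)"
    unfolding jm_def sum_distrib_left sum_distrib_right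
  proof (intro sum.cong refl)
    fix l assume l: "l \<in> {1..<i}"
    then have "?\<tau> l = l" "?\<tau> i = Suc i" by (auto simp: Transposition.transpose_def)
    then show "tp i (Suc i) * tp l i = tp l (Suc i) * tp i (Suc i)"
      using tp_conj[of i "Suc i" l i] by simp
  qed
  also have "(\<Sum>l=1..<i. tp l (Suc i)) = jm (Suc i) - tp i (Suc i)"
    using assms by (simp add: jm_def)
  finally show ?thesis by (simp add: left_diff_distrib tp_tp)
qed

lemma tp_jm':
  assumes "1 \<le> i"
  shows "tp i (Suc i) * jm (Suc i) = jm i * tp i (Suc i) + 1"
proof -
  let ?s = "tp i (Suc i)"
  have "?s * (?s * jm i) * ?s = ?s * (jm (Suc i) * ?s - 1) * ?s"
    unfolding tp_jm[OF assms] ..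
  then have "jm i * ?s = ?s * jm (Suc i) * (?s * ?s) - ?s * ?s"
    by (simp add: right_diff_distrib left_diff_distrib mult.assoc tp_tp) (simp add: mult.assoc[symmetric] tp_tp)
  then show ?thesis by (simp add: tp_tp)
qed

lemma tp_jm_lower:
  assumes "a \<in> {1..<k}" "b \<in> {1..<k}" "a \<noteq> b"
  shows "tp a b * jm k = jm k * tp a b"
proof -
  let ?\<tau> = "Transposition.transpose a b"
  have k: "?\<tau> k = k" using assms by (auto simp: Transposition.transpose_def)
  have "tp a b * jm k = (\<Sum>l=1..<k. tp (?\<tau> l) k) * tp a b"
    unfolding jm_def sum_distrib_left sum_distrib_right by (intro sum.cong refl) (simp add: tp_conj k assms(3))
  also have "(\<Sum>l=1..<k. tp (?\<tau> l) k) = jm k"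
    unfolding jm_def
    by (rule sum.reindex_bij_witness[of _ ?\<tau> ?\<tau>]) (use assms in \<open>auto simp: Transposition.transpose_def\<close>)
  finally show ?thesis .
qed

lemma jm_comm:
  assumes "j < k"
  shows "jm j * jm k = jm k * jm j"
proof -
  have "tp l j * jm k = jm k * tp l j" if "l \<in> {1..<j}" for l
    by (rule tp_jm_lower) (use assms that in auto)
  then show ?thesis
    unfolding jm_def[of j] sum_distrib_left sum_distrib_right by (intro sum.cong refl) auto
qed

lemma esym_commute:
  assumes "\<And>k. 1 \<le> k \<Longrightarrow> k \<le> m \<Longrightarrow> y * x k = x k * y"
  shows "y * esym x r m = esym x r m * (y :: 'a)"
  using assms
proof (induction x r m rule: esym.induct)
  case (3 x r m)
  have "y * (esym x r m * x (Suc m)) = esym x r m * x (Suc m) * y"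
  proof -
    have "y * (esym x r m * x (Suc m)) = (y * esym x r m) * x (Suc m)" by (simp add: mult.assoc)
    also have "\<dots> = esym x r m * (y * x (Suc m))" using 3 by (simp add: mult.assoc)
    finally show ?thesis using 3(3)[of "Suc m"] by (simp add: mult.assoc)
  qed
  then show ?case using 3 by (simp add: distrib_left distrib_right)
qed auto

text \<open>The elementary symmetric polynomials involve x_i and x_(i+1) only through their sum and
  product. These commute with s_i by \<open>tp_jm\<close> and \<open>tp_jm'\<close>, and the other
  x_k commute with s_i.\<close>

lemma esym_jm_adjacent:
  assumes "1 \<le> i" "Suc i \<le> m"
  shows "tp i (Suc i) * esym jm r m = esym jm r m * tp i (Suc i)"
  using assms(2)
proof (induction m arbitrary: r)
  case 0
  then show ?case by simp
next
  case (Suc m)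
  let ?s = "tp i (Suc i)"
  show ?case
  proof (cases "m = i")
    case False
    then have far: "?s * jm (Suc m) = jm (Suc m) * ?s" and c: "?s * esym jm r m = esym jm r m * ?s" for r
      using Suc assms(1) by (auto intro: tp_jm_far)
    show ?thesis
    proof (cases r)
      case (Suc r')
      have "?s * (esym jm r' m * jm (Suc m)) = esym jm r' m * (?s * jm (Suc m))"
        using c[of r'] by (simp add: mult.assoc[symmetric])
      then show ?thesis using Suc c far by (simp add: distrib_left distrib_right mult.assoc)
    qed simp
  next
    case True
    obtain m' where m': "m = Suc m'" using True assms(1) by (cases m) auto
    have c: "?s * esym jm r m' = esym jm r m' * ?s" for r
      by (rule esym_commute) (use True m' assms(1) in \<open>auto intro: tp_jm_far\<close>)
    have one: "?s * (jm i + jm (Suc i)) = (jm i + jm (Suc i)) * ?s"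
      using tp_jm[OF assms(1)] tp_jm'[OF assms(1)] by (simp add: distrib_left distrib_right)
    have two: "?s * (jm i * jm (Suc i)) = jm i * jm (Suc i) * ?s"
    proof -
      have "?s * (jm i * jm (Suc i)) = (jm (Suc i) * ?s - 1) * jm (Suc i)"
        using tp_jm[OF assms(1)] by (simp add: mult.assoc[symmetric])
      also have "\<dots> = jm (Suc i) * (jm i * ?s + 1) - jm (Suc i)"
        using tp_jm'[OF assms(1)] by (simp add: left_diff_distrib mult.assoc)
      finally show ?thesis using jm_comm[of i "Suc i"] by (simp add: distrib_left mult.assoc[symmetric])
    qed
    have p: "?s * (A * B) = A * B * ?s" if "?s * A = A * ?s" "?s * B = B * ?s" for A B
      using that by (rule commute_mult_right)
    consider "r = 0" | "r = 1" | r' where "r = Suc (Suc r')" by (metis One_nat_def not0_implies_Suc)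
    then show ?thesis
    proof cases
      case 1
      then show ?thesis by simp
    next
      case 2
      then have "esym jm r (Suc m) = esym jm 1 m' + (jm i + jm (Suc i))"
        using m' True by (simp add: add.assoc)
      then show ?thesis using c[of 1] one by (simp only: distrib_left distrib_right)
    next
      case 3
      have "esym jm r (Suc m) = esym jm r m' + esym jm (Suc r') m' * (jm i + jm (Suc i)) + esym jm r' m' * (jm i * jm (Suc i))"
        using m' True 3 by (simp add: distrib_left distrib_right mult.assoc add.assoc)
      then show ?thesis
        using c[of r] p[OF c[of "Suc r'"] one] p[OF c[of r'] two] by (simp only: distrib_left distrib_right)
    qed
  qed
qed

lemma \<pi>_inv_tp: "bij p \<Longrightarrow> \<pi> p * y = y * \<pi> p \<Longrightarrow> tp a b * y = y * tp a b \<Longrightarrow>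
    \<pi> (Transposition.transpose a b \<circ> p) * y = y * \<pi> (Transposition.transpose a b \<circ> p)"
  by (simp add: hom commute_mult_left)

text \<open>By induction on b: (a, b + 1) is obtained from (a, b) by conjugation with (b, b +
  1).\<close>

lemma esym_jm_transposition:
  assumes "1 \<le> a" "a < b" "b \<le> m"
  shows "tp a b * esym jm r m = esym jm r m * tp a b"
  using assms(2,3)
proof (induction b)
  case (Suc b)
  let ?y = "esym jm r m"
  show ?case
  proof (cases "a = b")
    case True
    then show ?thesis using esym_jm_adjacent[OF assms(1), of m r] Suc by simp
  next
    case False
    then have ab: "a < b" and IH: "tp a b * ?y = ?y * tp a b" using Suc by auto
    have adj: "tp b (Suc b) * ?y = ?y * tp b (Suc b)"
      by (rule esym_jm_adjacent) (use ab assms(1) Suc in auto)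
    have "tp b (Suc b) * tp a b = tp a (Suc b) * tp b (Suc b)"
      using tp_conj[of b "Suc b" a b] ab by (simp add: Transposition.transpose_def)
    then have "tp a (Suc b) = tp b (Suc b) * tp a b * tp b (Suc b)"
      by (simp add: mult.assoc tp_tp)
    then show ?thesis using commute_mult_left[OF commute_mult_left[OF adj IH] adj] by (simp only:)
  qed
qed simp

lemma esym_jm_central:
  assumes "p permutes {1..m}"
  shows "\<pi> p * esym jm r m = esym jm r m * \<pi> p"
  using assms finite_atLeastAtMost[of 1 m]
proof (induction p rule: permutes_induct)
  case id
  show ?case unfolding hom_id by simp
next
  case (swap a b p)
  have "tp a b * esym jm r m = esym jm r m * tp a b"
    using esym_jm_transposition[of a b m r] esym_jm_transposition[of b a m r] swap
    by (cases a b rule: linorder_cases) (auto simp: transpose_commute)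
  moreover have "bij p" using swap permutes_bij by blast
  ultimately show ?case using swap by (intro \<pi>_inv_tp) auto
qed

end

interpretation pr: perm_rep perm_op
  by unfold_locales (rule op_eqI, simp add: app_simps perm_op.rep_eq comp_assoc)+

interpretation lr: perm_rep lt_op
  by unfold_locales (rule op_eqI, simp add: app_simps lt_op.rep_eq comp_assoc o_inv_distrib)+

text \<open>The group algebra element v applied to w by place permutations. It transports identities
  in the group algebra to tensors, where they can be evaluated at an index.\<close>

definition gact :: "nat \<Rightarrow> gvec \<Rightarrow> tensor \<Rightarrow> tensor" where
  "gact m v w = (\<lambda>j. \<Sum>s | s permutes {1..m}. v s * w (j \<circ> s))"

lemma gact_linear: "gact m (\<lambda>s. a * v s + b * u s) w = (\<lambda>j. a * gact m v w j + b * gact m u w j)"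
  by (rule ext) (simp add: gact_def sum_distrib_left sum.distrib algebra_simps)

lemma gact_left_transl:
  assumes p: "p permutes {1..m}"
  shows "gact m (left_transl p v) w = (\<lambda>j. gact m v w (j \<circ> p))"
proof
  fix j
  have "(\<Sum>s | s permutes {1..m}. v (Hilbert_Choice.inv p \<circ> s) * w (j \<circ> s))
    = (\<Sum>s | s permutes {1..m}. v s * w (j \<circ> p \<circ> s))"
  proof (rule sum.reindex_bij_witness[of _ "\<lambda>s. p \<circ> s" "\<lambda>s. Hilbert_Choice.inv p \<circ> s"])
    fix s assume s: "s \<in> {s. s permutes {1..m}}"
    show "p \<circ> (Hilbert_Choice.inv p \<circ> s) = s" "Hilbert_Choice.inv p \<circ> (p \<circ> s) = s"
      using permutes_inv_o[OF p] by (simp_all add: comp_assoc[symmetric])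
    show "Hilbert_Choice.inv p \<circ> s \<in> {s. s permutes {1..m}}" "p \<circ> s \<in> {s. s permutes {1..m}}"
      using s p by (auto intro: permutes_compose permutes_inv)
    have "j \<circ> p \<circ> (Hilbert_Choice.inv p \<circ> s) = j \<circ> (p \<circ> Hilbert_Choice.inv p) \<circ> s"
      by (simp only: comp_assoc)
    then show "v (Hilbert_Choice.inv p \<circ> s) * w (j \<circ> p \<circ> (Hilbert_Choice.inv p \<circ> s)) = v (Hilbert_Choice.inv p \<circ> s) * w (j \<circ> s)"
      using permutes_inv_o(1)[OF p] by simp
  qed
  then show "gact m (left_transl p v) w j = gact m v w (j \<circ> p)"
    by (simp add: gact_def left_transl_def)
qed

text \<open>A linear map which intertwines the permutations also intertwines the symmetric functions of the
  Jucys-Murphy elements.\<close>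

lemma esym_intertwine:
  assumes K: "\<And>v p. v \<in> K \<Longrightarrow> p permutes {1..m} \<Longrightarrow> left_transl p v \<in> K"
    and K0: "(\<lambda>_. 0) \<in> K" and Kadd: "\<And>v u. v \<in> K \<Longrightarrow> u \<in> K \<Longrightarrow> (\<lambda>s. v s + u s) \<in> K"
    and \<phi>0: "\<phi> (\<lambda>_. 0) = (\<lambda>_. 0)"
    and \<phi>add: "\<And>v u. v \<in> K \<Longrightarrow> u \<in> K \<Longrightarrow> \<phi> (\<lambda>s. v s + u s) = (\<lambda>j. \<phi> v j + \<phi> u j)"
    and \<phi>: "\<And>v p. v \<in> K \<Longrightarrow> p permutes {1..m} \<Longrightarrow> \<phi> (left_transl p v) = (\<lambda>j. \<phi> v (j \<circ> p))"
    and "k \<le> m" "v \<in> K"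
  shows "app (esym lr.jm r k) v \<in> K \<and> \<phi> (app (esym lr.jm r k) v) = app (esym pr.jm r k) (\<phi> v)"
  using assms(7,8)
proof (induction k arbitrary: r v)
  case 0
  then show ?case using K0 \<phi>0 by (cases r) (simp_all add: app_simps)
next
  case (Suc k)
  show ?case
  proof (cases r)
    case 0
    then show ?thesis using Suc by (simp add: app_simps)
  next
    case r: (Suc r')
    have J: "app (\<Sum>l\<in>L. lt_op (Transposition.transpose l (Suc k))) v \<in> K \<and>
      \<phi> (app (\<Sum>l\<in>L. lt_op (Transposition.transpose l (Suc k))) v) = app (\<Sum>l\<in>L. perm_op (Transposition.transpose l (Suc k))) (\<phi> v)"
      if "L \<subseteq> {1..<Suc k}" for L
    proof -
      have "finite L" using that by (rule finite_subset) simp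
      then show ?thesis using that
      proof (induction L)
        case empty
        then show ?case using K0 \<phi>0 by (simp add: app_simps)
      next
        case (insert l L)
        have p: "Transposition.transpose l (Suc k) permutes {1..m}"
          by (rule permutes_swap_id) (use insert.prems Suc.prems in auto)
        have 1: "app (lt_op (Transposition.transpose l (Suc k))) v \<in> K"
          unfolding app_lt_op by (rule K[OF Suc.prems(2) p])
        have 2: "\<phi> (app (lt_op (Transposition.transpose l (Suc k))) v) = app (perm_op (Transposition.transpose l (Suc k))) (\<phi> v)"
          unfolding app_lt_op \<phi>[OF Suc.prems(2) p] perm_op.rep_eq ..
        have 3: "app (\<Sum>l\<in>L. lt_op (Transposition.transpose l (Suc k))) v \<in> K"
          "\<phi> (app (\<Sum>l\<in>L. lt_op (Transposition.transpose l (Suc k))) v) = app (\<Sum>l\<in>L. perm_op (Transposition.transpose l (Suc k))) (\<phi> v)"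
          using insert.IH insert.prems by auto
        show ?case
          using Kadd[OF 1 3(1)] \<phi>add[OF 1 3(1)] 2 3(2) insert.hyps
          by (simp add: plus_tensor_op.rep_eq)
      qed
    qed
    have J1: "app (lr.jm (Suc k)) v \<in> K" "\<phi> (app (lr.jm (Suc k)) v) = app (pr.jm (Suc k)) (\<phi> v)"
      using J[of "{1..<Suc k}"] by (simp_all only: lr.jm_def pr.jm_def order_refl)
    have A: "app (esym lr.jm (Suc r') k) v \<in> K" "\<phi> (app (esym lr.jm (Suc r') k) v) = app (esym pr.jm (Suc r') k) (\<phi> v)"
      using Suc.IH[of v "Suc r'"] Suc.prems by auto
    have B: "app (esym lr.jm r' k) (app (lr.jm (Suc k)) v) \<in> K"
      "\<phi> (app (esym lr.jm r' k) (app (lr.jm (Suc k)) v)) = app (esym pr.jm r' k) (\<phi> (app (lr.jm (Suc k)) v))"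
      using Suc.IH[OF _ J1(1), of r'] Suc.prems by auto
    show ?thesis
      using Kadd[OF A(1) B(1)] \<phi>add[OF A(1) B(1)] A(2) B(2) J1(2)
      by (simp add: r plus_tensor_op.rep_eq times_tensor_op.rep_eq)
  qed
qed

section \<open>The row-reading tableau\<close>

definition lex_less :: "nat \<times> nat \<Rightarrow> nat \<times> nat \<Rightarrow> bool" where
  "lex_less x y \<longleftrightarrow> fst x < fst y \<or> fst x = fst y \<and> snd x < snd y"

lemma lex_less_linear: "lex_less x y \<or> x = y \<or> lex_less y x"
  by (auto simp: lex_less_def prod_eq_iff)

lemma lex_less_trans: "lex_less x y \<Longrightarrow> lex_less y z \<Longrightarrow> lex_less x z"
  by (auto simp: lex_less_def)

lemma lex_less_irrefl: "\<not> lex_less x x"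
  by (simp add: lex_less_def)

lemma finite_permutes [simp]: "finite {p. p permutes {1..m :: nat}}"
  by (rule finite_permutations) simp

locale young =
  fixes \<mu> :: diagram
  assumes young: "young_diagram \<mu>"
begin

abbreviation "m \<equiv> card \<mu>"
abbreviation "box \<equiv> box_at \<mu>"
definition row :: "nat \<Rightarrow> nat" where "row k = fst (box k)"
definition col :: "nat \<Rightarrow> nat" where "col k = snd (box k)"

lemma fin: "finite \<mu>" using young by (simp add: young_diagram_def)

lemma young_down: "(i, j) \<in> \<mu> \<Longrightarrow> 1 \<le> r \<Longrightarrow> r \<le> i \<Longrightarrow> 1 \<le> c \<Longrightarrow> c \<le> j \<Longrightarrow> (r, c) \<in> \<mu>"
  using young unfolding young_diagram_def by fastforce

lemma young_pos: "(i, j) \<in> \<mu> \<Longrightarrow> 1 \<le> i \<and> 1 \<le> j"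
  using young unfolding young_diagram_def by blast

lemma box_number_eq: "box_number \<mu> x = card {y \<in> \<mu>. y = x \<or> lex_less y x}"
proof -
  have "{(i', j') \<in> \<mu>. i' < fst x \<or> i' = fst x \<and> j' \<le> snd x} = {y \<in> \<mu>. y = x \<or> lex_less y x}"
    by (cases x) (auto simp: lex_less_def)
  then show ?thesis by (simp add: box_number_def case_prod_unfold)
qed

lemma box_number_less:
  assumes "lex_less x y" "y \<in> \<mu>"
  shows "box_number \<mu> x < box_number \<mu> y"
  unfolding box_number_eq
proof (rule psubset_card_mono)
  show "finite {z \<in> \<mu>. z = y \<or> lex_less z y}" using fin by simp
  have "y \<notin> {z \<in> \<mu>. z = x \<or> lex_less z x}"
    using assms(1) lex_less_irrefl lex_less_trans by blast
  then show "{z \<in> \<mu>. z = x \<or> lex_less z x} \<subset> {z \<in> \<mu>. z = y \<or> lex_less z y}"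
    using assms lex_less_trans by blast
qed

lemma box_number_bij: "bij_betw (box_number \<mu>) \<mu> {1..m}"
proof -
  have inj: "inj_on (box_number \<mu>) \<mu>"
  proof (rule inj_onI)
    fix x y assume "x \<in> \<mu>" "y \<in> \<mu>" "box_number \<mu> x = box_number \<mu> y"
    then show "x = y" using lex_less_linear[of x y] box_number_less[of x y] box_number_less[of y x] by fastforce
  qed
  have "box_number \<mu> x \<in> {1..m}" if "x \<in> \<mu>" for x
  proof -
    have "card {y \<in> \<mu>. y = x \<or> lex_less y x} \<le> m" by (rule card_mono) (use fin in auto)
    moreover have "card {y \<in> \<mu>. y = x \<or> lex_less y x} > 0"
    proof -
      have "{y \<in> \<mu>. y = x \<or> lex_less y x} \<noteq> {}" using that by blast
      then show ?thesis using fin by (simp add: card_gt_0_iff)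
    qed
    ultimately show ?thesis unfolding box_number_eq by simp
  qed
  then have "box_number \<mu> ` \<mu> \<subseteq> {1..m}" by blast
  moreover have "card (box_number \<mu> ` \<mu>) = card {1..m}" using card_image[OF inj] by simp
  ultimately have "box_number \<mu> ` \<mu> = {1..m}" by (intro card_subset_eq) auto
  then show ?thesis using inj by (simp add: bij_betw_def)
qed

lemma box_number_inj: "inj_on (box_number \<mu>) \<mu>"
  using box_number_bij by (rule bij_betw_imp_inj_on)

lemma box_mem: "k \<in> {1..m} \<Longrightarrow> box k \<in> \<mu>"
  unfolding box_at_def using bij_betwE[OF bij_betw_the_inv_into[OF box_number_bij]] by blast

lemma box_number_box: "k \<in> {1..m} \<Longrightarrow> box_number \<mu> (box k) = k"
  unfolding box_at_def by (rule f_the_inv_into_f_bij_betw[OF box_number_bij]) auto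

lemma box_surj: "x \<in> \<mu> \<Longrightarrow> \<exists>k\<in>{1..m}. box k = x"
  using bij_betwE[OF box_number_bij] the_inv_into_f_f[OF box_number_inj] unfolding box_at_def by blast

lemma box_inj: "k \<in> {1..m} \<Longrightarrow> l \<in> {1..m} \<Longrightarrow> box k = box l \<Longrightarrow> k = l"
  using box_number_box by metis

lemma box_inj': "k \<in> {1..m} \<Longrightarrow> l \<in> {1..m} \<Longrightarrow> row k = row l \<Longrightarrow> col k = col l \<Longrightarrow> k = l"
proof -
  assume kl: "k \<in> {1..m}" "l \<in> {1..m}" "row k = row l" "col k = col l"
  then have "box k = box l" unfolding row_def col_def by (intro prod_eqI)
  then show "k = l" by (rule box_inj[OF kl(1,2)])
qed

lemma box_less: "k \<in> {1..m} \<Longrightarrow> l \<in> {1..m} \<Longrightarrow> lex_less (box k) (box l) \<Longrightarrow> k < l"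
  using box_number_less[of "box k" "box l"] box_number_box[of k] box_number_box[of l] box_mem[of l] by simp

lemma box_lex: "k \<in> {1..m} \<Longrightarrow> l \<in> {1..m} \<Longrightarrow> k < l \<Longrightarrow> lex_less (box k) (box l)"
  using box_less[of l k] lex_less_linear[of "box k" "box l"] box_inj[of k l] by fastforce

lemma row_col_pos: "k \<in> {1..m} \<Longrightarrow> 1 \<le> row k \<and> 1 \<le> col k"
  using young_pos[of "row k" "col k"] box_mem[of k] by (simp add: row_def col_def)

lemma box_down:
  assumes "k \<in> {1..m}" "1 \<le> r" "r \<le> row k" "1 \<le> c" "c \<le> col k" "(r, c) \<noteq> (row k, col k)"
  shows "\<exists>l\<in>{1..<k}. row l = r \<and> col l = c"
proof -
  have "(r, c) \<in> \<mu>" using young_down[of "row k" "col k" r c] box_mem[OF assms(1)] assms by (simp add: row_def col_def)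
  then obtain l where l: "l \<in> {1..m}" "box l = (r, c)" using box_surj by blast
  then have "lex_less (box l) (box k)" using assms by (cases "box k") (auto simp: lex_less_def row_def col_def)
  then have "l < k" using box_less l assms(1) by blast
  then show ?thesis using l by (intro bexI[of _ l]) (auto simp: row_def col_def)
qed

lemma row_le_of_less: "k \<in> {1..m} \<Longrightarrow> l \<in> {1..<k} \<Longrightarrow> row l < row k \<or> row l = row k \<and> col l < col k"
  using box_lex[of l k] by (auto simp: lex_less_def row_def col_def)

section \<open>A column-antisymmetric tensor and its Jucys-Murphy eigenvalues\<close>

definition cols :: "nat \<Rightarrow> (nat \<Rightarrow> nat) set" where
  "cols k = {q. q permutes {1..k} \<and> (\<forall>l\<in>{1..k}. col (q l) = col l)}"

text \<open>The basis tensor that labels each box by its row, antisymmetrized over the columns and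
  truncated to the boxes 1, ..., k. The truncation allows an induction that removes the last
  Jucys-Murphy element together with the last box.\<close>

definition fcol :: "nat \<Rightarrow> tensor" where
  "fcol k i = (\<Sum>q\<in>cols k. of_int (sign q) * (if \<forall>l\<in>{1..k}. i l = row (q l) then 1 else 0))"

lemma finite_cols [simp]: "finite (cols k)"
  by (rule finite_subset[OF _ finite_permutes[of k]]) (auto simp: cols_def)

lemma sign_comp_permutes: "p permutes {1..k} \<Longrightarrow> q permutes {1..k} \<Longrightarrow> sign (p \<circ> q) = sign p * sign q"
  for k :: nat
  by (intro sign_compose) (auto intro: permutes_imp_permutation[of "{1..k}"])

lemma cols_transpose:
  assumes "a \<in> {1..k}" "b \<in> {1..k}" "col a = col b" "q \<in> cols k"
  shows "q \<circ> Transposition.transpose a b \<in> cols k"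
proof -
  have p: "Transposition.transpose a b permutes {1..k}" by (rule permutes_swap_id) (use assms in auto)
  have "col (q (Transposition.transpose a b l)) = col l" if "l \<in> {1..k}" for l
    using assms that by (auto simp: cols_def Transposition.transpose_def)
  then show ?thesis using assms(4) p by (auto simp: cols_def intro: permutes_compose)
qed

lemma fcol_antisym:
  assumes ab: "a \<in> {1..k}" "b \<in> {1..k}" "a \<noteq> b" "col a = col b"
  shows "fcol k (i \<circ> Transposition.transpose a b) = - fcol k i"
proof -
  let ?\<tau> = "Transposition.transpose a b"
  have p: "?\<tau> permutes {1..k}" by (rule permutes_swap_id) (use ab in auto)
  have eq: "(\<forall>l\<in>{1..k}. i (?\<tau> l) = row (q l)) \<longleftrightarrow> (\<forall>l\<in>{1..k}. i l = row (q (?\<tau> l)))" for q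
  proof
    assume *: "\<forall>l\<in>{1..k}. i (?\<tau> l) = row (q l)"
    show "\<forall>l\<in>{1..k}. i l = row (q (?\<tau> l))"
    proof
      fix l assume "l \<in> {1..k}"
      then have "?\<tau> l \<in> {1..k}" by (simp only: permutes_in_image[OF p])
      from bspec[OF * this] show "i l = row (q (?\<tau> l))" by simp
    qed
  next
    assume *: "\<forall>l\<in>{1..k}. i l = row (q (?\<tau> l))"
    show "\<forall>l\<in>{1..k}. i (?\<tau> l) = row (q l)"
    proof
      fix l assume "l \<in> {1..k}"
      then have "?\<tau> l \<in> {1..k}" by (simp only: permutes_in_image[OF p])
      from bspec[OF * this] show "i (?\<tau> l) = row (q l)" by simp
    qed
  qed
  have "fcol k (i \<circ> ?\<tau>) = (\<Sum>q\<in>cols k. - (of_int (sign q) * (if \<forall>l\<in>{1..k}. i l = row (q l) then 1 else 0)))"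
    unfolding fcol_def
  proof (rule sum.reindex_bij_witness[of _ "\<lambda>q. q \<circ> ?\<tau>" "\<lambda>q. q \<circ> ?\<tau>"])
    fix q assume q: "q \<in> cols k"
    show "q \<circ> ?\<tau> \<circ> ?\<tau> = q" by (simp add: comp_assoc)
    then show "q \<circ> ?\<tau> \<circ> ?\<tau> = q" .
    show "q \<circ> ?\<tau> \<in> cols k" by (rule cols_transpose) (use ab q in auto)
    then show "q \<circ> ?\<tau> \<in> cols k" .
    have "sign (q \<circ> ?\<tau>) = - sign q"
      using sign_comp_permutes[of q k ?\<tau>] q p ab(3) by (simp add: cols_def sign_swap_id)
    then show "- (of_int (sign (q \<circ> ?\<tau>)) * (if \<forall>l\<in>{1..k}. i l = row ((q \<circ> ?\<tau>) l) then 1 else 0))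
      = of_int (sign q) * (if \<forall>l\<in>{1..k}. (i \<circ> ?\<tau>) l = row (q l) then 1 else 0)"
      using eq[of q] by simp
  qed
  then show ?thesis by (simp add: fcol_def sum_negf)
qed

lemma fcol_nonzero:
  assumes "fcol k i \<noteq> 0" "l \<in> {1..k}"
  shows "\<exists>l'\<in>{1..k}. col l' = col l \<and> i l = row l'"
proof -
  obtain q where q: "q \<in> cols k" "\<forall>l\<in>{1..k}. i l = row (q l)"
  proof (rule sum.not_neutral_contains_not_neutral[OF assms(1)[unfolded fcol_def]])
    fix q assume "q \<in> cols k" "of_int (sign q) * (if \<forall>l\<in>{1..k}. i l = row (q l) then 1 else 0) \<noteq> (0 :: complex)"
    then show thesis using that by (auto split: if_splits)
  qed
  then have "q l \<in> {1..k}" "col (q l) = col l"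
    using assms(2) permutes_in_image[of q "{1..k}" l] by (auto simp: cols_def)
  then show ?thesis using q assms(2) by blast
qed

lemma cols_subset: "cols k \<subseteq> cols (Suc k)"
proof
  fix q assume q: "q \<in> cols k"
  then have p: "q permutes {1..k}" by (simp add: cols_def)
  have "q (Suc k) = Suc k" by (rule permutes_not_in[OF p]) simp
  moreover have "{1..Suc k} = insert (Suc k) {1..k}" by auto
  moreover have "q permutes {1..Suc k}" by (rule permutes_subset[OF p]) auto
  ultimately show "q \<in> cols (Suc k)" using q by (simp add: cols_def)
qed

text \<open>A contributing q sends k + 1 to a box of the same column and, by the assumption on i, of
  the same row, so it fixes k + 1.\<close>

lemma fcol_restrict:
  assumes k: "Suc k \<le> m" and i: "i (Suc k) = row (Suc k)"
  shows "fcol (Suc k) i = fcol k i"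
  unfolding fcol_def
proof (rule sum.mono_neutral_cong_right)
  have S: "{1..Suc k} = insert (Suc k) {1..k}" by auto
  show "\<forall>q\<in>cols (Suc k) - cols k. of_int (sign q) * (if \<forall>l\<in>{1..Suc k}. i l = row (q l) then 1 else 0) = (0 :: complex)"
  proof
    fix q assume q: "q \<in> cols (Suc k) - cols k"
    have p: "q permutes {1..Suc k}" using q by (simp add: cols_def)
    have "\<not> (\<forall>l\<in>{1..Suc k}. i l = row (q l))"
    proof
      assume "\<forall>l\<in>{1..Suc k}. i l = row (q l)"
      then have 1: "row (q (Suc k)) = row (Suc k)" using i by simp
      have 2: "col (q (Suc k)) = col (Suc k)" using q by (simp add: cols_def)
      have 3: "q (Suc k) \<in> {1..m}" using permutes_in_image[OF p, of "Suc k"] k by simp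
      have "q (Suc k) = Suc k" by (rule box_inj'[OF 3 _ 1 2]) (use k in simp)
      then have "q permutes {1..k}" by (intro permutes_superset[OF p]) (auto simp: le_Suc_eq)
      then show False using q by (auto simp: cols_def)
    qed
    then show "of_int (sign q) * (if \<forall>l\<in>{1..Suc k}. i l = row (q l) then 1 else 0) = (0 :: complex)" by simp
  qed
  fix q assume "q \<in> cols k"
  then have "q (Suc k) = Suc k" by (intro permutes_not_in[of q "{1..k}"]) (auto simp: cols_def)
  then show "of_int (sign q) * (if \<forall>l\<in>{1..Suc k}. i l = row (q l) then 1 else 0) =
    of_int (sign q) * (if \<forall>l\<in>{1..k}. i l = row (q l) then 1 else (0 :: complex))"
    unfolding S using i by simp
qed (use cols_subset in auto)

text \<open>A Garnir relation: exchanging \<open>k\<close> in all ways with the boxes of a column \<open>c\<close> to the left of it. The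
  difference is antisymmetric in the boxes of that column and \<open>k\<close>, which carry too few labels.\<close>

lemma garnir:
  assumes k: "k \<in> {1..m}" and c: "1 \<le> c" "c < col k"
  shows "(\<Sum>l | l \<in> {1..<k} \<and> col l = c. fcol k (i \<circ> Transposition.transpose l k)) = fcol k i"
proof -
  define D where "D = {l. l \<in> {1..<k} \<and> col l = c}"
  define h where "h i = fcol k i - (\<Sum>l\<in>D. fcol k (i \<circ> Transposition.transpose l k))" for i
  have D: "finite D" "k \<notin> D" "\<And>l. l \<in> D \<Longrightarrow> l \<in> {1..k} \<and> l \<noteq> k \<and> col l = c" by (auto simp: D_def)
  have km: "l \<in> {1..m}" if "l \<in> {1..k}" for l using that k by auto
  have labels_c: "row l \<in> row ` D" if "l \<in> {1..k}" "col l = c" for l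
    using that c(2) by (cases "l = k") (auto simp: D_def)
  have labels_k: "row l \<in> row ` D" if lk: "l \<in> {1..k}" "col l = col k" for l
  proof -
    have "row l \<le> row k" using row_le_of_less[OF k, of l] lk by (cases "l = k") auto
    then obtain l' where "l' \<in> {1..<k}" "row l' = row l" "col l' = c"
      using box_down[OF k, of "row l" c] row_col_pos[OF km[OF lk(1)]] c by fastforce
    then show ?thesis by (intro image_eqI[of _ _ l']) (auto simp: D_def)
  qed
  have anti1: "h (i \<circ> Transposition.transpose a b) = - h i" if ab: "a \<in> D" "b \<in> D" "a \<noteq> b" for a b i
  proof -
    let ?\<tau> = "Transposition.transpose a b"
    have f: "fcol k (i \<circ> ?\<tau>) = - fcol k i" for i by (rule fcol_antisym) (use D ab in auto)
    have "(\<Sum>l\<in>D. fcol k (i \<circ> ?\<tau> \<circ> Transposition.transpose l k)) = (\<Sum>l\<in>D. - fcol k (i \<circ> Transposition.transpose l k))"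
    proof (rule sum.reindex_bij_witness[of _ ?\<tau> ?\<tau>])
      fix l assume l: "l \<in> D"
      show "?\<tau> (?\<tau> l) = l" by simp
      then show "?\<tau> (?\<tau> l) = l" .
      show "?\<tau> l \<in> D" using l ab by (auto simp: Transposition.transpose_def)
      then show "?\<tau> l \<in> D" .
      have "i \<circ> ?\<tau> \<circ> Transposition.transpose l k = i \<circ> Transposition.transpose (?\<tau> l) k \<circ> ?\<tau>"
        using l ab D by (auto simp: fun_eq_iff Transposition.transpose_def)
      then show "- fcol k (i \<circ> Transposition.transpose (?\<tau> l) k) = fcol k (i \<circ> ?\<tau> \<circ> Transposition.transpose l k)"
        using f by simp
    qed
    then show ?thesis unfolding h_def f by (simp add: sum_negf)
  qed
  have anti2: "h (i \<circ> Transposition.transpose a k) = - h i" if a: "a \<in> D" for a i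
  proof -
    let ?\<tau> = "Transposition.transpose a k"
    have t: "fcol k (i \<circ> ?\<tau> \<circ> Transposition.transpose l k) = - fcol k (i \<circ> Transposition.transpose l k)"
      if l: "l \<in> D - {a}" for l
    proof -
      have "i \<circ> ?\<tau> \<circ> Transposition.transpose l k = i \<circ> Transposition.transpose l k \<circ> Transposition.transpose a l"
        using l a D by (auto simp: fun_eq_iff Transposition.transpose_def)
      then show ?thesis using fcol_antisym[of a k l] D a l by auto
    qed
    have s: "sum F D = F a + sum F (D - {a})" for F :: "nat \<Rightarrow> complex"
      using a D(1) by (rule sum.remove[rotated])
    have "i \<circ> ?\<tau> \<circ> ?\<tau> = i" by (simp add: comp_assoc)
    then show ?thesis unfolding h_def s by (simp add: t sum_negf)
  qed
  \<comment> \<open>Pigeonhole: the positions in D and k are one more than the row labels of D.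
    Either two of them carry equal labels and antisymmetry gives h i = - h i, or a label occurs that
    no box of either column can carry, and every term is 0.\<close>
  have "h i = 0"
  proof (cases "\<forall>d\<in>insert k D. i d \<in> row ` D")
    case True
    have "card (i ` insert k D) \<le> card (row ` D)" by (rule card_mono) (use True D(1) in auto)
    also have "\<dots> \<le> card D" by (rule card_image_le[OF D(1)])
    finally have le: "card (i ` insert k D) \<le> card D" .
    have "\<not> inj_on i (insert k D)"
    proof
      assume "inj_on i (insert k D)"
      then have "card (i ` insert k D) = Suc (card D)" using D(1,2) by (simp only: card_image card_insert_disjoint not_False_eq_True)
      then show False using le by simp
    qed
    then obtain a b where ab: "a \<in> insert k D" "b \<in> insert k D" "a \<noteq> b" "i a = i b" by (auto simp: inj_on_def)
    have "h (i \<circ> Transposition.transpose a b) = - h i"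
    proof (cases "a = k")
      case True
      then show ?thesis using anti2[of b i] ab by (simp add: transpose_commute)
    next
      case False
      then show ?thesis using anti1[of a b i] anti2[of a i] ab by (cases "b = k") auto
    qed
    moreover have "i \<circ> Transposition.transpose a b = i"
      using ab(4) by (auto simp: fun_eq_iff Transposition.transpose_def)
    ultimately show ?thesis by simp
  next
    case False
    then obtain d where d: "d \<in> insert k D" "i d \<notin> row ` D" by blast
    have z: "fcol k i' = 0" if "e \<in> insert k D" "i' e = i d" for i' e
    proof (rule ccontr)
      assume nz: "fcol k i' \<noteq> 0"
      have e: "e \<in> {1..k}" "col e = c \<or> col e = col k" using that(1) D k by auto
      then obtain l where "l \<in> {1..k}" "col l = col e" "i' e = row l"
        using fcol_nonzero[OF nz] by blast
      then show False using labels_c[of l] labels_k[of l] e that(2) d(2) by auto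
    qed
    have "fcol k (i \<circ> Transposition.transpose l k) = 0" if "l \<in> D" for l
      by (rule z[of "Transposition.transpose l k d"]) (use that d in \<open>auto simp: Transposition.transpose_def\<close>)
    then show ?thesis unfolding h_def using z[OF d(1)] by simp
  qed
  then show ?thesis by (simp add: h_def D_def)
qed

lemma jm_app: "app (pr.jm k) g i = (\<Sum>l=1..<k. g (i \<circ> Transposition.transpose l k))"
  unfolding pr.jm_def app_sum by (simp add: perm_op.rep_eq)

text \<open>The positions l < k in the column of k give - \<open>fcol k i\<close> each, and there
  are row k - 1 of them. Each of the col k - 1 columns to the left gives \<open>fcol k i\<close> by
  \<open>garnir\<close>, and columns to the right give 0. The total is the content of box k.\<close>

lemma jm_fcol:
  assumes k: "k \<in> {1..m}" and i: "i k = row k"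
  shows "app (pr.jm k) (fcol k) i = (of_nat (col k) - of_nat (row k)) * fcol k i"
proof -
  let ?F = "\<lambda>l. fcol k (i \<circ> Transposition.transpose l k)"
  let ?K = "{1..<k}"
  have same: "?F l = - fcol k i" if "l \<in> ?K" "col l = col k" for l
    by (rule fcol_antisym) (use that k in auto)
  \<comment> \<open>In a column to the right, the boxes numbered below k lie in rows strictly above
    that of k, so the label row k has no place there.\<close>
  have right: "?F l = 0" if l: "l \<in> ?K" "col k < col l" for l
  proof (rule ccontr)
    assume nz: "?F l \<noteq> 0"
    have "l \<in> {1..k}" using l by auto
    from fcol_nonzero[OF nz this] obtain l' where l': "l' \<in> {1..k}" "col l' = col l" "row k = row l'"
      using i by auto
    then show False using row_le_of_less[OF k, of l'] l by (cases "l' = k") auto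
  qed
  have "sum ?F ?K = sum ?F {l \<in> ?K. col l < col k} + (sum ?F {l \<in> ?K. col l = col k} + sum ?F {l \<in> ?K. col k < col l})"
  proof -
    have "?K = {l \<in> ?K. col l < col k} \<union> ({l \<in> ?K. col l = col k} \<union> {l \<in> ?K. col k < col l})" by auto
    then have "sum ?F ?K = sum ?F ({l \<in> ?K. col l < col k} \<union> ({l \<in> ?K. col l = col k} \<union> {l \<in> ?K. col k < col l}))"
      by (rule arg_cong[where f = "sum ?F"])
    also have "\<dots> = sum ?F {l \<in> ?K. col l < col k} + sum ?F ({l \<in> ?K. col l = col k} \<union> {l \<in> ?K. col k < col l})"
      by (rule sum.union_disjoint) auto
    also have "sum ?F ({l \<in> ?K. col l = col k} \<union> {l \<in> ?K. col k < col l}) = sum ?F {l \<in> ?K. col l = col k} + sum ?F {l \<in> ?K. col k < col l}"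
      by (rule sum.union_disjoint) auto
    finally show ?thesis .
  qed
  also have "sum ?F {l \<in> ?K. col k < col l} = 0"
    by (rule sum.neutral) (use right in auto)
  also have "sum ?F {l \<in> ?K. col l = col k} = - (of_nat (row k) - 1) * fcol k i"
  proof -
    have inj: "inj_on row {l \<in> ?K. col l = col k}"
    proof (rule inj_onI)
      fix a b assume "a \<in> {l \<in> ?K. col l = col k}" "b \<in> {l \<in> ?K. col l = col k}" "row a = row b"
      then show "a = b" using k by (intro box_inj'[of a b]) auto
    qed
    have "row ` {l \<in> ?K. col l = col k} = {1..<row k}"
    proof
      show "row ` {l \<in> ?K. col l = col k} \<subseteq> {1..<row k}"
      proof
        fix r assume "r \<in> row ` {l \<in> ?K. col l = col k}"
        then obtain l where l: "l \<in> ?K" "col l = col k" "r = row l" by auto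
        then show "r \<in> {1..<row k}" using row_le_of_less[OF k l(1)] row_col_pos[of l] k by auto
      qed
      show "{1..<row k} \<subseteq> row ` {l \<in> ?K. col l = col k}"
      proof
        fix r assume r: "r \<in> {1..<row k}"
        then obtain l where "l \<in> ?K" "row l = r" "col l = col k"
          using box_down[OF k, of r "col k"] row_col_pos[OF k] by auto
        then show "r \<in> row ` {l \<in> ?K. col l = col k}" by blast
      qed
    qed
    then have c: "card {l \<in> ?K. col l = col k} = row k - 1" using card_image[OF inj] by simp
    have "sum ?F {l \<in> ?K. col l = col k} = (\<Sum>l\<in>{l \<in> ?K. col l = col k}. - fcol k i)"
      by (rule sum.cong) (use same in auto)
    then show ?thesis using c row_col_pos[OF k] by (simp add: of_nat_diff algebra_simps)
  qed
  also have "sum ?F {l \<in> ?K. col l < col k} = (of_nat (col k) - 1) * fcol k i"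
  proof -
    have "sum ?F {l \<in> ?K. col l < col k} = (\<Sum>c\<in>{1..<col k}. sum ?F {l \<in> {l \<in> ?K. col l < col k}. col l = c})"
      by (rule sum.group[symmetric]) (use row_col_pos k in auto)
    also have "\<dots> = (\<Sum>c\<in>{1..<col k}. fcol k i)"
    proof (intro sum.cong refl)
      fix c assume c: "c \<in> {1..<col k}"
      then have "{l \<in> {l \<in> ?K. col l < col k}. col l = c} = {l. l \<in> ?K \<and> col l = c}" by auto
      then show "sum ?F {l \<in> {l \<in> ?K. col l < col k}. col l = c} = fcol k i"
        using garnir[OF k, of c i] c by simp
    qed
    finally show ?thesis using row_col_pos[OF k] by (simp add: of_nat_diff)
  qed
  finally show ?thesis unfolding jm_app by (simp add: algebra_simps comp_def)
qed

text \<open>Only positions 1, ..., k are permuted, so the value at i involves just the orbit of i.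
  This allows the tensor to be replaced by one that agrees with it on the orbit.\<close>

lemma esym_pr_cong:
  assumes "\<And>p. p permutes {1..k} \<Longrightarrow> g (i \<circ> p) = g' (i \<circ> p)"
  shows "app (esym pr.jm r k) g i = app (esym pr.jm r k) g' i"
  using assms
proof (induction k arbitrary: r g g')
  case 0
  have "g (i \<circ> id) = g' (i \<circ> id)" by (rule 0) (rule permutes_id)
  then have "g i = g' i" by simp
  then show ?case by (cases r) (simp_all add: app_simps)
next
  case (Suc k)
  have sub: "p permutes {1..Suc k}" if "p permutes {1..k}" for p
    by (rule permutes_subset[OF that]) auto
  show ?case
  proof (cases r)
    case 0
    have "g (i \<circ> id) = g' (i \<circ> id)" by (rule Suc.prems) (rule permutes_id)
    then show ?thesis using 0 by (simp add: app_simps)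
  next
    case r: (Suc r')
    have "app (esym pr.jm (Suc r') k) g i = app (esym pr.jm (Suc r') k) g' i"
      by (rule Suc.IH) (use Suc.prems sub in blast)
    moreover have "app (esym pr.jm r' k) (app (pr.jm (Suc k)) g) i = app (esym pr.jm r' k) (app (pr.jm (Suc k)) g') i"
    proof (rule Suc.IH)
      fix p assume p: "p permutes {1..k}"
      show "app (pr.jm (Suc k)) g (i \<circ> p) = app (pr.jm (Suc k)) g' (i \<circ> p)"
        unfolding jm_app
      proof (intro sum.cong refl)
        fix l assume l: "l \<in> {1..<Suc k}"
        have "Transposition.transpose l (Suc k) permutes {1..Suc k}"
          by (rule permutes_swap_id) (use l in auto)
        then have "p \<circ> Transposition.transpose l (Suc k) permutes {1..Suc k}"
          using sub[OF p] by (intro permutes_compose)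
        from Suc.prems[OF this] show "g (i \<circ> p \<circ> Transposition.transpose l (Suc k)) = g' (i \<circ> p \<circ> Transposition.transpose l (Suc k))"
          by (simp add: comp_def)
      qed
    qed
    ultimately show ?thesis by (simp add: r app_simps)
  qed
qed

definition content :: "nat \<Rightarrow> complex" where "content k = box_content (box k)"

lemma content_eq: "content k = of_nat (col k) - of_nat (row k)"
  by (simp add: content_def box_content_def row_def col_def case_prod_unfold)

text \<open>Evaluation at the single index \<open>row\<close> suffices. Every index reached from it
  by permuting 1, ..., k still carries its own row at k + 1, so there x_(k+1) multiplies by the
  content and \<open>fcol_restrict\<close> removes the box.\<close>

lemma esym_fcol:
  assumes "k \<le> m"
  shows "app (esym pr.jm r k) (fcol k) row = esym content r k"
  using assms
proof (induction k arbitrary: r)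
  case 0
  have "fcol 0 row = 1"
  proof -
    have "cols 0 = {id}" by (auto simp: cols_def)
    then show ?thesis by (simp add: fcol_def)
  qed
  then show ?case by (cases r) (simp_all add: app_simps)
next
  case (Suc k)
  have IH: "app (esym pr.jm r k) (fcol k) row = esym content r k" for r
    using Suc by simp
  have fix_k: "(row \<circ> p) (Suc k) = row (Suc k)" if "p permutes {1..k}" for p
    using permutes_not_in[OF that, of "Suc k"] by simp
  have f: "fcol (Suc k) (row \<circ> p) = fcol k (row \<circ> p)" if "p permutes {1..k}" for p
    by (rule fcol_restrict[where i = "row \<circ> p", OF Suc.prems fix_k[OF that]])
  have A: "app (esym pr.jm r k) (fcol (Suc k)) row = esym content r k" for r
    unfolding IH[symmetric] by (rule esym_pr_cong) (rule f)
  have B: "app (esym pr.jm r k) (app (pr.jm (Suc k)) (fcol (Suc k))) row = content (Suc k) * esym content r k" for r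
  proof -
    have "app (esym pr.jm r k) (app (pr.jm (Suc k)) (fcol (Suc k))) row = app (esym pr.jm r k) (\<lambda>i. content (Suc k) * fcol k i) row"
    proof (rule esym_pr_cong)
      fix p assume p: "p permutes {1..k}"
      show "app (pr.jm (Suc k)) (fcol (Suc k)) (row \<circ> p) = content (Suc k) * fcol k (row \<circ> p)"
        using jm_fcol[of "Suc k" "row \<circ> p"] fix_k[OF p] f[OF p] Suc.prems by (simp add: content_eq)
    qed
    then show ?thesis by (simp add: app_scale_arg IH)
  qed
  show ?case
  proof (cases r)
    case 0
    then show ?thesis using A[of 0] by simp
  next
    case (Suc r')
    then show ?thesis using A[of r] B[of r'] by (simp add: app_simps)
  qed
qed

end

section \<open>The Young symmetrizer and the Specht module\<close>

context young
begin

abbreviation "y \<equiv> young_symmetrizer \<mu>"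
abbreviation "rowg \<equiv> row_group \<mu>"

lemma rows_iff: "p \<in> rowg \<longleftrightarrow> p permutes {1..m} \<and> (\<forall>l\<in>{1..m}. row (p l) = row l)"
  by (simp add: row_group_def row_def)

lemma col_group_eq: "col_group \<mu> = cols m"
  by (simp add: col_group_def cols_def col_def)

lemma finite_rows [simp]: "finite rowg"
  by (rule finite_subset[OF _ finite_permutes[of m]]) (auto simp: rows_iff)

lemma cols_permutes: "q \<in> cols m \<Longrightarrow> q permutes {1..m}"
  by (simp add: cols_def)

lemma rows_permutes: "p \<in> rowg \<Longrightarrow> p permutes {1..m}"
  by (simp add: rows_iff)

lemma id_rows: "id \<in> rowg" and id_cols: "id \<in> cols m"
  by (simp_all add: rows_iff cols_def permutes_id)

lemma rows_comp: "p \<in> rowg \<Longrightarrow> p' \<in> rowg \<Longrightarrow> p \<circ> p' \<in> rowg"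
  using permutes_in_image[of p' "{1..m}"] by (auto simp: rows_iff intro: permutes_compose)

lemma cols_comp: "p \<in> cols m \<Longrightarrow> p' \<in> cols m \<Longrightarrow> p \<circ> p' \<in> cols m"
  using permutes_in_image[of p' "{1..m}"] by (auto simp: cols_def intro: permutes_compose)

lemma rows_inv:
  assumes p: "p \<in> rowg"
  shows "Hilbert_Choice.inv p \<in> rowg"
  unfolding rows_iff
proof (intro conjI ballI)
  show inv: "Hilbert_Choice.inv p permutes {1..m}" by (rule permutes_inv[OF rows_permutes[OF p]])
  fix l assume "l \<in> {1..m}"
  then have "Hilbert_Choice.inv p l \<in> {1..m}" by (simp only: permutes_in_image[OF inv])
  then have "row (p (Hilbert_Choice.inv p l)) = row (Hilbert_Choice.inv p l)" using p unfolding rows_iff by blast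
  then show "row (Hilbert_Choice.inv p l) = row l" by (simp only: permutes_inverses(1)[OF rows_permutes[OF p]])
qed

lemma cols_inv:
  assumes p: "p \<in> cols m"
  shows "Hilbert_Choice.inv p \<in> cols m"
  unfolding cols_def
proof (intro CollectI conjI ballI)
  show inv: "Hilbert_Choice.inv p permutes {1..m}" by (rule permutes_inv[OF cols_permutes[OF p]])
  fix l assume "l \<in> {1..m}"
  then have "Hilbert_Choice.inv p l \<in> {1..m}" by (simp only: permutes_in_image[OF inv])
  then have "col (p (Hilbert_Choice.inv p l)) = col (Hilbert_Choice.inv p l)" using p unfolding cols_def by blast
  then show "col (Hilbert_Choice.inv p l) = col l" by (simp only: permutes_inverses(1)[OF cols_permutes[OF p]])
qed

lemma sign_inv_cols: "q \<in> cols m \<Longrightarrow> sign (Hilbert_Choice.inv q) = sign q"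
  by (intro sign_inverse permutes_imp_permutation[OF _ cols_permutes]) auto

lemma inv_comp:
  assumes "p permutes {1..m}"
  shows "Hilbert_Choice.inv p \<circ> (p \<circ> s) = s" "p \<circ> (Hilbert_Choice.inv p \<circ> s) = s"
    "s \<circ> p \<circ> Hilbert_Choice.inv p = s" "s \<circ> Hilbert_Choice.inv p \<circ> p = s"
proof -
  note i = permutes_inv_o[OF assms]
  show "Hilbert_Choice.inv p \<circ> (p \<circ> s) = s" "p \<circ> (Hilbert_Choice.inv p \<circ> s) = s"
    by (simp_all only: comp_assoc[symmetric] i id_comp)
  show "s \<circ> p \<circ> Hilbert_Choice.inv p = s" "s \<circ> Hilbert_Choice.inv p \<circ> p = s"
    by (simp_all only: comp_assoc i comp_id)
qed

lemma y_eq: "y s = (\<Sum>p\<in>rowg. \<Sum>q\<in>cols m. if p \<circ> q = s then of_int (sign q) else 0)"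
  by (simp add: young_symmetrizer_def col_group_eq)

lemma y_left:
  assumes p0: "p0 \<in> rowg"
  shows "left_transl p0 y = y"
proof
  fix s
  let ?F = "\<lambda>s p. \<Sum>q\<in>cols m. if p \<circ> q = s then of_int (sign q) else (0 :: complex)"
  have "sum (?F (Hilbert_Choice.inv p0 \<circ> s)) rowg = sum (?F s) rowg"
  proof (rule sum.reindex_bij_witness[of _ "\<lambda>p. Hilbert_Choice.inv p0 \<circ> p" "\<lambda>p. p0 \<circ> p"])
    fix p assume p: "p \<in> rowg"
    show "Hilbert_Choice.inv p0 \<circ> (p0 \<circ> p) = p" "p0 \<circ> (Hilbert_Choice.inv p0 \<circ> p) = p"
      by (rule inv_comp[OF rows_permutes[OF p0]])+
    show "p0 \<circ> p \<in> rowg" "Hilbert_Choice.inv p0 \<circ> p \<in> rowg"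
      using rows_comp[OF p0 p] rows_comp[OF rows_inv[OF p0] p] by blast+
    have "p0 \<circ> p \<circ> q = s \<longleftrightarrow> p \<circ> q = Hilbert_Choice.inv p0 \<circ> s" for q
      using inv_comp[OF rows_permutes[OF p0]] by (metis comp_assoc)
    then show "?F s (p0 \<circ> p) = ?F (Hilbert_Choice.inv p0 \<circ> s) p" by simp
  qed
  then show "left_transl p0 y s = y s" by (simp add: left_transl_def y_eq)
qed

lemma y_right:
  assumes q0: "q0 \<in> cols m"
  shows "y (s \<circ> q0) = of_int (sign q0) * y s"
proof -
  have "(\<Sum>q\<in>cols m. if p \<circ> q = s \<circ> q0 then of_int (sign q) else (0 :: complex))
    = (\<Sum>q\<in>cols m. of_int (sign q0) * (if p \<circ> q = s then of_int (sign q) else 0))" for p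
  proof (rule sum.reindex_bij_witness[of _ "\<lambda>q. q \<circ> q0" "\<lambda>q. q \<circ> Hilbert_Choice.inv q0"])
    fix q assume q: "q \<in> cols m"
    show "q \<circ> Hilbert_Choice.inv q0 \<circ> q0 = q" "q \<circ> q0 \<circ> Hilbert_Choice.inv q0 = q"
      by (rule inv_comp[OF cols_permutes[OF q0]])+
    show "q \<circ> Hilbert_Choice.inv q0 \<in> cols m" "q \<circ> q0 \<in> cols m"
      using cols_comp[OF q q0] cols_comp[OF q cols_inv[OF q0]] by blast+
    have "p \<circ> (q \<circ> Hilbert_Choice.inv q0) = s \<longleftrightarrow> p \<circ> q = s \<circ> q0"
      using inv_comp[OF cols_permutes[OF q0]] by (metis comp_assoc)
    moreover have "sign (q \<circ> Hilbert_Choice.inv q0) = sign q * sign q0"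
      using sign_comp_permutes[OF cols_permutes[OF q] cols_permutes[OF cols_inv[OF q0]]] sign_inv_cols[OF q0] by simp
    ultimately show "of_int (sign q0) * (if p \<circ> (q \<circ> Hilbert_Choice.inv q0) = s then of_int (sign (q \<circ> Hilbert_Choice.inv q0)) else 0)
      = (if p \<circ> q = s \<circ> q0 then of_int (sign q) else (0 :: complex))"
      by (simp add: sign_def)
  qed
  then show ?thesis by (simp add: y_eq sum_distrib_left)
qed

lemma rows_cols_id:
  assumes "p \<in> rowg" "q \<in> cols m" "p \<circ> q = id"
  shows "q = id"
proof
  fix l
  show "q l = id l"
  proof (cases "l \<in> {1..m}")
    case True
    then have ql: "q l \<in> {1..m}" by (simp only: permutes_in_image[OF cols_permutes[OF assms(2)]])
    have "p (q l) = l" using assms(3) by (metis comp_apply id_apply)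
    then have 1: "row (q l) = row l" using assms(1) ql unfolding rows_iff by metis
    have 2: "col (q l) = col l" using assms(2) True by (simp add: cols_def)
    show ?thesis using box_inj'[OF ql True 1 2] by simp
  next
    case False
    then show ?thesis using permutes_not_in[OF cols_permutes[OF assms(2)]] by simp
  qed
qed

lemma y_id: "y id = 1"
proof -
  have "(\<Sum>q\<in>cols m. if p \<circ> q = id then of_int (sign q) else 0) = (if p = id then 1 else (0 :: complex))"
    if p: "p \<in> rowg" for p
  proof -
    have "(\<Sum>q\<in>cols m. if p \<circ> q = id then of_int (sign q) else 0) = (\<Sum>q\<in>cols m. if q = id then if p = id then 1 else 0 else (0 :: complex))"
      by (intro sum.cong refl) (use rows_cols_id[OF p] in \<open>auto simp: sign_id\<close>)
    then show ?thesis using id_cols by simp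
  qed
  then show ?thesis using id_rows by (simp add: y_eq)
qed

text \<open>Either two boxes of a column are sent to the same row, or the permutation is a product from the
  row and column groups: in each column, at most as many boxes as initially can have small labels.\<close>

lemma row_col_factor:
  assumes x: "x permutes {1..m}"
  shows "(\<exists>a\<in>{1..m}. \<exists>b\<in>{1..m}. a \<noteq> b \<and> col a = col b \<and> row (x a) = row (x b)) \<or>
    (\<exists>p\<in>rowg. \<exists>q\<in>cols m. x = p \<circ> q)"
proof (cases "\<exists>a\<in>{1..m}. \<exists>b\<in>{1..m}. a \<noteq> b \<and> col a = col b \<and> row (x a) = row (x b)")
  case False
  define K where "K c = {l \<in> {1..m}. col l = c}" for c
  have finK: "finite (K c)" for c by (simp add: K_def)
  have xm: "x l \<in> {1..m}" if "l \<in> {1..m}" for l using that by (simp only: permutes_in_image[OF x])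
  have inj1: "inj_on (\<lambda>l. row (x l)) (K c)" for c
  proof (rule inj_onI)
    fix a b assume "a \<in> K c" "b \<in> K c" "row (x a) = row (x b)"
    then have "a \<in> {1..m}" "b \<in> {1..m}" "col a = col b" "row (x a) = row (x b)" by (auto simp: K_def)
    then show "a = b" using False by blast
  qed
  have inj0: "inj_on row (K c)" for c
  proof (rule inj_onI)
    fix a b assume "a \<in> K c" "b \<in> K c" "row a = row b"
    then show "a = b" by (intro box_inj'[of a b]) (auto simp: K_def)
  qed
  have rowK: "row ` K c = {1..card (K c)}" for c
  proof -
    have down: "r \<in> row ` K c" if lK: "l \<in> K c" and r: "1 \<le> r" "r \<le> row l" for l r
    proof (cases "r = row l")
      case False
      have lm: "l \<in> {1..m}" "col l = c" using lK by (auto simp: K_def)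
      have "\<exists>l'\<in>{1..<l}. row l' = r \<and> col l' = c"
        using box_down[OF lm(1), of r c] row_col_pos[OF lm(1)] lm r False by auto
      then obtain l' where "l' \<in> {1..<l}" "row l' = r" "col l' = c" by blast
      then show ?thesis using lm by (intro image_eqI[of _ _ l']) (auto simp: K_def)
    qed (use lK in simp)
    define h where "h = Max (insert 0 (row ` K c))"
    have "row ` K c = {1..h}"
    proof
      show "row ` K c \<subseteq> {1..h}"
        using row_col_pos finK[of c] by (auto simp: h_def K_def)
      show "{1..h} \<subseteq> row ` K c"
      proof
        fix r assume r: "r \<in> {1..h}"
        have "h \<in> insert 0 (row ` K c)" unfolding h_def by (rule Max_in) (use finK in auto)
        then obtain l where "l \<in> K c" "h = row l" using r by auto
        then show "r \<in> row ` K c" using down[of l r] r by auto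
      qed
    qed
    moreover have "card (row ` K c) = card (K c)" by (rule card_image[OF inj0])
    ultimately show ?thesis by simp
  qed
  \<comment> \<open>The labels row (x l) are distinct within a column, so at most min(h, height) of
    them are at most h. The original labels attain this bound.\<close>
  have le: "card {l \<in> K c. row (x l) \<le> h} \<le> card {l \<in> K c. row l \<le> h}" for c h
  proof -
    have "card {l \<in> K c. row (x l) \<le> h} = card ((\<lambda>l. row (x l)) ` {l \<in> K c. row (x l) \<le> h})"
      by (rule card_image[symmetric]) (rule inj_on_subset[OF inj1[of c]], auto)
    also have "\<dots> \<le> min h (card (K c))"
    proof -
      have "(\<lambda>l. row (x l)) ` {l \<in> K c. row (x l) \<le> h} \<subseteq> {1..h}"
        using row_col_pos[OF xm] by (auto simp: K_def)
      then have "card ((\<lambda>l. row (x l)) ` {l \<in> K c. row (x l) \<le> h}) \<le> h" using card_mono[of "{1..h}"] by simp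
      moreover have "card ((\<lambda>l. row (x l)) ` {l \<in> K c. row (x l) \<le> h}) \<le> card (K c)"
        by (rule order_trans[OF card_image_le card_mono]) (use finK in auto)
      ultimately show ?thesis by simp
    qed
    also have "\<dots> = card (row ` {l \<in> K c. row l \<le> h})"
    proof -
      have "row ` {l \<in> K c. row l \<le> h} = {r \<in> row ` K c. r \<le> h}" by auto
      also have "\<dots> = {1..min h (card (K c))}" unfolding rowK by auto
      finally show ?thesis by simp
    qed
    also have "\<dots> = card {l \<in> K c. row l \<le> h}"
      by (rule card_image) (rule inj_on_subset[OF inj0[of c]], auto)
    finally show ?thesis .
  qed
  have total: "card {l \<in> {1..m}. row (x l) \<le> h} = card {l \<in> {1..m}. row l \<le> h}" for h
  proof -
    have inj: "inj_on x {l \<in> {1..m}. row (x l) \<le> h}" by (rule inj_on_subset[OF permutes_inj_on[OF x]]) auto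
    have "x ` {l \<in> {1..m}. row (x l) \<le> h} = {l \<in> {1..m}. row l \<le> h}"
    proof
      show "x ` {l \<in> {1..m}. row (x l) \<le> h} \<subseteq> {l \<in> {1..m}. row l \<le> h}" using xm by blast
      show "{l \<in> {1..m}. row l \<le> h} \<subseteq> x ` {l \<in> {1..m}. row (x l) \<le> h}"
      proof
        fix l assume l: "l \<in> {l \<in> {1..m}. row l \<le> h}"
        then have "l \<in> x ` {1..m}" unfolding permutes_image[OF x] by blast
        then show "l \<in> x ` {l \<in> {1..m}. row (x l) \<le> h}" using l by blast
      qed
    qed
    then show ?thesis using card_image[OF inj] by simp
  qed
  let ?cs = "col ` {1..m}"
  have split: "card {l \<in> {1..m}. P l} = (\<Sum>c\<in>?cs. card {l \<in> K c. P l})" for P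
  proof -
    have "card {l \<in> {1..m}. P l} = (\<Sum>l\<in>{l \<in> {1..m}. P l}. 1)" by simp
    also have "\<dots> = (\<Sum>c\<in>?cs. \<Sum>l\<in>{l' \<in> {l \<in> {1..m}. P l}. col l' = c}. 1)"
      by (rule sum.group[symmetric]) auto
    also have "\<dots> = (\<Sum>c\<in>?cs. card {l \<in> K c. P l})"
    proof (intro sum.cong refl)
      fix c
      have "{l' \<in> {l \<in> {1..m}. P l}. col l' = c} = {l \<in> K c. P l}" by (auto simp: K_def)
      then show "(\<Sum>l\<in>{l' \<in> {l \<in> {1..m}. P l}. col l' = c}. 1) = card {l \<in> K c. P l}" by simp
    qed
    finally show ?thesis .
  qed
  \<comment> \<open>As x is a bijection, both counts have the same sum over all columns, so the
    inequalities between them are equalities.\<close>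
  have same: "card {l \<in> K c. row (x l) \<le> h} = card {l \<in> K c. row l \<le> h}" if "c \<in> ?cs" for c h
  proof (rule sum_mono_inv[of "\<lambda>c. card {l \<in> K c. row (x l) \<le> h}" ?cs "\<lambda>c. card {l \<in> K c. row l \<le> h}"])
    show "(\<Sum>c\<in>?cs. card {l \<in> K c. row (x l) \<le> h}) = (\<Sum>c\<in>?cs. card {l \<in> K c. row l \<le> h})"
      using total[of h] unfolding split .
  qed (use le that in simp_all)
  have img: "(\<lambda>l. row (x l)) ` K c = row ` K c" if c: "c \<in> ?cs" for c
  proof -
    let ?h = "card (K c)"
    have "row l \<le> ?h" if "l \<in> K c" for l using imageI[OF that, of row] unfolding rowK by simp
    then have "{l \<in> K c. row l \<le> ?h} = K c" by blast
    then have "card {l \<in> K c. row (x l) \<le> ?h} = card (K c)" using same[OF c, of ?h] by simp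
    then have all: "{l \<in> K c. row (x l) \<le> ?h} = K c" by (intro card_subset_eq[OF finK]) auto
    have "(\<lambda>l. row (x l)) ` K c \<subseteq> {1..?h}"
    proof
      fix r assume "r \<in> (\<lambda>l. row (x l)) ` K c"
      then obtain l where l: "l \<in> K c" "r = row (x l)" by blast
      then have "row (x l) \<le> ?h" using all by blast
      moreover have "1 \<le> row (x l)" using row_col_pos[OF xm] l by (simp add: K_def)
      ultimately show "r \<in> {1..?h}" using l by simp
    qed
    moreover have "card ((\<lambda>l. row (x l)) ` K c) = card {1..?h}" using card_image[OF inj1[of c]] by simp
    ultimately show ?thesis unfolding rowK by (intro card_subset_eq) auto
  qed
  have "\<exists>l'\<in>{1..m}. col l' = col l \<and> row l' = row (x l)" if "l \<in> {1..m}" for l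
  proof -
    have "row (x l) \<in> row ` K (col l)" using img[of "col l"] that by (auto simp: K_def)
    then show ?thesis by (auto simp: K_def)
  qed
  \<comment> \<open>Within each column the labels row (x l) are a rearrangement of the rows. This
    rearrangement is the column permutation q, and x composed with the inverse of q preserves
    rows.\<close>
  then obtain q0 where q0: "\<And>l. l \<in> {1..m} \<Longrightarrow> q0 l \<in> {1..m} \<and> col (q0 l) = col l \<and> row (q0 l) = row (x l)"
    by metis
  define q where "q l = (if l \<in> {1..m} then q0 l else l)" for l
  have qp: "q permutes {1..m}"
  proof (rule bij_imp_permutes)
    have "inj_on q {1..m}"
    proof (rule inj_onI)
      fix a b assume ab: "a \<in> {1..m}" "b \<in> {1..m}" "q a = q b"
      then have "col a = col b" "row (x a) = row (x b)" using q0[OF ab(1)] q0[OF ab(2)] by (simp_all add: q_def)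
      then show "a = b" using False ab by blast
    qed
    moreover have "q ` {1..m} \<subseteq> {1..m}" using q0 by (auto simp: q_def)
    ultimately show "bij_betw q {1..m} {1..m}"
      using endo_inj_surj[of "{1..m}" q] by (simp add: bij_betw_def)
    show "q l = l" if "l \<notin> {1..m}" for l using that by (auto simp: q_def)
  qed
  have qc: "q \<in> cols m" using qp q0 by (auto simp: cols_def q_def)
  have "x \<circ> Hilbert_Choice.inv q \<in> rowg"
    unfolding rows_iff
  proof (intro conjI ballI)
    show "x \<circ> Hilbert_Choice.inv q permutes {1..m}" by (rule permutes_compose[OF permutes_inv[OF qp] x])
    fix l assume "l \<in> {1..m}"
    then have l': "Hilbert_Choice.inv q l \<in> {1..m}" by (simp only: permutes_in_image[OF permutes_inv[OF qp]])
    have "row (x (Hilbert_Choice.inv q l)) = row (q (Hilbert_Choice.inv q l))"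
      using q0[OF l'] l' by (simp add: q_def)
    then show "row ((x \<circ> Hilbert_Choice.inv q) l) = row l" using permutes_inverses(1)[OF qp] by simp
  qed
  then show ?thesis using qc inv_comp(4)[OF qp, of x] by metis
qed blast

text \<open>These symmetries cut out a line. At x = p q the value is fixed by the value at
  \<open>id\<close>. If x is not of this form, a row transposition on the left of x equals a column
  transposition on its right, and the value is its own negative.\<close>

lemma symmetrizer_unique:
  assumes left: "\<And>p. p \<in> rowg \<Longrightarrow> left_transl p v = v"
    and right: "\<And>q s. q \<in> cols m \<Longrightarrow> v (s \<circ> q) = of_int (sign q) * v s"
    and supp: "\<And>s. \<not> s permutes {1..m} \<Longrightarrow> v s = 0"
  shows "v = (\<lambda>s. v id * y s)"
proof
  fix x
  \<comment> \<open>With \<open>SOME\<close> the coefficient depends on x alone, so it is the same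
    for v and for \<open>y\<close>.\<close>
  have gen: "u x = (if \<exists>p\<in>rowg. \<exists>q\<in>cols m. x = p \<circ> q then of_int (sign (SOME q. q \<in> cols m \<and> (\<exists>p\<in>rowg. x = p \<circ> q))) * u id else 0)"
    if x: "x permutes {1..m}" and l: "\<And>p. p \<in> rowg \<Longrightarrow> left_transl p u = u"
      and r: "\<And>q s. q \<in> cols m \<Longrightarrow> u (s \<circ> q) = of_int (sign q) * u s" for u
  proof (cases "\<exists>p\<in>rowg. \<exists>q\<in>cols m. x = p \<circ> q")
    case True
    let ?q = "SOME q. q \<in> cols m \<and> (\<exists>p\<in>rowg. x = p \<circ> q)"
    have "\<exists>q. q \<in> cols m \<and> (\<exists>p\<in>rowg. x = p \<circ> q)" using True by blast
    from someI_ex[OF this] obtain p where q: "?q \<in> cols m" and p: "p \<in> rowg" "x = p \<circ> ?q" by blast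
    have "u x = of_int (sign ?q) * u p" using r[OF q, of p] p(2) by metis
    also have "u p = left_transl p u p" using l[OF p(1)] by simp
    also have "\<dots> = u id" using permutes_inv_o(2)[OF rows_permutes[OF p(1)]] by (simp add: left_transl_def)
    finally show ?thesis unfolding if_P[OF True] .
  next
    case False
    then obtain a b where ab: "a \<in> {1..m}" "b \<in> {1..m}" "a \<noteq> b" "col a = col b" "row (x a) = row (x b)"
      using row_col_factor[OF x] by blast
    let ?\<tau> = "Transposition.transpose a b" and ?\<sigma> = "Transposition.transpose (x a) (x b)"
    have \<tau>: "?\<tau> \<in> cols m" using cols_transpose[OF ab(1,2,4) id_cols] by simp
    have xab: "x a \<in> {1..m}" "x b \<in> {1..m}" using ab(1,2) by (simp_all only: permutes_in_image[OF x])
    have \<sigma>: "?\<sigma> \<in> rowg"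
      unfolding rows_iff using permutes_swap_id[OF xab] ab(5) by (auto simp: Transposition.transpose_def)
    have conj: "?\<sigma> \<circ> x = x \<circ> ?\<tau>"
      using permutes_inj[OF x] by (auto simp: fun_eq_iff Transposition.transpose_def inj_eq)
    have "u x = left_transl ?\<sigma> u x" using l[OF \<sigma>] by simp
    also have "\<dots> = u (x \<circ> ?\<tau>)" by (simp add: left_transl_def conj)
    also have "\<dots> = - u x" using r[OF \<tau>, of x] ab(3) by (simp add: sign_swap_id)
    finally show ?thesis using False by simp
  qed
  show "v x = v id * y x"
  proof (cases "x permutes {1..m}")
    case True
    show ?thesis
      using gen[OF True left right] gen[OF True y_left y_right] y_id by (simp add: mult.commute)
  next
    case False
    have "p \<circ> q \<noteq> x" if "p \<in> rowg" "q \<in> cols m" for p q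
      using False permutes_compose[OF cols_permutes[OF that(2)] rows_permutes[OF that(1)]] by blast
    then have "y x = 0" unfolding y_eq by (intro sum.neutral ballI) auto
    then show ?thesis using supp[OF False] by simp
  qed
qed

lemma gact_y: "gact m y w = (\<lambda>j. \<Sum>p\<in>rowg. \<Sum>q\<in>cols m. of_int (sign q) * w (j \<circ> p \<circ> q))"
proof
  fix j
  let ?S = "{s. s permutes {1..m}}"
  have "gact m y w j = (\<Sum>s\<in>?S. \<Sum>p\<in>rowg. \<Sum>q\<in>cols m. if p \<circ> q = s then of_int (sign q) * w (j \<circ> s) else 0)"
    unfolding gact_def y_eq by (simp add: sum_distrib_right if_distrib[of "\<lambda>x. x * _"] cong: if_cong)
  also have "\<dots> = (\<Sum>p\<in>rowg. \<Sum>q\<in>cols m. \<Sum>s\<in>?S. if p \<circ> q = s then of_int (sign q) * w (j \<circ> s) else 0)"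
    by (rule trans[OF sum.swap]) (intro sum.cong refl sum.swap)
  also have "\<dots> = (\<Sum>p\<in>rowg. \<Sum>q\<in>cols m. of_int (sign q) * w (j \<circ> p \<circ> q))"
  proof (intro sum.cong refl)
    fix p q assume "p \<in> rowg" "q \<in> cols m"
    then have "p \<circ> q \<in> ?S" using permutes_compose[OF cols_permutes rows_permutes] by blast
    then show "(\<Sum>s\<in>?S. if p \<circ> q = s then of_int (sign q) * w (j \<circ> s) else 0) = of_int (sign q) * w (j \<circ> p \<circ> q)"
      by (simp add: comp_assoc finite_permutations)
  qed
  finally show "gact m y w j = (\<Sum>p\<in>rowg. \<Sum>q\<in>cols m. of_int (sign q) * w (j \<circ> p \<circ> q))" .
qed

lemma row_comp_rows:
  assumes "p \<in> rowg"
  shows "row \<circ> p = row"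
proof
  fix l
  show "(row \<circ> p) l = row l"
    using assms permutes_not_in[OF rows_permutes[OF assms], of l] by (cases "l \<in> {1..m}") (auto simp: rows_iff)
qed

text \<open>The left side inherits both symmetries of \<open>y\<close>: the left one by centrality,
  the right one because left and right translations commute. Hence it is a multiple of
  \<open>y\<close>. The factor is found by applying both sides to a tensor and evaluating at the
  index \<open>row\<close> with \<open>esym_fcol\<close>.\<close>

lemma esym_symmetrizer:
  "app (esym lr.jm r m) y = (\<lambda>s. esym content r m * y s)"
proof -
  let ?g = "app (esym lr.jm r m) y"
  \<comment> \<open>\<open>esym_intertwine\<close> with the zero map for \<open>\<phi>\<close> says
    just that a set closed under left translations and sums is preserved.\<close>
  have closed: "?g \<in> K" if "\<And>v p. v \<in> K \<Longrightarrow> p permutes {1..m} \<Longrightarrow> left_transl p v \<in> K"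
    "(\<lambda>_. 0) \<in> K" "\<And>v u. v \<in> K \<Longrightarrow> u \<in> K \<Longrightarrow> (\<lambda>s. v s + u s) \<in> K" "y \<in> K" for K
  proof -
    have "?g \<in> K \<and> (\<lambda>_ _. 0) ?g = app (esym pr.jm r m) ((\<lambda>_ _. 0) y)"
      by (rule esym_intertwine, erule (1) that(1), rule that(2), erule (1) that(3), simp, simp, simp, rule order_refl, rule that(4))
    then show ?thesis by blast
  qed
  have left: "left_transl p ?g = ?g" if p: "p \<in> rowg" for p
  proof -
    have "left_transl p ?g = app (lt_op p * esym lr.jm r m) y" by (simp add: app_simps app_lt_op)
    also have "\<dots> = app (esym lr.jm r m) (left_transl p y)"
      unfolding lr.esym_jm_central[OF rows_permutes[OF p]] by (simp add: app_simps app_lt_op)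
    finally show ?thesis unfolding y_left[OF p] .
  qed
  have right: "?g (s \<circ> q) = of_int (sign q) * ?g s" if q: "q \<in> cols m" for q s
  proof -
    have "?g \<in> {v. \<forall>s. v (s \<circ> q) = of_int (sign q) * v s}"
      by (rule closed) (use y_right[OF q] in \<open>auto simp: left_transl_def comp_assoc[symmetric] distrib_left\<close>)
    then show ?thesis by blast
  qed
  have supp: "?g s = 0" if s: "\<not> s permutes {1..m}" for s
  proof -
    have "?g \<in> {v. \<forall>s. \<not> s permutes {1..m} \<longrightarrow> v s = 0}"
    proof (rule closed)
      fix v p assume v: "v \<in> {v. \<forall>s. \<not> s permutes {1..m} \<longrightarrow> v s = (0 :: complex)}" and p: "p permutes {1..m}"
      have "s permutes {1..m}" if "Hilbert_Choice.inv p \<circ> s permutes {1..m}" for s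
        using permutes_compose[OF that p] inv_comp(2)[OF p, of s] by simp
      then show "left_transl p v \<in> {v. \<forall>s. \<not> s permutes {1..m} \<longrightarrow> v s = 0}"
        using v unfolding left_transl_def mem_Collect_eq by blast
    next
      have "y s = 0" if "\<not> s permutes {1..m}" for s
      proof -
        have "p \<circ> q \<noteq> s" if "p \<in> rowg" "q \<in> cols m" for p q
          using \<open>\<not> s permutes {1..m}\<close> permutes_compose[OF cols_permutes[OF that(2)] rows_permutes[OF that(1)]] by blast
        then show ?thesis unfolding y_eq by (intro sum.neutral ballI) auto
      qed
      then show "y \<in> {v. \<forall>s. \<not> s permutes {1..m} \<longrightarrow> v s = 0}" by blast
    qed auto
    then show ?thesis using s by blast
  qed
  have g: "?g = (\<lambda>s. ?g id * y s)" by (rule symmetrizer_unique[OF left right supp])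
  \<comment> \<open>Each box labelled by its row; the antisymmetrization over columns is then
    \<open>fcol m\<close>.\<close>
  define T0 :: tensor where "T0 j = (if \<forall>l\<in>{1..m}. j l = row l then 1 else 0)" for j
  have f: "(\<Sum>q\<in>cols m. of_int (sign q) * T0 (i \<circ> q)) = fcol m i" for i
    unfolding fcol_def
  proof (rule sum.reindex_bij_witness[of _ Hilbert_Choice.inv Hilbert_Choice.inv])
    fix q assume q: "q \<in> cols m"
    note qp = cols_permutes[OF q]
    show "Hilbert_Choice.inv (Hilbert_Choice.inv q) = q" using permutes_inv_inv[OF qp] .
    then show "Hilbert_Choice.inv (Hilbert_Choice.inv q) = q" .
    show "Hilbert_Choice.inv q \<in> cols m" by (rule cols_inv[OF q])
    then show "Hilbert_Choice.inv q \<in> cols m" .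
    have "(\<forall>l\<in>{1..m}. i l = row (Hilbert_Choice.inv q l)) \<longleftrightarrow> (\<forall>l\<in>{1..m}. (i \<circ> q) l = row l)"
    proof
      assume *: "\<forall>l\<in>{1..m}. i l = row (Hilbert_Choice.inv q l)"
      show "\<forall>l\<in>{1..m}. (i \<circ> q) l = row l"
      proof
        fix l assume "l \<in> {1..m}"
        then have "q l \<in> {1..m}" by (simp only: permutes_in_image[OF qp])
        from bspec[OF * this] show "(i \<circ> q) l = row l" using permutes_inverses(2)[OF qp] by simp
      qed
    next
      assume *: "\<forall>l\<in>{1..m}. (i \<circ> q) l = row l"
      show "\<forall>l\<in>{1..m}. i l = row (Hilbert_Choice.inv q l)"
      proof
        fix l assume "l \<in> {1..m}"
        then have "Hilbert_Choice.inv q l \<in> {1..m}" by (simp only: permutes_in_image[OF permutes_inv[OF qp]])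
        from bspec[OF * this] show "i l = row (Hilbert_Choice.inv q l)" using permutes_inverses(1)[OF qp] by simp
      qed
    qed
    then show "of_int (sign (Hilbert_Choice.inv q)) * (if \<forall>l\<in>{1..m}. i l = row (Hilbert_Choice.inv q l) then 1 else 0)
      = of_int (sign q) * T0 (i \<circ> q)"
      unfolding T0_def sign_inv_cols[OF q] by simp
  qed
  have \<phi>y: "gact m y T0 = (\<lambda>j. \<Sum>p\<in>rowg. app (perm_op p) (fcol m) j)"
    unfolding gact_y f by (simp add: perm_op.rep_eq)
  have "gact m ?g T0 = app (esym pr.jm r m) (gact m y T0)"
  proof -
    have "?g \<in> UNIV \<and> (\<lambda>v. gact m v T0) ?g = app (esym pr.jm r m) ((\<lambda>v. gact m v T0) y)"
    proof (rule esym_intertwine)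
      show "gact m (\<lambda>s. v s + u s) T0 = (\<lambda>j. gact m v T0 j + gact m u T0 j)" for v u
        using gact_linear[of m 1 v 1 u T0] by simp
      show "gact m (left_transl p v) T0 = (\<lambda>j. gact m v T0 (j \<circ> p))" if "p permutes {1..m}" for v p
        by (rule gact_left_transl[OF that])
    qed (simp_all add: gact_def)
    then show ?thesis by simp
  qed
  moreover have "gact m ?g T0 row = ?g id * of_nat (card rowg)"
  proof -
    have "gact m ?g T0 row = ?g id * gact m y T0 row"
      by (subst g) (simp add: gact_def sum_distrib_left mult.assoc)
    moreover have "fcol m row = 1" using esym_fcol[of m 0] by (simp add: app_simps)
    then have "gact m y T0 row = of_nat (card rowg)"
      unfolding \<phi>y by (simp add: perm_op.rep_eq row_comp_rows)
    ultimately show ?thesis by simp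
  qed
  moreover have "app (esym pr.jm r m) (gact m y T0) row = of_nat (card rowg) * esym content r m"
  proof -
    have "app (esym pr.jm r m) (app (perm_op p) (fcol m)) row = esym content r m" if p: "p \<in> rowg" for p
    proof -
      have "app (esym pr.jm r m) (app (perm_op p) (fcol m)) = app (perm_op p) (app (esym pr.jm r m) (fcol m))"
      proof -
        have "app (perm_op p * esym pr.jm r m) (fcol m) = app (esym pr.jm r m * perm_op p) (fcol m)"
          unfolding pr.esym_jm_central[OF rows_permutes[OF p]] ..
        then show ?thesis unfolding times_tensor_op.rep_eq by (simp only: comp_apply)
      qed
      then show ?thesis using esym_fcol[of m r] row_comp_rows[OF p] by (simp add: perm_op.rep_eq)
    qed
    then show ?thesis unfolding \<phi>y app_sum_arg by simp
  qed
  moreover have "card rowg \<noteq> 0" using id_rows by auto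
  ultimately have "?g id = esym content r m" by simp
  then show ?thesis using g by simp
qed

lemma y_specht: "y \<in> specht \<mu>"
proof -
  have "y = (\<lambda>s. \<Sum>p | p permutes {1..m}. (if p = id then 1 else 0) * left_transl p y s)"
    by (rule ext) (simp add: if_distrib[of "\<lambda>x. x * _"] permutes_id left_transl_def finite_permutations cong: if_cong)
  then show ?thesis unfolding specht_def mem_Collect_eq by (rule exI[of _ "\<lambda>p. if p = id then 1 else 0"])
qed

lemma specht_zero: "(\<lambda>_. 0) \<in> specht \<mu>"
  unfolding specht_def mem_Collect_eq by (rule exI[of _ "\<lambda>_. 0"]) simp

lemma specht_add:
  assumes "u \<in> specht \<mu>" "v \<in> specht \<mu>"
  shows "(\<lambda>s. u s + v s) \<in> specht \<mu>"
proof -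
  obtain a b where "u = (\<lambda>s. \<Sum>p | p permutes {1..m}. a p * left_transl p y s)"
    "v = (\<lambda>s. \<Sum>p | p permutes {1..m}. b p * left_transl p y s)"
    using assms by (auto simp: specht_def)
  then have "(\<lambda>s. u s + v s) = (\<lambda>s. \<Sum>p | p permutes {1..m}. (a p + b p) * left_transl p y s)"
    by (simp add: sum.distrib distrib_right)
  then show ?thesis unfolding specht_def mem_Collect_eq by (rule exI[of _ "\<lambda>p. a p + b p"])
qed

lemma esym_specht:
  assumes "v \<in> specht \<mu>"
  shows "app (esym lr.jm r m) v = (\<lambda>s. esym content r m * v s)"
proof -
  obtain a where v: "v = (\<lambda>s. \<Sum>p | p permutes {1..m}. a p * left_transl p y s)"
    using assms by (auto simp: specht_def)
  have base: "app (esym lr.jm r m) (left_transl p y) = (\<lambda>s. esym content r m * left_transl p y s)"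
    if "p permutes {1..m}" for p
  proof -
    have "app (lt_op p * esym lr.jm r m) y = app (esym lr.jm r m * lt_op p) y"
      unfolding lr.esym_jm_central[OF that] ..
    then have "app (esym lr.jm r m) (left_transl p y) = app (lt_op p) (app (esym lr.jm r m) y)"
      by (simp add: app_simps app_lt_op)
    then show ?thesis unfolding esym_symmetrizer app_scale_arg app_lt_op .
  qed
  have "app (esym lr.jm r m) v = (\<lambda>s. \<Sum>p | p permutes {1..m}. a p * app (esym lr.jm r m) (left_transl p y) s)"
    unfolding v app_sum_arg app_scale_arg ..
  also have "\<dots> = (\<lambda>s. \<Sum>p | p permutes {1..m}. esym content r m * (a p * left_transl p y s))"
    by (intro ext sum.cong refl) (simp add: base)
  also have "\<dots> = (\<lambda>s. esym content r m * v s)"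
    unfolding v sum_distrib_left ..
  finally show ?thesis .
qed

end

section \<open>Symmetric functions of Jucys-Murphy elements on traceless tensors\<close>

context orth_ops
begin

lemma traceless_perm:
  assumes p: "p permutes {1..n}" and t: "t \<in> traceless n N"
  shows "(\<lambda>j. t (j \<circ> p)) \<in> traceless n N"
  unfolding traceless_iff
proof (intro conjI ballI impI)
  show "(\<lambda>j. t (j \<circ> p)) \<in> tensors n N" by (rule tensors_comp[OF p traceless_tensors[OF t]])
  fix k l j assume kl: "k \<in> {1..n}" "l \<in> {1..n}" "k \<noteq> l" and j: "j \<in> multi_indices n N" "j k = j l"
  let ?i = "Hilbert_Choice.inv p"
  have ip: "p (?i k) = k" "p (?i l) = l" using permutes_inverses(1)[OF p] by auto
  have upd: "j(k := a, l := a) \<circ> p = (j \<circ> p)(?i k := a, ?i l := a)" for a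
    using ip permutes_inj[OF p] by (auto simp: fun_eq_iff inj_eq permutes_inverses(2)[OF p])
  have "?i k \<in> {1..n}" "?i l \<in> {1..n}" using kl(1,2) by (simp_all only: permutes_in_image[OF permutes_inv[OF p]])
  moreover have "?i k \<noteq> ?i l" using ip kl(3) by metis
  moreover have "(j \<circ> p) (?i k) = (j \<circ> p) (?i l)" using ip j by simp
  moreover have "j \<circ> p \<in> multi_indices n N" using j multi_indices_permute[OF p] by simp
  ultimately show "(\<Sum>a<N. t (j(k := a, l := a) \<circ> p)) = 0"
    using t unfolding traceless_iff upd by blast
qed

text \<open>Contractions vanish on traceless tensors, so only the swaps in x_k are left. The result
  is again traceless, which allows products to be treated factor by factor.\<close>

lemma jm_op_traceless:
  assumes w: "w \<in> traceless n N" and k: "1 \<le> k" "k \<le> n"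
  shows "app (jm_op k) w = app (pr.jm k) w" "app (pr.jm k) w \<in> traceless n N"
proof -
  have wT: "w \<in> tensors n N" by (rule traceless_tensors[OF w])
  have ct0: "app (op.ct k l) w = (\<lambda>_. 0)" if "l \<in> {1..<k}" for l
  proof -
    have "brauer_act n N (bar_transpos n k l) w = (\<lambda>_. 0)"
      using w that k by (auto simp: traceless_def)
    then show ?thesis using bar_transpos_act_op[of k n l w] wT that k by simp
  qed
  have sw1: "app (op.sw k l) w = (\<lambda>j. w (j \<circ> Transposition.transpose l k))" if "l \<in> {1..<k}" for l
    using sw_act[of k n l w] wT that k by (simp add: transpose_commute)
  have "jm_op k = (\<Sum>l=1..<k. op.sw k l - op.ct k l)" by (simp add: jm_op_def op.X_def)
  then show eq: "app (jm_op k) w = app (pr.jm k) w"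
    unfolding pr.jm_def by (auto simp: app_sum app_simps ct0 sw1 perm_op.rep_eq fun_eq_iff intro!: sum.cong)
  have tl: "(\<lambda>j. \<Sum>l\<in>L. w (j \<circ> Transposition.transpose l k)) \<in> traceless n N" if "L \<subseteq> {1..<k}" for L
  proof -
    have "finite L" using that by (rule finite_subset) simp
    then show ?thesis using that
    proof (induction L)
      case empty
      then show ?case using traceless_linear[OF w w, of 0 0] by simp
    next
      case (insert l L)
      have "Transposition.transpose l k permutes {1..n}" by (rule permutes_swap_id) (use insert.prems k in auto)
      then have "(\<lambda>j. w (j \<circ> Transposition.transpose l k)) \<in> traceless n N" by (rule traceless_perm[OF _ w])
      moreover have "(\<lambda>j. \<Sum>l\<in>L. w (j \<circ> Transposition.transpose l k)) \<in> traceless n N"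
        using insert.IH insert.prems by (simp only: insert_subset)
      ultimately show ?case using traceless_linear[of "\<lambda>j. w (j \<circ> Transposition.transpose l k)" n N
          "\<lambda>j. \<Sum>l\<in>L. w (j \<circ> Transposition.transpose l k)" 1 1] insert.hyps by (simp add: comp_def)
    qed
  qed
  have "app (pr.jm k) w = (\<lambda>j. \<Sum>l\<in>{1..<k}. w (j \<circ> Transposition.transpose l k))"
    unfolding pr.jm_def by (simp add: app_sum_fun perm_op.rep_eq)
  then show "app (pr.jm k) w \<in> traceless n N" using tl[of "{1..<k}"] by simp
qed

lemma esym_jm_op_traceless:
  assumes "w \<in> traceless n N" "k \<le> n"
  shows "app (esym jm_op r k) w = app (esym pr.jm r k) w"
  using assms
proof (induction k arbitrary: r w)
  case 0
  then show ?case by (cases r) simp_all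
next
  case (Suc k)
  have J: "app (jm_op (Suc k)) w = app (pr.jm (Suc k)) w" "app (pr.jm (Suc k)) w \<in> traceless n N"
    by (rule jm_op_traceless[OF Suc.prems(1)]; use Suc.prems in simp)+
  show ?case
  proof (cases r)
    case 0
    then show ?thesis by simp
  next
    case r: (Suc r')
    have "app (esym jm_op (Suc r') k) w = app (esym pr.jm (Suc r') k) w"
      by (rule Suc.IH[OF Suc.prems(1)]) (use Suc.prems in simp)
    moreover have "app (esym jm_op r' k) (app (pr.jm (Suc k)) w) = app (esym pr.jm r' k) (app (pr.jm (Suc k)) w)"
      by (rule Suc.IH[OF J(2)]) (use Suc.prems in simp)
    ultimately show ?thesis
      using J(1) by (simp add: r plus_tensor_op.rep_eq times_tensor_op.rep_eq)
  qed
qed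

text \<open>The symmetric functions are moved through the equivariant map \<open>\<phi>\<close> to
  the Specht module, where they are scalars.\<close>

lemma esym_weyl:
  assumes y: "young_diagram \<mu>" and \<phi>: "\<phi> \<in> weyl_module \<mu> N" and v: "v \<in> specht \<mu>"
  shows "app (esym jm_op r (card \<mu>)) (\<phi> v) = (\<lambda>j. esym (young.content \<mu>) r (card \<mu>) * \<phi> v j)"
proof -
  interpret young \<mu> by unfold_locales (rule y)
  have z: "\<phi> (\<lambda>_. 0) = (\<lambda>_. 0)"
    using weyl_moduleD(3)[OF \<phi> specht_zero specht_zero, of 0 0] by simp
  have "app (esym jm_op r m) (\<phi> v) = app (esym pr.jm r m) (\<phi> v)"
    by (rule esym_jm_op_traceless[OF weyl_moduleD(1)[OF \<phi> v]]) simp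
  also have "\<dots> = \<phi> (app (esym lr.jm r m) v)"
  proof -
    have "app (esym lr.jm r m) v \<in> specht \<mu> \<and> \<phi> (app (esym lr.jm r m) v) = app (esym pr.jm r m) (\<phi> v)"
    proof (rule esym_intertwine)
      show "\<phi> (\<lambda>s. v s + u s) = (\<lambda>j. \<phi> v j + \<phi> u j)" if "v \<in> specht \<mu>" "u \<in> specht \<mu>" for v u
        using weyl_moduleD(3)[OF \<phi> that, of 1 1] by simp
    qed (use v z specht_zero specht_add specht_transl weyl_moduleD(4)[OF \<phi>] in \<open>auto simp: comp_def\<close>)
    then show ?thesis by simp
  qed
  also have "\<dots> = (\<lambda>j. esym content r m * \<phi> v j)"
    unfolding esym_specht[OF v] using weyl_moduleD(3)[OF \<phi> v v, of "esym content r m" 0] by simp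
  finally show ?thesis .
qed

end

section \<open>Nonvanishing of the modules\<close>

text \<open>For \<open>r < N\<close> these vectors are isotropic, and each of them pairs nontrivially only with the
  vector of the opposite index \<open>N - 1 - r\<close>.\<close>

definition eps :: "nat \<Rightarrow> nat \<Rightarrow> nat \<Rightarrow> complex" where
  "eps N r x = (if x = r then 1 else 0) + \<i> * (if x = N - 1 - r then 1 else 0)"

text \<open>For odd N the middle vector is 1 + i times a basis vector and opposite to itself; its
  pairing (1 + i)^2 = 2 i fits the same formula.\<close>

lemma eps_pair:
  assumes "r < N" "s < N"
  shows "(\<Sum>x<N. eps N r x * eps N s x) = (if s = N - 1 - r then 2 * \<i> else 0)"
proof -
  define d where "d a x = (if x = a then 1 else (0 :: complex))" for a x :: nat
  have dd: "(\<Sum>x<N. d a x * d b x) = (if a = b then 1 else 0)" if "a < N" for a b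
  proof -
    have "(\<Sum>x<N. d a x * d b x) = (\<Sum>x<N. if x = a then (if a = b then 1 else 0) else 0)"
      by (intro sum.cong refl) (simp add: d_def)
    then show ?thesis using that by simp
  qed
  let ?r = "N - 1 - r" and ?s = "N - 1 - s"
  have "eps N r x * eps N s x = d r x * d s x + \<i> * (d r x * d ?s x) + \<i> * (d ?r x * d s x) - d ?r x * d ?s x" for x
  proof -
    have e: "eps N a x = d a x + \<i> * d (N - 1 - a) x" for a by (simp add: eps_def d_def)
    show ?thesis unfolding e by (simp add: algebra_simps)
  qed
  then have "(\<Sum>x<N. eps N r x * eps N s x) = (\<Sum>x<N. d r x * d s x) + \<i> * (\<Sum>x<N. d r x * d ?s x)
    + \<i> * (\<Sum>x<N. d ?r x * d s x) - (\<Sum>x<N. d ?r x * d ?s x)"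
    by (simp only: sum.distrib sum_subtractf sum_distrib_left)
  also have "\<dots> = (if r = s then 1 else 0) + \<i> * (if r = ?s then 1 else 0) + \<i> * (if ?r = s then 1 else 0)
    - (if ?r = ?s then 1 else 0)"
    using assms by (simp only: dd)
  also have "\<dots> = (if s = N - 1 - r then 2 * \<i> else 0)"
  proof -
    have "r = ?s \<longleftrightarrow> s = ?r" "?r = s \<longleftrightarrow> s = ?r" "?r = ?s \<longleftrightarrow> r = s" using assms by auto
    then show ?thesis by (simp only: ) auto
  qed
  finally show ?thesis .
qed

lemma traceless_sum:
  assumes "finite S" "\<And>s. s \<in> S \<Longrightarrow> t s \<in> traceless n N"
  shows "(\<lambda>j. \<Sum>s\<in>S. c s * t s j) \<in> traceless n N"
  using assms
proof (induction S)
  case empty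
  then show ?case by (simp add: traceless_iff tensors_def)
next
  case (insert s S)
  have "(\<lambda>j. \<Sum>s\<in>S. c s * t s j) \<in> traceless n N" using insert.IH insert.prems by simp
  then have "(\<lambda>j. c s * t s j + 1 * (\<Sum>s\<in>S. c s * t s j)) \<in> traceless n N"
    by (intro traceless_linear insert.prems) auto
  then show ?case using insert.hyps by simp
qed

lemma upd_comp:
  assumes p: "p permutes S"
  shows "j(k := a, l := b) \<circ> p = (j \<circ> p)(Hilbert_Choice.inv p k := a, Hilbert_Choice.inv p l := b)"
proof
  fix x
  have "p x = k \<longleftrightarrow> x = Hilbert_Choice.inv p k" for k using permutes_inverses[OF p] by metis
  then show "(j(k := a, l := b) \<circ> p) x = ((j \<circ> p)(Hilbert_Choice.inv p k := a, Hilbert_Choice.inv p l := b)) x"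
    by simp
qed

context young
begin

lemma specht_linear:
  assumes "u \<in> specht \<mu>" "v \<in> specht \<mu>"
  shows "(\<lambda>s. a * u s + b * v s) \<in> specht \<mu>"
proof -
  obtain c d where e: "u = (\<lambda>s. \<Sum>p | p permutes {1..m}. c p * left_transl p y s)"
    "v = (\<lambda>s. \<Sum>p | p permutes {1..m}. d p * left_transl p y s)"
    using assms by (auto simp: specht_def)
  have "(\<lambda>s. a * u s + b * v s) = (\<lambda>s. \<Sum>p | p permutes {1..m}. (a * c p + b * d p) * left_transl p y s)"
    unfolding e by (rule ext) (simp add: sum.distrib sum_distrib_left distrib_right mult.assoc)
  then show ?thesis unfolding specht_def mem_Collect_eq by (rule exI[of _ "\<lambda>p. a * c p + b * d p"])
qed

end

section \<open>A nonzero element of the module U\<close>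

locale orth_young = young +
  fixes N :: nat
  assumes N1: "N \<ge> 1" and two_cols: "card {x \<in> \<mu>. snd x \<le> 2} \<le> N"
begin

text \<open>The column segments above the boxes k and l, moved left to columns 1 and 2, stay in the
  diagram. This is where the bound on the first two columns enters.\<close>

lemma rows_two_cols:
  assumes k: "k \<in> {1..m}" and l: "l \<in> {1..m}" and c: "col k < col l"
  shows "row k + row l \<le> N"
proof -
  have kl: "(row k, col k) \<in> \<mu>" "(row l, col l) \<in> \<mu>" using box_mem[OF k] box_mem[OF l] by (simp_all add: row_def col_def)
  have "{1..row k} \<times> {1} \<union> {1..row l} \<times> {2} \<subseteq> {x \<in> \<mu>. snd x \<le> 2}"
    using young_down[OF kl(1)] young_down[OF kl(2)] row_col_pos[OF k] c by auto
  then have "card ({1..row k} \<times> {1} \<union> {1..row l} \<times> {2 :: nat}) \<le> card {x \<in> \<mu>. snd x \<le> 2}"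
    using fin by (intro card_mono) auto
  moreover have "card ({1..row k} \<times> {1} \<union> {1..row l} \<times> {2 :: nat}) = row k + row l"
    by (subst card_Un_disjoint) (auto simp: card_cartesian_product)
  ultimately show ?thesis using two_cols by simp
qed

lemma row_le:
  assumes k: "k \<in> {1..m}"
  shows "row k \<le> N"
proof -
  have kl: "(row k, col k) \<in> \<mu>" using box_mem[OF k] by (simp add: row_def col_def)
  have "{1..row k} \<times> {1} \<subseteq> {x \<in> \<mu>. snd x \<le> 2}"
    using young_down[OF kl] row_col_pos[OF k] by auto
  then have "card ({1..row k} \<times> {1 :: nat}) \<le> card {x \<in> \<mu>. snd x \<le> 2}"
    using fin by (intro card_mono) auto
  then show ?thesis using two_cols by (simp add: card_cartesian_product)
qed

text \<open>A product of the vectors \<open>eps\<close>, chosen by the row of each box and counted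
  from 0. Vectors of rows r and s pair to 0 unless r + s = N + 1.\<close>

definition T :: tensor where
  "T i = (if i \<in> multi_indices m N then \<Prod>l=1..m. eps N (row l - 1) (i l) else 0)"

definition bT :: tensor where
  "bT j = (\<Sum>q\<in>cols m. of_int (sign q) * T (j \<circ> q))"

lemma T_contract:
  assumes kl: "k \<in> {1..m}" "l \<in> {1..m}" "k \<noteq> l" "row k + row l \<le> N" and i: "i \<in> multi_indices m N"
  shows "(\<Sum>a<N. T (i(k := a, l := a))) = 0"
proof -
  let ?r = "\<Prod>x\<in>{1..m} - {k} - {l}. eps N (row x - 1) (i x)"
  have "T (i(k := a, l := a)) = eps N (row k - 1) a * eps N (row l - 1) a * ?r" if a: "a < N" for a
  proof -
    let ?i = "i(k := a, l := a)"
    have ik: "?i k = a" "?i l = a" using kl(3) by simp_all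
    have "?i \<in> multi_indices m N" using multi_indices_upd[OF multi_indices_upd[OF i kl(1) a] kl(2) a] .
    then have "T ?i = (\<Prod>x=1..m. eps N (row x - 1) (?i x))" by (simp add: T_def)
    also have "\<dots> = eps N (row k - 1) (?i k) * (\<Prod>x\<in>{1..m} - {k}. eps N (row x - 1) (?i x))"
      by (rule prod.remove) (use kl in auto)
    also have "(\<Prod>x\<in>{1..m} - {k}. eps N (row x - 1) (?i x))
      = eps N (row l - 1) (?i l) * (\<Prod>x\<in>{1..m} - {k} - {l}. eps N (row x - 1) (?i x))"
      by (rule prod.remove) (use kl in auto)
    also have "(\<Prod>x\<in>{1..m} - {k} - {l}. eps N (row x - 1) (?i x)) = ?r" by (intro prod.cong) auto
    finally show ?thesis unfolding ik by (simp only: mult.assoc)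
  qed
  then have "(\<Sum>a<N. T (i(k := a, l := a))) = (\<Sum>a<N. eps N (row k - 1) a * eps N (row l - 1) a) * ?r"
    unfolding sum_distrib_right by (intro sum.cong) auto
  also have "(\<Sum>a<N. eps N (row k - 1) a * eps N (row l - 1) a) = 0"
  proof -
    have "row k - 1 < N" "row l - 1 < N" "row l - 1 \<noteq> N - 1 - (row k - 1)"
      using row_col_pos[OF kl(1)] row_col_pos[OF kl(2)] kl(4) by arith+
    then show ?thesis using eps_pair[of "row k - 1" N "row l - 1"] by simp
  qed
  finally show ?thesis unfolding mult_zero_left .
qed

text \<open>Two boxes of one column contract to 0 by antisymmetry. For two boxes of different
  columns, column permutations keep them in these columns, and their rows add up to at most N, so
  the vectors pair to 0.\<close>

lemma bT_traceless: "bT \<in> traceless m N"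
  unfolding traceless_iff
proof (intro conjI ballI impI)
  show "bT \<in> tensors m N"
    unfolding tensors_def
  proof (intro CollectI allI impI)
    fix j assume "j \<notin> multi_indices m N"
    then have "T (j \<circ> q) = 0" if "q \<in> cols m" for q
      using multi_indices_permute[OF cols_permutes[OF that]] by (simp add: T_def)
    then show "bT j = 0" by (simp add: bT_def)
  qed
  fix k l j assume kl: "k \<in> {1..m}" "l \<in> {1..m}" "k \<noteq> l" and j: "j \<in> multi_indices m N" "j k = j l"
  show "(\<Sum>a<N. bT (j(k := a, l := a))) = 0"
  proof (cases "col k = col l")
    case True
    let ?\<tau> = "Transposition.transpose k l"
    have \<tau>: "?\<tau> \<in> cols m" using cols_transpose[OF kl(1,2) True id_cols] by simp
    have "bT (j(k := a, l := a)) = 0" for a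
    proof -
      let ?j = "j(k := a, l := a)"
      have j\<tau>: "?j \<circ> ?\<tau> = ?j" by (auto simp: fun_eq_iff Transposition.transpose_def)
      have "bT ?j = (\<Sum>q\<in>cols m. - (of_int (sign q) * T (?j \<circ> q)))"
        unfolding bT_def
      proof (rule sum.reindex_bij_witness[of _ "\<lambda>q. ?\<tau> \<circ> q" "\<lambda>q. ?\<tau> \<circ> q"])
        fix q assume q: "q \<in> cols m"
        show "?\<tau> \<circ> (?\<tau> \<circ> q) = q" by (simp add: comp_assoc[symmetric])
        then show "?\<tau> \<circ> (?\<tau> \<circ> q) = q" .
        show "?\<tau> \<circ> q \<in> cols m" by (rule cols_comp[OF \<tau> q])
        then show "?\<tau> \<circ> q \<in> cols m" .
        have "sign (?\<tau> \<circ> q) = - sign q"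
          using sign_comp_permutes[OF cols_permutes[OF \<tau>] cols_permutes[OF q]] kl(3) by (simp add: sign_swap_id)
        moreover have "?j \<circ> (?\<tau> \<circ> q) = ?j \<circ> q" by (simp only: comp_assoc[symmetric] j\<tau>)
        ultimately show "- (of_int (sign (?\<tau> \<circ> q)) * T (?j \<circ> (?\<tau> \<circ> q))) = of_int (sign q) * T (?j \<circ> q)" by simp
      qed
      then have "bT ?j = - bT ?j" by (simp add: bT_def sum_negf)
      then show ?thesis by simp
    qed
    then show ?thesis by simp
  next
    case False
    have "(\<Sum>a<N. T (j(k := a, l := a) \<circ> q)) = 0" if q: "q \<in> cols m" for q
    proof -
      note qp = cols_permutes[OF q]
      let ?k = "Hilbert_Choice.inv q k" and ?l = "Hilbert_Choice.inv q l"
      have kl': "?k \<in> {1..m}" "?l \<in> {1..m}" using kl(1,2) by (simp_all only: permutes_in_image[OF permutes_inv[OF qp]])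
      have c: "col ?k = col k" "col ?l = col l" using cols_inv[OF q] kl(1,2) by (simp_all add: cols_def)
      have ne: "?k \<noteq> ?l" using c False by auto
      have "row ?k + row ?l \<le> N"
        using rows_two_cols[OF kl'] rows_two_cols[OF kl'(2,1)] c False by linarith
      moreover have "j \<circ> q \<in> multi_indices m N" using multi_indices_permute[OF qp] j by simp
      ultimately show ?thesis unfolding upd_comp[OF qp] by (intro T_contract kl' ne)
    qed
    then have "(\<Sum>q\<in>cols m. of_int (sign q) * (\<Sum>a<N. T (j(k := a, l := a) \<circ> q))) = 0" by simp
    then show ?thesis unfolding bT_def sum_distrib_left by (subst sum.swap)
  qed
qed

lemma gact_y_traceless: "gact m y T \<in> traceless m N"
proof -
  have "gact m y T = (\<lambda>j. \<Sum>p\<in>rowg. 1 * bT (j \<circ> p))" by (simp add: gact_y bT_def)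
  moreover have "(\<lambda>j. \<Sum>p\<in>rowg. 1 * bT (j \<circ> p)) \<in> traceless m N"
  proof (rule traceless_sum)
    interpret orth_ops N by unfold_locales (rule N1)
    show "(\<lambda>j. bT (j \<circ> p)) \<in> traceless m N" if "p \<in> rowg" for p
      by (rule traceless_perm[OF rows_permutes[OF that] bT_traceless])
  qed simp
  ultimately show ?thesis by simp
qed

definition \<phi>0 :: "gvec \<Rightarrow> tensor" where
  "\<phi>0 v = (if v \<in> specht \<mu> then gact m v T else (\<lambda>_. 0))"

lemma \<phi>0_weyl: "\<phi>0 \<in> weyl_module \<mu> N"
proof (rule weyl_moduleI)
  interpret orth_ops N by unfold_locales (rule N1)
  fix v assume v: "v \<in> specht \<mu>"
  then obtain a where va: "v = (\<lambda>s. \<Sum>p | p permutes {1..m}. a p * left_transl p y s)" by (auto simp: specht_def)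
  have "gact m v T = (\<lambda>j. \<Sum>p | p permutes {1..m}. a p * gact m (left_transl p y) T j)"
  proof
    fix j
    have "gact m v T j = (\<Sum>s | s permutes {1..m}. \<Sum>p | p permutes {1..m}. a p * (left_transl p y s * T (j \<circ> s)))"
      unfolding gact_def va by (simp add: sum_distrib_right mult.assoc)
    also have "\<dots> = (\<Sum>p | p permutes {1..m}. \<Sum>s | s permutes {1..m}. a p * (left_transl p y s * T (j \<circ> s)))"
      by (rule sum.swap)
    finally show "gact m v T j = (\<Sum>p | p permutes {1..m}. a p * gact m (left_transl p y) T j)"
      by (simp add: gact_def sum_distrib_left)
  qed
  moreover have "(\<lambda>j. \<Sum>p | p permutes {1..m}. a p * gact m (left_transl p y) T j) \<in> traceless m N"
  proof (rule traceless_sum)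
    show "gact m (left_transl p y) T \<in> traceless m N" if "p \<in> {p. p permutes {1..m}}" for p
      using that traceless_perm[OF _ gact_y_traceless, of p] by (simp add: gact_left_transl)
  qed (simp add: finite_permutations)
  ultimately show "\<phi>0 v \<in> traceless m N" using v by (simp add: \<phi>0_def)
  show "\<phi>0 (left_transl p v) = (\<lambda>j. \<phi>0 v (j \<circ> p))" if "p permutes {1..m}" for p
    using v specht_transl[OF v that] by (simp add: \<phi>0_def gact_left_transl[OF that])
  show "\<phi>0 (\<lambda>s. a * v s + b * w s) = (\<lambda>i. a * \<phi>0 v i + b * \<phi>0 w i)" if "w \<in> specht \<mu>" for w a b
    using v that specht_linear[OF v that, of a b] by (simp add: \<phi>0_def gact_linear)
qed (simp add: \<phi>0_def)

text \<open>Paired with the product of the opposite vectors, the term p q of the symmetrizer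
  survives only if p q preserves all rows, which means q = id. All surviving terms are equal, so
  nothing cancels.\<close>

lemma \<phi>0_nonzero: "\<phi>0 y \<noteq> (\<lambda>_. 0)"
proof
  assume z: "\<phi>0 y = (\<lambda>_. 0)"
  let ?M = "multi_indices m N"
  \<comment> \<open>N - row l = N - 1 - (row l - 1) is the index opposite to that used in
    \<open>T\<close>.\<close>
  define S where "S i = (\<Prod>l=1..m. eps N (N - row l) (i l))" for i :: "nat \<Rightarrow> nat"
  have pair: "(\<Sum>i\<in>?M. S i * T (i \<circ> (p \<circ> q))) = (if q = id then (2 * \<i>) ^ m else 0)"
    if p: "p \<in> rowg" and q: "q \<in> cols m" for p q
  proof -
    let ?\<sigma> = "p \<circ> q"
    define \<rho> where "\<rho> = Hilbert_Choice.inv ?\<sigma>"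
    have \<sigma>p: "?\<sigma> permutes {1..m}" by (rule permutes_compose[OF cols_permutes[OF q] rows_permutes[OF p]])
    have \<rho>p: "\<rho> permutes {1..m}" unfolding \<rho>_def by (rule permutes_inv[OF \<sigma>p])
    have \<rho>m: "\<rho> l \<in> {1..m}" if "l \<in> {1..m}" for l using that by (simp only: permutes_in_image[OF \<rho>p])
    have \<sigma>\<rho>: "?\<sigma> (\<rho> l) = l" for l unfolding \<rho>_def by (rule permutes_inverses(1)[OF \<sigma>p])
    have "S i * T (i \<circ> ?\<sigma>) = (\<Prod>l=1..m. eps N (N - row l) (i l) * eps N (row (\<rho> l) - 1) (i l))" if i: "i \<in> ?M" for i
    proof -
      have "T (i \<circ> ?\<sigma>) = (\<Prod>l=1..m. eps N (row l - 1) (i (?\<sigma> l)))"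
        using multi_indices_permute[OF \<sigma>p, of i N] i by (simp add: T_def)
      also have "\<dots> = (\<Prod>l=1..m. eps N (row (\<rho> l) - 1) (i (?\<sigma> (\<rho> l))))"
        using prod.permute[OF \<rho>p, of "\<lambda>l. eps N (row l - 1) (i (?\<sigma> l))"] by (simp only: comp_def)
      finally show ?thesis unfolding S_def \<sigma>\<rho> prod.distrib by simp
    qed
    then have "(\<Sum>i\<in>?M. S i * T (i \<circ> ?\<sigma>)) = (\<Sum>i\<in>?M. \<Prod>l=1..m. eps N (N - row l) (i l) * eps N (row (\<rho> l) - 1) (i l))"
      by (intro sum.cong) auto
    also have "\<dots> = (\<Prod>l=1..m. \<Sum>x<N. eps N (N - row l) x * eps N (row (\<rho> l) - 1) x)"
      unfolding multi_indices_def by (rule prod_sum_PiE[symmetric]) auto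
    also have "\<dots> = (\<Prod>l=1..m. if row (\<rho> l) = row l then 2 * \<i> else 0)"
    proof (intro prod.cong refl)
      fix l assume l: "l \<in> {1..m}"
      have b: "1 \<le> row l" "row l \<le> N" "1 \<le> row (\<rho> l)" "row (\<rho> l) \<le> N"
        using row_col_pos[OF l] row_col_pos[OF \<rho>m[OF l]] row_le[OF l] row_le[OF \<rho>m[OF l]] by auto
      then have "row (\<rho> l) - 1 = N - 1 - (N - row l) \<longleftrightarrow> row (\<rho> l) = row l" by auto
      then show "(\<Sum>x<N. eps N (N - row l) x * eps N (row (\<rho> l) - 1) x) = (if row (\<rho> l) = row l then 2 * \<i> else 0)"
        using eps_pair[of "N - row l" N "row (\<rho> l) - 1"] b by simp
    qed
    also have "\<dots> = (if \<forall>l\<in>{1..m}. row (\<rho> l) = row l then (2 * \<i>) ^ m else 0)"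
    proof (cases "\<forall>l\<in>{1..m}. row (\<rho> l) = row l")
      case True
      then have "(\<Prod>l=1..m. if row (\<rho> l) = row l then 2 * \<i> else 0) = (\<Prod>l=1..m. 2 * \<i>)" by (intro prod.cong) auto
      then show ?thesis using True by simp
    next
      case False
      then obtain l where "l \<in> {1..m}" "row (\<rho> l) \<noteq> row l" by blast
      then have "(\<Prod>l=1..m. if row (\<rho> l) = row l then 2 * \<i> else 0) = 0" by (intro prod_zero) auto
      then show ?thesis using False by (simp only: if_False)
    qed
    also have "(\<forall>l\<in>{1..m}. row (\<rho> l) = row l) \<longleftrightarrow> \<rho> \<in> rowg" using \<rho>p by (simp add: rows_iff)
    also have "\<rho> \<in> rowg \<longleftrightarrow> q = id"
    proof
      assume "\<rho> \<in> rowg"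
      from rows_inv[OF this] have "?\<sigma> \<in> rowg" unfolding \<rho>_def permutes_inv_inv[OF \<sigma>p] .
      from rows_comp[OF rows_inv[OF p] this] have "q \<in> rowg" unfolding inv_comp(1)[OF rows_permutes[OF p]] .
      from rows_cols_id[OF rows_inv[OF this] q] show "q = id" using permutes_inv_o(2)[OF cols_permutes[OF q]] by simp
    next
      assume "q = id"
      then show "\<rho> \<in> rowg" unfolding \<rho>_def using rows_inv[OF p] by simp
    qed
    finally show ?thesis .
  qed
  have "(\<Sum>i\<in>?M. S i * gact m y T i) = (\<Sum>i\<in>?M. \<Sum>p\<in>rowg. \<Sum>q\<in>cols m. of_int (sign q) * (S i * T (i \<circ> (p \<circ> q))))"
    unfolding gact_y sum_distrib_left by (intro sum.cong refl) (simp add: comp_assoc mult.left_commute)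
  also have "\<dots> = (\<Sum>p\<in>rowg. \<Sum>i\<in>?M. \<Sum>q\<in>cols m. of_int (sign q) * (S i * T (i \<circ> (p \<circ> q))))"
    by (rule sum.swap)
  also have "\<dots> = (\<Sum>p\<in>rowg. \<Sum>q\<in>cols m. of_int (sign q) * (\<Sum>i\<in>?M. S i * T (i \<circ> (p \<circ> q))))"
    unfolding sum_distrib_left by (intro sum.cong refl sum.swap)
  also have "\<dots> = (\<Sum>p\<in>rowg. \<Sum>q\<in>cols m. if q = id then (2 * \<i>) ^ m else 0)"
    by (intro sum.cong refl) (simp add: pair sign_id)
  also have "\<dots> = of_nat (card rowg) * (2 * \<i>) ^ m"
  proof -
    have "finite (cols m)" by (rule finite_cols)
    then have "(\<Sum>q\<in>cols m. if q = id then (2 * \<i>) ^ m else 0) = (2 * \<i>) ^ m" using id_cols by simp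
    then show ?thesis by simp
  qed
  finally have e: "(\<Sum>i\<in>?M. S i * gact m y T i) = of_nat (card rowg) * (2 * \<i>) ^ m" .
  have "card rowg \<noteq> 0" using id_rows finite_rows by (metis card_0_eq empty_iff)
  moreover have "gact m y T = (\<lambda>_. 0)" using z y_specht by (simp add: \<phi>0_def)
  ultimately show False using e by simp
qed

text \<open>Evaluation at the generator \<open>y\<close> of the Specht module is a G-homomorphism
  from U to the tensors of degree m; it does not vanish at \<open>\<phi>0\<close>.\<close>

lemma brauer_module_base:
  "(\<lambda>\<phi>. if \<phi> \<in> weyl_module \<mu> N then \<phi> y else (\<lambda>_. 0)) \<in> brauer_module \<mu> m N"
  unfolding brauer_module_def mem_Collect_eq
proof (intro conjI ballI allI impI)
  fix \<phi> assume "\<phi> \<in> weyl_module \<mu> N"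
  then show "(if \<phi> \<in> weyl_module \<mu> N then \<phi> y else (\<lambda>_. 0)) \<in> tensors m N"
    using weyl_moduleD(1)[OF _ y_specht] traceless_tensors by auto
next
  fix \<phi> \<psi> a b assume "\<phi> \<in> weyl_module \<mu> N" "\<psi> \<in> weyl_module \<mu> N"
  then show "(if (\<lambda>v i. a * \<phi> v i + b * \<psi> v i) \<in> weyl_module \<mu> N then \<lambda>i. a * \<phi> y i + b * \<psi> y i else (\<lambda>_. 0))
    = (\<lambda>i. a * (if \<phi> \<in> weyl_module \<mu> N then \<phi> y else (\<lambda>_. 0)) i + b * (if \<psi> \<in> weyl_module \<mu> N then \<psi> y else (\<lambda>_. 0)) i)"
    using weyl_module_linear by simp
next
  fix \<phi> g assume "\<phi> \<in> weyl_module \<mu> N" "g \<in> orthogonal_group N"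
  then show "(if (\<lambda>v. group_act m N g (\<phi> v)) \<in> weyl_module \<mu> N then group_act m N g (\<phi> y) else (\<lambda>_. 0))
    = group_act m N g (if \<phi> \<in> weyl_module \<mu> N then \<phi> y else (\<lambda>_. 0))"
    using weyl_module_group by simp
qed simp

end

text \<open>The tensor product with the invariant vector \<open>\<Sum>a. u(a) \<otimes> u(a)\<close>, in the last two factors.\<close>

definition om :: "nat \<Rightarrow> nat \<Rightarrow> tensor \<Rightarrow> tensor" where
  "om n N t = (\<lambda>j. if j \<in> multi_indices (n + 2) N \<and> j (n + 1) = j (n + 2)
     then t (j(n + 1 := undefined, n + 2 := undefined)) else 0)"

lemma multi_indices_extend:
  "i \<in> multi_indices n N \<Longrightarrow> a < N \<Longrightarrow> b < N \<Longrightarrow> i(n + 1 := a, n + 2 := b) \<in> multi_indices (n + 2) N"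
  "j \<in> multi_indices (n + 2) N \<Longrightarrow> j(n + 1 := undefined, n + 2 := undefined) \<in> multi_indices n N"
  "i \<in> multi_indices n N \<Longrightarrow> i(n + 1 := undefined, n + 2 := undefined) = i"
proof -
  have out: "x \<in> {1..n + 2} \<longleftrightarrow> x \<in> {1..n}" if "x \<noteq> n + 1" "x \<noteq> n + 2" for x
    using that by auto
  have in2: "n + 1 \<in> {1..n + 2}" "n + 2 \<in> {1..n + 2}" "n + 1 \<notin> {1..n}" "n + 2 \<notin> {1..n}" by auto
  show "i(n + 1 := a, n + 2 := b) \<in> multi_indices (n + 2) N" if i: "i \<in> multi_indices n N" and ab: "a < N" "b < N"
    unfolding multi_indices_iff
  proof
    fix x
    show "if x \<in> {1..n + 2} then (i(n + 1 := a, n + 2 := b)) x < N else (i(n + 1 := a, n + 2 := b)) x = undefined"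
      using spec[OF i[unfolded multi_indices_iff], of x] out[of x] in2 ab
      by (cases "x = n + 1"; cases "x = n + 2") (simp_all del: atLeastAtMost_iff)
  qed
  show "j(n + 1 := undefined, n + 2 := undefined) \<in> multi_indices n N" if j: "j \<in> multi_indices (n + 2) N"
    unfolding multi_indices_iff
  proof
    fix x
    show "if x \<in> {1..n} then (j(n + 1 := undefined, n + 2 := undefined)) x < N
      else (j(n + 1 := undefined, n + 2 := undefined)) x = undefined"
      using spec[OF j[unfolded multi_indices_iff], of x] out[of x] in2
      by (cases "x = n + 1"; cases "x = n + 2") (simp_all del: atLeastAtMost_iff)
  qed
  show "i(n + 1 := undefined, n + 2 := undefined) = i" if i: "i \<in> multi_indices n N"
  proof -
    have "i (n + 1) = undefined" "i (n + 2) = undefined" using i in2(3,4) unfolding multi_indices_iff by presburger+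
    then show ?thesis by (intro ext) simp
  qed
qed

text \<open>Invariance of the added vector is the orthonormality of the rows of g.\<close>

lemma om_group_act:
  assumes g: "g \<in> orthogonal_group N"
  shows "om n N (group_act n N g t) = group_act (n + 2) N g (om n N t)"
proof
  fix j
  let ?u = "undefined :: nat" and ?M = "\<lambda>n. multi_indices n N"
  show "om n N (group_act n N g t) j = group_act (n + 2) N g (om n N t) j"
  proof (cases "j \<in> ?M (n + 2)")
    case True
    let ?x = "j (n + 1)" and ?y = "j (n + 2)" and ?j = "j(n + 1 := ?u, n + 2 := ?u)"
    have xy: "?x < N" "?y < N" using multi_indices_less[OF True] by auto
    have gc: "g \<in> carrier_mat N N" "g * transpose_mat g = 1\<^sub>m N" using g by (auto simp: orthogonal_group_def)
    have orth: "(\<Sum>a<N. g $$ (?x, a) * g $$ (?y, a)) = (if ?x = ?y then 1 else 0)"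
    proof -
      have "(g * transpose_mat g) $$ (?x, ?y) = (\<Sum>a<N. g $$ (?x, a) * g $$ (?y, a))"
        using gc(1) xy by (simp add: scalar_prod_def atLeast0LessThan)
      then show ?thesis unfolding gc(2) using xy by simp
    qed
    let ?P = "\<lambda>i. \<Prod>m=1..n. g $$ (?j m, i m)"
    let ?S = "{i \<in> ?M (n + 2). i (n + 1) = i (n + 2)}"
    have fin: "finite (?M n)" for n unfolding multi_indices_def by (intro finite_PiE) auto
    have "group_act (n + 2) N g (om n N t) j = (\<Sum>i\<in>?M (n + 2). (\<Prod>m=1..n + 2. g $$ (j m, i m)) * om n N t i)"
      using True by (simp add: group_act_def)
    also have "\<dots> = (\<Sum>i\<in>?S. (\<Prod>m=1..n + 2. g $$ (j m, i m)) * om n N t i)"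
      by (rule sum.mono_neutral_right) (auto simp: fin om_def)
    also have "\<dots> = (\<Sum>(i, a)\<in>?M n \<times> {..<N}. (?P i * t i) * (g $$ (?x, a) * g $$ (?y, a)))"
    proof (rule sum.reindex_bij_witness[of _ "\<lambda>(i, a). i(n + 1 := a, n + 2 := a)" "\<lambda>i. (i(n + 1 := ?u, n + 2 := ?u), i (n + 1))"])
      fix i assume i: "i \<in> ?S"
      then have iM: "i \<in> ?M (n + 2)" and e: "i (n + 1) = i (n + 2)" by auto
      show "(case (i(n + 1 := ?u, n + 2 := ?u), i (n + 1)) of (i, a) \<Rightarrow> i(n + 1 := a, n + 2 := a)) = i"
        unfolding prod.case using e by (intro ext) simp
      show "(i(n + 1 := ?u, n + 2 := ?u), i (n + 1)) \<in> ?M n \<times> {..<N}"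
        using multi_indices_extend(2)[OF iM] multi_indices_less[OF iM, of "n + 1"] by simp
      have iv: "{1..n + 2} = insert (n + 2) (insert (n + 1) {1..n})" by auto
      have p1: "(\<Prod>m=1..n + 2. g $$ (j m, i m)) = g $$ (?y, i (n + 2)) * (g $$ (?x, i (n + 1)) * (\<Prod>m=1..n. g $$ (j m, i m)))"
        unfolding iv by (subst prod.insert; (subst prod.insert)?) auto
      have p2: "(\<Prod>m=1..n. g $$ (j m, i m)) = ?P (i(n + 1 := ?u, n + 2 := ?u))" by (intro prod.cong) auto
      have o: "om n N t i = t (i(n + 1 := ?u, n + 2 := ?u))" unfolding om_def using iM e by (simp only: if_True simp_thms)
      show "(case (i(n + 1 := ?u, n + 2 := ?u), i (n + 1)) of (i, a) \<Rightarrow> (?P i * t i) * (g $$ (?x, a) * g $$ (?y, a)))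
        = (\<Prod>m=1..n + 2. g $$ (j m, i m)) * om n N t i"
        unfolding prod.case p1 p2 o e[symmetric] by (simp only: mult_ac)
    next
      fix z assume "z \<in> ?M n \<times> {..<N}"
      then obtain i a where z: "z = (i, a)" "i \<in> ?M n" "a < N" by auto
      show "((case z of (i, a) \<Rightarrow> i(n + 1 := a, n + 2 := a))(n + 1 := ?u, n + 2 := ?u), (case z of (i, a) \<Rightarrow> i(n + 1 := a, n + 2 := a)) (n + 1)) = z"
      proof -
        have "(i(n + 1 := a, n + 2 := a))(n + 1 := ?u, n + 2 := ?u) = i(n + 1 := ?u, n + 2 := ?u)" by (intro ext) simp
        then show ?thesis unfolding z(1) prod.case multi_indices_extend(3)[OF z(2)] by simp
      qed
      show "(case z of (i, a) \<Rightarrow> i(n + 1 := a, n + 2 := a)) \<in> ?S"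
        using multi_indices_extend(1)[OF z(2,3,3)] z(1) by simp
    qed
    also have "\<dots> = (\<Sum>i\<in>?M n. ?P i * t i) * (\<Sum>a<N. g $$ (?x, a) * g $$ (?y, a))"
      unfolding sum_product sum.cartesian_product ..
    also have "\<dots> = om n N (group_act n N g t) j"
      unfolding orth using True multi_indices_extend(2)[OF True] by (simp add: om_def group_act_def)
    finally show ?thesis by simp
  qed (simp add: om_def group_act_def)
qed

lemma om_nonzero:
  assumes "N \<ge> 1" "t \<in> tensors n N" "t \<noteq> (\<lambda>_. 0)"
  shows "om n N t \<noteq> (\<lambda>_. 0)"
proof
  assume z: "om n N t = (\<lambda>_. 0)"
  obtain i where i: "t i \<noteq> 0" using assms(3) by auto
  then have iM: "i \<in> multi_indices n N" using tensors_outside[OF assms(2)] by blast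
  let ?j = "i(n + 1 := 0, n + 2 := 0)"
  have "?j \<in> multi_indices (n + 2) N" using multi_indices_extend(1)[OF iM] assms(1) by simp
  moreover have "?j(n + 1 := undefined, n + 2 := undefined) = i"
  proof -
    have "?j(n + 1 := undefined, n + 2 := undefined) = i(n + 1 := undefined, n + 2 := undefined)" by (intro ext) simp
    then show ?thesis unfolding multi_indices_extend(3)[OF iM] .
  qed
  ultimately have "om n N t ?j = t i" by (simp add: om_def)
  then show False using z i by simp
qed

lemma (in orth_ops) brauer_module_om:
  assumes f: "f \<in> brauer_module \<mu> n N"
  shows "(\<lambda>\<phi>. om n N (f \<phi>)) \<in> brauer_module \<mu> (n + 2) N"
  unfolding brauer_module_def mem_Collect_eq
proof (intro conjI ballI allI impI)
  show "om n N (f \<phi>) \<in> tensors (n + 2) N" for \<phi> by (simp add: om_def tensors_def)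
  show "om n N (f \<phi>) = (\<lambda>_. 0)" if "\<phi> \<notin> weyl_module \<mu> N" for \<phi>
    using brauer_moduleD(2)[OF f that] by (simp add: om_def fun_eq_iff)
  show "om n N (f (\<lambda>v i. a * \<phi> v i + b * \<psi> v i)) = (\<lambda>i. a * om n N (f \<phi>) i + b * om n N (f \<psi>) i)"
    if "\<phi> \<in> weyl_module \<mu> N" "\<psi> \<in> weyl_module \<mu> N" for \<phi> \<psi> a b
    unfolding brauer_moduleD(3)[OF f that] by (simp add: om_def fun_eq_iff)
  show "om n N (f (\<lambda>v. group_act (card \<mu>) N g (\<phi> v))) = group_act (n + 2) N g (om n N (f \<phi>))"
    if "\<phi> \<in> weyl_module \<mu> N" "g \<in> orthogonal_group N" for \<phi> g
    unfolding brauer_moduleD(4)[OF f that] by (rule om_group_act[OF that(2)])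
qed

text \<open>Adding the invariant vector r times leads from degree m to degree m + 2 r, and every
  degree in which \<mu> occurs has this form.\<close>

lemma (in orth_young) brauer_module_nonzero:
  "\<exists>f\<in>brauer_module \<mu> (m + 2 * r) N. f \<phi>0 \<noteq> (\<lambda>_. 0)"
proof (induction r)
  interpret orth_ops N by unfold_locales (rule N1)
  case 0
  have "brauer_module \<mu> (m + 2 * 0) N = brauer_module \<mu> m N" by simp
  then show ?case using brauer_module_base \<phi>0_nonzero \<phi>0_weyl by (intro bexI[of _ "\<lambda>\<phi>. if \<phi> \<in> weyl_module \<mu> N then \<phi> y else (\<lambda>_. 0)"]) simp_all
next
  interpret orth_ops N by unfold_locales (rule N1)
  case (Suc r)
  then obtain f where f: "f \<in> brauer_module \<mu> (m + 2 * r) N" "f \<phi>0 \<noteq> (\<lambda>_. 0)" by blast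
  have "om (m + 2 * r) N (f \<phi>0) \<noteq> (\<lambda>_. 0)"
    by (rule om_nonzero[OF N1 brauer_moduleD(1)[OF f(1) \<phi>0_weyl] f(2)])
  moreover have "brauer_module \<mu> (m + 2 * Suc r) N = brauer_module \<mu> (m + 2 * r + 2) N" by simp
  ultimately show ?case
    using brauer_module_om[OF f(1)] by (intro bexI[of _ "\<lambda>\<phi>. om (m + 2 * r) N (f \<phi>)"]) (simp_all only: not_False_eq_True)
qed

section \<open>The generating series\<close>

lemma young_diagram_iff:
  "young_diagram \<mu> \<longleftrightarrow> finite \<mu> \<and> (\<forall>i j. (i, j) \<in> \<mu> \<longrightarrow> 1 \<le> i \<and> 1 \<le> j \<and>
     (\<forall>r c. 1 \<le> r \<longrightarrow> r \<le> i \<longrightarrow> 1 \<le> c \<longrightarrow> c \<le> j \<longrightarrow> (r, c) \<in> \<mu>))"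
  unfolding young_diagram_def by (auto simp: subset_iff) 

lemma added_boxes_iff:
  assumes y: "young_diagram \<mu>"
  shows "(i, j) \<in> added_boxes \<mu> \<longleftrightarrow> (i, j) \<notin> \<mu> \<and> 1 \<le> i \<and> 1 \<le> j \<and>
    (i = 1 \<or> (i - 1, j) \<in> \<mu>) \<and> (j = 1 \<or> (i, j - 1) \<in> \<mu>)"
proof
  assume a: "(i, j) \<in> added_boxes \<mu>"
  then have n: "(i, j) \<notin> \<mu>" and y': "young_diagram (insert (i, j) \<mu>)" by (auto simp: added_boxes_def)
  have p: "1 \<le> i" "1 \<le> j" and d: "\<And>r c. 1 \<le> r \<Longrightarrow> r \<le> i \<Longrightarrow> 1 \<le> c \<Longrightarrow> c \<le> j \<Longrightarrow> (r, c) \<in> insert (i, j) \<mu>"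
    using y' unfolding young_diagram_iff by blast+
  have "i = 1 \<or> (i - 1, j) \<in> \<mu>" 
  proof (cases "i = 1")
    case False
    then have "1 \<le> i - 1" "i - 1 \<noteq> i" using p by auto
    then show ?thesis using d[of "i - 1" j] p by auto
  qed simp
  moreover have "j = 1 \<or> (i, j - 1) \<in> \<mu>" 
  proof (cases "j = 1")
    case False
    then have "1 \<le> j - 1" "j - 1 \<noteq> j" using p by auto
    then show ?thesis using d[of i "j - 1"] p by auto
  qed simp
  ultimately show "(i, j) \<notin> \<mu> \<and> 1 \<le> i \<and> 1 \<le> j \<and> (i = 1 \<or> (i - 1, j) \<in> \<mu>) \<and> (j = 1 \<or> (i, j - 1) \<in> \<mu>)"
    using n p by blast
next
  assume a: "(i, j) \<notin> \<mu> \<and> 1 \<le> i \<and> 1 \<le> j \<and> (i = 1 \<or> (i - 1, j) \<in> \<mu>) \<and> (j = 1 \<or> (i, j - 1) \<in> \<mu>)"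
  have d: "(r, c) \<in> \<mu>" if "(a, b) \<in> \<mu>" "1 \<le> r" "r \<le> a" "1 \<le> c" "c \<le> b" for a b r c
    using y that unfolding young_diagram_iff by blast
  have "(r, c) \<in> insert (i, j) \<mu>" if rc: "1 \<le> r" "r \<le> i" "1 \<le> c" "c \<le> j" for r c
  proof (cases "r = i")
    case True
    show ?thesis
    proof (cases "c = j")
      case False
      then have "j \<noteq> 1" "c \<le> j - 1" using rc by auto
      then show ?thesis using a d[of i "j - 1" r c] rc True by auto
    qed (use True in simp)
  next
    case False
    then have "i \<noteq> 1" "r \<le> i - 1" using rc by auto
    then show ?thesis using a d[of "i - 1" j r c] rc by auto
  qed
  then have "young_diagram (insert (i, j) \<mu>)"
    using y a d unfolding young_diagram_iff by (metis finite_insert insertE insertI2 prod.inject)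
  then show "(i, j) \<in> added_boxes \<mu>" using a by (simp add: added_boxes_def)
qed

lemma removed_boxes_iff:
  assumes y: "young_diagram \<mu>"
  shows "(i, j) \<in> removed_boxes \<mu> \<longleftrightarrow> (i, j) \<in> \<mu> \<and> (i + 1, j) \<notin> \<mu> \<and> (i, j + 1) \<notin> \<mu>"
proof
  have d: "(r, c) \<in> \<mu>" if "(a, b) \<in> \<mu>" "1 \<le> r" "r \<le> a" "1 \<le> c" "c \<le> b" for a b r c
    using y that unfolding young_diagram_iff by blast
  assume a: "(i, j) \<in> removed_boxes \<mu>"
  then have m: "(i, j) \<in> \<mu>" and y': "young_diagram (\<mu> - {(i, j)})" by (auto simp: removed_boxes_def)
  have p: "1 \<le> i" "1 \<le> j" using y m unfolding young_diagram_iff by blast+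
  have d': "(r, c) \<in> \<mu> - {(i, j)}" if "(a, b) \<in> \<mu> - {(i, j)}" "1 \<le> r" "r \<le> a" "1 \<le> c" "c \<le> b" for a b r c
    using y' that unfolding young_diagram_iff by blast
  have "(i + 1, j) \<notin> \<mu>" using d'[of "i + 1" j i j] p by auto
  moreover have "(i, j + 1) \<notin> \<mu>" using d'[of i "j + 1" i j] p by auto
  ultimately show "(i, j) \<in> \<mu> \<and> (i + 1, j) \<notin> \<mu> \<and> (i, j + 1) \<notin> \<mu>" using m by blast
next
  have d: "(r, c) \<in> \<mu>" if "(a, b) \<in> \<mu>" "1 \<le> r" "r \<le> a" "1 \<le> c" "c \<le> b" for a b r c
    using y that unfolding young_diagram_iff by blast
  assume a: "(i, j) \<in> \<mu> \<and> (i + 1, j) \<notin> \<mu> \<and> (i, j + 1) \<notin> \<mu>"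
  have p: "1 \<le> a" "1 \<le> b" if "(a, b) \<in> \<mu>" for a b using y that unfolding young_diagram_iff by blast+
  have ne: "(r, c) \<noteq> (i, j)" if "(a', b') \<in> \<mu> - {(i, j)}" "1 \<le> r" "r \<le> a'" "1 \<le> c" "c \<le> b'" for a' b' r c
  proof
    assume e: "(r, c) = (i, j)"
    then have "i + 1 \<le> a' \<or> j + 1 \<le> b'" using that by auto
    then show False using d[of a' b' "i + 1" j] d[of a' b' i "j + 1"] a that e p[of i j] by auto
  qed
  have "young_diagram (\<mu> - {(i, j)})"
    unfolding young_diagram_iff
  proof (intro conjI allI impI)
    show "finite (\<mu> - {(i, j)})" using y by (simp add: young_diagram_def)
    fix a' b' assume m: "(a', b') \<in> \<mu> - {(i, j)}"
    show "1 \<le> a'" "1 \<le> b'" using p m by blast+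
    fix r c assume rc: "1 \<le> r" "r \<le> a'" "1 \<le> c" "c \<le> b'"
    have "(r, c) \<in> \<mu>" using d[OF _ rc] m by blast
    then show "(r, c) \<in> \<mu> - {(i, j)}" using ne[OF m rc] by blast
  qed
  then show "(i, j) \<in> removed_boxes \<mu>" using a by (simp add: removed_boxes_def)
qed

lemma finite_added_boxes:
  assumes "young_diagram \<mu>"
  shows "finite (added_boxes \<mu>)"
proof (rule finite_subset)
  show "added_boxes \<mu> \<subseteq> insert (1, 1) ((\<lambda>(i, j). (i + 1, j)) ` \<mu> \<union> (\<lambda>(i, j). (i, j + 1)) ` \<mu>)"
  proof
    fix x assume x: "x \<in> added_boxes \<mu>"
    obtain i j where [simp]: "x = (i, j)" by (cases x)
    have a: "1 \<le> i" "1 \<le> j" "i = 1 \<or> (i - 1, j) \<in> \<mu>" "j = 1 \<or> (i, j - 1) \<in> \<mu>"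
      using x added_boxes_iff[OF assms, of i j] by auto
    have "x \<in> (\<lambda>(i, j). (i + 1, j)) ` \<mu>" if "(i - 1, j) \<in> \<mu>"
      by (rule image_eqI[OF _ that]) (use a in simp)
    moreover have "x \<in> (\<lambda>(i, j). (i, j + 1)) ` \<mu>" if "(i, j - 1) \<in> \<mu>"
      by (rule image_eqI[OF _ that]) (use a in simp)
    ultimately show "x \<in> insert (1, 1) ((\<lambda>(i, j). (i + 1, j)) ` \<mu> \<union> (\<lambda>(i, j). (i, j + 1)) ` \<mu>)"
      using a by auto
  qed
  have "finite \<mu>" using assms by (simp add: young_diagram_def)
  then show "finite (insert (1, 1) ((\<lambda>(i, j). (i + 1, j)) ` \<mu> \<union> (\<lambda>(i, j). (i, j + 1)) ` \<mu>))" by simp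
qed

lemma finite_removed_boxes: "young_diagram \<mu> \<Longrightarrow> finite (removed_boxes \<mu>)"
  by (simp add: removed_boxes_def young_diagram_def)

lemma var_u_const_nonzero: "var_u - fls_const b \<noteq> 0" "var_u + fls_const b \<noteq> 0"
proof -
  have "fls_nth (var_u - fls_const b) (-1) = 1" "fls_nth (var_u + fls_const b) (-1) = 1" by simp_all
  then show "var_u - fls_const b \<noteq> 0" "var_u + fls_const b \<noteq> 0" by (metis fls_zero_nth zero_neq_one)+
qed

lemma Q_factor_nonzero: "Q_factor b \<noteq> 0"
  using var_u_const_nonzero by (simp add: Q_factor_def)

lemma Q_factor_uminus: "Q_factor b * Q_factor (- b) = 1"
  using var_u_const_nonzero[of b] by (simp add: Q_factor_def)

text \<open>When a box \<open>x\<close> is added, each of its two outer neighbours either becomes an added box, or stops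
  an inner neighbour of the same content from being a removed box. Either way \<open>Q\<close> gains the same factor.\<close>

lemma Q_series_insert:
  fixes N :: nat
  assumes y: "young_diagram \<mu>" and x: "x \<in> added_boxes \<mu>"
  defines "b \<equiv> (of_nat N - 1) / 2 + box_content x"
  shows "Q_series N (insert x \<mu>) * Q_factor b ^ 2 = Q_series N \<mu> * Q_factor (b + 1) * Q_factor (b - 1)"
proof -
  obtain i j where xij [simp]: "x = (i, j)" by (cases x)
  let ?\<nu> = "insert (i, j) \<mu>"
  have y': "young_diagram ?\<nu>" using x by (simp add: added_boxes_def)
  have a: "(i, j) \<notin> \<mu>" "1 \<le> i" "1 \<le> j" "i = 1 \<or> (i - 1, j) \<in> \<mu>" "j = 1 \<or> (i, j - 1) \<in> \<mu>"
    using x added_boxes_iff[OF y, of i j] by auto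
  have d: "(r, c) \<in> \<mu>" if "(a, b) \<in> \<mu>" "1 \<le> r" "r \<le> a" "1 \<le> c" "c \<le> b" for a b r c
    using y that unfolding young_diagram_iff by blast
  have pos: "1 \<le> r \<and> 1 \<le> c" if "(r, c) \<in> \<mu>" for r c using y that unfolding young_diagram_iff by blast
  have out: "(r, c) \<notin> \<mu>" if "i \<le> r" "j \<le> c" for r c using d[of r c i j] a that by auto
  define e where "e = (of_nat N - 1) / (2 :: complex)"
  define Pa where "Pa S = (\<Prod>x\<in>S. Q_factor (e + box_content x))" for S
  define Pr where "Pr S = (\<Prod>x\<in>S. Q_factor (- e - box_content x))" for S
  have Q: "Q_series N M = Pa (added_boxes M) * Pr (removed_boxes M)" for M
    unfolding Q_series_def Pa_def Pr_def e_def by (simp add: minus_divide_left)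
  have fa: "finite (added_boxes \<mu>)" "finite (removed_boxes \<mu>)"
    by (rule finite_added_boxes[OF y], rule finite_removed_boxes[OF y])
  \<comment> \<open>\<open>right\<close> and \<open>below\<close> tell whether the outer neighbours
    (i, j + 1) and (i + 1, j) become added boxes. Where this fails, the inner neighbour (i - 1, j)
    or (i, j - 1), of the same content, was a removed box until now.\<close>
  define right where "right \<longleftrightarrow> i = 1 \<or> (i - 1, j + 1) \<in> \<mu>"
  define below where "below \<longleftrightarrow> j = 1 \<or> (i + 1, j - 1) \<in> \<mu>"
  define A where "A = added_boxes \<mu> - {(i, j)}"
  define C where "C = removed_boxes \<mu> - {(i - 1, j), (i, j - 1)}"
  have fAC: "finite A" "finite C" using fa by (auto simp: A_def C_def)
  have bd: "b = e + (of_nat j - of_nat i)" by (simp add: b_def e_def box_content_def)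
  have A1: "added_boxes \<mu> = insert (i, j) A" using x by (auto simp: A_def)
  have r1: "(i, j + 1) \<notin> added_boxes \<mu>" "(i + 1, j) \<notin> added_boxes \<mu>"
    using a added_boxes_iff[OF y, of i "j + 1"] added_boxes_iff[OF y, of "i + 1" j] by auto
  have A2: "added_boxes ?\<nu> = A \<union> ((if right then {(i, j + 1)} else {}) \<union> (if below then {(i + 1, j)} else {}))"
  proof (rule Set.set_eqI)
    fix z :: "nat \<times> nat"
    obtain r c where [simp]: "z = (r, c)" by (cases z)
    consider "(r, c) = (i, j)" | "(r, c) = (i, j + 1)" | "(r, c) = (i + 1, j)"
      | "(r, c) \<noteq> (i, j)" "(r, c) \<noteq> (i, j + 1)" "(r, c) \<noteq> (i + 1, j)" by blast
    then show "z \<in> added_boxes ?\<nu> \<longleftrightarrow> z \<in> A \<union> ((if right then {(i, j + 1)} else {}) \<union> (if below then {(i + 1, j)} else {}))"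
    proof cases
      case 1
      then show ?thesis by (auto simp: added_boxes_def A_def)
    next
      case 2
      then show ?thesis using a out[of i "j + 1"] r1 by (auto simp: added_boxes_iff[OF y'] A_def right_def)
    next
      case 3
      then show ?thesis using a out[of "i + 1" j] r1 by (auto simp: added_boxes_iff[OF y'] A_def below_def)
    next
      case 4
      have "(r - 1, c) \<noteq> (i, j) \<or> r = 0" "(r, c - 1) \<noteq> (i, j) \<or> c = 0" using 4 by auto
      then show ?thesis using 4 by (auto simp: added_boxes_iff[OF y'] added_boxes_iff[OF y] A_def)
    qed
  qed
  have C1: "removed_boxes \<mu> = C \<union> ((if right then {} else {(i - 1, j)}) \<union> (if below then {} else {(i, j - 1)}))"
  proof -
    have "(i - 1, j) \<in> removed_boxes \<mu> \<longleftrightarrow> \<not> right"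
      using a pos[of "i - 1" j] pos[of 0 j] by (cases "i = 1") (auto simp: removed_boxes_iff[OF y] right_def)
    moreover have "(i, j - 1) \<in> removed_boxes \<mu> \<longleftrightarrow> \<not> below"
      using a pos[of i "j - 1"] pos[of i 0] by (cases "j = 1") (auto simp: removed_boxes_iff[OF y] below_def)
    ultimately show ?thesis unfolding C_def by auto
  qed
  have C2: "removed_boxes ?\<nu> = insert (i, j) C"
  proof (rule Set.set_eqI)
    fix z :: "nat \<times> nat"
    obtain r c where [simp]: "z = (r, c)" by (cases z)
    have n: "(i + 1, j) \<notin> \<mu>" "(i, j + 1) \<notin> \<mu>" using out by auto
    show "z \<in> removed_boxes ?\<nu> \<longleftrightarrow> z \<in> insert (i, j) C"
    proof (cases "(r, c) = (i, j)")
      case True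
      then show ?thesis using n by (auto simp: removed_boxes_iff[OF y'])
    next
      case False
      have e: "(r + 1, c) = (i, j) \<longleftrightarrow> (r, c) = (i - 1, j)" "(r, c + 1) = (i, j) \<longleftrightarrow> (r, c) = (i, j - 1)"
        unfolding prod.inject using a(2,3) by presburger+
      have "(r, c) \<in> removed_boxes ?\<nu> \<longleftrightarrow> (r, c) \<in> \<mu> \<and> \<not> ((r, c) = (i - 1, j) \<or> (r + 1, c) \<in> \<mu>) \<and>
        \<not> ((r, c) = (i, j - 1) \<or> (r, c + 1) \<in> \<mu>)"
        unfolding removed_boxes_iff[OF y'] insert_iff e using False by argo
      moreover have "(r, c) \<in> C \<longleftrightarrow> ((r, c) \<in> \<mu> \<and> (r + 1, c) \<notin> \<mu> \<and> (r, c + 1) \<notin> \<mu>) \<and>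
        \<not> ((r, c) = (i - 1, j) \<or> (r, c) = (i, j - 1))"
        unfolding C_def Diff_iff removed_boxes_iff[OF y] insert_iff empty_iff by argo
      moreover have "z \<in> insert (i, j) C \<longleftrightarrow> (r, c) \<in> C"
        by (simp only: insert_iff \<open>z = (r, c)\<close> False simp_thms)
      ultimately show ?thesis unfolding \<open>z = (r, c)\<close> by argo
    qed
  qed
  have n1: "(i, j) \<notin> A" "(i, j) \<notin> C" "(i, j + 1) \<notin> A" "(i + 1, j) \<notin> A" "(i - 1, j) \<notin> C" "(i, j - 1) \<notin> C"
    using r1 a by (auto simp: A_def C_def removed_boxes_def)
  have c1: "box_content (i, j + 1) = box_content (i, j) + 1" "box_content (i + 1, j) = box_content (i, j) - 1"
    by (simp_all add: box_content_def)
  have c2: "i \<noteq> 1 \<Longrightarrow> box_content (i - 1, j) = box_content (i, j) + 1"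
    "j \<noteq> 1 \<Longrightarrow> box_content (i, j - 1) = box_content (i, j) - 1"
    using a by (simp_all add: box_content_def of_nat_diff)
  have bc: "b = e + box_content (i, j)" unfolding b_def e_def by simp
  have Pa1: "Pa (added_boxes \<mu>) = Q_factor b * Pa A"
    unfolding A1 Pa_def bc using n1(1) fAC by simp
  have Pa2: "Pa (added_boxes ?\<nu>) = Pa A * (if right then Q_factor (b + 1) else 1) * (if below then Q_factor (b - 1) else 1)"
    unfolding A2 Pa_def using n1 fAC by (auto simp: c1[unfolded Suc_eq_plus1[symmetric]] bc add.assoc add_diff_eq mult_ac)
  have Pr1: "Pr (removed_boxes \<mu>) = Pr C * (if right then 1 else Q_factor (- (b + 1))) * (if below then 1 else Q_factor (- (b - 1)))"
  proof -
    have i1: "i \<noteq> 1" if "\<not> right" using that by (simp add: right_def)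
    have j1: "j \<noteq> 1" if "\<not> below" using that by (simp add: below_def)
    have ne: "(i - 1, j) \<noteq> (i, j - 1)" "(i, j - 1) \<noteq> (i - 1, j)" using a by auto
    have q1: "Q_factor (- e - box_content (i - 1, j)) = Q_factor (- (b + 1))" if "\<not> right"
      unfolding c2(1)[OF i1[OF that]] bc by (rule arg_cong[where f = Q_factor]) simp
    have q2: "Q_factor (- e - box_content (i, j - 1)) = Q_factor (- (b - 1))" if "\<not> below"
      unfolding c2(2)[OF j1[OF that]] bc by (rule arg_cong[where f = Q_factor]) simp
    show ?thesis
      unfolding C1 Pr_def using n1(5,6) fAC ne q1 q2 by (cases right; cases below) (simp_all del: prod.inject add: mult_ac)
  qed
  \<comment> \<open>The new box itself changes from an added to a removed box:
    \<open>Q_factor b\<close> is replaced by its inverse, whence the square in the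
    statement.\<close>
  have Pr2: "Pr (removed_boxes ?\<nu>) = Q_factor (- b) * Pr C"
  proof -
    have "- e - box_content (i, j) = - b" unfolding bc by simp
    then show ?thesis unfolding C2 Pr_def using n1(2) fAC by simp
  qed
  have inv: "Q_factor (c) * Q_factor (- c) = 1" for c by (rule Q_factor_uminus)
  have R: "(if right then Q_factor (b + 1) else 1) = (if right then 1 else Q_factor (- (b + 1))) * Q_factor (b + 1)"
    and B: "(if below then Q_factor (b - 1) else 1) = (if below then 1 else Q_factor (- (b - 1))) * Q_factor (b - 1)"
    using inv[of "b + 1"] inv[of "b - 1"] by (simp_all add: mult.commute)
  define ra be where "ra = (if right then 1 else Q_factor (- (b + 1)))" and "be = (if below then 1 else Q_factor (- (b - 1)))"
  have "Q_series N ?\<nu> * Q_factor b ^ 2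
    = (Pa A * (ra * Q_factor (b + 1)) * (be * Q_factor (b - 1))) * (Q_factor (- b) * Pr C) * Q_factor b ^ 2"
    unfolding Q Pr2 Pa2 R B ra_def be_def ..
  also have "\<dots> = (Q_factor b * Q_factor (- b)) * ((Q_factor b * Pa A) * (Pr C * ra * be) * Q_factor (b + 1) * Q_factor (b - 1))"
    unfolding power2_eq_square by (simp only: mult_ac)
  also have "\<dots> = Q_series N \<mu> * Q_factor (b + 1) * Q_factor (b - 1)"
    unfolding Q Pa1 Pr1 inv ra_def be_def mult_1_left ..
  finally show ?thesis unfolding xij .
qed

lemma Q_series_empty: "Q_series N {} = Q_factor ((of_nat N - 1) / 2)"
proof -
  have "added_boxes {} = {(1, 1)}"
  proof (rule Set.set_eqI)
    fix z :: "nat \<times> nat"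
    have "young_diagram {}" by (simp add: young_diagram_def)
    then show "z \<in> added_boxes {} \<longleftrightarrow> z \<in> {(1, 1)}"
      by (cases z) (auto simp: added_boxes_iff)
  qed
  then show ?thesis by (simp add: Q_series_def removed_boxes_def box_content_def)
qed

section \<open>Q as a product over all boxes\<close>

context young
begin

lemma initial_young:
  assumes "k \<le> m"
  shows "young_diagram (box ` {1..k})"
  unfolding young_diagram_iff
proof (intro conjI allI impI)
  fix i j assume ij: "(i, j) \<in> box ` {1..k}"
  then obtain l where l: "l \<in> {1..k}" "box l = (i, j)" by auto
  have lm: "l \<in> {1..m}" using l assms by auto
  have rc: "row l = i" "col l = j" using l by (simp_all add: row_def col_def)
  show "1 \<le> i" "1 \<le> j" using row_col_pos[OF lm] rc by auto
  fix r c assume rc': "1 \<le> r" "r \<le> i" "1 \<le> c" "c \<le> j"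
  show "(r, c) \<in> box ` {1..k}"
  proof (cases "(r, c) = (i, j)")
    case False
    then obtain l' where l': "l' \<in> {1..<l}" "row l' = r" "col l' = c"
      using box_down[OF lm, of r c] rc rc' by auto
    then have "box l' = (r, c)" unfolding row_def col_def by (intro prod_eqI) simp_all
    then show ?thesis using l' l by (intro image_eqI[of _ _ l']) auto
  qed (use ij in simp)
qed simp

lemma initial_added:
  assumes "Suc k \<le> m"
  shows "box (Suc k) \<in> added_boxes (box ` {1..k})" "box ` {1..Suc k} = insert (box (Suc k)) (box ` {1..k})"
proof -
  have S: "{1..Suc k} = insert (Suc k) {1..k}" by auto
  then show eq: "box ` {1..Suc k} = insert (box (Suc k)) (box ` {1..k})" by simp
  have "box (Suc k) \<notin> box ` {1..k}"
  proof
    assume "box (Suc k) \<in> box ` {1..k}"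
    then obtain l where "l \<in> {1..k}" "box (Suc k) = box l" by auto
    then show False using box_inj[of "Suc k" l] assms by auto
  qed
  then show "box (Suc k) \<in> added_boxes (box ` {1..k})"
    using initial_young[OF assms] eq by (simp add: added_boxes_def)
qed

lemma box_image: "box ` {1..m} = \<mu>"
  using box_mem box_surj by blast

text \<open>The boxes are added in row-reading order, each initial segment being a diagram by
  \<open>initial_young\<close>, starting from \<open>Q_series_empty\<close>.\<close>

lemma Q_series_content:
  fixes N :: nat
  defines "b \<equiv> \<lambda>k. (of_nat N - 1) / 2 + content k"
  shows "Q_series N \<mu> * (\<Prod>k=1..m. Q_factor (b k) ^ 2) =
    Q_factor ((of_nat N - 1) / 2) * (\<Prod>k=1..m. Q_factor (b k + 1) * Q_factor (b k - 1))"
proof -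
  have "k \<le> m \<Longrightarrow> Q_series N (box ` {1..k}) * (\<Prod>k=1..k. Q_factor (b k) ^ 2) =
    Q_factor ((of_nat N - 1) / 2) * (\<Prod>k=1..k. Q_factor (b k + 1) * Q_factor (b k - 1))" for k
  proof (induction k)
    case 0
    then show ?case by (simp add: Q_series_empty)
  next
    case (Suc k)
    let ?\<mu> = "box ` {1..k}"
    have "Q_series N (insert (box (Suc k)) ?\<mu>) * Q_factor (b (Suc k)) ^ 2 =
      Q_series N ?\<mu> * Q_factor (b (Suc k) + 1) * Q_factor (b (Suc k) - 1)"
      unfolding b_def content_def
      by (rule Q_series_insert[OF initial_young initial_added(1)]) (use Suc in auto)
    then have s: "Q_series N (box ` {1..Suc k}) * Q_factor (b (Suc k)) ^ 2 =
      Q_series N ?\<mu> * Q_factor (b (Suc k) + 1) * Q_factor (b (Suc k) - 1)"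
      using initial_added(2)[OF Suc.prems] by simp
    have P: "(\<Prod>k=1..Suc k. f k) = (\<Prod>k=1..k. f k) * f (Suc k)" for f :: "nat \<Rightarrow> complex fls" by simp
    have "Q_series N (box ` {1..Suc k}) * (\<Prod>k=1..Suc k. Q_factor (b k) ^ 2) =
      (Q_series N (box ` {1..Suc k}) * Q_factor (b (Suc k)) ^ 2) * (\<Prod>k=1..k. Q_factor (b k) ^ 2)"
      unfolding P by (simp only: mult_ac)
    also have "\<dots> = (Q_series N ?\<mu> * (\<Prod>k=1..k. Q_factor (b k) ^ 2)) * (Q_factor (b (Suc k) + 1) * Q_factor (b (Suc k) - 1))"
      unfolding s by (simp only: mult_ac)
    also have "\<dots> = (Q_factor ((of_nat N - 1) / 2) * (\<Prod>k=1..k. Q_factor (b k + 1) * Q_factor (b k - 1)))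
      * (Q_factor (b (Suc k) + 1) * Q_factor (b (Suc k) - 1))"
      unfolding Suc.IH[OF Suc_leD[OF Suc.prems]] ..
    also have "\<dots> = Q_factor ((of_nat N - 1) / 2) * (\<Prod>k=1..Suc k. Q_factor (b k + 1) * Q_factor (b k - 1))"
      unfolding P by (simp only: mult.assoc)
    finally show ?case .
  qed
  from this[OF order_refl] show ?thesis unfolding box_image .
qed

end

section \<open>The eigenvalue and the conclusion\<close>

context orth_ops
begin

text \<open>The scalar is computed on U in degree \<open>card \<mu>\<close> and carried to degree n
  by \<open>Z_op_intertwine\<close>. A nonzero value of some f0 makes it unique, as the definite
  description in \<open>eigenvalue_on_def\<close> demands.\<close>

lemma brauer_eigenvalue:
  assumes c: "\<And>i \<phi> v. \<phi> \<in> weyl_module \<mu> N \<Longrightarrow> v \<in> specht \<mu> \<Longrightarrow>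
      app (Z_op (Suc (card \<mu>)) i) (\<phi> v) = (\<lambda>j. c i * \<phi> v j)"
    and n: "card \<mu> \<le> n" and f0: "f0 \<in> brauer_module \<mu> n N" "f0 \<psi> \<noteq> (\<lambda>_. 0)"
  shows "eigenvalue_on \<mu> n N (z_elem N (Suc n) i) = c i"
proof -
  let ?z = "z_elem N (Suc n) i"
  have ev: "(\<lambda>\<phi>. brauer_act n N ?z (f \<phi>)) = (\<lambda>\<phi> j. c i * f \<phi> j)" if f: "f \<in> brauer_module \<mu> n N" for f
  proof
    fix \<phi>
    show "brauer_act n N ?z (f \<phi>) = (\<lambda>j. c i * f \<phi> j)"
    proof (cases "\<phi> \<in> weyl_module \<mu> N")
      case True
      have "brauer_act n N ?z (f \<phi>) = app (Z_op (Suc n) i) (f \<phi>)"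
        using z_elem_act[of "Suc n" "f \<phi>" i] brauer_moduleD(1)[OF f True] by simp
      also have "\<dots> = f (\<lambda>v. app (Z_op (Suc (card \<mu>)) i) (\<phi> v))"
        by (rule Z_op_intertwine[OF f True n, symmetric])
      also have "(\<lambda>v. app (Z_op (Suc (card \<mu>)) i) (\<phi> v)) = (\<lambda>v j. c i * \<phi> v j + 0 * \<phi> v j)"
      proof
        fix v
        show "app (Z_op (Suc (card \<mu>)) i) (\<phi> v) = (\<lambda>j. c i * \<phi> v j + 0 * \<phi> v j)"
          using c[OF True, of v] weyl_moduleD(2)[OF True, of v] by (cases "v \<in> specht \<mu>") simp_all
      qed
      also have "f (\<lambda>v j. c i * \<phi> v j + 0 * \<phi> v j) = (\<lambda>j. c i * f \<phi> j)"
        using brauer_moduleD(3)[OF f True True, of "c i" 0] by simp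
      finally show ?thesis .
    next
      case False
      then show ?thesis using brauer_moduleD(2)[OF f False] by (simp add: brauer_act_def fun_eq_iff)
    qed
  qed
  show ?thesis
    unfolding eigenvalue_on_def
  proof (rule the_equality)
    show "\<forall>f\<in>brauer_module \<mu> n N. (\<lambda>\<phi>. brauer_act n N ?z (f \<phi>)) = (\<lambda>\<phi> j. c i * f \<phi> j)"
      using ev by blast
    fix d assume d: "\<forall>f\<in>brauer_module \<mu> n N. (\<lambda>\<phi>. brauer_act n N ?z (f \<phi>)) = (\<lambda>\<phi> j. d * f \<phi> j)"
    have e: "(\<lambda>\<phi> j. d * f0 \<phi> j) = (\<lambda>\<phi> j. c i * f0 \<phi> j)"
      by (rule trans[OF bspec[OF d f0(1), symmetric] ev[OF f0(1)]])
    obtain j where j: "f0 \<psi> j \<noteq> 0" using f0(2) by auto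
    have "d * f0 \<psi> j = c i * f0 \<psi> j" by (rule fun_cong[OF fun_cong[OF e]])
    then show "d = c i" using j by simp
  qed
qed

text \<open>\<open>Z_op_eigen\<close> yields a series for each tensor separately. The equation
  determines it, its left factor being nonzero, so that one F serves for all.\<close>

lemma Z_op_weyl:
  assumes yd: "young_diagram \<mu>"
  defines "x \<equiv> \<lambda>k. fps_X * fps_const (c0 + young.content \<mu> k)"
  shows "\<exists>F. F * ((1 - fps_X * fps_const c0) * (\<Prod>k=1..card \<mu>. (1 - fps_X - x k) * (1 + fps_X - x k) * (1 + x k) ^ 2))
     = (2 * of_nat N * fps_X + (2 - fps_X) * (1 - fps_X * fps_const c0)) *
       (\<Prod>k=1..card \<mu>. (1 - fps_X + x k) * (1 + fps_X + x k) * (1 - x k) ^ 2) \<and>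
     (\<forall>i. \<forall>\<phi>\<in>weyl_module \<mu> N. \<forall>v\<in>specht \<mu>. app (Z_op (Suc (card \<mu>)) i) (\<phi> v)
      = (\<lambda>j. (fps_nth F (Suc i) + (if i = 0 then 1 else 0)) / 2 * \<phi> v j))"
proof -
  let ?P = "\<Prod>k=1..card \<mu>. (1 - fps_X - x k) * (1 + fps_X - x k) * (1 + x k) ^ 2"
  let ?D = "(1 - fps_X * fps_const c0) * ?P"
  let ?N = "(2 * of_nat N * fps_X + (2 - fps_X) * (1 - fps_X * fps_const c0)) *
       (\<Prod>k=1..card \<mu>. (1 - fps_X + x k) * (1 + fps_X + x k) * (1 - x k) ^ 2)"
  have ex: "\<exists>F. F * ?D = ?N \<and> (\<forall>i. app (Z_op (Suc (card \<mu>)) i) w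
      = (\<lambda>j. (fps_nth F (Suc i) + (if i = 0 then 1 else 0)) / 2 * w j))"
    if w: "\<And>r. r \<le> card \<mu> \<Longrightarrow> app (esym jm_op r (card \<mu>)) w = (\<lambda>j. esym (young.content \<mu>) r (card \<mu>) * w j)" for w
  proof -
    show ?thesis
      unfolding x_def by (rule Z_op_eigen[OF w], assumption?, intro exI conjI allI, assumption) (simp only:)
  qed
  \<comment> \<open>The zero tensor is an eigenvector for any scalars, which already provides a
    solution F.\<close>
  have "app (esym jm_op r (card \<mu>)) (\<lambda>_. 0) = (\<lambda>j. esym (young.content \<mu>) r (card \<mu>) * 0)" for r by simp
  from ex[OF this] obtain F where F: "F * ?D = ?N" by blast
  have nz: "f \<noteq> 0" if "fps_nth f 0 = 1" for f :: "complex fps" using that by auto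
  have "(1 - fps_X - x k) * (1 + fps_X - x k) * (1 + x k) ^ 2 \<noteq> 0" for k
    by (rule nz) (simp add: x_def power2_eq_square)
  then have "?P \<noteq> 0" by (simp only: prod_zero_iff finite_atLeastAtMost) blast
  moreover have "1 - fps_X * fps_const c0 \<noteq> 0" by (rule nz) simp
  ultimately have D: "?D \<noteq> 0" by (rule no_zero_divisors[rotated])
  have "app (Z_op (Suc (card \<mu>)) i) (\<phi> v) = (\<lambda>j. (fps_nth F (Suc i) + (if i = 0 then 1 else 0)) / 2 * \<phi> v j)"
    if \<phi>: "\<phi> \<in> weyl_module \<mu> N" and v: "v \<in> specht \<mu>" for i \<phi> v
  proof -
    from ex[OF esym_weyl[OF yd \<phi> v]] obtain G where G: "G * ?D = ?N"
      and a: "app (Z_op (Suc (card \<mu>)) i) (\<phi> v) = (\<lambda>j. (fps_nth G (Suc i) + (if i = 0 then 1 else 0)) / 2 * \<phi> v j)"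
      by blast
    have "G * ?D = F * ?D" unfolding F G ..
    then have "G = F" using D by (simp only: mult_right_cancel[OF D])
    then show ?thesis using a by simp
  qed
  then show ?thesis by (intro exI[of _ F] conjI allI ballI F)
qed

end

lemma fps_to_fls_prod: "fps_to_fls (\<Prod>k\<in>A. f k) = (\<Prod>k\<in>A. fps_to_fls (f k :: complex fps))"
  by (induction A rule: infinite_finite_induct) (simp_all add: fls_times_fps_to_fls)

lemma fps_nth_prod_0: "fps_nth (\<Prod>k\<in>A. f k) 0 = (\<Prod>k\<in>A. fps_nth (f k :: complex fps) 0)"
  by (induction A rule: infinite_finite_induct) simp_all

lemma fls_X_var_u: "fls_X * var_u = 1" "var_u * fls_X = 1"
proof -
  show "fls_X * var_u = 1" by (simp add: fls_X_times_conv_shift fls_X_inv_conv_shift_1)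
  then show "var_u * fls_X = 1" by (simp add: mult.commute)
qed

text \<open>Each linear factor in T is T times a linear factor in u, and the powers of T cancel.
  Then F and (2 + T) Q solve the same linear equation by \<open>Q_series_content\<close>.\<close>

lemma (in young) fls_solution:
  fixes N :: nat and F :: "complex fps"
  defines "e \<equiv> (of_nat N - 1) / 2 :: complex"
  defines "x \<equiv> \<lambda>k. fps_X * fps_const (e + content k)"
  assumes eq: "F * ((1 - fps_X * fps_const e) * (\<Prod>k=1..m. (1 - fps_X - x k) * (1 + fps_X - x k) * (1 + x k) ^ 2))
     = (2 * of_nat N * fps_X + (2 - fps_X) * (1 - fps_X * fps_const e)) *
       (\<Prod>k=1..m. (1 - fps_X + x k) * (1 + fps_X + x k) * (1 - x k) ^ 2)"
  shows "fps_to_fls F = (2 + fls_X) * Q_series N \<mu>"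
proof -
  let ?u = "fls_X_inv :: complex fls" and ?X = "fls_X :: complex fls"
  define b where "b k = e + content k" for k
  define C where "C k = fls_const (b k)" for k
  define C0 where "C0 = fls_const e"
  define Y where "Y = fps_to_fls F"
  define A where "A k = (?u - C k - 1) * (?u + 1 - C k) * (?u + C k) ^ 2" for k
  define B where "B k = (?u + C k - 1) * (?u + C k + 1) * (?u - C k) ^ 2" for k
  define S where "S k = Q_factor (b k) ^ 2" for k
  define R where "R k = Q_factor (b k + 1) * Q_factor (b k - 1)" for k
  note Xu = fls_X_var_u
  have E: "Y * ((1 - ?X * C0) * (\<Prod>k=1..m. (1 - ?X - ?X * C k) * (1 + ?X - ?X * C k) * (1 + ?X * C k) ^ 2))
     = (2 * of_nat N * ?X + (2 - ?X) * (1 - ?X * C0)) *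
       (\<Prod>k=1..m. (1 - ?X + ?X * C k) * (1 + ?X + ?X * C k) * (1 - ?X * C k) ^ 2)"
    using arg_cong[OF eq, of fps_to_fls]
    by (simp only: fls_times_fps_to_fls fps_to_fls_prod fps_to_fls_power fps_to_fls_plus fps_to_fls_minus
      fps_one_to_fls fps_X_to_fls fps_const_to_fls fps_to_fls_numeral fps_to_fls_of_nat x_def C_def b_def C0_def Y_def)
  have f: "1 - ?X - ?X * c = ?X * (?u - c - 1)" "1 + ?X - ?X * c = ?X * (?u + 1 - c)" "1 + ?X * c = ?X * (?u + c)"
    "1 - ?X + ?X * c = ?X * (?u + c - 1)" "1 + ?X + ?X * c = ?X * (?u + c + 1)" "1 - ?X * c = ?X * (?u - c)" for c
    by (simp_all add: algebra_simps Xu)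
  have X4: "?X * p * (?X * q) * (?X * r) ^ 2 = ?X ^ 4 * (p * q * r ^ 2)" for p q r
    by (simp add: power2_eq_square power4_eq_xxxx mult_ac)
  have N: "of_nat N = 2 * C0 + 1"
  proof -
    have "fls_const (of_nat N :: complex) = fls_const 2 * fls_const e + fls_const 1"
      unfolding fls_const_mult_const fls_plus_const e_def by (rule arg_cong[of _ _ fls_const]) (simp add: field_simps)
    then show ?thesis by (simp add: fls_of_nat C0_def)
  qed
  \<comment> \<open>With N = 2 e + 1 the initial value factors as (2 + T) (1 + T e). The first
    factor is 2 T (u + 1/2), the origin of u + 1/2 in the theorem.\<close>
  have h: "2 * of_nat N * ?X + (2 - ?X) * (1 - ?X * C0) = (2 + ?X) * (?X * (?u + C0))"
    unfolding f(3)[symmetric] N by (simp add: algebra_simps)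
  let ?PA = "\<Prod>k=1..m. ?X ^ 4 * A k" and ?PB = "\<Prod>k=1..m. ?X ^ 4 * B k"
  let ?PS = "\<Prod>k=1..m. S k" and ?PR = "\<Prod>k=1..m. R k"
  have E2: "Y * ((?X * (?u - C0)) * ?PA) = (2 + ?X) * (?X * (?u + C0)) * ?PB"
    using E unfolding h unfolding f X4 A_def B_def .
  have nz: "?u - C k \<noteq> 0" "?u + C k \<noteq> 0" "?u - C0 \<noteq> 0" "?u - C k - 1 \<noteq> 0" "?u + 1 - C k \<noteq> 0" for k
    using var_u_const_nonzero[of "b k"] var_u_const_nonzero(1)[of e] var_u_const_nonzero(1)[of "b k + 1"]
      var_u_const_nonzero(1)[of "b k - 1"]
    by (simp_all add: C_def C0_def fls_plus_const[symmetric] fls_minus_const[symmetric] algebra_simps)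
  \<comment> \<open>B k / A k, the factor of box k in the recursion, is
    \<open>Q_factor (b k + 1) * Q_factor (b k - 1)\<close> divided by the square of
    \<open>Q_factor (b k)\<close>, exactly the change in \<open>Q_series_insert\<close>.\<close>
  have BS: "?X ^ 4 * B k * S k = ?X ^ 4 * A k * R k" for k
  proof -
    have l: "(?u - C k) ^ 2 * S k = (?u + C k) ^ 2"
      using nz(1)[of k] unfolding S_def Q_factor_def C_def[symmetric] power_divide by simp
    have p: "fls_const (b k + 1) = C k + 1" "fls_const (b k - 1) = C k - 1"
      unfolding C_def by (simp_all add: fls_plus_const[symmetric] fls_minus_const[symmetric])
    have r1: "(?u - C k - 1) * Q_factor (b k + 1) = ?u + C k + 1"
      using nz(4)[of k] unfolding Q_factor_def p by (simp add: diff_diff_eq add.assoc)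
    have r2: "(?u + 1 - C k) * Q_factor (b k - 1) = ?u + C k - 1"
    proof -
      have q: "?u - (C k - 1) = ?u + 1 - C k" "?u + (C k - 1) = ?u + C k - 1" by simp_all
      show ?thesis using nz(5)[of k] unfolding Q_factor_def p q by simp
    qed
    have "?X ^ 4 * B k * S k = ?X ^ 4 * ((?u + C k - 1) * (?u + C k + 1) * ((?u - C k) ^ 2 * S k))"
      by (simp only: B_def mult_ac)
    also have "\<dots> = ?X ^ 4 * (((?u + 1 - C k) * Q_factor (b k - 1)) * ((?u - C k - 1) * Q_factor (b k + 1)) * (?u + C k) ^ 2)"
      unfolding l r1 r2 ..
    also have "\<dots> = ?X ^ 4 * A k * R k"
      by (simp only: A_def R_def mult_ac)
    finally show ?thesis .
  qed
  have PBS: "?PB * ?PS = ?PA * ?PR"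
    unfolding prod.distrib[symmetric] by (intro prod.cong refl BS)
  have Q: "Q_series N \<mu> * ?PS = Q_factor e * ?PR"
    using Q_series_content[of N] unfolding S_def R_def b_def e_def .
  have q0: "?u + C0 = (?u - C0) * Q_factor e"
    using nz(3) unfolding Q_factor_def C0_def[symmetric] by simp
  have "Y * ((?X * (?u - C0)) * ?PA * ?PS) = (Y * ((?X * (?u - C0)) * ?PA)) * ?PS" by (simp only: mult_ac)
  also have "\<dots> = (2 + ?X) * (?X * (?u + C0)) * (?PB * ?PS)" unfolding E2 by (simp only: mult_ac)
  also have "\<dots> = (2 + ?X) * (?X * (?u - C0)) * ?PA * (Q_factor e * ?PR)" unfolding PBS q0 by (simp only: mult_ac)
  also have "\<dots> = ((2 + ?X) * Q_series N \<mu>) * ((?X * (?u - C0)) * ?PA * ?PS)" unfolding Q[symmetric] by (simp only: mult_ac)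
  finally have fin: "Y * ((?X * (?u - C0)) * ?PA * ?PS) = ((2 + ?X) * Q_series N \<mu>) * ((?X * (?u - C0)) * ?PA * ?PS)" .
  have X0: "?X \<noteq> 0" using Xu by auto
  have "?X ^ 4 * A k \<noteq> 0" for k using X0 nz(2,4,5)[of k] unfolding A_def by simp
  then have "?PA \<noteq> 0" by (simp only: prod_zero_iff finite_atLeastAtMost) blast
  moreover have "?PS \<noteq> 0" unfolding S_def using Q_factor_nonzero by (simp add: prod_zero_iff)
  ultimately have "(?X * (?u - C0)) * ?PA * ?PS \<noteq> 0" using X0 nz(3) by (intro no_zero_divisors)
  from fin[unfolded mult_right_cancel[OF this]] show ?thesis unfolding Y_def .
qed

theorem theorem3p9:
  fixes N k :: nat and \<mu> :: diagram
  assumes "N \<ge> 1" and "k \<ge> 1" and "\<mu> \<in> orth_diagrams (k - 1) N"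
  shows "Z_series N k \<mu> = (var_u + fls_const (1 / 2)) * Q_series N \<mu> - var_u + fls_const (1 / 2)"
proof -
  define n where "n = k - 1"
  have k: "k = Suc n" using assms(2) by (simp add: n_def)
  have yd: "young_diagram \<mu>" and card: "card {x \<in> \<mu>. snd x \<le> 2} \<le> N"
    using assms(3) by (auto simp: orth_diagrams_def)
  obtain r where "r \<le> n div 2" "card \<mu> = n - 2 * r" using assms(3) by (auto simp: orth_diagrams_def n_def)
  then have n: "n = card \<mu> + 2 * r" by linarith
  have oy: "orth_young \<mu> N" by unfold_locales (fact yd, fact assms(1), fact card)
  have oo: "orth_ops N" by unfold_locales (fact assms(1))
  have yo: "young \<mu>" by unfold_locales (fact yd)
  obtain F where F: "F * ((1 - fps_X * fps_const ((of_nat N - 1) / 2)) * (\<Prod>k=1..card \<mu>.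
        (1 - fps_X - fps_X * fps_const ((of_nat N - 1) / 2 + young.content \<mu> k)) *
        (1 + fps_X - fps_X * fps_const ((of_nat N - 1) / 2 + young.content \<mu> k)) *
        (1 + fps_X * fps_const ((of_nat N - 1) / 2 + young.content \<mu> k)) ^ 2))
     = (2 * of_nat N * fps_X + (2 - fps_X) * (1 - fps_X * fps_const ((of_nat N - 1) / 2))) *
       (\<Prod>k=1..card \<mu>. (1 - fps_X + fps_X * fps_const ((of_nat N - 1) / 2 + young.content \<mu> k)) *
        (1 + fps_X + fps_X * fps_const ((of_nat N - 1) / 2 + young.content \<mu> k)) *
        (1 - fps_X * fps_const ((of_nat N - 1) / 2 + young.content \<mu> k)) ^ 2)"
    and ev: "\<forall>i. \<forall>\<phi>\<in>weyl_module \<mu> N. \<forall>v\<in>specht \<mu>. app (orth_ops.Z_op N (Suc (card \<mu>)) i) (\<phi> v)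
      = (\<lambda>j. (fps_nth F (Suc i) + (if i = 0 then 1 else 0)) / 2 * \<phi> v j)"
    using orth_ops.Z_op_weyl[OF oo yd] by (elim exE conjE) (rule that)
  define c where "c i = (fps_nth F (Suc i) + (if i = 0 then 1 else 0)) / 2" for i
  obtain f0 where f0: "f0 \<in> brauer_module \<mu> n N" "f0 (orth_young.\<phi>0 \<mu> N) \<noteq> (\<lambda>_. 0)"
    using orth_young.brauer_module_nonzero[OF oy, of r] unfolding n by blast
  have cc: "app (orth_ops.Z_op N (Suc (card \<mu>)) i) (\<phi> v) = (\<lambda>j. c i * \<phi> v j)"
    if "\<phi> \<in> weyl_module \<mu> N" "v \<in> specht \<mu>" for i \<phi> v
    unfolding c_def using ev that by blast
  have "eigenvalue_on \<mu> n N (z_elem N (Suc n) i) = c i" for i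
  proof (rule orth_ops.brauer_eigenvalue[OF oo, where c = c and \<mu> = \<mu> and n = n])
    show "app (orth_ops.Z_op N (Suc (card \<mu>)) l) (\<phi> v) = (\<lambda>j. c l * \<phi> v j)"
      if "\<phi> \<in> weyl_module \<mu> N" "v \<in> specht \<mu>" for l \<phi> v by (rule cc[OF that])
    show "card \<mu> \<le> n" using n by simp
    show "f0 \<in> brauer_module \<mu> n N" "f0 (orth_young.\<phi>0 \<mu> N) \<noteq> (\<lambda>_. 0)" by (rule f0)+
  qed
  then have Z: "Z_series N k \<mu> = fps_to_fls (Abs_fps c)"
    unfolding Z_series_def k by simp
  \<comment> \<open>At T = 0 the equation for F reads F = 2.\<close>
  have "fps_nth F 0 = 2"
    using arg_cong[OF F, of "\<lambda>f. fps_nth f 0"] by (simp add: fps_nth_prod_0 power2_eq_square)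
  \<comment> \<open>F is the eigenvalue of Y = 2 W + 2 - T with W = T Z.\<close>
  then have "F = fps_const 2 + fps_X * (fps_const 2 * Abs_fps c - 1)"
  proof (intro fps_ext)
    fix l assume F0: "fps_nth F 0 = 2"
    show "fps_nth F l = fps_nth (fps_const 2 + fps_X * (fps_const 2 * Abs_fps c - 1)) l"
      by (cases l) (simp_all add: F0 c_def add_divide_distrib)
  qed
  then have "fps_to_fls F = 2 + fls_X * (2 * Z_series N k \<mu> - 1)"
    unfolding Z by (simp add: fls_times_fps_to_fls)
  moreover have "fps_to_fls F = (2 + fls_X) * Q_series N \<mu>"
    by (rule young.fls_solution[OF yo F])
  ultimately have "(2 + fls_X) * Q_series N \<mu> = 2 + fls_X * (2 * Z_series N k \<mu> - 1)" by simp
  \<comment> \<open>Multiplication by u turns the equation into (2 u + 1) Q = 2 u + 2 Z - 1, twice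
    the claim up to rearrangement.\<close>
  then have u: "var_u * ((2 + fls_X) * Q_series N \<mu>) = var_u * (2 + fls_X * (2 * Z_series N k \<mu> - 1))" by simp
  have e: "var_u * ((2 + fls_X) * q) = 2 * (var_u * q) + (var_u * fls_X) * q"
    "var_u * (2 + fls_X * (2 * q - 1)) = 2 * var_u + (var_u * fls_X) * (2 * q - 1)" for q :: "complex fls"
    by (simp_all add: algebra_simps)
  have l: "2 * (var_u * Q_series N \<mu>) + Q_series N \<mu> = 2 * var_u + (2 * Z_series N k \<mu> - 1)"
    using u unfolding e fls_X_var_u mult_1_left .
  have "2 * Z_series N k \<mu> = (2 * var_u + (2 * Z_series N k \<mu> - 1)) - 2 * var_u + 1" by simp
  also have "\<dots> = 2 * (var_u * Q_series N \<mu>) + Q_series N \<mu> - 2 * var_u + 1" unfolding l[symmetric] ..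
  finally have z: "2 * Z_series N k \<mu> = 2 * (var_u * Q_series N \<mu>) + Q_series N \<mu> - 2 * var_u + 1" .
  have "2 * fls_const (1 / 2) = fls_const (1 :: complex)"
    unfolding fls_const_numeral[symmetric] fls_const_mult_const by simp
  also have "fls_const (1 :: complex) = 1" by simp
  finally have half: "2 * fls_const (1 / 2) = (1 :: complex fls)" .
  have "2 * ((var_u + fls_const (1 / 2)) * Q_series N \<mu> - var_u + fls_const (1 / 2))
    = 2 * (var_u * Q_series N \<mu>) + (2 * fls_const (1 / 2)) * Q_series N \<mu> - 2 * var_u + 2 * fls_const (1 / 2)"
    by (simp only: distrib_left distrib_right right_diff_distrib mult.assoc)
  also have "\<dots> = 2 * Z_series N k \<mu>" unfolding half z mult_1_left ..
  finally have fin: "2 * Z_series N k \<mu> = 2 * ((var_u + fls_const (1 / 2)) * Q_series N \<mu> - var_u + fls_const (1 / 2))" by (rule sym)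
  have two: "(2 :: complex fls) \<noteq> 0" using half by auto
  show ?thesis by (rule mult_left_cancel[OF two, THEN iffD1, OF fin])
qed

end
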